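(* (1) Given a knot $K$ with $\mathtt{str}(K)=n$, then $p(K)\leq 3n$. (2) Given a knot $K$ with $\mathtt{cstr}(K)=n$, then $p(K)\leq 2n+3$.
   Context: Knots are classical knots in $S^3$. Given a knot diagram with $k$ crossings, choose a non-crossing starting point and a direction and traverse the knot, labeling the crossings $1,2,\ldots,k$ in the order in which they are first encountered; listing the labels of the crossings met in one full traversal gives a $2k$-tuple, a knot word of the diagram. The diagram is straight if, for some choice of starting point and direction, its knot word has the form $(1,2,\ldots,k,\sigma(1),\ldots,\sigma(k))$ with $\sigma\in S_k$, the symmetric group on $k$ elements. The straight number $\mathtt{str}(K)$ is the minimum $k$ such that $K$ has a $k$-crossing straight diagram. A straight diagram is in straight position if it is drawn in the plane so that the first sub-arc, passing through the crossings $1,\ldots,k$ in order, is a horizontal line segment, called the straight strand. The extended straight strand is the horizontal line containing the straight strand, with the straight strand itself removed. The contained straight number $\mathtt{cstr}(K)$ is the minimum $k$ such that $K$ has a $k$-crossing diagram in straight position in which no arc crosses the extended straight strand. A petal projection of a knot (Adams et al.) is a projection to the plane with exactly one multi-crossing (a point through which several strands of the knot pass, each strand bisecting the crossing, at distinct heights) and no other crossings, and such that the loops (petals) of the projection based at the multi-crossing are pairwise non-nested. The petal number $p(K)$ is the minimum number of petals over all petal projections of $K$.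
   Formalization: Part (1) is stated for n ≥ 1: for the unknot str(K)=0 (the crossingless diagram is trivially straight), while every petal projection has at least one petal, so p(K) ≤ 3n fails at n = 0. *)

theory Defs
  imports "HOL-Analysis.Analysis" "HOL-Library.Extended_Nat" "HOL-Combinatorics.Permutations"
begin

text \<open>
  Knots live in the 3-sphere. Curves are drawn in 3-space, modelled as plane times height
  and placed in the 3-sphere by inverse stereographic projection, so that \<^term>\<open>fst\<close>
  is the projection to the plane and \<^term>\<open>snd\<close> the height.
\<close>

type_synonym space = "complex \<times> real"

definition S3 :: "(space \<times> real) set" where
  "S3 = sphere 0 1"

definition inv_stereographic :: "space \<Rightarrow> space \<times> real" where
  "inv_stereographic x =
     ((2 / ((norm x)\<^sup>2 + 1)) *\<^sub>R x, ((norm x)\<^sup>2 - 1) / ((norm x)\<^sup>2 + 1))"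

definition ambient_isotopic :: "(space \<times> real) set \<Rightarrow> (space \<times> real) set \<Rightarrow> bool" where
  "ambient_isotopic K L \<longleftrightarrow> K \<subseteq> S3 \<and>
     (\<exists>h :: real \<times> (space \<times> real) \<Rightarrow> space \<times> real.
        continuous_on ({0..1} \<times> S3) h \<and>
        (\<forall>x\<in>S3. h (0, x) = x) \<and>
        (\<forall>t\<in>{0..1}. \<exists>g. homeomorphism S3 S3 (\<lambda>x. h (t, x)) g) \<and>
        (\<lambda>x. h (1, x)) ` K = L)"

definition piecewise_affine :: "(real \<Rightarrow> 'a::real_normed_vector) \<Rightarrow> bool" where
  "piecewise_affine \<gamma> \<longleftrightarrow>
     (\<exists>S. finite S \<and>
        (\<forall>a b. 0 \<le> a \<and> a < b \<and> b \<le> 1 \<and> S \<inter> {a<..<b} = {} \<longrightarrow>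
           (\<forall>t\<in>{a..b}. \<gamma> t = linepath (\<gamma> a) (\<gamma> b) ((t - a) / (b - a)))))"

definition polygonal_knot :: "(real \<Rightarrow> space) \<Rightarrow> bool" where
  "polygonal_knot \<gamma> \<longleftrightarrow>
     simple_path \<gamma> \<and> pathfinish \<gamma> = pathstart \<gamma> \<and> piecewise_affine \<gamma>"

definition represents :: "(real \<Rightarrow> space) \<Rightarrow> (space \<times> real) set \<Rightarrow> bool" where
  "represents \<gamma> K \<longleftrightarrow>
     polygonal_knot \<gamma> \<and> ambient_isotopic K (inv_stereographic ` path_image \<gamma>)"

text \<open>Classical knots are tame, i.e. ambient isotopic to a polygon.\<close>

definition knot :: "(space \<times> real) set \<Rightarrow> bool" where
  "knot K \<longleftrightarrow> (\<exists>\<gamma>. represents \<gamma> K)"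

definition shadow :: "(real \<Rightarrow> space) \<Rightarrow> real \<Rightarrow> complex" where
  "shadow \<gamma> = fst \<circ> \<gamma>"

text \<open>The parameters at which the curve passes through a point of the plane; the parameter
  1 is left out because it gives the same point of the closed curve as 0.\<close>

definition passes :: "(real \<Rightarrow> space) \<Rightarrow> complex \<Rightarrow> real set" where
  "passes \<gamma> c = {t \<in> {0..<1}. shadow \<gamma> t = c}"

definition crossings :: "(real \<Rightarrow> space) \<Rightarrow> complex set" where
  "crossings \<gamma> = {c. \<exists>s\<in>passes \<gamma> c. \<exists>t\<in>passes \<gamma> c. s \<noteq> t}"

text \<open>The strands through a point are straight near that point and have pairwise
  different tangent lines. In particular each strand bisects the crossing: every other
  strand passes from one of its sides to the other. The heights of the strands are distinct
  because the curve in space is simple.\<close>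

definition transverse_at :: "(real \<Rightarrow> space) \<Rightarrow> complex \<Rightarrow> bool" where
  "transverse_at \<gamma> c \<longleftrightarrow>
     (\<forall>s\<in>passes \<gamma> c. \<forall>t\<in>passes \<gamma> c. s \<noteq> t \<longrightarrow>
        (\<exists>d e. (shadow \<gamma> has_vector_derivative d) (at s) \<and>
               (shadow \<gamma> has_vector_derivative e) (at t) \<and> \<not> collinear {0, d, e}))"

text \<open>The curve carries its starting point and direction of traversal. All knot words of a
  diagram arise by letting the parametrised curve vary.\<close>

definition knot_diagram :: "(real \<Rightarrow> space) \<Rightarrow> nat \<Rightarrow> bool" where
  "knot_diagram \<gamma> k \<longleftrightarrow>
     polygonal_knot \<gamma> \<and> finite (crossings \<gamma>) \<and> card (crossings \<gamma>) = k \<and>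
     shadow \<gamma> 0 \<notin> crossings \<gamma> \<and>
     (\<forall>c\<in>crossings \<gamma>. card (passes \<gamma> c) = 2 \<and> transverse_at \<gamma> c)"

definition crossing_times :: "(real \<Rightarrow> space) \<Rightarrow> real set" where
  "crossing_times \<gamma> = {t \<in> {0..<1}. shadow \<gamma> t \<in> crossings \<gamma>}"

definition first_time :: "(real \<Rightarrow> space) \<Rightarrow> complex \<Rightarrow> real" where
  "first_time \<gamma> c = Min (passes \<gamma> c)"

text \<open>Labels 1, 2, ... in the order of first encounter.\<close>

definition crossing_label :: "(real \<Rightarrow> space) \<Rightarrow> complex \<Rightarrow> nat" where
  "crossing_label \<gamma> c = card {d \<in> crossings \<gamma>. first_time \<gamma> d \<le> first_time \<gamma> c}"

definition knot_word :: "(real \<Rightarrow> space) \<Rightarrow> nat list" where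
  "knot_word \<gamma> =
     map (\<lambda>t. crossing_label \<gamma> (shadow \<gamma> t)) (sorted_list_of_set (crossing_times \<gamma>))"

definition straight_diagram :: "(real \<Rightarrow> space) \<Rightarrow> nat \<Rightarrow> bool" where
  "straight_diagram \<gamma> k \<longleftrightarrow> knot_diagram \<gamma> k \<and>
     (\<exists>\<sigma>. \<sigma> permutes {1..k} \<and> knot_word \<gamma> = [1..<Suc k] @ map \<sigma> [1..<Suc k])"

text \<open>The numbers below are minima, with value \<^term>\<open>\<infinity>\<close> if there is no diagram
  of the required kind.\<close>

definition straight_number :: "(space \<times> real) set \<Rightarrow> enat" where
  "straight_number K = (INF k \<in> {k. \<exists>\<gamma>. represents \<gamma> K \<and> straight_diagram \<gamma> k}. enat k)"

text \<open>The parameter \<open>u\<close> is where the first sub-arc, the straight strand, ends.\<close>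

definition straight_position :: "(real \<Rightarrow> space) \<Rightarrow> nat \<Rightarrow> real \<Rightarrow> bool" where
  "straight_position \<gamma> k u \<longleftrightarrow> straight_diagram \<gamma> k \<and>
     0 < u \<and> u < 1 \<and> u \<notin> crossing_times \<gamma> \<and> card {t \<in> crossing_times \<gamma>. t < u} = k \<and>
     Im (shadow \<gamma> u) = Im (shadow \<gamma> 0) \<and>
     shadow \<gamma> ` {0..u} = closed_segment (shadow \<gamma> 0) (shadow \<gamma> u)"

definition extended_straight_strand :: "(real \<Rightarrow> space) \<Rightarrow> real \<Rightarrow> complex set" where
  "extended_straight_strand \<gamma> u = {z. Im z = Im (shadow \<gamma> 0)} - shadow \<gamma> ` {0..u}"

text \<open>As crossing means crossing transversally and a mere touching can be pushed off the
  line, the projection is required to avoid the extended straight strand altogether.\<close>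

definition contained_straight_diagram :: "(real \<Rightarrow> space) \<Rightarrow> nat \<Rightarrow> bool" where
  "contained_straight_diagram \<gamma> k \<longleftrightarrow>
     (\<exists>u. straight_position \<gamma> k u \<and>
          path_image (shadow \<gamma>) \<inter> extended_straight_strand \<gamma> u = {})"

definition contained_straight_number :: "(space \<times> real) set \<Rightarrow> enat" where
  "contained_straight_number K =
     (INF k \<in> {k. \<exists>\<gamma>. represents \<gamma> K \<and> contained_straight_diagram \<gamma> k}. enat k)"

text \<open>A petal is a component of the projection with the multi-crossing removed; adding the
  multi-crossing back gives the loop based at it, a Jordan curve.\<close>

definition petals :: "(real \<Rightarrow> space) \<Rightarrow> complex \<Rightarrow> complex set set" where
  "petals \<gamma> c = components (path_image (shadow \<gamma>) - {c})"

definition petal_projection :: "(real \<Rightarrow> space) \<Rightarrow> complex \<Rightarrow> bool" where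
  "petal_projection \<gamma> c \<longleftrightarrow>
     polygonal_knot \<gamma> \<and> crossings \<gamma> = {c} \<and> shadow \<gamma> 0 \<noteq> c \<and>
     finite (passes \<gamma> c) \<and> transverse_at \<gamma> c \<and>
     (\<forall>A\<in>petals \<gamma> c. \<forall>B\<in>petals \<gamma> c. A \<noteq> B \<longrightarrow> B \<inter> inside (insert c A) = {})"

definition petal_number :: "(space \<times> real) set \<Rightarrow> enat" where
  "petal_number K =
     (INF n \<in> {n. \<exists>\<gamma> c. represents \<gamma> K \<and> petal_projection \<gamma> c \<and> card (petals \<gamma> c) = n}. enat n)"

end

theory Submission
  imports Defs
begin

text \<open>
  Straighten the first sub-arc of the diagram into a segment of a line by isotopies of the plane and take this
  line as the axis of an open book. The rest of the knot can be moved, keeping its shadow, into pages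
  near the plane of the diagram, and the straight strand, which lies above or below the rest at every crossing, into the
  remaining pages. The knot is then a fan: it makes one half turn around the axis
  and meets it in finitely many strands, so that looking along the axis yields a petal
  projection with one petal per strand. Each of the two ends of the segment contributes a strand, and the straight strand at
  most one between consecutive crossings. In the contained case the rest meets the axis
  only in the crossings. Otherwise it may meet the axis elsewhere;
  a planar arc on one side of the axis can be flipped to the other side when no strand separates its ends in height,
  and since arcs of the diagram on the same side do not interlace, this reduces
  the number of its strands below twice the number of crossings.
\<close>

text \<open>All isotopies rest on one principle, \<open>kiso_linear\<close>: linear interpolation
  between two closed polygons is an ambient isotopy as soon as it is simple at every time. The
  vertex number \<open>M\<close> is therefore fixed in advance, with vertices in reserve: strands
  through the axis are zeros of the signed radius \<open>r\<close>, and a strand is removed by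
  making a zero nonzero, never by deleting a vertex. The obstacle in part (1) is that the line
  outside the segment consists of two rays, and arcs from one ray to the other seem to be separated
  by the strands on the segment. Swinging the lowest strands over the top joins the rays through
  infinity, so that the strands off the segment become neighbours on the axis. When no flip applies
  any more, the zero that follows an outer zero along the knot lies on the segment, and so does the
  one that follows vertex 0. Hence there are fewer outer zeros than the at most \<open>n\<close>
  zeros on the segment, and both kinds together number at most \<open>2 * n - 1\<close>. With two
  ends and \<open>n - 1\<close> changes of side this makes \<open>3 * n\<close>.\<close>

abbreviation mix :: "real \<Rightarrow> 'a::real_vector \<Rightarrow> 'a \<Rightarrow> 'a" where
  "mix s x y \<equiv> (1 - s) *\<^sub>R x + s *\<^sub>R y"

abbreviation rmix :: "real \<Rightarrow> real \<Rightarrow> real \<Rightarrow> real" where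
  "rmix s x y \<equiv> (1 - s) * x + s * y"

section \<open>Piecewise affine paths\<close>

text \<open>Closure under linear maps, sums, absolute values and restriction follows by rule
  induction, where \<open>piecewise_affine\<close> would require merging finite sets of breaks;
  \<open>piecewise_affine_iff_pa\<close> links the two notions. Degenerate intervals
  \<open>a = b\<close> are included, which spares case distinctions when cutting.\<close>

inductive pa :: "real => real => (real => 'a::real_normed_vector) => bool" where
  pa_affine: "a \<le> b ==> (\<And>t. t \<in> {a..b} ==> f t = p + t *\<^sub>R v) ==> pa a b f"
| pa_cat: "pa a c f ==> pa c b f ==> pa a b f"

lemma pa_le: "pa a b f ==> a \<le> b"
  by (induction rule: pa.induct) auto

lemma pa_restrict:
  "pa a b f ==> a \<le> c ==> c \<le> d ==> d \<le> b ==> pa c d f"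
proof (induction arbitrary: c d rule: pa.induct)
  case (pa_affine a b f p v)
  thus ?case by (intro pa.pa_affine[of c d f p v]) auto
next
  case (pa_cat a m f b)
  consider "d \<le> m" | "m \<le> c" | "c \<le> m" "m \<le> d" by linarith
  thus ?case
    by cases (use pa_cat in "auto intro: pa.pa_cat[of c m f d]")
qed

lemma pa_compose_affine:
  assumes "pa a b f" "linear L"
  shows "pa a b (\<lambda>t. c + L (f t))"
  using assms(1)
proof (induction rule: pa.induct)
  case (pa_affine a b f p v)
  show ?case
    by (rule pa.pa_affine[of a b _ "c + L p" "L v"])
      (use pa_affine in "auto simp: linear_add[OF assms(2)] linear_scale[OF assms(2)]")
qed (rule pa.pa_cat)

lemma pa_linear: "pa a b f ==> linear L ==> pa a b (\<lambda>t. L (f t))"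
  using pa_compose_affine[of a b f L 0] by simp

lemma pa_const: "a \<le> b ==> pa a b (\<lambda>t. c)"
  by (rule pa_affine[of a b _ c 0]) auto

lemma pa_add:
  assumes "pa a b f" "pa a b g"
  shows "pa a b (\<lambda>t. f t + g t)"
  using assms
proof (induction arbitrary: rule: pa.induct)
  case (pa_affine a b f p v)
  note f = pa_affine(2)
  from pa_affine(3) f show ?case
  proof (induction rule: pa.induct)
    case (pa_affine a b g q w)
    thus ?case
      by (intro pa.pa_affine[of a b _ "p + q" "v + w"]) (auto simp: algebra_simps)
  next
    case (pa_cat a c g b)
    have "a \<le> c" "c \<le> b" using pa_cat pa_le by blast+
    thus ?case using pa_cat by (intro pa.pa_cat[of a c _ b]) auto
  qed
next
  case (pa_cat a c f b)
  have "a \<le> c" "c \<le> b" using pa_cat pa_le by blast+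
  hence "pa a c g" "pa c b g" using pa_cat.prems pa_restrict by force+
  thus ?case using pa_cat by (intro pa.pa_cat[of a c _ b]) auto
qed

lemma pa_scaleR: "pa a b f ==> pa a b (\<lambda>t. c *\<^sub>R f t)"
  by (rule pa_linear) (auto intro: linear_scaleR)

lemma pa_scaleR_left: "pa a b f ==> pa a b (\<lambda>t. f t *\<^sub>R v)"
  by (rule pa_linear) (auto intro: bounded_linear.linear bounded_linear_scaleR_left)

lemma pa_mult: "pa a b f ==> pa a b (\<lambda>t. c * f t :: real)"
  using pa_scaleR[of a b f c] by simp

lemma pa_diff:
  assumes "pa a b f" "pa a b g"
  shows "pa a b (\<lambda>t. f t - g t)"
  using pa_add[OF assms(1) pa_scaleR[OF assms(2), of "-1"]] by simp

lemma pa_abs: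
  fixes f :: "real => real"
  assumes "pa a b f"
  shows "pa a b (\<lambda>t. \<bar>f t\<bar>)"
  using assms
proof (induction rule: pa.induct)
  case (pa_affine a b f p v)
  have nonneg: "pa c d (\<lambda>t. \<bar>f t\<bar>)" if "a \<le> c" "c \<le> d" "d \<le> b" "p + c * v \<ge> 0" "p + d * v \<ge> 0" for c d
  proof (rule pa.pa_affine[of c d _ p v])
    fix t assume t: "t \<in> {c..d}"
    have "p + t * v \<ge> 0"
    proof (cases "v \<ge> 0")
      case True
      hence "c * v \<le> t * v" using t by (intro mult_right_mono) auto
      thus ?thesis using that by linarith
    next
      case False
      hence "d * v \<le> t * v" using t by (intro mult_right_mono_neg) auto
      thus ?thesis using that by linarith
    qed
    thus "\<bar>f t\<bar> = p + t *\<^sub>R v" using pa_affine(2) t that by auto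
  qed (use that in auto)
  have nonpos: "pa c d (\<lambda>t. \<bar>f t\<bar>)" if "a \<le> c" "c \<le> d" "d \<le> b" "p + c * v \<le> 0" "p + d * v \<le> 0" for c d
  proof (rule pa.pa_affine[of c d _ "-p" "-v"])
    fix t assume t: "t \<in> {c..d}"
    have "p + t * v \<le> 0"
    proof (cases "v \<ge> 0")
      case True
      hence "t * v \<le> d * v" using t by (intro mult_right_mono) auto
      thus ?thesis using that by linarith
    next
      case False
      hence "t * v \<le> c * v" using t by (intro mult_right_mono_neg) auto
      thus ?thesis using that by linarith
    qed
    thus "\<bar>f t\<bar> = - p + t *\<^sub>R - v" using pa_affine(2) t that by auto
  qed (use that in auto)
  show ?case
  proof (cases "(p + a * v) * (p + b * v) \<ge> 0")
    case True
    hence "(p + a * v \<ge> 0 \<and> p + b * v \<ge> 0) \<or> (p + a * v \<le> 0 \<and> p + b * v \<le> 0)"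
      by (auto simp: zero_le_mult_iff)
    thus ?thesis using nonneg[of a b] nonpos[of a b] pa_affine by auto
  next
    case False
    hence lt: "(p + a * v < 0 \<and> p + b * v > 0) \<or> (p + a * v > 0 \<and> p + b * v < 0)"
      by (auto simp: not_le mult_less_0_iff)
    hence v0: "v \<noteq> 0" by auto
    define c where "c = - p / v"
    have pc: "p + c * v = 0" using v0 by (simp add: c_def)
    have c: "a \<le> c" "c \<le> b"
    proof -
      have va: "p + a * v = (a - c) * v" "p + b * v = (b - c) * v"
        using pc by (auto simp: algebra_simps)
      show "a \<le> c" using lt pa_affine(1) unfolding va
        by (smt (verit) mult_less_0_iff zero_less_mult_iff)
      show "c \<le> b" using lt pa_affine(1) unfolding va
        by (smt (verit) mult_less_0_iff zero_less_mult_iff)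
    qed
    show ?thesis
      using lt nonneg[of a c] nonneg[of c b] nonpos[of a c] nonpos[of c b] c pc
      by (intro pa.pa_cat[of a c _ b]) auto
  qed
qed (rule pa.pa_cat)

lemma pa_max:
  fixes f g :: "real => real"
  assumes "pa a b f" "pa a b g"
  shows "pa a b (\<lambda>t. max (f t) (g t))"
proof -
  have "pa a b (\<lambda>t. (1/2) *\<^sub>R ((f t + g t) + \<bar>f t - g t\<bar>))"
    by (intro pa_scaleR pa_add pa_abs pa_diff assms)
  moreover have "max (f t) (g t) = (1/2) *\<^sub>R ((f t + g t) + \<bar>f t - g t\<bar>)" for t
    by (auto simp: max_def field_simps)
  ultimately show ?thesis by (simp only:)
qed

lemma pa_min:
  fixes f g :: "real => real"
  assumes "pa a b f" "pa a b g"
  shows "pa a b (\<lambda>t. min (f t) (g t))"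
proof -
  have "pa a b (\<lambda>t. (1/2) *\<^sub>R ((f t + g t) - \<bar>f t - g t\<bar>))"
    by (intro pa_scaleR pa_add pa_diff pa_abs assms)
  moreover have "min (f t) (g t) = (1/2) *\<^sub>R ((f t + g t) - \<bar>f t - g t\<bar>)" for t
    by (auto simp: min_def field_simps)
  ultimately show ?thesis by (simp only:)
qed

lemma pa_Pair: "pa a b f ==> pa a b g ==> pa a b (\<lambda>t. (f t, g t))"
proof -
  assume "pa a b f" "pa a b g"
  hence "pa a b (\<lambda>t. (f t, 0) + (0, g t))"
    by (intro pa_add pa_linear[of a b f "\<lambda>x. (x, 0)"] pa_linear[of a b g "\<lambda>x. (0, x)"])
      (auto intro!: linearI)
  thus ?thesis by simp
qed

lemma linear_fst': "linear (fst :: 'a::real_vector \<times> 'b::real_vector => 'a)"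
  by (rule linearI) auto

lemma linear_snd': "linear (snd :: 'a::real_vector \<times> 'b::real_vector => 'b)"
  by (rule linearI) auto

lemma pa_fst: "pa a b f ==> pa a b (\<lambda>t. fst (f t))"
  by (rule pa_linear[OF _ linear_fst'])

lemma pa_snd: "pa a b f ==> pa a b (\<lambda>t. snd (f t))"
  by (rule pa_linear[OF _ linear_snd'])

lemma pa_Im: "pa a b f ==> pa a b (\<lambda>t. Im (f t))"
  by (rule pa_linear) (auto intro: linearI)

lemma pa_cmult: "pa a b f ==> pa a b (\<lambda>t. c * f t :: complex)"
  by (rule pa_linear) (auto intro!: linearI simp: algebra_simps)

lemma pa_continuous: "pa a b f ==> continuous_on {a..b} f"
proof (induction rule: pa.induct)
  case (pa_affine a b f p v)
  have "continuous_on {a..b} (\<lambda>t. p + t *\<^sub>R v)" by (intro continuous_intros)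
  thus ?case using pa_affine(2) by (subst continuous_on_cong[OF refl]) auto
next
  case (pa_cat a c f b)
  hence "continuous_on ({a..c} \<union> {c..b}) f"
    by (intro continuous_on_closed_Un) auto
  thus ?case using pa_le[OF pa_cat(1)] pa_le[OF pa_cat(2)] by (simp add: ivl_disj_un_two_touch)
qed

text \<open>Next to every parameter the path is affine for a short time. The local comparison of a
  polygon with its displacement in \<open>branch_bound\<close> rests on these one-sided
  germs.\<close>

lemma pa_right_germ:
  "pa a b f ==> a \<le> t ==> t < b ==>
   \<exists>\<epsilon>>0. \<exists>v. t + \<epsilon> \<le> b \<and> (\<forall>x. 0 \<le> x --> x \<le> \<epsilon> --> f (t + x) = f t + x *\<^sub>R v)"
proof (induction rule: pa.induct)
  case (pa_affine a b f p v)
  thus ?case by (intro exI[of _ "b - t"] conjI exI[of _ v]) (auto simp: scaleR_add_left)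
next
  case (pa_cat a c f b)
  show ?case
  proof (cases "t < c")
    case True
    thus ?thesis using pa_cat pa_le[OF pa_cat(2)] by force
  next
    case False
    thus ?thesis using pa_cat by auto
  qed
qed

lemma pa_left_germ:
  "pa a b f ==> a < t ==> t \<le> b ==>
   \<exists>\<epsilon>>0. \<exists>v. a \<le> t - \<epsilon> \<and> (\<forall>x. 0 \<le> x --> x \<le> \<epsilon> --> f (t - x) = f t + x *\<^sub>R v)"
proof (induction rule: pa.induct)
  case (pa_affine a b f p v)
  thus ?case by (intro exI[of _ "t - a"] conjI exI[of _ "-v"]) (auto simp: scaleR_diff_left)
next
  case (pa_cat a c f b)
  show ?case
  proof (cases "c < t")
    case True
    thus ?thesis using pa_cat pa_le[OF pa_cat(1)] by force
  next
    case False
    thus ?thesis using pa_cat by auto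
  qed
qed

lemma linepath_affine:
  fixes p v :: "'a::real_normed_vector"
  assumes "c < d"
  shows "linepath (p + c *\<^sub>R v) (p + d *\<^sub>R v) ((t - c) / (d - c)) = p + t *\<^sub>R v"
proof -
  define s where "s = (t - c) / (d - c)"
  have "s * (d - c) = t - c" using assms by (simp add: s_def)
  hence "rmix s c d = t" by (simp add: algebra_simps)
  moreover have "linepath (p + c *\<^sub>R v) (p + d *\<^sub>R v) s = p + (rmix s c d) *\<^sub>R v"
    by (simp add: linepath_def algebra_simps)
  ultimately show ?thesis by (simp add: s_def)
qed

lemma pa_imp_linepath:
  assumes "pa a b f"
  shows "\<exists>S. finite S \<and> (\<forall>c d. a \<le> c \<and> c < d \<and> d \<le> b \<and> S \<inter> {c<..<d} = {} -->
           (\<forall>t\<in>{c..d}. f t = linepath (f c) (f d) ((t - c) / (d - c))))"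
  using assms
proof (induction rule: pa.induct)
  case (pa_affine a b f p v)
  thus ?case
    by (intro exI[of _ "{}"]) (auto simp: linepath_affine)
next
  case (pa_cat a m f b)
  then obtain S T where S: "finite S" "\<And>c d. a \<le> c \<and> c < d \<and> d \<le> m \<and> S \<inter> {c<..<d} = {} ==>
           (\<forall>t\<in>{c..d}. f t = linepath (f c) (f d) ((t - c) / (d - c)))"
    and T: "finite T" "\<And>c d. m \<le> c \<and> c < d \<and> d \<le> b \<and> T \<inter> {c<..<d} = {} ==>
           (\<forall>t\<in>{c..d}. f t = linepath (f c) (f d) ((t - c) / (d - c)))"
    by metis
  show ?case
  proof (intro exI[of _ "insert m (S \<union> T)"] conjI allI impI)
    fix c d assume *: "a \<le> c \<and> c < d \<and> d \<le> b \<and> insert m (S \<union> T) \<inter> {c<..<d} = {}"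
    hence "d \<le> m \<or> m \<le> c" by force
    thus "\<forall>t\<in>{c..d}. f t = linepath (f c) (f d) ((t - c) / (d - c))"
      using S(2)[of c d] T(2)[of c d] * by blast
  qed (use S T in auto)
qed

text \<open>Induction on the number of breaks strictly inside the interval: after a cut at one of
  them both halves contain fewer.\<close>

lemma linepath_imp_pa:
  assumes "finite S" "a < b" and
    "\<And>c d. a \<le> c ==> c < d ==> d \<le> b ==> S \<inter> {c<..<d} = {} ==>
           (\<forall>t\<in>{c..d}. f t = linepath (f c) (f d) ((t - c) / (d - c)))"
  shows "pa a b f"
  using assms
proof (induction "card (S \<inter> {a<..<b})" arbitrary: a b rule: less_induct)
  case less
  show ?case
  proof (cases "S \<inter> {a<..<b} = {}")
    case True
    hence eq: "f t = linepath (f a) (f b) ((t - a) / (b - a))" if "t \<in> {a..b}" for t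
      using less.prems(3)[of a b] less.prems(2) that by blast
    show ?thesis
    proof (rule pa_affine[of a b f "f a - (a / (b - a)) *\<^sub>R (f b - f a)" "(1 / (b - a)) *\<^sub>R (f b - f a)"])
      fix t assume "t \<in> {a..b}"
      hence "f t = f a + ((t - a) / (b - a)) *\<^sub>R (f b - f a)"
        by (subst eq) (auto simp: linepath_def algebra_simps)
      also have "(t - a) / (b - a) = - (a / (b - a)) + t * (1 / (b - a))"
        by (simp add: diff_divide_distrib)
      finally show "f t = f a - (a / (b - a)) *\<^sub>R (f b - f a) + t *\<^sub>R (1 / (b - a)) *\<^sub>R (f b - f a)"
        by (simp add: scaleR_diff_left)
    qed (use less.prems in auto)
  next
    case False
    then obtain m where m: "m \<in> S" "a < m" "m < b" by auto
    have fin: "finite (S \<inter> {a<..<b})" using less.prems by auto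
    have "S \<inter> {a<..<m} \<subset> S \<inter> {a<..<b}" "S \<inter> {m<..<b} \<subset> S \<inter> {a<..<b}" using m by auto
    hence "card (S \<inter> {a<..<m}) < card (S \<inter> {a<..<b})" "card (S \<inter> {m<..<b}) < card (S \<inter> {a<..<b})"
      by (auto intro: psubset_card_mono fin)
    note hyps = less.hyps[OF this(1) less.prems(1) m(2)] less.hyps[OF this(2) less.prems(1) m(3)]
    have "pa a m f"
      by (rule hyps(1), rule less.prems(3)) (use m in auto)
    moreover have "pa m b f"
      by (rule hyps(2), rule less.prems(3)) (use m in auto)
    ultimately show ?thesis by (rule pa_cat)
  qed
qed

lemma piecewise_affine_iff_pa: "piecewise_affine f \<longleftrightarrow> pa 0 1 f"
proof
  assume "piecewise_affine f"
  from this[unfolded piecewise_affine_def] show "pa 0 1 f"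
  proof (elim exE conjE)
    fix S assume S: "finite S" and
      *: "\<forall>a b. 0 \<le> a \<and> a < b \<and> b \<le> 1 \<and> S \<inter> {a<..<b} = {} -->
           (\<forall>t\<in>{a..b}. f t = linepath (f a) (f b) ((t - a) / (b - a)))"
    show "pa 0 1 f"
    proof (rule linepath_imp_pa[OF S])
      fix c d :: real assume "0 \<le> c" "c < d" "d \<le> 1" "S \<inter> {c<..<d} = {}"
      thus "\<forall>t\<in>{c..d}. f t = linepath (f c) (f d) ((t - c) / (d - c))"
        by (intro *[THEN spec, THEN spec, THEN mp] conjI)
    qed simp
  qed
next
  assume "pa 0 1 f"
  thus "piecewise_affine f" unfolding piecewise_affine_def by (rule pa_imp_linepath)
qed


section \<open>Ambient isotopies\<close>

lemma ambient_isotopicE: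
  assumes "ambient_isotopic K L"
  obtains h :: "real \<times> (space \<times> real) => space \<times> real"
  where "K \<subseteq> S3" "continuous_on ({0..1} \<times> S3) h" "\<And>x. x \<in> S3 ==> h (0, x) = x"
    "\<And>t. t \<in> {0..1} ==> \<exists>g. homeomorphism S3 S3 (\<lambda>x. h (t, x)) g" "(\<lambda>x. h (1, x)) ` K = L"
proof -
  from assms[unfolded ambient_isotopic_def] show thesis
  proof (elim conjE exE)
    fix h :: "real \<times> (space \<times> real) => space \<times> real"
    assume *: "K \<subseteq> S3" "continuous_on ({0..1} \<times> S3) h" "\<forall>x\<in>S3. h (0, x) = x"
      "\<forall>t\<in>{0..1}. \<exists>g. homeomorphism S3 S3 (\<lambda>x. h (t, x)) g" "(\<lambda>x. h (1, x)) ` K = L"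
    show thesis
      by (rule that[OF *(1,2) *(3)[rule_format] *(4)[rule_format] *(5)])
  qed
qed

text \<open>The isotopies are composed time by time instead of being run one after the other, so no
  gluing in the time direction is needed.\<close>

lemma ambient_isotopic_trans:
  assumes "ambient_isotopic K L" "ambient_isotopic L M"
  shows "ambient_isotopic K M"
proof -
  obtain h1 :: "real \<times> (space \<times> real) => space \<times> real" where K: "K \<subseteq> S3" and c1: "continuous_on ({0..1} \<times> S3) h1"
    and z1: "\<And>x. x \<in> S3 ==> h1 (0, x) = x"
    and m1: "\<And>t. t \<in> {0..1} ==> \<exists>g. homeomorphism S3 S3 (\<lambda>x. h1 (t, x)) g"
    and L: "(\<lambda>x. h1 (1, x)) ` K = L"
    by (rule ambient_isotopicE[OF assms(1)], rule that) assumption+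
  obtain h2 :: "real \<times> (space \<times> real) => space \<times> real" where c2: "continuous_on ({0..1} \<times> S3) h2"
    and z2: "\<And>x. x \<in> S3 ==> h2 (0, x) = x"
    and m2: "\<And>t. t \<in> {0..1} ==> \<exists>g. homeomorphism S3 S3 (\<lambda>x. h2 (t, x)) g"
    and M: "(\<lambda>x. h2 (1, x)) ` L = M"
    by (rule ambient_isotopicE[OF assms(2)], rule that) assumption+
  have mem1: "h1 (t, x) \<in> S3" if "t \<in> {0..1}" "x \<in> S3" for t x
    using m1[OF that(1)] that(2) unfolding homeomorphism_def by blast
  show ?thesis
    unfolding ambient_isotopic_def
  proof (intro conjI exI[of _ "\<lambda>p. h2 (fst p, h1 p)"] ballI)
    show "continuous_on ({0..1} \<times> S3) (\<lambda>p. h2 (fst p, h1 p))"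
      by (rule continuous_on_compose2[OF c2]) (auto intro!: continuous_intros c1 mem1)
    show "h2 (fst (0, x), h1 (0, x)) = x" if "x \<in> S3" for x
      using that z1 z2 by simp
    show "\<exists>g. homeomorphism S3 S3 (\<lambda>x. h2 (fst (t, x), h1 (t, x))) g" if "t \<in> {0..1}" for t
    proof -
      note m12 = m1[OF that] m2[OF that]
      obtain g1 g2 where "homeomorphism S3 S3 (\<lambda>x. h1 (t, x)) g1" "homeomorphism S3 S3 (\<lambda>x. h2 (t, x)) g2"
        using m12 by blast
      from homeomorphism_compose[OF this] show ?thesis by (auto simp: o_def)
    qed
    show "(\<lambda>x. h2 (fst (1, x), h1 (1, x))) ` K = M"
      unfolding M[symmetric] L[symmetric] by (auto simp: image_image)
  qed (rule K)
qed

text \<open>With \<open>g\<close> the inverse of the final map, \<open>h (1 - t, g x)\<close> starts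
  at the identity and ends at \<open>g\<close>. Only this single inverse occurs, so continuity of
  the inverses jointly in time is not an issue.\<close>

lemma ambient_isotopic_sym:
  assumes "ambient_isotopic K L"
  shows "ambient_isotopic L K"
proof -
  obtain h :: "real \<times> (space \<times> real) => space \<times> real" where K: "K \<subseteq> S3" and c1: "continuous_on ({0..1} \<times> S3) h"
    and z1: "\<And>x. x \<in> S3 ==> h (0, x) = x"
    and m1: "\<And>t. t \<in> {0..1} ==> \<exists>g. homeomorphism S3 S3 (\<lambda>x. h (t, x)) g"
    and L: "(\<lambda>x. h (1, x)) ` K = L"
    by (rule ambient_isotopicE[OF assms], rule that) assumption+
  obtain g where g: "homeomorphism S3 S3 (\<lambda>x. h (1, x)) g" using m1[of 1] by auto
  have gc: "continuous_on S3 g" and gm: "\<And>x. x \<in> S3 ==> g x \<in> S3"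
    and hg: "\<And>x. x \<in> S3 ==> h (1, g x) = x" and gh: "\<And>x. x \<in> S3 ==> g (h (1, x)) = x"
    and hm: "\<And>x. x \<in> S3 ==> h (1, x) \<in> S3"
    using g unfolding homeomorphism_def by blast+
  show ?thesis
    unfolding ambient_isotopic_def
  proof (intro conjI exI[of _ "\<lambda>p. h (1 - fst p, g (snd p))"] ballI)
    show "L \<subseteq> S3" using L K hm by blast
    show "continuous_on ({0..1} \<times> S3) (\<lambda>p. h (1 - fst p, g (snd p)))"
      by (rule continuous_on_compose2[OF c1])
        (auto intro!: continuous_intros gm continuous_on_compose2[OF gc])
    show "h (1 - fst (0, x), g (snd (0, x))) = x" if "x \<in> S3" for x
      using that hg by simp
    show "\<exists>f. homeomorphism S3 S3 (\<lambda>x. h (1 - fst (t, x), g (snd (t, x)))) f" if "t \<in> {0..1}" for t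
    proof -
      have "1 - t \<in> {0..1}" using that by auto
      then obtain g2 where "homeomorphism S3 S3 (\<lambda>x. h (1 - t, x)) g2"
        using m1 by blast
      from homeomorphism_compose[OF homeomorphism_symD[OF g] this] show ?thesis by (auto simp: o_def)
    qed
    have "(\<lambda>x. h (0, g x)) ` L = K"
      unfolding L[symmetric] image_image using K z1 gh by (force simp: image_iff)
    thus "(\<lambda>x. h (1 - fst (1, x), g (snd (1, x)))) ` L = K" by simp
  qed
qed

section \<open>Isotopy of subsets of 3-space through the stereographic chart\<close>

definition kiso :: "space set => space set => bool" where
  "kiso A B \<longleftrightarrow> ambient_isotopic (inv_stereographic ` A) (inv_stereographic ` B)"

lemma kiso_trans: "kiso A B ==> kiso B C ==> kiso A C"
  unfolding kiso_def by (rule ambient_isotopic_trans)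

lemma kiso_sym: "kiso A B ==> kiso B A"
  unfolding kiso_def by (rule ambient_isotopic_sym)

definition stereographic :: "space \<times> real => space" where
  "stereographic p = (1 / (1 - snd p)) *\<^sub>R fst p"

lemma S3_iff: "p \<in> S3 \<longleftrightarrow> (norm (fst p))\<^sup>2 + (snd p)\<^sup>2 = 1"
proof -
  have "norm p = sqrt ((norm (fst p))\<^sup>2 + (snd p)\<^sup>2)" by (simp add: norm_prod_def)
  thus ?thesis by (auto simp: S3_def)
qed

lemma inv_stereographic_S3: "inv_stereographic x \<in> S3"
proof -
  define n where "n = (norm x)\<^sup>2"
  have n: "n + 1 > 0" using zero_le_power2[of "norm x"] by (simp add: n_def add_nonneg_pos)
  have "(norm (fst (inv_stereographic x)))\<^sup>2 = (2 / (n + 1))\<^sup>2 * n"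
    using n by (simp add: inv_stereographic_def n_def power_mult_distrib power_divide)
  moreover have "(2 / (n + 1))\<^sup>2 * n + ((n - 1) / (n + 1))\<^sup>2 = (4 * n + (n - 1)\<^sup>2) / (n + 1)\<^sup>2"
    by (simp add: power_divide add_divide_distrib)
  moreover have "4 * n + (n - 1)\<^sup>2 = (n + 1)\<^sup>2" by (simp add: power2_eq_square algebra_simps)
  ultimately show ?thesis using n by (simp add: S3_iff inv_stereographic_def n_def)
qed

lemma inv_stereographic_snd: "snd (inv_stereographic x) < 1"
  by (simp add: inv_stereographic_def divide_less_eq add_nonneg_pos)

lemma stereographic_inverse: "stereographic (inv_stereographic x) = x"
proof -
  define n where "n = (norm x)\<^sup>2"
  have n: "n + 1 > 0" using zero_le_power2[of "norm x"] by (simp add: n_def add_nonneg_pos)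
  have "1 - (n - 1) / (n + 1) = 2 / (n + 1)" using n by (simp add: field_simps)
  hence "stereographic (inv_stereographic x) = (1 / (2 / (n + 1)) * (2 / (n + 1))) *\<^sub>R x"
    by (simp only: stereographic_def inv_stereographic_def n_def[symmetric] fst_conv snd_conv scaleR_scaleR)
  moreover have "1 / (2 / (n + 1)) * (2 / (n + 1)) = 1" using n by simp
  ultimately show ?thesis by (simp only: scaleR_one)
qed

lemma norm_stereographic:
  assumes "p \<in> S3" "snd p < 1"
  shows "(norm (stereographic p))\<^sup>2 = (1 + snd p) / (1 - snd p)"
proof -
  have "(norm (stereographic p))\<^sup>2 = (norm (fst p))\<^sup>2 / (1 - snd p)\<^sup>2"
    using assms by (simp add: stereographic_def power_divide)
  also have "(norm (fst p))\<^sup>2 = (1 + snd p) * (1 - snd p)"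
    using assms(1) by (simp add: S3_iff power2_eq_square algebra_simps)
  finally show ?thesis using assms by (simp add: power2_eq_square)
qed

lemma inv_stereographic_inverse:
  assumes "p \<in> S3" "snd p < 1"
  shows "inv_stereographic (stereographic p) = p"
proof -
  define s where "s = snd p"
  have s: "s < 1" using assms by (simp add: s_def)
  have n: "(norm (stereographic p))\<^sup>2 = (1 + s) / (1 - s)"
    using norm_stereographic[OF assms] by (simp add: s_def)
  have e: "(1 + s) / (1 - s) + 1 = 2 / (1 - s)" "(1 + s) / (1 - s) - 1 = 2 * s / (1 - s)"
    using s by (simp_all add: field_simps)
  have "inv_stereographic (stereographic p) = ((2 / (2 / (1 - s))) *\<^sub>R stereographic p, (2 * s / (1 - s)) / (2 / (1 - s)))"
    unfolding inv_stereographic_def n e by simp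
  also have "\<dots> = (fst p, s)" using s by (simp add: stereographic_def s_def[symmetric])
  finally show ?thesis by (simp add: s_def)
qed

lemma S3_north:
  assumes "p \<in> S3" "p \<noteq> (0, 1)"
  shows "snd p < 1"
proof -
  have "(snd p)\<^sup>2 \<le> 1" using assms(1) zero_le_power2[of "norm (fst p)"] unfolding S3_iff by linarith
  hence "\<bar>snd p\<bar> \<le> 1" by (simp add: abs_square_le_1)
  moreover have "snd p \<noteq> 1"
  proof
    assume "snd p = 1"
    hence "fst p = 0" using assms(1) by (simp add: S3_iff)
    thus False using assms(2) \<open>snd p = 1\<close> by (simp add: prod_eq_iff)
  qed
  ultimately show ?thesis by linarith
qed

lemma continuous_on_inv_stereographic [continuous_intros]:
  assumes "continuous_on S f"
  shows "continuous_on S (\<lambda>x. inv_stereographic (f x))"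
proof -
  have "(norm (f x))\<^sup>2 + 1 \<noteq> 0" for x
    using zero_le_power2[of "norm (f x)"] by linarith
  thus ?thesis unfolding inv_stereographic_def by (intro continuous_intros assms) auto
qed

text \<open>The maps \<open>x + t E x\<close> are injective because \<open>E\<close> contracts
  distances, and surjective by the Banach fixed point theorem. They are the identity outside a ball,
  hence extend to the sphere by fixing the pole; compactness supplies continuity of the
  inverses.\<close>

lemma kiso_displacement:
  fixes E :: "space => space"
  assumes k: "0 \<le> k" "k < 1" and lip: "\<And>x y. norm (E x - E y) \<le> k * norm (x - y)"
    and supp: "\<And>x. norm x \<ge> \<rho> ==> E x = 0"
  shows "kiso A ((\<lambda>x. x + E x) ` A)"
proof -
  define N :: "space \<times> real" where "N = (0, 1)"
  define F where "F t x = x + t *\<^sub>R E x" for t x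
  define R where "R = max \<rho> 1"
  \<comment> \<open>The height on the sphere of the points of norm \<open>R\<close>. Above it the
    map is the identity, which gives continuity at the pole.\<close>
  define c where "c = (R\<^sup>2 - 1) / (R\<^sup>2 + 1)"
  define h where "h q = (if snd q = N then snd q else inv_stereographic (F (fst q) (stereographic (snd q))))"
    for q :: "real \<times> (space \<times> real)"
  have R1: "R \<ge> 1" by (simp add: R_def)
  have R2: "R\<^sup>2 + 1 > 0" by (simp add: add_nonneg_pos)
  have N3: "N \<in> S3" by (simp add: N_def S3_iff)
  have contE: "continuous_on UNIV E"
  proof -
    have "k-lipschitz_on UNIV E" using k lip by (intro lipschitz_onI) (auto simp: dist_norm)
    thus ?thesis by (rule lipschitz_on_continuous_on)
  qed
  have far: "h (t, p) = p" if "p \<in> S3" "snd p > c" for t p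
  proof (cases "p = N")
    case False
    hence s: "snd p < 1" using S3_north[OF that(1)] by (simp add: N_def)
    have "R\<^sup>2 * (1 - snd p) < 1 + snd p"
      using that(2) R2 by (simp add: c_def divide_less_eq algebra_simps)
    hence "R\<^sup>2 < (1 + snd p) / (1 - snd p)" using s by (simp add: less_divide_eq)
    hence "R\<^sup>2 < (norm (stereographic p))\<^sup>2" using norm_stereographic[OF that(1) s] by simp
    hence "R < norm (stereographic p)" by (rule power_less_imp_less_base) simp
    hence "E (stereographic p) = 0" using supp by (simp add: R_def)
    thus ?thesis using False inv_stereographic_inverse[OF that(1) s] by (simp add: h_def F_def)
  qed (simp add: h_def)
  have injF: "inj (F t)" if t: "t \<in> {0..1}" for t
  proof (rule injI)
    fix x y assume "F t x = F t y"
    hence "x - y = - (t *\<^sub>R (E x - E y))" by (simp add: F_def algebra_simps)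
    hence "norm (x - y) = t * norm (E x - E y)" using t by simp
    also have "\<dots> \<le> 1 * norm (E x - E y)" using t by (intro mult_right_mono) auto
    finally have "norm (x - y) \<le> k * norm (x - y)" using lip[of x y] by simp
    hence "(1 - k) * norm (x - y) \<le> 0" by (simp add: algebra_simps)
    hence "norm (x - y) \<le> 0" using k by (simp add: mult_le_0_iff)
    thus "x = y" by simp
  qed
  \<comment> \<open>A preimage of \<open>z\<close> is a fixed point of the contraction sending
    \<open>x\<close> to \<open>z - t E x\<close>.\<close>
  have surjF: "\<exists>x. F t x = z" if t: "t \<in> {0..1}" for t z
  proof -
    have "\<exists>!x. z - t *\<^sub>R E x = x"
    proof (rule banach_fix_type[OF k], intro allI)
      fix x y
      have "dist (z - t *\<^sub>R E x) (z - t *\<^sub>R E y) = norm (t *\<^sub>R (E y - E x))"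
        by (simp add: dist_norm algebra_simps)
      also have "\<dots> = t * norm (E y - E x)" using t by simp
      also have "\<dots> \<le> 1 * norm (E y - E x)" using t by (intro mult_right_mono) auto
      finally show "dist (z - t *\<^sub>R E x) (z - t *\<^sub>R E y) \<le> k * dist x y"
        using lip[of x y] by (simp add: dist_norm norm_minus_commute)
    qed
    thus ?thesis unfolding F_def by (metis diff_add_cancel)
  qed
  have hN: "h (t, N) = N" for t by (simp add: h_def)
  have hx: "h (t, inv_stereographic x) = inv_stereographic (F t x)" for t x
    using inv_stereographic_snd[of x] by (auto simp: h_def stereographic_inverse N_def)
  have S3_split: "p = N \<or> (\<exists>x. p = inv_stereographic x)" if "p \<in> S3" for p
    using inv_stereographic_inverse[OF that] S3_north[OF that] by (metis N_def)
  have inv_inj: "inv_stereographic x = inv_stereographic y ==> x = y" for x y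
    by (metis stereographic_inverse)
  have inv_N: "inv_stereographic x \<noteq> N" for x
    using inv_stereographic_snd[of x] by (auto simp: N_def)
  have conth: "continuous_on ({0..1} \<times> S3) h"
  proof -
    define U where "U = ({0..1::real} \<times> S3) \<inter> (UNIV \<times> (- {N}))"
    define W where "W = ({0..1::real} \<times> S3) \<inter> (UNIV \<times> {p. snd p > c})"
    have UW: "U \<union> W = {0..1} \<times> S3"
    proof -
      have "snd N > c" using R2 by (simp add: N_def c_def)
      thus ?thesis by (auto simp: U_def W_def)
    qed
    have opW: "open {p :: space \<times> real. snd p > c}"
      by (intro open_Collect_less continuous_intros)
    \<comment> \<open>Two relatively open pieces: off the pole the chart formula is continuous, and
      above height \<open>c\<close> the map is the identity.\<close>
    have "continuous_on (U \<union> W) h"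
    proof (rule continuous_on_Un_local_open)
      show "openin (top_of_set (U \<union> W)) U"
        by (subst UW, subst U_def, intro openin_open_Int open_Times) auto
      show "openin (top_of_set (U \<union> W)) W"
        by (subst UW, subst W_def, intro openin_open_Int open_Times opW) auto
      have ne: "1 - snd (snd q) \<noteq> 0" if "q \<in> U" for q
      proof -
        have "snd q \<in> S3" "snd q \<noteq> N" using that by (auto simp: U_def)
        thus ?thesis using S3_north[of "snd q"] by (simp add: N_def)
      qed
      have cs: "continuous_on U (\<lambda>q. stereographic (snd q))"
        unfolding stereographic_def by (intro continuous_intros) (use ne in auto)
      have "continuous_on U (\<lambda>q. inv_stereographic (F (fst q) (stereographic (snd q))))"
        unfolding F_def
        by (intro continuous_intros cs continuous_on_compose2[OF contE cs]) auto
      thus "continuous_on U h"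
        by (subst continuous_on_cong[OF refl, of _ h]) (auto simp: U_def h_def)
      show "continuous_on W h"
        by (subst continuous_on_cong[OF refl, of _ h snd]) (auto simp: W_def intro!: far continuous_intros)
    qed
    thus ?thesis by (simp add: UW)
  qed
  have homeo: "\<exists>g. homeomorphism S3 S3 (\<lambda>x. h (t, x)) g" if t: "t \<in> {0..1}" for t
  proof (rule homeomorphism_compact)
    show "compact S3" by (simp add: S3_def)
    show "continuous_on S3 (\<lambda>x. h (t, x))"
      by (rule continuous_on_compose2[OF conth]) (use t in "auto intro!: continuous_intros")
    show "(\<lambda>x. h (t, x)) ` S3 = S3"
    proof (intro equalityI subsetI)
      fix q assume "q \<in> (\<lambda>x. h (t, x)) ` S3"
      then obtain p where p: "p \<in> S3" "q = h (t, p)" by blast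
      consider "p = N" | x where "p = inv_stereographic x" using S3_split[OF p(1)] by blast
      thus "q \<in> S3"
        by cases (simp_all add: p(2) hN hx N3 inv_stereographic_S3)
    next
      fix q assume "q \<in> S3"
      then consider "q = N" | x where "q = inv_stereographic x" using S3_split by blast
      thus "q \<in> (\<lambda>x. h (t, x)) ` S3"
      proof cases
        case 1
        show ?thesis unfolding 1 using hN[of t] N3 by (metis image_eqI)
      next
        case 2
        obtain y where "F t y = x" using surjF[OF t] by blast
        hence "q = h (t, inv_stereographic y)" using 2 hx by simp
        thus ?thesis by (rule image_eqI) (rule inv_stereographic_S3)
      qed
    qed
    show "inj_on (\<lambda>x. h (t, x)) S3"
    proof (rule inj_onI)
      fix p q assume pq: "p \<in> S3" "q \<in> S3" "h (t, p) = h (t, q)"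
      consider "p = N" | x where "p = inv_stereographic x" using S3_split[OF pq(1)] by blast
      thus "p = q"
      proof cases
        case 1
        hence "h (t, q) = N" using pq(3) hN by simp
        thus ?thesis using S3_split[OF pq(2)] inv_N hx 1 by metis
      next
        case (2 x)
        hence hq: "h (t, q) = inv_stereographic (F t x)" using pq(3) hx by simp
        hence "q \<noteq> N" using hN inv_N by metis
        then obtain y where y: "q = inv_stereographic y" using S3_split[OF pq(2)] by blast
        hence "F t x = F t y" using hq hx inv_inj by metis
        thus ?thesis using 2 y injD[OF injF[OF t]] by blast
      qed
    qed
  qed
  show ?thesis
    unfolding kiso_def ambient_isotopic_def
  proof (intro conjI exI[of _ h] ballI)
    show "inv_stereographic ` A \<subseteq> S3" using inv_stereographic_S3 by blast
    show "h (0, x) = x" if "x \<in> S3" for x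
      using S3_split[OF that] hN hx by (auto simp: F_def)
    show "(\<lambda>x. h (1, x)) ` inv_stereographic ` A = inv_stereographic ` (\<lambda>x. x + E x) ` A"
      by (simp add: image_image hx F_def)
  qed (use conth homeo in auto)
qed


section \<open>Linear homotopies of simple closed polygons\<close>

lemma lipschitz_extension_real:
  fixes e :: "'a::metric_space => real"
  assumes "Y \<noteq> {}" "k \<ge> 0" and lip: "\<And>x y. x \<in> Y ==> y \<in> Y ==> \<bar>e x - e y\<bar> \<le> k * dist x y"
  shows "\<exists>E. (\<forall>x\<in>Y. E x = e x) \<and> (\<forall>x y. \<bar>E x - E y\<bar> \<le> k * dist x y)"
proof -
  \<comment> \<open>The McShane extension: the largest function with the given Lipschitz constant
    that lies below \<open>e\<close> on \<open>Y\<close>.\<close>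
  define E where "E x = (INF y\<in>Y. e y + k * dist x y)" for x
  obtain y0 where y0: "y0 \<in> Y" using assms(1) by blast
  have lb: "e y + k * dist x y \<ge> e y0 - k * dist x y0" if "y \<in> Y" for x y
  proof -
    have "k * dist y y0 \<le> k * (dist x y + dist x y0)"
      using dist_triangle3[of y y0 x] assms(2) by (intro mult_left_mono) auto
    thus ?thesis using lip[OF that y0] by (simp add: algebra_simps)
  qed
  have bdd: "bdd_below ((\<lambda>y. e y + k * dist x y) ` Y)" for x
    using lb by (intro bdd_belowI2[of _ "e y0 - k * dist x y0"]) auto
  have le: "E x \<le> E x' + k * dist x x'" for x x'
  proof -
    have "E x - k * dist x x' \<le> E x'"
      unfolding E_def[of x']
    proof (rule cINF_greatest)
      fix y assume y: "y \<in> Y"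
      have "E x \<le> e y + k * dist x y" unfolding E_def by (rule cINF_lower[OF bdd y])
      moreover have "k * dist x y \<le> k * (dist x x' + dist x' y)"
        using dist_triangle assms(2) by (intro mult_left_mono) auto
      ultimately show "E x - k * dist x x' \<le> e y + k * dist x' y" by (simp add: algebra_simps)
    qed (rule assms(1))
    thus ?thesis by simp
  qed
  have "E x = e x" if x: "x \<in> Y" for x
  proof (rule antisym)
    show "E x \<le> e x" unfolding E_def using cINF_lower[OF bdd x, of x] by simp
    show "e x \<le> E x" unfolding E_def
    proof (rule cINF_greatest)
      fix y assume "y \<in> Y"
      thus "e x \<le> e y + k * dist x y" using lip[OF x, of y] by linarith
    qed (rule assms(1))
  qed
  moreover have "\<bar>E x - E y\<bar> \<le> k * dist x y" for x y
    using le[of x y] le[of y x] by (simp add: dist_commute)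
  ultimately show ?thesis by blast
qed

lemma lipschitz_extension:
  fixes e :: "'a::metric_space => 'b::euclidean_space" and k :: real
  assumes "Y \<noteq> {}" "k \<ge> 0" and lip: "\<And>x y. x \<in> Y ==> y \<in> Y ==> norm (e x - e y) \<le> k * dist x y"
  shows "\<exists>E. (\<forall>x\<in>Y. E x = e x) \<and> (\<forall>x y. norm (E x - E y) \<le> real DIM('b) * k * dist x y)"
proof -
  have "\<exists>E. (\<forall>x\<in>Y. E x = e x \<bullet> b) \<and> (\<forall>x y. \<bar>E x - E y\<bar> \<le> k * dist x y)" if b: "b \<in> Basis" for b
  proof (rule lipschitz_extension_real[OF assms(1,2)])
    fix x y assume "x \<in> Y" "y \<in> Y"
    moreover have "\<bar>e x \<bullet> b - e y \<bullet> b\<bar> \<le> norm (e x - e y)"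
      using Basis_le_norm[OF b, of "e x - e y"] by (simp add: inner_diff_left)
    ultimately show "\<bar>e x \<bullet> b - e y \<bullet> b\<bar> \<le> k * dist x y" using lip order_trans by blast
  qed
  then obtain E where E1: "\<And>b x. b \<in> Basis ==> x \<in> Y ==> E b x = e x \<bullet> b"
    and E2: "\<And>b x y. b \<in> Basis ==> \<bar>E b x - E b y\<bar> \<le> k * dist x y" by metis
  define F where "F x = (\<Sum>b\<in>Basis. E b x *\<^sub>R b)" for x
  have "F x = e x" if "x \<in> Y" for x
    unfolding F_def using E1[OF _ that] by (simp add: euclidean_representation)
  moreover have "norm (F x - F y) \<le> real DIM('b) * k * dist x y" for x y
  proof -
    have "F x - F y = (\<Sum>b\<in>Basis. (E b x - E b y) *\<^sub>R b)"
      by (simp add: F_def sum_subtractf[symmetric] scaleR_diff_left)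
    also have "norm \<dots> \<le> (\<Sum>b\<in>Basis. norm ((E b x - E b y) *\<^sub>R b))" by (rule norm_sum)
    also have "\<dots> \<le> (\<Sum>b\<in>(Basis::'b set). k * dist x y)"
      by (rule sum_mono) (use E2 in auto)
    finally show ?thesis by simp
  qed
  ultimately show ?thesis by blast
qed

text \<open>Two rays that meet only in their common origin diverge at a linear rate. By homogeneity
  it suffices to take weights with sum 1, where the distance is continuous and, by
  \<open>inj\<close> after scaling with \<open>\<epsilon>\<close>, never zero; its minimum yields
  the constant.\<close>

lemma germ_pair_bound:
  fixes v v' :: "'a::real_normed_vector" and d d' :: "'b::real_normed_vector"
  assumes "\<epsilon> > 0" and inj: "\<And>a b. 0 \<le> a ==> a \<le> \<epsilon> ==> 0 \<le> b ==> b \<le> \<epsilon> ==> a *\<^sub>R v = b *\<^sub>R v' ==> a = 0 \<and> b = 0"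
  shows "\<exists>C. \<forall>a b. 0 \<le> a --> 0 \<le> b --> norm (a *\<^sub>R d - b *\<^sub>R d') \<le> C * norm (a *\<^sub>R v - b *\<^sub>R v')"
proof -
  define f where "f a = norm (a *\<^sub>R v - (1 - a) *\<^sub>R v')" for a
  have "continuous_on {0..1} f" unfolding f_def by (intro continuous_intros)
  from continuous_attains_inf[OF compact_Icc _ this] obtain m where
    m: "m \<in> {0..1}" "\<And>a. a \<in> {0..1} ==> f m \<le> f a" by auto
  have "f m \<noteq> 0"
  proof
    assume "f m = 0"
    hence "m *\<^sub>R v = (1 - m) *\<^sub>R v'" by (simp add: f_def)
    hence "(\<epsilon> * m) *\<^sub>R v = (\<epsilon> * (1 - m)) *\<^sub>R v'" by (metis scaleR_scaleR)
    hence "\<epsilon> * m = 0 \<and> \<epsilon> * (1 - m) = 0"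
      using m(1) assms(1) by (intro inj) (auto simp: mult_le_cancel_left1)
    thus False using assms(1) by auto
  qed
  hence fm: "f m > 0" by (simp add: f_def)
  have "norm (a *\<^sub>R d - b *\<^sub>R d') \<le> (norm d + norm d') / f m * norm (a *\<^sub>R v - b *\<^sub>R v')"
    if ab: "0 \<le> a" "0 \<le> b" for a b
  proof (cases "a + b = 0")
    case False
    hence pos: "a + b > 0" using ab by auto
    define c where "c = a / (a + b)"
    have c: "c \<in> {0..1}" using ab pos by (auto simp: c_def divide_simps)
    have "a = (a + b) * c" "b = (a + b) * (1 - c)" using pos by (simp_all add: c_def field_simps)
    hence "a *\<^sub>R v - b *\<^sub>R v' = (a + b) *\<^sub>R (c *\<^sub>R v - (1 - c) *\<^sub>R v')"
      by (metis scaleR_diff_right scaleR_scaleR)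
    hence "norm (a *\<^sub>R v - b *\<^sub>R v') = (a + b) * f c" using pos by (simp add: f_def)
    also have "\<dots> \<ge> (a + b) * f m" using pos m(2)[OF c] by (intro mult_left_mono) auto
    finally have low: "(a + b) * f m \<le> norm (a *\<^sub>R v - b *\<^sub>R v')" .
    have "norm (a *\<^sub>R d - b *\<^sub>R d') \<le> a * norm d + b * norm d'"
      using norm_triangle_ineq4[of "a *\<^sub>R d" "b *\<^sub>R d'"] ab by simp
    also have "\<dots> \<le> (a + b) * norm d + (a + b) * norm d'"
      using ab by (intro add_mono mult_right_mono) auto
    also have "\<dots> = (norm d + norm d') / f m * ((a + b) * f m)" using fm by (simp add: field_simps)
    also have "\<dots> \<le> (norm d + norm d') / f m * norm (a *\<^sub>R v - b *\<^sub>R v')"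
      using low fm by (intro mult_left_mono) auto
    finally show ?thesis .
  qed (use ab in "auto simp: add_nonneg_eq_0_iff")
  thus ?thesis by blast
qed

lemma pa_germ:
  assumes "pa 0 1 f" "s \<in> {0..1}" "\<sigma> = 1 \<and> s < 1 \<or> \<sigma> = -1 \<and> s > 0"
  shows "\<exists>\<epsilon>>0. \<exists>v. \<forall>a. 0 \<le> a --> a \<le> \<epsilon> --> s + \<sigma> * a \<in> {0..1} \<and> f (s + \<sigma> * a) = f s + a *\<^sub>R v"
  using assms(3)
proof (elim disjE conjE)
  assume \<sigma>: "\<sigma> = 1" and "s < 1"
  from pa_right_germ[OF assms(1) _ this(2)] assms(2) obtain \<epsilon> v where
    "\<epsilon> > 0" "s + \<epsilon> \<le> 1" "\<forall>x. 0 \<le> x --> x \<le> \<epsilon> --> f (s + x) = f s + x *\<^sub>R v" by auto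
  thus ?thesis using assms(2) \<sigma> by (intro exI[of _ \<epsilon>] conjI exI[of _ v]) auto
next
  assume \<sigma>: "\<sigma> = -1" and "s > 0"
  from pa_left_germ[OF assms(1) this(2)] assms(2) obtain \<epsilon> v where
    "\<epsilon> > 0" "0 \<le> s - \<epsilon>" "\<forall>x. 0 \<le> x --> x \<le> \<epsilon> --> f (s - x) = f s + x *\<^sub>R v" by auto
  thus ?thesis using assms(2) \<sigma> by (intro exI[of _ \<epsilon>] conjI exI[of _ v]) auto
qed

lemma simple_pathD:
  assumes "simple_path g" "x \<in> {0..1}" "y \<in> {0..1}" "g x = g y"
  shows "x = y \<or> x = 0 \<and> y = 1 \<or> x = 1 \<and> y = 0"
  using assms unfolding simple_path_def loop_free_def by blast

text \<open>\<open>\<sigma>\<close> and \<open>\<tau>\<close> select the sides from which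
  \<open>s\<close> and \<open>t\<close> are approached. Either both branches coincide and have
  nonzero velocity, or they are the two branches at one point of the curve, possibly the closing
  point, and simplicity separates them.\<close>

lemma branch_bound:
  fixes \<gamma> :: "real => 'a::real_normed_vector" and D :: "real => 'b::real_normed_vector"
  assumes sim: "simple_path \<gamma>" and pg: "pa 0 1 \<gamma>" and pd: "pa 0 1 D" and cd: "D 0 = D 1"
    and st: "s \<in> {0..1}" "t \<in> {0..1}" "\<gamma> s = \<gamma> t"
    and \<sigma>: "\<sigma> = 1 \<and> s < 1 \<or> \<sigma> = -1 \<and> s > 0" and \<tau>: "\<tau> = 1 \<and> t < 1 \<or> \<tau> = -1 \<and> t > 0"
  shows "\<exists>C. \<exists>\<epsilon>>0. \<forall>a b. 0 \<le> a --> a \<le> \<epsilon> --> 0 \<le> b --> b \<le> \<epsilon> -->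
    norm (D (s + \<sigma> * a) - D (t + \<tau> * b)) \<le> C * norm (\<gamma> (s + \<sigma> * a) - \<gamma> (t + \<tau> * b))"
proof -
  have st': "s = t \<or> s = 0 \<and> t = 1 \<or> s = 1 \<and> t = 0" using simple_pathD[OF sim st] .
  hence Dst: "D s = D t" using cd by auto
  obtain e1 v where v: "e1 > 0" "\<And>a. 0 \<le> a ==> a \<le> e1 ==> s + \<sigma> * a \<in> {0..1} \<and> \<gamma> (s + \<sigma> * a) = \<gamma> s + a *\<^sub>R v"
    using pa_germ[OF pg st(1) \<sigma>] by blast
  obtain e2 v' where v': "e2 > 0" "\<And>a. 0 \<le> a ==> a \<le> e2 ==> t + \<tau> * a \<in> {0..1} \<and> \<gamma> (t + \<tau> * a) = \<gamma> t + a *\<^sub>R v'"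
    using pa_germ[OF pg st(2) \<tau>] by blast
  obtain e3 d where d: "e3 > 0" "\<And>a. 0 \<le> a ==> a \<le> e3 ==> s + \<sigma> * a \<in> {0..1} \<and> D (s + \<sigma> * a) = D s + a *\<^sub>R d"
    using pa_germ[OF pd st(1) \<sigma>] by blast
  obtain e4 d' where d': "e4 > 0" "\<And>a. 0 \<le> a ==> a \<le> e4 ==> t + \<tau> * a \<in> {0..1} \<and> D (t + \<tau> * a) = D t + a *\<^sub>R d'"
    using pa_germ[OF pd st(2) \<tau>] by blast
  \<comment> \<open>The cap \<open>1/4\<close> rules out the exceptional alternative 0 and 1 of
    \<open>simple_pathD\<close> for parameters that have left the base point, since the two steps
    add up to less than 1.\<close>
  define \<epsilon> where "\<epsilon> = min (min (min e1 e2) (min e3 e4)) (1/4)"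
  have \<epsilon>: "\<epsilon> > 0" "\<epsilon> \<le> e1" "\<epsilon> \<le> e2" "\<epsilon> \<le> e3" "\<epsilon> \<le> e4" "\<epsilon> \<le> 1/4"
    using v v' d d' by (auto simp: \<epsilon>_def)
  have "\<exists>C. \<forall>a b. 0 \<le> a --> a \<le> \<epsilon> --> 0 \<le> b --> b \<le> \<epsilon> --> norm (a *\<^sub>R d - b *\<^sub>R d') \<le> C * norm (a *\<^sub>R v - b *\<^sub>R v')"
  proof (cases "s = t \<and> \<sigma> = \<tau>")
    case True
    have "\<gamma> s + \<epsilon> *\<^sub>R v = \<gamma> t + \<epsilon> *\<^sub>R v'" "D s + \<epsilon> *\<^sub>R d = D t + \<epsilon> *\<^sub>R d'"
      using v(2)[of \<epsilon>] v'(2)[of \<epsilon>] d(2)[of \<epsilon>] d'(2)[of \<epsilon>] \<epsilon> True by auto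
    hence eq: "v' = v" "d' = d" using True \<epsilon>(1) by auto
    have "v \<noteq> 0"
    proof
      assume "v = 0"
      hence "\<gamma> (s + \<sigma> * \<epsilon>) = \<gamma> s" "s + \<sigma> * \<epsilon> \<in> {0..1}" using v(2)[of \<epsilon>] \<epsilon> by auto
      from simple_pathD[OF sim this(2) st(1) this(1)] show False
        using \<epsilon> \<sigma> by auto
    qed
    hence "norm (a *\<^sub>R d - b *\<^sub>R d') \<le> norm d / norm v * norm (a *\<^sub>R v - b *\<^sub>R v')" for a b
      unfolding eq scaleR_diff_left[symmetric] by simp
    thus ?thesis by blast
  next
    case False
    have "a = 0 \<and> b = 0" if ab: "0 \<le> a" "a \<le> \<epsilon>" "0 \<le> b" "b \<le> \<epsilon>" "a *\<^sub>R v = b *\<^sub>R v'" for a b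
    proof -
      have "\<gamma> (s + \<sigma> * a) = \<gamma> (t + \<tau> * b)" "s + \<sigma> * a \<in> {0..1}" "t + \<tau> * b \<in> {0..1}"
        using v(2)[of a] v'(2)[of b] ab \<epsilon> st(3) by auto
      from simple_pathD[OF sim this(2,3,1)] show ?thesis
        using st' \<sigma> \<tau> False ab \<epsilon>(6) by auto
    qed
    from germ_pair_bound[OF \<epsilon>(1) this] show ?thesis by blast
  qed
  then obtain C where C: "\<And>a b. 0 \<le> a ==> a \<le> \<epsilon> ==> 0 \<le> b ==> b \<le> \<epsilon> ==> norm (a *\<^sub>R d - b *\<^sub>R d') \<le> C * norm (a *\<^sub>R v - b *\<^sub>R v')" by blast
  show ?thesis
  proof (rule exI[of _ C], rule exI[of _ \<epsilon>], intro conjI allI impI)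
    fix a b assume ab: "0 \<le> a" "a \<le> \<epsilon>" "0 \<le> b" "b \<le> \<epsilon>"
    have "D (s + \<sigma> * a) - D (t + \<tau> * b) = a *\<^sub>R d - b *\<^sub>R d'"
      using d(2)[of a] d'(2)[of b] ab \<epsilon> Dst by auto
    moreover have "\<gamma> (s + \<sigma> * a) - \<gamma> (t + \<tau> * b) = a *\<^sub>R v - b *\<^sub>R v'"
      using v(2)[of a] v'(2)[of b] ab \<epsilon> st(3) by auto
    ultimately show "norm (D (s + \<sigma> * a) - D (t + \<tau> * b)) \<le> C * norm (\<gamma> (s + \<sigma> * a) - \<gamma> (t + \<tau> * b))"
      using C[OF ab] by simp
  qed (rule \<epsilon>(1))
qed

text \<open>If the images of \<open>s\<close> and \<open>t\<close> differ, the right side stays away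
  from 0 while \<open>D\<close> is bounded. If they agree, the worst of the four one-sided bounds is
  taken.\<close>

lemma local_bound:
  fixes \<gamma> :: "real => 'a::real_normed_vector" and D :: "real => 'b::real_normed_vector"
  assumes sim: "simple_path \<gamma>" and pg: "pa 0 1 \<gamma>" and pd: "pa 0 1 D" and cd: "D 0 = D 1"
    and st: "s \<in> {0..1}" "t \<in> {0..1}"
  shows "\<exists>C. \<exists>\<epsilon>>0. \<forall>s'\<in>{0..1}. \<forall>t'\<in>{0..1}. \<bar>s' - s\<bar> \<le> \<epsilon> --> \<bar>t' - t\<bar> \<le> \<epsilon> -->
    norm (D s' - D t') \<le> C * norm (\<gamma> s' - \<gamma> t')"
proof (cases "\<gamma> s = \<gamma> t")
  case False
  define \<eta> where "\<eta> = norm (\<gamma> s - \<gamma> t)"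
  have \<eta>: "\<eta> > 0" using False by (simp add: \<eta>_def)
  have cg: "continuous_on {0..1} \<gamma>" by (rule pa_continuous[OF pg])
  obtain \<delta>1 where d1: "\<delta>1 > 0" "\<And>x. x \<in> {0..1} ==> dist x s < \<delta>1 ==> dist (\<gamma> x) (\<gamma> s) < \<eta> / 4"
    using cg[unfolded continuous_on_iff] st(1) \<eta> by (metis zero_less_divide_iff zero_less_numeral)
  obtain \<delta>2 where d2: "\<delta>2 > 0" "\<And>x. x \<in> {0..1} ==> dist x t < \<delta>2 ==> dist (\<gamma> x) (\<gamma> t) < \<eta> / 4"
    using cg[unfolded continuous_on_iff] st(2) \<eta> by (metis zero_less_divide_iff zero_less_numeral)
  have "bounded (D ` {0..1})"
    by (intro compact_imp_bounded compact_continuous_image pa_continuous[OF pd] compact_Icc)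
  then obtain B where B: "\<And>x. x \<in> {0..1} ==> norm (D x) \<le> B" unfolding bounded_iff by blast
  show ?thesis
  proof (rule exI[of _ "4 * B / \<eta>"], rule exI[of _ "min \<delta>1 \<delta>2 / 2"], intro conjI ballI impI)
    fix s' t' assume a: "s' \<in> {0..1}" "t' \<in> {0..1}" "\<bar>s' - s\<bar> \<le> min \<delta>1 \<delta>2 / 2" "\<bar>t' - t\<bar> \<le> min \<delta>1 \<delta>2 / 2"
    have 1: "dist (\<gamma> s') (\<gamma> s) < \<eta> / 4" "dist (\<gamma> t') (\<gamma> t) < \<eta> / 4"
      using d1 d2 a by (auto simp: dist_real_def)
    have "\<eta> \<le> dist (\<gamma> s') (\<gamma> s) + dist (\<gamma> s') (\<gamma> t') + dist (\<gamma> t') (\<gamma> t)"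
      using dist_triangle[of "\<gamma> s" "\<gamma> t" "\<gamma> s'"] dist_triangle[of "\<gamma> s'" "\<gamma> t" "\<gamma> t'"]
      by (simp add: \<eta>_def dist_norm norm_minus_commute)
    hence "norm (\<gamma> s' - \<gamma> t') \<ge> \<eta> / 2" using 1 by (simp add: dist_norm)
    moreover have "norm (D s' - D t') \<le> 2 * B"
      using norm_triangle_ineq4[of "D s'" "D t'"] B a(1,2) by (smt (verit))
    moreover have "B \<ge> 0" using B[of 0] norm_ge_zero[of "D 0"] by (smt (verit) atLeastAtMost_iff)
    moreover have "4 * B / \<eta> * (\<eta> / 2) = 2 * B" using \<eta> by simp
    ultimately show "norm (D s' - D t') \<le> 4 * B / \<eta> * norm (\<gamma> s' - \<gamma> t')"
      by (smt (verit) \<eta> divide_nonneg_pos mult_left_mono)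
  qed (use d1 d2 in auto)
next
  case True
  define V where "V x \<sigma> \<longleftrightarrow> \<sigma> = 1 \<and> x < 1 \<or> \<sigma> = -1 \<and> x > 0" for x \<sigma> :: real
  have "\<exists>C. \<exists>\<epsilon>>0. V s \<sigma> --> V t \<tau> --> (\<forall>a b. 0 \<le> a --> a \<le> \<epsilon> --> 0 \<le> b --> b \<le> \<epsilon> -->
    norm (D (s + \<sigma> * a) - D (t + \<tau> * b)) \<le> C * norm (\<gamma> (s + \<sigma> * a) - \<gamma> (t + \<tau> * b)))" for \<sigma> \<tau>
  proof (cases "V s \<sigma> \<and> V t \<tau>")
    case VV: True
    thus ?thesis using branch_bound[OF sim pg pd cd st True, of \<sigma> \<tau>] unfolding V_def by blast
  qed (auto intro: exI[of _ "1::real"])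
  then obtain C \<epsilon> where Ce: "\<And>\<sigma> \<tau>. \<epsilon> \<sigma> \<tau> > 0" "\<And>\<sigma> \<tau> a b. V s \<sigma> ==> V t \<tau> ==> 0 \<le> a ==> a \<le> \<epsilon> \<sigma> \<tau> ==> 0 \<le> b ==> b \<le> \<epsilon> \<sigma> \<tau> ==>
    norm (D (s + \<sigma> * a) - D (t + \<tau> * b)) \<le> C \<sigma> \<tau> * norm (\<gamma> (s + \<sigma> * a) - \<gamma> (t + \<tau> * b))"
    by metis
  define e where "e = Min ((\<lambda>(\<sigma>, \<tau>). \<epsilon> \<sigma> \<tau>) ` ({1, -1} \<times> {1, -1}))"
  define M where "M = Max ((\<lambda>(\<sigma>, \<tau>). C \<sigma> \<tau>) ` ({1, -1} \<times> {1, -1}))"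
  have e: "e > 0" unfolding e_def using Ce(1) by (subst Min_gr_iff) auto
  have eM: "e \<le> \<epsilon> \<sigma> \<tau>" "C \<sigma> \<tau> \<le> M" if "V s \<sigma>" "V t \<tau>" for \<sigma> \<tau>
    unfolding e_def M_def using that by (auto simp: V_def intro!: Min_le Max_ge)
  show ?thesis
  proof (rule exI[of _ M], rule exI[of _ e], intro conjI ballI impI)
    fix s' t' assume a: "s' \<in> {0..1}" "t' \<in> {0..1}" "\<bar>s' - s\<bar> \<le> e" "\<bar>t' - t\<bar> \<le> e"
    have ex: "\<exists>\<sigma>. V x \<sigma> \<and> x' = x + \<sigma> * \<bar>x' - x\<bar>" if "x \<in> {0..1}" "x' \<in> {0..1}" for x x' :: real
    proof (cases "x < x' \<or> x = 0")
      case True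
      thus ?thesis using that by (intro exI[of _ 1]) (auto simp: V_def)
    next
      case False
      thus ?thesis using that by (intro exI[of _ "-1"]) (auto simp: V_def)
    qed
    obtain \<sigma> where \<sigma>: "V s \<sigma>" "s' = s + \<sigma> * \<bar>s' - s\<bar>" using ex[OF st(1) a(1)] by blast
    obtain \<tau> where \<tau>: "V t \<tau>" "t' = t + \<tau> * \<bar>t' - t\<bar>" using ex[OF st(2) a(2)] by blast
    have "norm (D s' - D t') \<le> C \<sigma> \<tau> * norm (\<gamma> s' - \<gamma> t')"
      using Ce(2)[OF \<sigma>(1) \<tau>(1), of "\<bar>s' - s\<bar>" "\<bar>t' - t\<bar>"] \<sigma>(2) \<tau>(2) a eM(1)[OF \<sigma>(1) \<tau>(1)] by auto
    also have "\<dots> \<le> M * norm (\<gamma> s' - \<gamma> t')" using eM(2)[OF \<sigma>(1) \<tau>(1)] by (intro mult_right_mono) auto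
    finally show "norm (D s' - D t') \<le> M * norm (\<gamma> s' - \<gamma> t')" .
  qed (rule e)
qed

text \<open>Thus \<open>D\<close> is a Lipschitz function of the point on the curve and not merely
  of the parameter. A sequence of violations with growing constants would accumulate, by
  compactness, at a pair where \<open>local_bound\<close> applies.\<close>

lemma closed_pa_bound:
  fixes \<gamma> :: "real => 'a::real_normed_vector" and D :: "real => 'b::real_normed_vector"
  assumes sim: "simple_path \<gamma>" and pg: "pa 0 1 \<gamma>" and pd: "pa 0 1 D" and cd: "D 0 = D 1"
  shows "\<exists>C. \<forall>s\<in>{0..1}. \<forall>t\<in>{0..1}. norm (D s - D t) \<le> C * norm (\<gamma> s - \<gamma> t)"
proof (rule ccontr)
  assume "\<not> ?thesis"
  hence "\<forall>n::nat. \<exists>s\<in>{0..1}. \<exists>t\<in>{0..1}. norm (D s - D t) > real n * norm (\<gamma> s - \<gamma> t)"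
    by (meson not_le)
  then obtain S T where ST: "\<And>n::nat. S n \<in> {0..1}" "\<And>n. T n \<in> {0..1}" "\<And>n. norm (D (S n) - D (T n)) > real n * norm (\<gamma> (S n) - \<gamma> (T n))"
    by metis
  have "compact ({0..1::real} \<times> {0..1::real})" by (intro compact_Times compact_Icc)
  hence "seq_compact ({0..1::real} \<times> {0..1::real})" by (simp add: compact_eq_seq_compact_metric)
  from seq_compactE[OF this, of "\<lambda>n. (S n, T n)"] ST(1,2) obtain l r where
    l: "l \<in> {0..1} \<times> {0..1}" and r: "strict_mono r" and lim: "((\<lambda>n. (S n, T n)) \<circ> r) \<longlonglongrightarrow> l"
    by auto
  obtain s t where lst: "l = (s, t)" by fastforce
  obtain C \<epsilon> where C: "\<epsilon> > 0" "\<And>s' t'. s' \<in> {0..1} ==> t' \<in> {0..1} ==> \<bar>s' - s\<bar> \<le> \<epsilon> ==> \<bar>t' - t\<bar> \<le> \<epsilon> ==>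
    norm (D s' - D t') \<le> C * norm (\<gamma> s' - \<gamma> t')"
    using local_bound[OF assms, of s t] l lst by (metis mem_Sigma_iff)
  have lims: "(\<lambda>n. S (r n)) \<longlonglongrightarrow> s" "(\<lambda>n. T (r n)) \<longlonglongrightarrow> t"
    using tendsto_fst[OF lim] tendsto_snd[OF lim] by (simp_all add: lst o_def)
  have "\<forall>\<^sub>F n in sequentially. \<bar>S (r n) - s\<bar> < \<epsilon>" "\<forall>\<^sub>F n in sequentially. \<bar>T (r n) - t\<bar> < \<epsilon>"
    using tendstoD[OF lims(1) C(1)] tendstoD[OF lims(2) C(1)] by (simp_all add: dist_real_def)
  moreover have "\<forall>\<^sub>F n in sequentially. real (r n) \<ge> C"
  proof -
    obtain m :: nat where "real m \<ge> C" using real_arch_simple by blast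
    hence "real (r n) \<ge> C" if "n \<ge> m" for n
      using seq_suble[OF r, of n] that by (meson of_nat_le_iff order_trans)
    thus ?thesis by (auto simp: eventually_sequentially)
  qed
  ultimately have "\<forall>\<^sub>F n in sequentially. False"
  proof eventually_elim
    case (elim n)
    have "norm (D (S (r n)) - D (T (r n))) \<le> C * norm (\<gamma> (S (r n)) - \<gamma> (T (r n)))"
      using elim ST(1,2) by (intro C(2)) auto
    also have "\<dots> \<le> real (r n) * norm (\<gamma> (S (r n)) - \<gamma> (T (r n)))"
      using elim by (intro mult_right_mono) auto
    finally show False using ST(3)[of "r n"] by linarith
  qed
  thus False by simp
qed

text \<open>Near a time \<open>s0\<close> the displacement \<open>(s - s0) *\<^sub>R D\<close> is,
  by \<open>closed_pa_bound\<close>, a function on the curve with small Lipschitz constant. It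
  extends to a displacement of space that vanishes far away, to which
  \<open>kiso_displacement\<close> applies. So nearby times are isotopic, and connectedness of the
  time interval chains them together.\<close>

lemma kiso_linear:
  fixes g0 g1 :: "real => space"
  assumes pa0: "pa 0 1 g0" and pa1: "pa 0 1 g1" and cl: "g0 0 = g0 1" "g1 0 = g1 1"
    and sim: "\<And>s. s \<in> {0..1} ==> simple_path (\<lambda>t. mix s (g0 t) (g1 t))"
  shows "kiso (g0 ` {0..1}) (g1 ` {0..1})"
proof -
  define g where "g s t = mix s (g0 t) (g1 t)" for s t
  define D where "D t = g1 t - g0 t" for t
  have pg: "pa 0 1 (g s)" for s unfolding g_def by (intro pa_add pa_scaleR pa0 pa1)
  have pd: "pa 0 1 D" unfolding D_def by (intro pa_diff pa0 pa1)
  have cd: "D 0 = D 1" using cl by (simp add: D_def)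
  have gD: "g s t = g s0 t + (s - s0) *\<^sub>R D t" for s s0 t
    by (simp add: g_def D_def algebra_simps)
  have "bounded (D ` {0..1})"
    by (intro compact_imp_bounded compact_continuous_image pa_continuous[OF pd] compact_Icc)
  then obtain B where B: "B > 0" "\<And>x. x \<in> {0..1} ==> norm (D x) \<le> B" unfolding bounded_pos by blast
  have near: "\<exists>\<delta>>0. \<forall>s. \<bar>s - s0\<bar> < \<delta> --> kiso (g s0 ` {0..1}) (g s ` {0..1})" if s0: "s0 \<in> {0..1}" for s0
  proof -
    have "simple_path (g s0)" using sim[OF s0] by (simp add: g_def[abs_def])
    from closed_pa_bound[OF this pg pd cd] obtain C0 where
      C0: "\<And>s t. s \<in> {0..1} ==> t \<in> {0..1} ==> norm (D s - D t) \<le> C0 * norm (g s0 s - g s0 t)" by blast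
    define C where "C = max C0 1"
    have C: "norm (D s - D t) \<le> C * norm (g s0 s - g s0 t)" if "s \<in> {0..1}" "t \<in> {0..1}" for s t
      by (rule order_trans[OF C0[OF that]]) (auto simp: C_def intro!: mult_right_mono)
    have C1: "C \<ge> 1" by (simp add: C_def)
    have "bounded (g s0 ` {0..1})"
      by (intro compact_imp_bounded compact_continuous_image pa_continuous[OF pg] compact_Icc)
    then obtain G where G: "G > 0" "\<And>x. x \<in> {0..1} ==> norm (g s0 x) \<le> G" unfolding bounded_pos by blast
    \<comment> \<open>Points of the curve and points beyond \<open>\<rho>\<close> are at distance at
      least \<open>6 * B\<close>, so prescribing 0 out there is compatible with the Lipschitz
      constant \<open>1/6\<close> for displacements of size at most \<open>B\<close>.\<close>
    define \<rho> where "\<rho> = G + 6 * B"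
    show ?thesis
    proof (intro exI[of _ "1 / (6 * C)"] conjI allI impI)
      show "1 / (6 * C) > 0" using C1 by simp
      fix s assume s: "\<bar>s - s0\<bar> < 1 / (6 * C)"
      hence sC: "\<bar>s - s0\<bar> * C \<le> 1 / 6" using C1 by (simp add: field_simps)
      moreover have "\<bar>s - s0\<bar> * 1 \<le> \<bar>s - s0\<bar> * C" using C1 by (intro mult_left_mono) auto
      ultimately have s1: "\<bar>s - s0\<bar> \<le> 1" by simp
      define \<tau> where "\<tau> x = (SOME t. t \<in> {0..1} \<and> g s0 t = x)" for x
      define e where "e x = (if x \<in> g s0 ` {0..1} then (s - s0) *\<^sub>R D (\<tau> x) else 0)" for x
      have \<tau>: "\<tau> x \<in> {0..1} \<and> g s0 (\<tau> x) = x" if "x \<in> g s0 ` {0..1}" for x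
        unfolding \<tau>_def by (rule someI_ex) (use that in blast)
      define Y where "Y = g s0 ` {0..1} \<union> {x. norm x \<ge> \<rho>}"
      have small: "norm x \<le> G" if "x \<in> g s0 ` {0..1}" for x using that G by blast
      have eB: "norm (e x) \<le> B" for x
      proof (cases "x \<in> g s0 ` {0..1}")
        case True
        have "norm (e x) = \<bar>s - s0\<bar> * norm (D (\<tau> x))" using True by (simp add: e_def)
        also have "\<dots> \<le> 1 * B" using s1 B(2) \<tau>[OF True] by (intro mult_mono) auto
        finally show ?thesis by simp
      qed (use B in "simp add: e_def")
      have mixed: "norm (e x - e y) \<le> 1 / 6 * dist x y" if "x \<in> g s0 ` {0..1}" "norm y \<ge> \<rho>" for x y
      proof -
        have "y \<notin> g s0 ` {0..1}" using small[of y] that(2) B(1) by (auto simp: \<rho>_def)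
        hence "norm (e x - e y) \<le> B" using eB[of x] by (simp add: e_def)
        also have "6 * B \<le> dist x y"
          using small[OF that(1)] that(2) norm_triangle_ineq2[of y x]
          by (simp add: dist_norm norm_minus_commute \<rho>_def)
        hence "B \<le> 1 / 6 * dist x y" by simp
        finally show ?thesis .
      qed
      have lip: "norm (e x - e y) \<le> 1 / 6 * dist x y" if "x \<in> Y" "y \<in> Y" for x y
      proof -
        note xy = that[unfolded Y_def]
        consider "x \<in> g s0 ` {0..1}" "y \<in> g s0 ` {0..1}" | "x \<in> g s0 ` {0..1}" "norm y \<ge> \<rho>"
          | "y \<in> g s0 ` {0..1}" "norm x \<ge> \<rho>" | "norm x \<ge> \<rho>" "norm y \<ge> \<rho>"
          using xy by blast
        thus ?thesis
        proof cases
          case 1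
          have "e x - e y = (s - s0) *\<^sub>R (D (\<tau> x) - D (\<tau> y))" using 1 by (simp add: e_def scaleR_diff_right)
          hence "norm (e x - e y) = \<bar>s - s0\<bar> * norm (D (\<tau> x) - D (\<tau> y))" by simp
          also have "\<dots> \<le> \<bar>s - s0\<bar> * (C * norm (x - y))"
            using C[of "\<tau> x" "\<tau> y"] \<tau>[OF 1(1)] \<tau>[OF 1(2)] by (intro mult_left_mono) auto
          also have "\<dots> = (\<bar>s - s0\<bar> * C) * norm (x - y)" by simp
          also have "\<dots> \<le> 1 / 6 * norm (x - y)" using sC by (intro mult_right_mono) auto
          finally show ?thesis by (simp add: dist_norm)
        next
          case 3
          thus ?thesis using mixed[of y x] by (simp add: dist_commute norm_minus_commute)
        next
          case 4
          hence "x \<notin> g s0 ` {0..1}" "y \<notin> g s0 ` {0..1}" using small[of x] small[of y] B(1) by (auto simp: \<rho>_def)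
          thus ?thesis by (simp add: e_def)
        qed (rule mixed)
      qed
      have "Y \<noteq> {}" unfolding Y_def by auto
      from lipschitz_extension[OF this _ lip] obtain E where
        E: "\<And>x. x \<in> Y ==> E x = e x" "\<And>x y. norm (E x - E y) \<le> real DIM(space) * (1/6) * dist x y" by auto
      have "kiso (g s0 ` {0..1}) ((\<lambda>x. x + E x) ` g s0 ` {0..1})"
      proof (rule kiso_displacement[of "1/2" _ \<rho>])
        show "norm (E x - E y) \<le> 1 / 2 * norm (x - y)" for x y
          using E(2)[of x y] by (simp add: dist_norm)
        show "E x = 0" if "norm x \<ge> \<rho>" for x
          using E(1)[of x] that small[of x] B(1) by (auto simp: Y_def e_def \<rho>_def)
      qed auto
      also have "(\<lambda>x. x + E x) ` g s0 ` {0..1} = g s ` {0..1}"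
        unfolding image_image
      proof (rule image_cong[OF refl])
        fix t :: real assume t: "t \<in> {0..1}"
        hence mem: "g s0 t \<in> g s0 ` {0..1}" by blast
        have "norm (D (\<tau> (g s0 t)) - D t) \<le> C * norm (g s0 t - g s0 t)"
          using C[of "\<tau> (g s0 t)" t] t \<tau>[OF mem] by simp
        hence "D (\<tau> (g s0 t)) = D t" by simp
        hence "E (g s0 t) = (s - s0) *\<^sub>R D t" using E(1)[of "g s0 t"] mem by (simp add: Y_def e_def)
        thus "g s0 t + E (g s0 t) = g s t" using gD[of s t s0] by simp
      qed
      finally show "kiso (g s0 ` {0..1}) (g s ` {0..1})" .
    qed
  qed
  have "kiso (g 0 ` {0..1}) (g 1 ` {0..1})"
  proof (rule connected_equivalence_relation[of "{0..1::real}" 0 1 "\<lambda>x y. kiso (g x ` {0..1}) (g y ` {0..1})"])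
    fix s0 :: real assume s0: "s0 \<in> {0..1}"
    obtain \<delta> where \<delta>: "\<delta> > 0" "\<And>s. \<bar>s - s0\<bar> < \<delta> ==> kiso (g s0 ` {0..1}) (g s ` {0..1})"
      using near[OF s0] by blast
    show "\<exists>T. openin (top_of_set {0..1}) T \<and> s0 \<in> T \<and> (\<forall>x\<in>T. kiso (g s0 ` {0..1}) (g x ` {0..1}))"
      by (intro exI[of _ "{0..1} \<inter> ball s0 \<delta>"])
        (use s0 \<delta> in "auto intro!: openin_open_Int \<delta>(2) simp: dist_real_def")
  qed (auto intro: kiso_sym kiso_trans)
  thus ?thesis by (simp add: g_def)
qed


section \<open>Straight diagrams\<close>

lemma INF_enat_attained:
  assumes "(INF k \<in> X. enat k) = enat n"
  shows "n \<in> X"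
proof -
  have "X \<noteq> {}" using assms by (auto simp: top_enat_def)
  hence "Inf (enat ` X) \<in> enat ` X"
    unfolding Inf_enat_def by (auto intro: LeastI)
  thus ?thesis using assms by auto
qed

text \<open>The knot word condensed to what homeomorphisms of the plane visibly preserve: both
  sub-arcs have no double points, and the second meets the first at most \<open>n\<close>
  times.\<close>

definition straight_state :: "(real => space) => real => nat => bool" where
  "straight_state \<gamma> u n \<longleftrightarrow> polygonal_knot \<gamma> \<and> 0 < u \<and> u < 1 \<and>
     inj_on (shadow \<gamma>) {0..u} \<and> inj_on (shadow \<gamma>) {u..1} \<and>
     finite {t \<in> {u<..<1}. shadow \<gamma> t \<in> shadow \<gamma> ` {0..u}} \<and>
     card {t \<in> {u<..<1}. shadow \<gamma> t \<in> shadow \<gamma> ` {0..u}} \<le> n"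

lemma finite_crossing_times:
  assumes "knot_diagram \<gamma> k"
  shows "finite (crossing_times \<gamma>)"
proof -
  have "crossing_times \<gamma> = (\<Union>c\<in>crossings \<gamma>. passes \<gamma> c)"
    by (auto simp: crossing_times_def passes_def)
  moreover have "finite (passes \<gamma> c)" if "c \<in> crossings \<gamma>" for c
    using assms that unfolding knot_diagram_def by (metis card.infinite zero_neq_numeral)
  ultimately show ?thesis using assms unfolding knot_diagram_def by auto
qed

lemma double_point_crossing:
  assumes "s \<in> {0..<1}" "t \<in> {0..<1}" "s \<noteq> t" "shadow \<gamma> s = shadow \<gamma> t"
  shows "shadow \<gamma> s \<in> crossings \<gamma>" "s \<in> crossing_times \<gamma>" "t \<in> crossing_times \<gamma>"
  using assms by (auto simp: crossings_def crossing_times_def passes_def)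

text \<open>The word is \<open>1, ..., n\<close> followed by a permutation of it, so labels do not
  repeat within a half; equal labels pair a position of the first half with one of the
  second.\<close>

lemma knot_word_split:
  fixes \<gamma> :: "real => space"
  assumes sd: "straight_diagram \<gamma> n"
  defines "xs \<equiv> sorted_list_of_set (crossing_times \<gamma>)"
  defines "lab \<equiv> \<lambda>t. crossing_label \<gamma> (shadow \<gamma> t)"
  shows "set xs = crossing_times \<gamma>" "length xs = 2 * n" "sorted xs" "distinct xs"
    "\<And>i j. i < n ==> j < n ==> lab (xs ! i) = lab (xs ! j) ==> i = j"
    "\<And>i j. n \<le> i ==> i < 2 * n ==> n \<le> j ==> j < 2 * n ==> lab (xs ! i) = lab (xs ! j) ==> i = j"
proof -
  have kd: "knot_diagram \<gamma> n" using sd unfolding straight_diagram_def by blast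
  obtain \<sigma> where \<sigma>: "\<sigma> permutes {1..n}" "knot_word \<gamma> = [1..<Suc n] @ map \<sigma> [1..<Suc n]"
    using sd unfolding straight_diagram_def by blast
  have w: "map lab xs = [1..<Suc n] @ map \<sigma> [1..<Suc n]"
    using \<sigma>(2) by (simp add: knot_word_def xs_def lab_def)
  show "set xs = crossing_times \<gamma>" "sorted xs" "distinct xs"
    using finite_crossing_times[OF kd] by (simp_all add: xs_def)
  have "length (map lab xs) = 2 * n" unfolding w by simp
  thus len: "length xs = 2 * n" by simp
  have l1: "lab (xs ! i) = Suc i" if "i < n" for i
  proof -
    have "map lab xs ! i = Suc i" unfolding w using that by (simp add: nth_append del: upt_Suc)
    thus ?thesis using len that by simp
  qed
  have l2: "lab (xs ! i) = \<sigma> (Suc (i - n))" if "n \<le> i" "i < 2 * n" for i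
  proof -
    have "map lab xs ! i = \<sigma> (Suc (i - n))" unfolding w using that by (simp add: nth_append del: upt_Suc)
    thus ?thesis using len that by simp
  qed
  show "i = j" if "i < n" "j < n" "lab (xs ! i) = lab (xs ! j)" for i j
    using that l1 by simp
  show "i = j" if "n \<le> i" "i < 2 * n" "n \<le> j" "j < 2 * n" "lab (xs ! i) = lab (xs ! j)" for i j
  proof -
    have "\<sigma> (Suc (i - n)) = \<sigma> (Suc (j - n))" using that l2 by simp
    hence "Suc (i - n) = Suc (j - n)" using permutes_inj[OF \<sigma>(1)] by (meson injD)
    thus ?thesis using that by simp
  qed
qed

text \<open>Two passages through one crossing carry the same label. As labels do not repeat within a
  half of the word, a cut between the halves leaves no double point on either side, and the second
  arc can meet the first only at the last \<open>n\<close> crossing times.\<close>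

lemma straight_state_of_cut:
  fixes \<gamma> :: "real => space"
  assumes sd: "straight_diagram \<gamma> n" and u: "0 < u" "u < 1" "u \<notin> crossing_times \<gamma>"
  defines "xs \<equiv> sorted_list_of_set (crossing_times \<gamma>)"
  assumes cut: "\<And>i. i < 2 * n ==> xs ! i < u \<longleftrightarrow> i < n"
  shows "straight_state \<gamma> u n"
proof -
  note ks = knot_word_split[OF sd, folded xs_def]
  have kd: "knot_diagram \<gamma> n" using sd unfolding straight_diagram_def by blast
  hence pk: "polygonal_knot \<gamma>" and s0: "shadow \<gamma> 0 \<notin> crossings \<gamma>" unfolding knot_diagram_def by blast+
  have s01: "shadow \<gamma> 0 = shadow \<gamma> 1" using pk by (simp add: polygonal_knot_def pathstart_def pathfinish_def shadow_def)
  have same: "s = t" if "s \<in> crossing_times \<gamma>" "t \<in> crossing_times \<gamma>" "shadow \<gamma> s = shadow \<gamma> t" "s < u \<longleftrightarrow> t < u" for s t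
  proof -
    note st = that
    obtain i j where ij: "i < 2 * n" "s = xs ! i" "j < 2 * n" "t = xs ! j"
      using st(1,2) ks(1,2) by (metis in_set_conv_nth)
    hence "i < n \<longleftrightarrow> j < n" using cut st(4) by auto
    hence "i = j" using ks(5)[of i j] ks(6)[of i j] ij st(3) by (metis not_le)
    thus ?thesis using ij by simp
  qed
  have i1: "inj_on (shadow \<gamma>) {0..u}"
  proof (rule inj_onI)
    fix s t assume st: "s \<in> {0..u}" "t \<in> {0..u}" "shadow \<gamma> s = shadow \<gamma> t"
    show "s = t"
    proof (rule ccontr)
      assume ne: "s \<noteq> t"
      have ct: "s \<in> crossing_times \<gamma>" "t \<in> crossing_times \<gamma>"
        using double_point_crossing[of s t \<gamma>] st u ne by auto
      hence "s < u" "t < u" using u(3) st by (metis atLeastAtMost_iff order_le_less)+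
      thus False using same[OF ct st(3)] ne by simp
    qed
  qed
  have i2: "inj_on (shadow \<gamma>) {u..1}"
  proof (rule inj_onI)
    fix s t assume st: "s \<in> {u..1}" "t \<in> {u..1}" "shadow \<gamma> s = shadow \<gamma> t"
    have one: "x = 1" if "x \<in> {u..1}" "shadow \<gamma> x = shadow \<gamma> 1" for x
    proof (rule ccontr)
      assume "x \<noteq> 1"
      hence "shadow \<gamma> 0 \<in> crossings \<gamma>"
        using double_point_crossing(1)[of 0 x \<gamma>] that s01 u by auto
      thus False using s0 by blast
    qed
    show "s = t"
    proof (cases "s = 1 \<or> t = 1")
      case True
      thus ?thesis using one st by metis
    next
      case False
      show ?thesis
      proof (rule ccontr)
        assume ne: "s \<noteq> t"
        have ct: "s \<in> crossing_times \<gamma>" "t \<in> crossing_times \<gamma>"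
          using double_point_crossing[of s t \<gamma>] st u ne False by auto
        show False using same[OF ct st(3)] ne st by auto
      qed
    qed
  qed
  define H where "H = {t \<in> {u<..<1}. shadow \<gamma> t \<in> shadow \<gamma> ` {0..u}}"
  have "H \<subseteq> (\<lambda>i. xs ! i) ` {n..<2*n}"
  proof
    fix t assume "t \<in> H"
    then obtain s where s: "s \<in> {0..u}" "shadow \<gamma> t = shadow \<gamma> s" "t \<in> {u<..<1}" by (auto simp: H_def)
    hence "t \<in> crossing_times \<gamma>" using double_point_crossing(2)[of t s \<gamma>] u by auto
    then obtain i where i: "i < 2 * n" "t = xs ! i" using ks(1,2) by (metis in_set_conv_nth)
    hence "\<not> i < n" using cut[of i] s by auto
    thus "t \<in> (\<lambda>i. xs ! i) ` {n..<2*n}" using i by auto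
  qed
  hence "finite H" "card H \<le> card {n..<2*n}"
    by (rule finite_subset[OF _ finite_imageI[OF finite_atLeastLessThan]], rule surj_card_le[OF finite_atLeastLessThan])
  thus ?thesis using pk i1 i2 u unfolding straight_state_def H_def by auto
qed

lemma straight_diagram_state:
  assumes sd: "straight_diagram \<gamma> n" and n: "n \<ge> 1"
  shows "\<exists>u. straight_state \<gamma> u n"
proof -
  define xs where "xs = sorted_list_of_set (crossing_times \<gamma>)"
  note ks = knot_word_split[OF sd, folded xs_def]
  \<comment> \<open>The midpoint of the two crossing times around the middle of the word; both exist
    because \<open>n \<ge> 1\<close>.\<close>
  define u where "u = (xs ! (n - 1) + xs ! n) / 2"
  have mem: "xs ! i \<in> {0..<1}" if "i < 2 * n" for i
    using ks(1,2) that nth_mem[of i xs] by (auto simp: crossing_times_def)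
  have "sorted_wrt (<) xs" using ks(3,4) by (simp add: strict_sorted_iff)
  hence lt: "xs ! i < xs ! j" if "i < j" "j < 2 * n" for i j
    using that ks(2) by (simp add: sorted_wrt_nth_less)
  have lt1: "xs ! (n - 1) < xs ! n" using lt n by simp
  have cut: "xs ! i < u \<and> i < n \<or> xs ! i > u \<and> \<not> i < n" if "i < 2 * n" for i
  proof (cases "i < n")
    case True
    hence "i = n - 1 \<or> i < n - 1" by linarith
    hence "xs ! i \<le> xs ! (n - 1)" using lt[of i "n - 1"] n by (auto intro: less_imp_le)
    thus ?thesis using lt1 True by (simp add: u_def)
  next
    case False
    hence "xs ! i \<ge> xs ! n" using lt[of n i] that by (cases "i = n") auto
    thus ?thesis using lt1 False by (simp add: u_def)
  qed
  have "u \<notin> crossing_times \<gamma>"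
  proof
    assume "u \<in> crossing_times \<gamma>"
    then obtain i where "i < 2 * n" "u = xs ! i" using ks(1,2) by (metis in_set_conv_nth)
    thus False using cut[of i] by auto
  qed
  hence "straight_state \<gamma> u n"
  proof (intro straight_state_of_cut[OF sd])
    have "xs ! (n - 1) \<ge> 0" "xs ! n < 1" using mem[of "n - 1"] mem[of n] n by auto
    thus "0 < u" "u < 1" using lt1 by (simp_all add: u_def)
    show "sorted_list_of_set (crossing_times \<gamma>) ! i < u \<longleftrightarrow> i < n" if "i < 2 * n" for i
      using cut[OF that] unfolding xs_def[symmetric] by linarith
  qed
  thus ?thesis by blast
qed

lemma straight_position_state:
  assumes sp: "straight_position \<gamma> n u"
  shows "straight_state \<gamma> u n"
proof -
  have sd: "straight_diagram \<gamma> n" and u: "0 < u" "u < 1" "u \<notin> crossing_times \<gamma>"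
    and ca: "card {t \<in> crossing_times \<gamma>. t < u} = n"
    using sp unfolding straight_position_def by auto
  define xs where "xs = sorted_list_of_set (crossing_times \<gamma>)"
  note ks = knot_word_split[OF sd, folded xs_def]
  define I where "I = {i. i < 2 * n \<and> xs ! i < u}"
  have "sorted_wrt (<) xs" using ks(3,4) by (simp add: strict_sorted_iff)
  hence lt: "xs ! i < xs ! j" if "i < j" "j < 2 * n" for i j
    using that ks(2) by (simp add: sorted_wrt_nth_less)
  have img: "(\<lambda>i. xs ! i) ` I = {t \<in> crossing_times \<gamma>. t < u}"
    unfolding I_def ks(1)[symmetric] using ks(2) by (force simp: in_set_conv_nth)
  have inj: "inj_on (\<lambda>i. xs ! i) I"
    using ks(2,4) by (auto simp: inj_on_def I_def nth_eq_iff_index_eq)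
  have cI: "card I = n" using card_image[OF inj] ca img by simp
  \<comment> \<open>\<open>I\<close> is an initial segment of the indices and has \<open>n\<close>
    elements.\<close>
  have "I \<subseteq> {..<n}"
  proof
    fix i assume i: "i \<in> I"
    have "{..i} \<subseteq> I"
    proof
      fix j assume "j \<in> {..i}"
      thus "j \<in> I" using i lt[of j i] by (cases "j = i") (auto simp: I_def)
    qed
    hence "card {..i} \<le> card I" by (intro card_mono) (auto simp: I_def)
    thus "i \<in> {..<n}" using cI by simp
  qed
  hence I: "I = {..<n}" using cI by (intro card_subset_eq) auto
  show ?thesis
    by (rule straight_state_of_cut[OF sd u]) (use I in "auto simp: I_def xs_def[symmetric]")
qed


section \<open>Straightening the first strand\<close>

text \<open>Heights are kept, and the interpolated plane maps are injective, so the interpolated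
  curve has no self-intersection that \<open>\<gamma>\<close> does not have. Injectivity of
  \<open>F\<close> preserves coincidences in the shadow and with them the state.\<close>

lemma plane_move:
  fixes \<gamma> :: "real => space" and F :: "complex => complex"
  assumes st: "straight_state \<gamma> u n"
    and paF: "pa 0 1 (\<lambda>t. F (shadow \<gamma> t))"
    and inj: "\<And>s. s \<in> {0..1} ==> inj (\<lambda>p. mix s p (F p))"
  obtains \<gamma>' where "kiso (\<gamma> ` {0..1}) (\<gamma>' ` {0..1})" "straight_state \<gamma>' u n"
    "\<And>t. shadow \<gamma>' t = F (shadow \<gamma> t)"
proof -
  define \<gamma>' where "\<gamma>' t = (F (shadow \<gamma> t), snd (\<gamma> t))" for t
  have sh: "shadow \<gamma>' t = F (shadow \<gamma> t)" for t by (simp add: shadow_def \<gamma>'_def)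
  have pk: "polygonal_knot \<gamma>" and u: "0 < u" "u < 1" using st by (auto simp: straight_state_def)
  have pg: "pa 0 1 \<gamma>" and sg: "simple_path \<gamma>" and cl: "\<gamma> 0 = \<gamma> 1"
    using pk by (simp_all add: polygonal_knot_def piecewise_affine_iff_pa pathstart_def pathfinish_def)
  have pg': "pa 0 1 \<gamma>'"
    unfolding \<gamma>'_def[abs_def] by (intro pa_Pair paF pa_snd pg)
  have cl': "\<gamma>' 0 = \<gamma>' 1" using cl by (simp add: \<gamma>'_def shadow_def)
  have sim: "simple_path (\<lambda>t. mix s (\<gamma> t) (\<gamma>' t))" if s: "s \<in> {0..1}" for s
  proof -
    have p: "pa 0 1 (\<lambda>t. mix s (\<gamma> t) (\<gamma>' t))" by (intro pa_add pa_scaleR pg pg')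
    have eq: "mix s (\<gamma> t) (\<gamma>' t) = (mix s (shadow \<gamma> t) (F (shadow \<gamma> t)), snd (\<gamma> t))" for t
      by (simp add: prod_eq_iff \<gamma>'_def shadow_def algebra_simps)
    show ?thesis
      unfolding simple_path_def loop_free_def
    proof (intro conjI ballI impI)
      show "path (\<lambda>t. mix s (\<gamma> t) (\<gamma>' t))" using pa_continuous[OF p] by (simp add: path_def)
      fix x y :: real assume xy: "x \<in> {0..1}" "y \<in> {0..1}"
        "mix s (\<gamma> x) (\<gamma>' x) = mix s (\<gamma> y) (\<gamma>' y)"
      from xy(3) have e: "mix s (shadow \<gamma> x) (F (shadow \<gamma> x)) = mix s (shadow \<gamma> y) (F (shadow \<gamma> y))"
        "snd (\<gamma> x) = snd (\<gamma> y)" unfolding eq by (simp_all only: prod.inject)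
      have "shadow \<gamma> x = shadow \<gamma> y" by (rule injD[OF inj[OF s]]) (rule e(1))
      with e(2) have "\<gamma> x = \<gamma> y" by (simp add: shadow_def prod_eq_iff)
      thus "x = y \<or> x = 0 \<and> y = 1 \<or> x = 1 \<and> y = 0" by (rule simple_pathD[OF sg xy(1,2)])
    qed
  qed
  have "simple_path \<gamma>'" using sim[of 1] by simp
  hence pk': "polygonal_knot \<gamma>'"
    using pg' cl' by (simp add: polygonal_knot_def piecewise_affine_iff_pa pathstart_def pathfinish_def)
  have "inj F" using inj[of 1] by simp
  hence Fe: "F p \<in> F ` A \<longleftrightarrow> p \<in> A" for p A by (rule inj_image_mem_iff)
  have shF: "shadow \<gamma>' = F \<circ> shadow \<gamma>" using sh by (simp add: fun_eq_iff)
  have "inj_on (shadow \<gamma>') A" if "inj_on (shadow \<gamma>) A" for A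
    unfolding shF using that \<open>inj F\<close> by (auto intro: comp_inj_on inj_on_subset)
  moreover have "shadow \<gamma>' t \<in> shadow \<gamma>' ` A \<longleftrightarrow> shadow \<gamma> t \<in> shadow \<gamma> ` A" for t A
    unfolding shF image_comp[symmetric] by (simp add: Fe)
  ultimately have "straight_state \<gamma>' u n"
    using st pk' unfolding straight_state_def by simp
  moreover have "kiso (\<gamma> ` {0..1}) (\<gamma>' ` {0..1})" by (rule kiso_linear[OF pg pg' cl cl' sim])
  ultimately show thesis using that sh by blast
qed

section \<open>Moves of the plane supported in a kite\<close>

definition cross :: "complex => complex => real" where
  "cross z w = Im (cnj z * w)"

lemma cross_eq: "cross z w = Re z * Im w - Im z * Re w"
  by (simp add: cross_def)

lemma cross_add_left: "cross (a + b) w = cross a w + cross b w"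
  and cross_add_right: "cross w (a + b) = cross w a + cross w b"
  and cross_diff_left: "cross (a - b) w = cross a w - cross b w"
  and cross_diff_right: "cross w (a - b) = cross w a - cross w b"
  and cross_scaleR_left: "cross (r *\<^sub>R a) w = r * cross a w"
  and cross_scaleR_right: "cross w (r *\<^sub>R a) = r * cross w a"
  and cross_minus_left: "cross (- a) w = - cross a w"
  and cross_minus_right: "cross w (- a) = - cross w a"
  and cross_self: "cross a a = 0"
  and cross_0_left: "cross 0 w = 0" and cross_0_right: "cross w 0 = 0"
  by (auto simp: cross_eq algebra_simps)

lemmas cross_simps = cross_add_left cross_add_right cross_diff_left cross_diff_right cross_scaleR_left
  cross_scaleR_right cross_minus_left cross_minus_right cross_self cross_0_left cross_0_right

lemma cross_commute: "cross a b = - cross b a"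
  by (simp add: cross_eq)

text \<open>Cramer's rule for the basis \<open>q\<close>, \<open>w\<close>.\<close>

lemma cross_basis:
  assumes "cross q w \<noteq> 0"
  shows "p = (cross p w / cross q w) *\<^sub>R q + (cross q p / cross q w) *\<^sub>R w"
proof -
  have "cross q w *\<^sub>R p = cross p w *\<^sub>R q + cross q p *\<^sub>R w"
    by (auto simp: complex_eq_iff cross_eq algebra_simps)
  hence "(1 / cross q w) *\<^sub>R (cross q w *\<^sub>R p) = (1 / cross q w) *\<^sub>R (cross p w *\<^sub>R q + cross q p *\<^sub>R w)" by simp
  thus ?thesis using assms by (simp add: scaleR_add_right)
qed

text \<open>A tent function with support in a kite with tip \<open>v\<close>, in the coordinates
  \<open>p = v + \<lambda> q + \<mu> w\<close>.\<close>

definition kite :: "complex => complex => complex => real => real => real => complex => real" where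
  "kite v q w K \<eta> L p =
     max 0 (min (cross (p - v) w / cross q w) (K * (1 + \<eta> - cross (p - v) w / cross q w))
            - L * \<bar>cross q (p - v) / cross q w\<bar>)"

lemma kite_coords:
  assumes "cross q w \<noteq> 0"
  shows "kite v q w K \<eta> L (v + a *\<^sub>R q + b *\<^sub>R w) = max 0 (min a (K * (1 + \<eta> - a)) - L * \<bar>b\<bar>)"
proof -
  have "cross (v + a *\<^sub>R q + b *\<^sub>R w - v) w = a * cross q w" "cross q (v + a *\<^sub>R q + b *\<^sub>R w - v) = b * cross q w"
    by (simp_all add: cross_simps)
  thus ?thesis using assms by (simp add: kite_def)
qed

lemma kite_decomp:
  assumes "cross q w \<noteq> 0"
  obtains a b where "p = v + a *\<^sub>R q + b *\<^sub>R w"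
proof -
  have "p - v = (cross (p - v) w / cross q w) *\<^sub>R q + (cross q (p - v) / cross q w) *\<^sub>R w"
    by (rule cross_basis[OF assms])
  thus thesis using that[of "cross (p - v) w / cross q w" "cross q (p - v) / cross q w"]
    by (metis add.assoc add_diff_cancel_left' diff_add_cancel add.commute)
qed

lemma pa_kite:
  assumes "pa a b z"
  shows "pa a b (\<lambda>t. kite v q w K \<eta> L (z t))"
proof -
  have ab: "a \<le> b" by (rule pa_le[OF assms])
  have z: "pa a b (\<lambda>t. z t - v)" by (intro pa_diff assms pa_const ab)
  have 1: "pa a b (\<lambda>t. cross (z t - v) w / cross q w)"
    by (rule pa_linear[OF z]) (auto intro!: linearI simp: cross_simps add_divide_distrib)
  have 2: "pa a b (\<lambda>t. cross q (z t - v) / cross q w)"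
    by (rule pa_linear[OF z]) (auto intro!: linearI simp: cross_simps add_divide_distrib)
  show ?thesis unfolding kite_def
    by (intro pa_max pa_min pa_diff pa_mult pa_abs 1 2 pa_const ab)
qed

text \<open>Every point slides along the fixed vector \<open>x q + y w\<close> by the value of the
  tent. A collision needs the tent to drop along this vector at least as fast as one advances. The
  drop is bounded by \<open>- x + L * \<bar>y\<bar>\<close>, and \<open>x \<le> 0\<close> means that
  the flank of slope \<open>K\<close> is only climbed, so \<open>K\<close> may be as large as
  desired.\<close>

lemma kite_move:
  fixes \<gamma> :: "real => space"
  assumes st: "straight_state \<gamma> u n" and c: "cross q w \<noteq> 0"
    and xy: "x \<le> 0" "- x + L * \<bar>y\<bar> < 1" and K: "K \<ge> 0" "L \<ge> 0"
  obtains \<gamma>' where "kiso (\<gamma> ` {0..1}) (\<gamma>' ` {0..1})" "straight_state \<gamma>' u n"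
    "\<And>t. shadow \<gamma>' t = shadow \<gamma> t + kite v q w K \<eta> L (shadow \<gamma> t) *\<^sub>R (x *\<^sub>R q + y *\<^sub>R w)"
proof -
  define d where "d = x *\<^sub>R q + y *\<^sub>R w"
  define tent where "tent = kite v q w K \<eta> L"
  define F where "F p = p + tent p *\<^sub>R d" for p
  have grow: "tent (p + \<tau> *\<^sub>R d) - tent p > - \<tau>" if \<tau>: "\<tau> > 0" for p \<tau>
  proof -
    obtain a b where p: "p = v + a *\<^sub>R q + b *\<^sub>R w" by (rule kite_decomp[OF c])
    have pd: "p + \<tau> *\<^sub>R d = v + (a + \<tau> * x) *\<^sub>R q + (b + \<tau> * y) *\<^sub>R w"
      by (simp add: p d_def algebra_simps)
    have tx: "\<tau> * x \<le> 0" using \<tau> xy by (simp add: mult_le_0_iff)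
    have "K * (1 + \<eta> - a) \<le> K * (1 + \<eta> - (a + \<tau> * x))" using tx K by (intro mult_left_mono) auto
    hence 1: "min (a + \<tau> * x) (K * (1 + \<eta> - (a + \<tau> * x))) \<ge> min a (K * (1 + \<eta> - a)) + \<tau> * x"
      using tx by (auto simp: min_def)
    have "L * \<bar>b + \<tau> * y\<bar> \<le> L * (\<bar>b\<bar> + \<tau> * \<bar>y\<bar>)"
      using K \<tau> abs_triangle_ineq[of b "\<tau> * y"] by (intro mult_left_mono) (auto simp: abs_mult)
    hence 2: "L * \<bar>b + \<tau> * y\<bar> \<le> L * \<bar>b\<bar> + \<tau> * (L * \<bar>y\<bar>)" by (simp add: algebra_simps)
    have "\<tau> * (- x + L * \<bar>y\<bar>) < \<tau> * 1" using xy \<tau> by (intro mult_strict_left_mono) auto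
    hence 3: "- \<tau> * x + \<tau> * (L * \<bar>y\<bar>) < \<tau>" by (simp add: algebra_simps)
    have 4: "max 0 (X' - Y') - max 0 (X - Y) > - \<tau>"
      if "X' \<ge> X + \<tau> * x" "Y' \<le> Y + \<tau> * (L * \<bar>y\<bar>)" for X X' Y Y' :: real
      using that 3 \<tau> by (simp add: max_def)
    show ?thesis unfolding pd unfolding p tent_def kite_coords[OF c] by (rule 4[OF 1 2])
  qed
  have inj: "inj (\<lambda>p. mix s p (F p))" if s: "s \<in> {0..1}" for s
  proof (rule injI)
    fix p p' assume "mix s p (F p) = mix s p' (F p')"
    hence e: "p + (s * tent p) *\<^sub>R d = p' + (s * tent p') *\<^sub>R d" by (simp add: F_def algebra_simps)
    define \<tau> where "\<tau> = s * (tent p - tent p')"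
    have p': "p' = p + \<tau> *\<^sub>R d" using e by (simp add: \<tau>_def algebra_simps)
    hence p: "p = p' + (- \<tau>) *\<^sub>R d" by simp
    have key: False if t: "t > 0" and "t = s * D" "D < t" for t D
    proof -
      have "s * D \<le> 1 * D" using s t that(2) by (intro mult_right_mono) (auto simp: zero_less_mult_iff)
      thus False using that by simp
    qed
    show "p = p'"
    proof (rule ccontr)
      assume ne: "p \<noteq> p'"
      hence "\<tau> \<noteq> 0" using p' by auto
      then consider "\<tau> > 0" | "- \<tau> > 0" by linarith
      thus False
      proof cases
        case 1
        have "tent p - tent p' < \<tau>" using grow[OF 1, of p] p' by simp
        thus False using key[OF 1, of "tent p - tent p'"] by (simp add: \<tau>_def)
      next
        case 2
        have "tent p' - tent p < - \<tau>" using grow[OF 2, of p'] p by simp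
        thus False using key[OF 2, of "tent p' - tent p"] by (simp add: \<tau>_def algebra_simps)
      qed
    qed
  qed
  have pk: "pa 0 1 (shadow \<gamma>)"
    using st unfolding shadow_def o_def straight_state_def polygonal_knot_def piecewise_affine_iff_pa
    by (auto intro: pa_fst)
  have "pa 0 1 (\<lambda>t. F (shadow \<gamma> t))"
    unfolding F_def tent_def by (intro pa_add pa_scaleR_left pa_kite pk)
  from plane_move[OF st this inj] show thesis
    using that unfolding F_def tent_def d_def by blast
qed

text \<open>A segment run through at an arbitrary increasing speed, because a merged segment keeps
  the different speeds of its parts.\<close>

definition mono_piece :: "(real => complex) => real => real => bool" where
  "mono_piece z b c \<longleftrightarrow> b < c \<and> (\<exists>p e f. e \<noteq> 0 \<and> strict_mono_on {b..c} f \<and>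
     (\<forall>t\<in>{b..c}. z t = p + f t *\<^sub>R e))"

lemma mono_pieceE:
  assumes "mono_piece z b c"
  obtains f where "b < c" "z c \<noteq> z b" "strict_mono_on {b..c} f" "f b = 0" "f c = 1"
    "\<And>t. t \<in> {b..c} ==> z t = z b + f t *\<^sub>R (z c - z b)"
proof -
  from assms[unfolded mono_piece_def] obtain p e g where *: "b < c" "e \<noteq> 0" "strict_mono_on {b..c} g"
    "\<forall>t\<in>{b..c}. z t = p + g t *\<^sub>R e" by blast
  have lt: "g b < g c" using *(1,3) by (auto simp: strict_mono_on_def)
  define f where "f t = (g t - g b) / (g c - g b)" for t
  have zc: "z c - z b = (g c - g b) *\<^sub>R e" using *(1,4) by (simp add: scaleR_diff_left)
  show thesis
  proof (rule that[of f])
    show "z c \<noteq> z b" using zc lt *(2) by auto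
    show "strict_mono_on {b..c} f"
      using *(3) lt by (auto simp: strict_mono_on_def f_def divide_strict_right_mono)
    show "z t = z b + f t *\<^sub>R (z c - z b)" if t: "t \<in> {b..c}" for t
    proof -
      have "f t *\<^sub>R (z c - z b) = (g t - g b) *\<^sub>R e" unfolding zc f_def using lt by simp
      thus ?thesis using t *(1,4) by (simp add: scaleR_diff_left)
    qed
  qed (use * lt in "auto simp: f_def")
qed

lemma mono_piece_onto:
  assumes mp: "mono_piece z b c" and cont: "continuous_on {b..c} z" and l: "0 \<le> l" "l \<le> 1"
  shows "\<exists>t\<in>{b..c}. z t = z b + l *\<^sub>R (z c - z b)"
proof -
  obtain f where f: "b < c" "z c \<noteq> z b" "strict_mono_on {b..c} f" "f b = 0" "f c = 1"
    "\<And>t. t \<in> {b..c} ==> z t = z b + f t *\<^sub>R (z c - z b)" using mono_pieceE[OF mp] by blast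
  have "f t = Re ((z t - z b) / (z c - z b))" if "t \<in> {b..c}" for t
    using f(2) f(6)[OF that] by (simp add: scaleR_conv_of_real)
  moreover have "continuous_on {b..c} (\<lambda>t. Re ((z t - z b) / (z c - z b)))"
    by (intro continuous_intros cont) (use f(2) in auto)
  ultimately have "continuous_on {b..c} f" by (subst continuous_on_cong[OF refl]) auto
  then obtain t where "b \<le> t" "t \<le> c" "f t = l" using IVT'[of f b l c] f(1,4,5) l by auto
  thus ?thesis using f(6)[of t] by (intro bexI[of _ t]) auto
qed

primrec pieces :: "(real => complex) => nat => real => bool" where
  "pieces z 0 x \<longleftrightarrow> x = 0"
| "pieces z (Suc m) x \<longleftrightarrow> (\<exists>c\<ge>0. pieces z m c \<and> mono_piece z c x)"

lemma pieces_cong: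
  "pieces z m x ==> (\<And>t. t \<in> {0..x} ==> z' t = z t) ==> pieces z' m x"
proof (induction m arbitrary: x)
  case (Suc m)
  then obtain c where c: "c \<ge> 0" "pieces z m c" "mono_piece z c x" by auto
  have cx: "c < x" using c(3) by (simp add: mono_piece_def)
  have "pieces z' m c" by (rule Suc.IH[OF c(2)]) (use Suc.prems cx in auto)
  moreover have "mono_piece z' c x"
    using c Suc.prems(2) unfolding mono_piece_def by (metis atLeastAtMost_iff order_trans)
  ultimately show ?case using c(1) by auto
qed simp

lemma pa_pieces:
  "pa a b z ==> 0 \<le> a ==> inj_on z {a..b} ==> pieces z m a ==> \<exists>m'. pieces z m' b"
proof (induction arbitrary: m rule: pa.induct)
  case (pa_affine a b z p v)
  show ?case
  proof (cases "a = b")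
    case True
    thus ?thesis using pa_affine by auto
  next
    case False
    hence ab: "a < b" using pa_affine by simp
    have "v \<noteq> 0"
    proof
      assume "v = 0"
      hence "z a = z b" using pa_affine ab by auto
      thus False using inj_onD[OF pa_affine.prems(2), of a b] ab by auto
    qed
    hence "mono_piece z a b"
      unfolding mono_piece_def using ab pa_affine(2)
      by (intro conjI exI[of _ p] exI[of _ v] exI[of _ id]) (auto simp: strict_mono_on_def)
    thus ?thesis using pa_affine by (intro exI[of _ "Suc m"]) auto
  qed
next
  case (pa_cat a c z b)
  have ac: "a \<le> c" "c \<le> b" using pa_cat pa_le by blast+
  have "inj_on z {a..c}" "inj_on z {c..b}" using pa_cat.prems(2) ac by (auto intro: inj_on_subset)
  thus ?case using pa_cat ac by (meson order_trans)
qed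

lemma mono_piece_join:
  assumes f: "strict_mono_on {b..c} f" "\<And>t. t \<in> {b..c} ==> z t = p + f t *\<^sub>R e"
    and g: "strict_mono_on {c..x} g" "\<And>t. t \<in> {c..x} ==> z t = p + g t *\<^sub>R e"
    and "b < c" "c < x" "e \<noteq> 0"
  shows "mono_piece z b x"
proof -
  have "p + f c *\<^sub>R e = p + g c *\<^sub>R e" using f(2)[of c] g(2)[of c] assms by auto
  hence fg: "f c = g c" using assms by simp
  define h where "h t = (if t \<le> c then f t else g t)" for t
  have "strict_mono_on {b..x} h"
    unfolding strict_mono_on_def
  proof (intro allI impI)
    fix s t assume st: "s \<in> {b..x} \<and> t \<in> {b..x} \<and> s < t"
    consider "t \<le> c" | "s \<le> c" "c < t" | "c < s" by linarith
    thus "h s < h t"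
    proof cases
      case 1
      thus ?thesis using f(1) st by (auto simp: h_def strict_mono_on_def)
    next
      case 2
      have "f s \<le> f c" using f(1) st 2 assms by (cases "s = c") (auto simp: strict_mono_on_def less_imp_le)
      moreover have "g c < g t" using g(1) st 2 assms by (auto simp: strict_mono_on_def)
      ultimately show ?thesis using 2 fg by (simp add: h_def)
    next
      case 3
      thus ?thesis using g(1) st by (auto simp: h_def strict_mono_on_def)
    qed
  qed
  moreover have "\<forall>t\<in>{b..x}. z t = p + h t *\<^sub>R e" using f(2) g(2) by (auto simp: h_def)
  ultimately show ?thesis using assms unfolding mono_piece_def by fastforce
qed

lemma kiso_refl:
  assumes "polygonal_knot \<gamma>"
  shows "kiso (\<gamma> ` {0..1}) (\<gamma> ` {0..1})"
proof (rule kiso_linear)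
  have p: "pa 0 1 \<gamma>" "simple_path \<gamma>" "\<gamma> 0 = \<gamma> 1"
    using assms by (simp_all add: polygonal_knot_def piecewise_affine_iff_pa pathstart_def pathfinish_def)
  show "pa 0 1 \<gamma>" "pa 0 1 \<gamma>" "\<gamma> 0 = \<gamma> 1" "\<gamma> 0 = \<gamma> 1" by (fact p)+
  show "simple_path (\<lambda>t. mix s (\<gamma> t) (\<gamma> t))" for s using p(2) by (simp only: scaleR_collapse)
qed

text \<open>The last edge is shrunk towards its start \<open>v\<close> until it is short compared
  with the distance to the earlier edges, and is then turned about \<open>v\<close> into the
  prolongation of the edge before it, so that both form one piece. Each move is supported in a kite
  that avoids the rest of the first strand; the second strand is dragged along.\<close>

lemma straighten_step:
  fixes \<gamma> :: "real => space"
  assumes st: "straight_state \<gamma> u n" and pc: "pieces (shadow \<gamma>) (Suc (Suc m)) u"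
  shows "\<exists>\<gamma>'. kiso (\<gamma> ` {0..1}) (\<gamma>' ` {0..1}) \<and> straight_state \<gamma>' u n \<and> pieces (shadow \<gamma>') (Suc m) u"
proof -
  define z where "z = shadow \<gamma>"
  obtain c b where bc: "0 \<le> b" "pieces z m b" "mono_piece z b c" "mono_piece z c u"
    using pc by (auto simp: z_def)
  obtain f where f: "b < c" "z c \<noteq> z b" "strict_mono_on {b..c} f" "f b = 0" "f c = 1"
    "\<And>t. t \<in> {b..c} ==> z t = z b + f t *\<^sub>R (z c - z b)" using mono_pieceE[OF bc(3)] by blast
  obtain f2 where f2: "c < u" "z u \<noteq> z c" "strict_mono_on {c..u} f2" "f2 c = 0" "f2 u = 1"
    "\<And>t. t \<in> {c..u} ==> z t = z c + f2 t *\<^sub>R (z u - z c)" using mono_pieceE[OF bc(4)] by blast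
  define v q g where "v = z c" and "q = z u - z c" and "g = z c - z b"
  have q0: "q \<noteq> 0" and g0: "g \<noteq> 0" using f(2) f2(2) by (auto simp: q_def g_def)
  have u: "0 < u" "u < 1" using st by (auto simp: straight_state_def)
  have inj: "inj_on z {0..u}" using st by (simp add: straight_state_def z_def)
  have paz: "pa 0 1 z"
    using st unfolding z_def shadow_def o_def straight_state_def polygonal_knot_def piecewise_affine_iff_pa
    by (auto intro: pa_fst)
  have contz: "continuous_on {0..1} z" by (rule pa_continuous[OF paz])
  have zprev: "z t = v - (1 - f t) *\<^sub>R g" if "t \<in> {b..c}" for t
    using f(6)[OF that] by (simp add: v_def g_def algebra_simps)
  have zlast: "z t = v + f2 t *\<^sub>R q" if "t \<in> {c..u}" for t
    using f2(6)[OF that] by (simp add: v_def q_def)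
  have f01: "0 \<le> f t \<and> f t \<le> 1" if "t \<in> {b..c}" for t
    using strict_mono_on_leD[OF f(3), of b t] strict_mono_on_leD[OF f(3), of t c] that f(1-5) by auto
  have f201: "0 \<le> f2 t \<and> f2 t \<le> 1" if "t \<in> {c..u}" for t
    using strict_mono_on_leD[OF f2(3), of c t] strict_mono_on_leD[OF f2(3), of t u] that f2(1-5) by auto
  have onto: "\<exists>t\<in>{c..u}. z t = v + l *\<^sub>R q" if "0 \<le> l" "l \<le> 1" for l
    unfolding v_def q_def
    by (rule mono_piece_onto[OF bc(4) _ that]) (use contz bc(1) f(1) f2(1) u in "auto intro: continuous_on_subset")
  have onto_prev: "\<exists>t\<in>{b..c}. z t = v - l *\<^sub>R g" if "0 \<le> l" "l \<le> 1" for l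
  proof -
    have "\<exists>t\<in>{b..c}. z t = z b + (1 - l) *\<^sub>R (z c - z b)"
      by (rule mono_piece_onto[OF bc(3)]) (use that contz bc(1) f(1) f2(1) u in "auto intro: continuous_on_subset")
    thus ?thesis by (simp add: v_def g_def algebra_simps)
  qed
  have pk_cong: "pieces z' m b" if "\<And>t. t \<in> {0..c} ==> z' t = z t" for z'
    by (rule pieces_cong[OF bc(2)]) (use that f(1) in auto)
  have join: "mono_piece z' b u" if eq: "\<And>t. t \<in> {b..c} ==> z' t = z t"
    and last: "\<And>t. t \<in> {c..u} ==> z' t = v + (r * f2 t) *\<^sub>R g" and r: "r > 0" for z' r
  proof (rule mono_piece_join[of b c "\<lambda>t. f t - 1" z' v g u "\<lambda>t. r * f2 t"])
    show "strict_mono_on {b..c} (\<lambda>t. f t - 1)" using f(3) by (simp add: strict_mono_on_def)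
    show "strict_mono_on {c..u} (\<lambda>t. r * f2 t)" using f2(3) r by (simp add: strict_mono_on_def)
    show "z' t = v + (f t - 1) *\<^sub>R g" if t: "t \<in> {b..c}" for t
      using zprev[OF t] eq[OF t] by (simp add: algebra_simps)
  qed (use last f(1) f2(1,4) g0 in auto)
  show ?thesis
  proof (cases "cross q g = 0")
    case True
    define r where "r = Re (q / g)"
    have "Im q * Re g - Re q * Im g = 0" using True by (simp add: cross_eq)
    hence "Im (q / g) = 0" by (simp add: Im_divide)
    hence "q / g = of_real r" by (simp add: r_def complex_eq_iff)
    hence qr: "q = r *\<^sub>R g" using g0 by (simp add: field_simps scaleR_conv_of_real)
    \<comment> \<open>A negative factor would fold the last edge back onto the previous one, against
      injectivity.\<close>
    have "r > 0"
    proof (rule ccontr)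
      assume "\<not> r > 0"
      hence r: "r < 0" using qr q0 by (cases "r = 0") auto
      define l where "l = min 1 (- 1 / r)"
      have l: "0 < l" "l \<le> 1" "l * (- r) \<le> 1" using r by (auto simp: l_def min_def field_simps)
      obtain t where t: "t \<in> {c..u}" "z t = v + l *\<^sub>R q" using onto[of l] l by auto
      have "0 \<le> l * - r" using l r by (simp add: mult_nonneg_nonpos)
      then obtain t' where t': "t' \<in> {b..c}" "z t' = v - (l * - r) *\<^sub>R g" using onto_prev[of "l * - r"] l by auto
      have "z t = z t'" using t t' qr by simp
      hence "t = t'" using inj_onD[OF inj] t(1) t'(1) bc(1) f(1) f2(1) by auto
      hence "t = c" using t t' by auto
      thus False using t(2) q0 l by (auto simp: v_def)
    qed
    hence "mono_piece z b u" by (intro join[of z r]) (use zlast qr in "auto simp: mult.commute")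
    hence "pieces z (Suc m) u" using bc by auto
    moreover have "kiso (\<gamma> ` {0..1}) (\<gamma> ` {0..1})"
      by (rule kiso_refl) (use st in "simp add: straight_state_def")
    ultimately show ?thesis using st by (auto simp: z_def)
  next
    case False
    define S0 where "S0 = z ` {0..b}"
    have S0c: "compact S0"
      unfolding S0_def by (intro compact_continuous_image continuous_on_subset[OF contz]) (use bc(1) f(1) f2(1) u in auto)
    have disj: "S0 \<inter> (\<lambda>l. v + l *\<^sub>R q) ` {0..1} = {}"
    proof (rule ccontr)
      assume "\<not> ?thesis"
      then obtain s l where sl: "s \<in> {0..b}" "l \<in> {0..1}" "z s = v + l *\<^sub>R q" unfolding S0_def by blast
      then obtain t where t: "t \<in> {c..u}" "z t = v + l *\<^sub>R q" using onto[of l] by auto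
      have "s = t" using inj_onD[OF inj, of s t] sl t bc(1) f(1) f2(1) by auto
      thus False using sl(1) t(1) f(1) by auto
    qed
    have "compact ((\<lambda>l. v + l *\<^sub>R q) ` {0..1::real})"
      by (intro compact_continuous_image continuous_intros) auto
    from separate_compact_closed[OF S0c compact_imp_closed[OF this] disj] obtain \<delta> where
      \<delta>: "\<delta> > 0" "\<And>p l. p \<in> S0 ==> l \<in> {0..1} ==> \<delta> \<le> dist p (v + l *\<^sub>R q)" by blast
    define w where "w = \<i> * q"
    have "cross q w = (Re q)\<^sup>2 + (Im q)\<^sup>2" by (simp add: w_def cross_eq power2_eq_square)
    hence cw0: "cross q w \<noteq> 0" using q0 by (simp add: sum_power2_eq_zero_iff complex_eq_iff)
    have nw: "norm w = norm q" by (simp add: w_def norm_mult)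
    obtain lg mg where lm: "g = 0 + lg *\<^sub>R q + mg *\<^sub>R w" by (rule kite_decomp[OF cw0])
    have mg0: "mg \<noteq> 0"
    proof
      assume "mg = 0"
      hence "cross q g = 0" using lm by (simp add: cross_simps)
      thus False using False by blast
    qed
    \<comment> \<open>\<open>\<eta>\<close> limits how far the kite reaches beyond the end of the
      last edge. \<open>L\<close> makes it so narrow that it avoids the previous edge (first term,
      from the slope of \<open>g\<close> in the coordinates \<open>q\<close>, \<open>w\<close>) and
      stays within \<open>\<delta>\<close> of the last edge (second term). \<open>\<kappa>\<close>
      makes the second kite fit into the disc of radius \<open>\<delta>\<close> about
      \<open>v\<close>.\<close>
    define \<eta> where "\<eta> = min 1 (\<delta> / (4 * norm q))"
    define L where "L = max (\<bar>lg\<bar> / \<bar>mg\<bar>) (8 * norm q / \<delta>)"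
    define G where "G = norm q + norm (g - q)"
    define \<kappa> where "\<kappa> = min (1/2) (\<delta> / (4 * G))"
    have G0: "G > 0" using q0 by (simp add: G_def add_pos_nonneg)
    have \<eta>0: "\<eta> > 0" "\<eta> \<le> 1" using \<delta> q0 by (auto simp: \<eta>_def)
    have Lge: "L \<ge> 8 * norm q / \<delta>" by (simp add: L_def)
    moreover have "8 * norm q / \<delta> > 0" using \<delta>(1) q0 by simp
    ultimately have L0: "L > 0" by linarith
    have Lq: "norm q * 8 \<le> L * \<delta>" using Lge \<delta>(1) by (simp add: pos_divide_le_eq mult.commute)
    have \<kappa>0: "\<kappa> > 0" "\<kappa> < 1" and \<kappa>G: "2 * \<kappa> * G < \<delta>"
    proof -
      show "\<kappa> > 0" "\<kappa> < 1" using \<delta> G0 by (auto simp: \<kappa>_def min_less_iff_disj)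
      have "\<kappa> \<le> \<delta> / (4 * G)" by (simp add: \<kappa>_def)
      hence "\<kappa> * (4 * G) \<le> \<delta>" using G0 by (simp add: pos_le_divide_eq)
      thus "2 * \<kappa> * G < \<delta>" using \<delta>(1) by linarith
    qed
    have S0v: "norm (z t - v) \<ge> \<delta>" if "t \<in> {0..b}" for t
      using \<delta>(2)[of "z t" 0] that by (auto simp: S0_def dist_norm)
    have kA: "kite v q w (1/\<eta>) \<eta> L (z t) = 0" if t: "t \<in> {0..c}" for t
    proof (rule ccontr)
      assume ne: "kite v q w (1/\<eta>) \<eta> L (z t) \<noteq> 0"
      obtain l k where zt: "z t = v + l *\<^sub>R q + k *\<^sub>R w" by (rule kite_decomp[OF cw0])
      from ne have pos: "min l (1/\<eta> * (1 + \<eta> - l)) - L * \<bar>k\<bar> > 0"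
        unfolding zt kite_coords[OF cw0] by (auto simp: max_def split: if_splits)
      have Lk: "L * \<bar>k\<bar> \<ge> 0" using L0 by simp
      have l0: "l > 0" "L * \<bar>k\<bar> < l" using pos Lk by auto
      have "(1 + \<eta> - l) / \<eta> > 0" using pos Lk by auto
      hence l1: "l < 1 + \<eta>" using \<eta>0 by (simp add: zero_less_divide_iff)
      show False
      proof (cases "t \<le> b")
        case True
        hence tS: "z t \<in> S0" using t by (auto simp: S0_def)
        define l' where "l' = min l 1"
        have "z t - (v + l' *\<^sub>R q) = (l - l') *\<^sub>R q + k *\<^sub>R w" by (simp add: zt algebra_simps)
        hence "norm (z t - (v + l' *\<^sub>R q)) \<le> \<bar>l - l'\<bar> * norm q + \<bar>k\<bar> * norm q"
          using norm_triangle_ineq[of "(l - l') *\<^sub>R q" "k *\<^sub>R w"] nw by simp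
        moreover have "\<bar>l - l'\<bar> * norm q \<le> \<eta> * norm q" using l1 \<eta>0 by (intro mult_right_mono) (auto simp: l'_def)
        moreover have "\<eta> * norm q \<le> \<delta> / 4"
        proof -
          have "\<eta> \<le> \<delta> / (4 * norm q)" by (simp add: \<eta>_def)
          thus ?thesis using q0 by (simp add: pos_le_divide_eq)
        qed
        moreover have "\<bar>k\<bar> * norm q < \<delta> / 2"
        proof -
          have "L * (\<bar>k\<bar> * norm q) < 2 * norm q"
            using mult_strict_right_mono[of "L * \<bar>k\<bar>" 2 "norm q"] l0 l1 \<eta>0 q0 by (simp add: mult.assoc)
          also have "2 * norm q \<le> L * \<delta> / 2" using Lq norm_ge_zero[of q] by linarith
          also have "L * \<delta> / 2 = L * (\<delta> / 2)" by simp
          finally show ?thesis by (rule mult_left_less_imp_less) (use L0 in simp)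
        qed
        ultimately have "dist (z t) (v + l' *\<^sub>R q) < \<delta>" using \<delta>(1) by (simp add: dist_norm)
        thus False using \<delta>(2)[OF tS, of l'] l0 by (simp add: l'_def)
      next
        case False
        hence tb: "t \<in> {b..c}" using t by auto
        define s where "s = 1 - f t"
        have s0: "s \<ge> 0" using f01[OF tb] by (simp add: s_def)
        have "v + l *\<^sub>R q + k *\<^sub>R w = v + (- s * lg) *\<^sub>R q + (- s * mg) *\<^sub>R w"
          using zprev[OF tb] unfolding zt[symmetric] by (subst (asm) lm) (simp add: s_def algebra_simps)
        hence "(l + s * lg) *\<^sub>R q + (k + s * mg) *\<^sub>R w = 0" by (simp add: algebra_simps)
        hence "cross ((l + s * lg) *\<^sub>R q + (k + s * mg) *\<^sub>R w) w = 0" "cross q ((l + s * lg) *\<^sub>R q + (k + s * mg) *\<^sub>R w) = 0"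
          by (simp_all add: cross_simps)
        hence "l + s * lg = 0" "k + s * mg = 0" using cw0 by (simp_all add: cross_simps)
        hence lk: "l = s * (- lg)" "k = - (s * mg)" by auto
        have "\<bar>lg\<bar> / \<bar>mg\<bar> \<le> L" by (simp add: L_def)
        hence "\<bar>lg\<bar> \<le> L * \<bar>mg\<bar>" using mg0 by (simp add: pos_divide_le_eq)
        hence "s * \<bar>lg\<bar> \<le> s * (L * \<bar>mg\<bar>)" using s0 by (intro mult_left_mono) auto
        hence "l \<le> L * \<bar>k\<bar>" using lk s0 abs_ge_minus_self[of lg]
          by (smt (verit) abs_minus_cancel abs_mult abs_of_nonneg mult.left_commute mult_left_mono)
        thus False using l0 by simp
      qed
    qed
    \<comment> \<open>At \<open>v + l q\<close> on the edge the tent has the value \<open>l\<close>,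
      so this point goes to \<open>v + \<kappa> l q\<close>.\<close>
    obtain \<gamma>1 where g1: "kiso (\<gamma> ` {0..1}) (\<gamma>1 ` {0..1})" "straight_state \<gamma>1 u n"
      "\<And>t. shadow \<gamma>1 t = z t + kite v q w (1/\<eta>) \<eta> L (z t) *\<^sub>R ((- (1 - \<kappa>)) *\<^sub>R q + 0 *\<^sub>R w)"
      using kite_move[OF st cw0, of "- (1 - \<kappa>)" L 0 "1/\<eta>"] \<kappa>0 \<eta>0 L0 unfolding z_def by auto
    define z1 where "z1 = shadow \<gamma>1"
    have z1prev: "z1 t = z t" if "t \<in> {0..c}" for t using g1(3)[of t] kA[OF that] by (simp add: z1_def)
    have z1last: "z1 t = v + f2 t *\<^sub>R (\<kappa> *\<^sub>R q)" if t: "t \<in> {c..u}" for t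
    proof -
      have l: "0 \<le> f2 t" "f2 t \<le> 1" using f201[OF t] by auto
      have "1 \<le> (1 + \<eta> - f2 t) / \<eta>" using l \<eta>0 by (simp add: le_divide_eq)
      hence "(1 + \<eta> - f2 t) / \<eta> \<ge> f2 t" using l by linarith
      hence "min (f2 t) ((1 + \<eta> - f2 t) / \<eta>) = f2 t" by simp
      hence "kite v q w (1/\<eta>) \<eta> L (z t) = f2 t"
        using kite_coords[OF cw0, of v "1/\<eta>" \<eta> L "f2 t" 0] zlast[OF t] l \<eta>0 by simp
      thus ?thesis using g1(3)[of t] zlast[OF t] by (simp add: z1_def algebra_simps)
    qed
    \<comment> \<open>Since \<open>q1 + d = \<kappa> *\<^sub>R g\<close>, moving the tip of the
      shortened edge by \<open>d\<close> lays the edge in the direction of \<open>g\<close>. The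
      previous edge has nonpositive coordinate along \<open>q1\<close>, so the second tent vanishes
      on it.\<close>
    define q1 d where "q1 = \<kappa> *\<^sub>R q" and "d = \<kappa> *\<^sub>R (g - q)"
    have cd0: "cross q1 d \<noteq> 0" using False \<kappa>0 by (simp add: q1_def d_def cross_simps)
    have kB: "kite v q1 d 1 1 (1/2) (z t) = 0" if t: "t \<in> {0..c}" for t
    proof (cases "t \<le> b")
      case True
      show ?thesis
      proof (rule ccontr)
        assume ne: "kite v q1 d 1 1 (1/2) (z t) \<noteq> 0"
        obtain l k where zt: "z t = v + l *\<^sub>R q1 + k *\<^sub>R d" by (rule kite_decomp[OF cd0])
        have mx: "max 0 x \<noteq> 0 ==> x > 0" for x :: real by (simp add: max_def split: if_splits)
        have pos: "min l (1 * (1 + 1 - l)) - 1/2 * \<bar>k\<bar> > 0"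
          by (rule mx) (use ne in "simp only: zt kite_coords[OF cd0] not_False_eq_True")
        have "min l (1 * (1 + 1 - l)) \<le> l" "min l (1 * (1 + 1 - l)) \<le> 2 - l" by auto
        hence lk: "0 < l" "l < 2" "\<bar>k\<bar> < 2" using pos abs_ge_zero[of k] by linarith+
        have "norm (z t - v) \<le> \<bar>l\<bar> * norm q1 + \<bar>k\<bar> * norm d"
          using norm_triangle_ineq[of "l *\<^sub>R q1" "k *\<^sub>R d"] by (simp add: zt add.assoc)
        also have "\<dots> \<le> 2 * norm q1 + 2 * norm d" using lk by (intro add_mono mult_right_mono) auto
        also have "\<dots> = 2 * \<kappa> * G" using \<kappa>0 by (simp add: q1_def d_def G_def distrib_left del: scaleR_diff_right scaleR_right_diff_distrib)
        finally show False using S0v[of t] \<kappa>G True t by auto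
      qed
    next
      case False
      hence tb: "t \<in> {b..c}" using t by auto
      define s where "s = (1 - f t) / \<kappa>"
      have "z t = v - (s * \<kappa>) *\<^sub>R g" using zprev[OF tb] \<kappa>0 by (simp add: s_def)
      also have "\<dots> = v + (- s) *\<^sub>R q1 + (- s) *\<^sub>R d" by (simp add: q1_def d_def algebra_simps)
      finally show ?thesis
        using f01[OF tb] \<kappa>0 by (simp only: kite_coords[OF cd0]) (simp add: s_def)
    qed
    obtain \<gamma>2 where g2: "kiso (\<gamma>1 ` {0..1}) (\<gamma>2 ` {0..1})" "straight_state \<gamma>2 u n"
      "\<And>t. shadow \<gamma>2 t = z1 t + kite v q1 d 1 1 (1/2) (z1 t) *\<^sub>R (0 *\<^sub>R q1 + 1 *\<^sub>R d)"
      using kite_move[OF g1(2) cd0, of 0 "1/2" 1 1] unfolding z1_def by auto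
    have z2prev: "shadow \<gamma>2 t = z t" if "t \<in> {0..c}" for t
      using g2(3)[of t] kB[OF that] z1prev[OF that] by simp
    have z2last: "shadow \<gamma>2 t = v + (\<kappa> * f2 t) *\<^sub>R g" if t: "t \<in> {c..u}" for t
    proof -
      have l: "0 \<le> f2 t" "f2 t \<le> 1" using f201[OF t] by auto
      have z1: "z1 t = v + f2 t *\<^sub>R q1 + 0 *\<^sub>R d" using z1last[OF t] by (simp add: q1_def)
      have "kite v q1 d 1 1 (1/2) (z1 t) = f2 t"
        using l unfolding z1 kite_coords[OF cd0] by simp
      thus ?thesis using g2(3)[of t] z1 by (simp add: q1_def d_def algebra_simps)
    qed
    have "mono_piece (shadow \<gamma>2) b u" by (rule join[of _ \<kappa>]) (use z2prev z2last \<kappa>0 bc in auto)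
    moreover have "pieces (shadow \<gamma>2) m b" by (rule pk_cong[OF z2prev])
    ultimately have "pieces (shadow \<gamma>2) (Suc m) u" using bc by auto
    thus ?thesis using g2 kiso_trans[OF g1(1) g2(1)] by blast
  qed
qed

lemma straighten:
  fixes \<gamma> :: "real => space"
  assumes "straight_state \<gamma> u n"
  shows "\<exists>\<gamma>'. kiso (\<gamma> ` {0..1}) (\<gamma>' ` {0..1}) \<and> straight_state \<gamma>' u n \<and> mono_piece (shadow \<gamma>') 0 u"
proof -
  have *: "\<exists>\<gamma>'. kiso (\<gamma> ` {0..1}) (\<gamma>' ` {0..1}) \<and> straight_state \<gamma>' u n \<and> mono_piece (shadow \<gamma>') 0 u"
    if "straight_state \<gamma> u n" "pieces (shadow \<gamma>) (Suc m) u" for m and \<gamma> :: "real => space"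
    using that
  proof (induction m arbitrary: \<gamma>)
    case 0
    have "kiso (\<gamma> ` {0..1}) (\<gamma> ` {0..1})"
      by (rule kiso_refl) (use 0 in "simp add: straight_state_def")
    thus ?case using 0 by auto
  next
    case (Suc m)
    from straighten_step[OF Suc.prems] Suc.IH show ?case using kiso_trans by blast
  qed
  have paz: "pa 0 1 (shadow \<gamma>)" and u: "0 < u" "u < 1" and inj: "inj_on (shadow \<gamma>) {0..u}"
    using assms unfolding shadow_def o_def straight_state_def polygonal_knot_def piecewise_affine_iff_pa
    by (auto intro: pa_fst)
  have "pa 0 u (shadow \<gamma>)" by (rule pa_restrict[OF paz]) (use u in auto)
  from pa_pieces[OF this _ inj, of 0] obtain m where m: "pieces (shadow \<gamma>) m u" by auto
  then obtain m' where "m = Suc m'" using u by (cases m) auto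
  thus ?thesis using *[OF assms] m by blast
qed

text \<open>For a negative real \<open>a\<close> the interpolation with the identity degenerates at
  some time. Multiplying twice by a square root avoids this, because the principal root is never a
  negative real.\<close>

lemma similarity_move:
  fixes \<gamma> :: "real => space"
  assumes st: "straight_state \<gamma> u n" and a: "a \<noteq> 0"
  shows "\<exists>\<gamma>'. kiso (\<gamma> ` {0..1}) (\<gamma>' ` {0..1}) \<and> straight_state \<gamma>' u n \<and> (\<forall>t. shadow \<gamma>' t = a * (shadow \<gamma> t - c))"
proof -
  have step: "\<exists>\<gamma>'. kiso (\<gamma> ` {0..1}) (\<gamma>' ` {0..1}) \<and> straight_state \<gamma>' u n \<and> (\<forall>t. shadow \<gamma>' t = a * (shadow \<gamma> t - c))"
    if st: "straight_state \<gamma> u n" and a: "Re a > 0 \<or> Im a \<noteq> 0" for a c and \<gamma> :: "real => space"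
  proof -
    have paz: "pa 0 1 (shadow \<gamma>)"
      using st unfolding shadow_def o_def straight_state_def polygonal_knot_def piecewise_affine_iff_pa
      by (auto intro: pa_fst)
    have p: "pa 0 1 (\<lambda>t. a * (shadow \<gamma> t - c))" by (intro pa_cmult pa_diff pa_const paz) simp
    have inj: "inj (\<lambda>p. mix s p (a * (p - c)))" if s: "s \<in> {0..1}" for s
    proof -
      define k where "k = of_real (1 - s) + of_real s * a"
      have "k \<noteq> 0"
      proof
        assume "k = 0"
        hence re: "1 - s + s * Re a = 0" and im: "s * Im a = 0" by (auto simp: k_def complex_eq_iff)
        hence "s \<noteq> 0" by auto
        hence "Re a > 0" using im a by auto
        hence "s * Re a \<ge> 0" using s by simp
        moreover have "s \<le> 1" using s by simp
        ultimately have "s = 1 \<and> s * Re a = 0" using re by linarith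
        thus False using \<open>Re a > 0\<close> by auto
      qed
      moreover have "mix s p (a * (p - c)) = k * p - of_real s * a * c" for p
        by (simp add: k_def scaleR_conv_of_real algebra_simps)
      ultimately show ?thesis by (auto intro: injI)
    qed
    show ?thesis by (rule plane_move[OF st p inj]) auto
  qed
  define r where "r = csqrt a"
  have r: "r * r = a" using power2_csqrt[of a] by (simp add: r_def power2_eq_square)
  have r0: "Re r > 0 \<or> Im r \<noteq> 0"
    using a r csqrt_principal[of a] by (auto simp: r_def complex_eq_iff)
  obtain \<gamma>1 where 1: "kiso (\<gamma> ` {0..1}) (\<gamma>1 ` {0..1})" "straight_state \<gamma>1 u n" "\<And>t. shadow \<gamma>1 t = r * (shadow \<gamma> t - c)"
    using step[OF st r0] by blast
  obtain \<gamma>2 where 2: "kiso (\<gamma>1 ` {0..1}) (\<gamma>2 ` {0..1})" "straight_state \<gamma>2 u n" "\<And>t. shadow \<gamma>2 t = r * (shadow \<gamma>1 t - 0)"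
    using step[OF 1(2) r0] by blast
  have "shadow \<gamma>2 t = a * (shadow \<gamma> t - c)" for t unfolding 2(3) 1(3) r[symmetric] by simp
  thus ?thesis using 2 kiso_trans[OF 1(1) 2(1)] by blast
qed

definition normal_state :: "(real => space) => real => nat => bool" where
  "normal_state \<gamma> u n \<longleftrightarrow> straight_state \<gamma> u n \<and>
     (\<exists>f. strict_mono_on {0..u} f \<and> (\<forall>t\<in>{0..u}. shadow \<gamma> t = of_real (f t)))"

lemma normalise:
  fixes \<gamma> :: "real => space"
  assumes st: "straight_state \<gamma> u n" and mp: "mono_piece (shadow \<gamma>) 0 u"
  shows "\<exists>\<gamma>'. kiso (\<gamma> ` {0..1}) (\<gamma>' ` {0..1}) \<and> normal_state \<gamma>' u n \<and>
    (\<forall>t. shadow \<gamma>' t = (shadow \<gamma> t - shadow \<gamma> 0) / (shadow \<gamma> u - shadow \<gamma> 0))"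
proof -
  define z where "z = shadow \<gamma>"
  obtain f where f: "0 < u" "z u \<noteq> z 0" "strict_mono_on {0..u} f" "f 0 = 0" "f u = 1"
    "\<And>t. t \<in> {0..u} ==> z t = z 0 + f t *\<^sub>R (z u - z 0)" using mono_pieceE[OF mp] unfolding z_def by blast
  obtain \<gamma>' where g: "kiso (\<gamma> ` {0..1}) (\<gamma>' ` {0..1})" "straight_state \<gamma>' u n"
    "\<And>t. shadow \<gamma>' t = (1 / (z u - z 0)) * (z t - z 0)"
    using similarity_move[OF st, of "1 / (z u - z 0)" "z 0"] f(2) unfolding z_def by auto
  have "shadow \<gamma>' t = of_real (f t)" if "t \<in> {0..u}" for t
    using f(2) f(6)[OF that] by (simp add: g(3) scaleR_conv_of_real)
  hence "normal_state \<gamma>' u n" using g(2) f(3) unfolding normal_state_def by blast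
  thus ?thesis using g by (auto simp: z_def)
qed

text \<open>Straight position fixes the strand as a set; that it is run through monotonically
  follows from continuity and injectivity.\<close>

lemma contained_mono_piece:
  fixes \<gamma> :: "real => space"
  assumes sp: "straight_position \<gamma> n u"
  shows "mono_piece (shadow \<gamma>) 0 u"
proof -
  define z where "z = shadow \<gamma>"
  have st: "straight_state \<gamma> u n" by (rule straight_position_state[OF sp])
  have u: "0 < u" "u < 1" and inj: "inj_on z {0..u}" and paz: "pa 0 1 z"
    using st unfolding z_def shadow_def o_def straight_state_def polygonal_knot_def piecewise_affine_iff_pa
    by (auto intro: pa_fst)
  have seg: "z ` {0..u} = closed_segment (z 0) (z u)" using sp by (simp add: straight_position_def z_def)
  have zu: "z u \<noteq> z 0" using inj_onD[OF inj, of u 0] u by auto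
  define f where "f t = Re ((z t - z 0) / (z u - z 0))" for t
  have zf: "z t = z 0 + f t *\<^sub>R (z u - z 0)" if t: "t \<in> {0..u}" for t
  proof -
    have "z t \<in> closed_segment (z 0) (z u)" using t seg by blast
    then obtain l where "z t = mix l (z 0) (z u)" by (auto simp: closed_segment_def)
    hence l: "z t = z 0 + l *\<^sub>R (z u - z 0)" by (simp add: algebra_simps)
    hence "f t = l" using zu by (simp add: f_def scaleR_conv_of_real)
    thus ?thesis using l by simp
  qed
  have "continuous_on {0..1} z" by (rule pa_continuous[OF paz])
  hence "continuous_on {0..u} z" by (rule continuous_on_subset) (use u in auto)
  hence cf: "continuous_on {0..u} f" unfolding f_def by (intro continuous_intros) (use zu in auto)
  have injf: "inj_on f {0..u}" using inj zf by (metis inj_on_def)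
  have f01: "f 0 = 0" "f u = 1" using zu by (auto simp: f_def)
  have first: "f 0 < f t" if "0 < t" "t \<le> u" for t
  proof (cases "t = u")
    case False
    thus ?thesis using continuous_inj_imp_mono[of 0 t u f] that cf injf f01 by auto
  qed (simp add: f01)
  have "f s < f t" if "0 \<le> s" "s < t" "t \<le> u" for s t
  proof (cases "s = 0")
    case False
    have "f 0 < f s \<and> f s < f t \<or> f t < f s \<and> f s < f 0"
      by (rule continuous_inj_imp_mono) (use that False cf injf in "auto intro: continuous_on_subset inj_on_subset")
    thus ?thesis using first[of t] that by auto
  qed (use first that in auto)
  hence sm: "strict_mono_on {0..u} f" by (auto simp: strict_mono_on_def)
  show ?thesis unfolding mono_piece_def z_def[symmetric]
  proof (rule conjI[OF u(1)], rule exI[of _ "z 0"], rule exI[of _ "z u - z 0"], rule exI[of _ f], intro conjI ballI)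
    show "z t = z 0 + f t *\<^sub>R (z u - z 0)" if "t \<in> {0..u}" for t by (rule zf[OF that])
  qed (use zu u sm in auto)
qed


section \<open>Polygons given by their vertices\<close>

definition pgon :: "nat => (nat => 'a::real_normed_vector) => real => 'a" where
  "pgon M V t = V (nat \<lfloor>M * t\<rfloor>) + (M * t - of_int \<lfloor>M * t\<rfloor>) *\<^sub>R (V (Suc (nat \<lfloor>M * t\<rfloor>)) - V (nat \<lfloor>M * t\<rfloor>))"

definition edge_pt :: "(nat => 'a::real_normed_vector) => nat => real => 'a" where
  "edge_pt V i s = mix s (V i) (V (Suc i))"

text \<open>Edges are taken half-open, so that the vertex shared by consecutive edges needs no
  exception.\<close>

definition simple_polygon :: "nat => (nat => 'a::real_normed_vector) => bool" where
  "simple_polygon M V \<longleftrightarrow> M \<ge> 1 \<and> V M = V 0 \<and>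
     (\<forall>i<M. \<forall>j<M. \<forall>s t. 0 \<le> s --> s < 1 --> 0 \<le> t --> t < 1 --> edge_pt V i s = edge_pt V j t --> i = j \<and> s = t)"

lemma edge_pt_0 [simp]: "edge_pt V i 0 = V i"
  and edge_pt_1 [simp]: "edge_pt V i 1 = V (Suc i)"
  by (simp_all add: edge_pt_def)

lemma pgon_edge:
  assumes "0 \<le> s" "s < 1" "M \<ge> 1"
  shows "pgon M V ((real i + s) / real M) = edge_pt V i s"
proof -
  have e: "real M * ((real i + s) / real M) = real i + s" using assms by simp
  have "\<lfloor>real i + s\<rfloor> = int i" using assms by (intro floor_unique) auto
  thus ?thesis unfolding pgon_def e edge_pt_def by (simp add: algebra_simps)
qed

lemma pgon_vertex: "M \<ge> 1 ==> pgon M V (real i / real M) = V i"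
  using pgon_edge[of 0 M V i] by simp

lemma pgon_param:
  assumes "0 \<le> t" "t < 1" "M \<ge> 1"
  obtains i s where "i < M" "0 \<le> s" "s < 1" "t = (real i + s) / real M"
proof -
  define i where "i = nat \<lfloor>M * t\<rfloor>"
  define s where "s = M * t - of_int \<lfloor>M * t\<rfloor>"
  have 0: "0 \<le> real M * t" using assms by simp
  have ri: "real i = of_int \<lfloor>M * t\<rfloor>" using 0 by (simp add: i_def)
  have "real i \<le> M * t" unfolding ri by linarith
  also have "M * t < M" using assms by simp
  finally have "i < M" by simp
  moreover have "0 \<le> s" "s < 1" unfolding s_def by linarith+
  moreover have "t = (real i + s) / real M" using assms unfolding ri s_def by simp
  ultimately show thesis by (rule that)
qed

lemma pgon_edge':
  assumes "0 \<le> s" "s \<le> 1" "M \<ge> 1"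
  shows "pgon M V ((real i + s) / real M) = edge_pt V i s"
proof (cases "s = 1")
  case True
  have "pgon M V (real (Suc i) / real M) = V (Suc i)" by (rule pgon_vertex[OF assms(3)])
  thus ?thesis using True by (simp add: add.commute)
qed (use pgon_edge[of s M V i] assms in simp)

lemma pgon_image:
  assumes "M \<ge> 1"
  shows "pgon M V ` {0..1} = (\<Union>i<M. edge_pt V i ` {0..1})"
proof (intro equalityI subsetI)
  fix p assume "p \<in> pgon M V ` {0..1}"
  then obtain t where t: "0 \<le> t" "t \<le> 1" "p = pgon M V t" by auto
  show "p \<in> (\<Union>i<M. edge_pt V i ` {0..1})"
  proof (cases "t = 1")
    case True
    hence pe: "p = edge_pt V (M - 1) 1" using pgon_vertex[OF assms, of V M] t assms by simp
    show ?thesis by (rule UN_I[of "M - 1"], use assms in simp, rule image_eqI[where x = 1], rule pe, simp)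
  next
    case False
    then obtain i s where "i < M" "0 \<le> s" "s < 1" "t = (real i + s) / real M"
      using pgon_param[of t M] t assms by auto
    thus ?thesis using pgon_edge[of s M V i] t(3) assms by (intro UN_I[of i]) auto
  qed
next
  fix p assume "p \<in> (\<Union>i<M. edge_pt V i ` {0..1})"
  then obtain i s where i: "i < M" "0 \<le> s" "s \<le> 1" "p = edge_pt V i s" by auto
  have "real i + s \<le> real M" using i by linarith
  hence "(real i + s) / real M \<in> {0..1}" using i assms by simp
  thus "p \<in> pgon M V ` {0..1}" using pgon_edge'[of s M V i] i assms by (metis image_eqI)
qed

lemma pa_pgon:
  assumes "M \<ge> 1"
  shows "pa 0 1 (pgon M V)"
proof -
  have piece: "pa (real k / M) (real (Suc k) / M) (pgon M V)" for k
  proof (rule pa_affine[of _ _ _ "V k - real k *\<^sub>R (V (Suc k) - V k)" "real M *\<^sub>R (V (Suc k) - V k)"])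
    fix t assume t: "t \<in> {real k / real M..real (Suc k) / real M}"
    define s where "s = real M * t - real k"
    have s: "0 \<le> s" "s \<le> 1" using t assms by (auto simp: s_def divide_simps mult.commute)
    have "t = (real k + s) / real M" using assms by (simp add: s_def)
    hence "pgon M V t = edge_pt V k s" using pgon_edge'[OF s assms] by simp
    also have "\<dots> = V k + (real M * t - real k) *\<^sub>R (V (Suc k) - V k)" by (simp add: edge_pt_def s_def algebra_simps)
    finally show "pgon M V t = V k - real k *\<^sub>R (V (Suc k) - V k) + t *\<^sub>R real M *\<^sub>R (V (Suc k) - V k)"
      by (simp add: algebra_simps)
  qed (simp add: divide_right_mono)
  have "pa 0 (real k / M) (pgon M V)" for k
  proof (induction k)
    case 0
    show ?case by (rule pa_affine[of _ _ _ "pgon M V 0" 0]) auto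
  next
    case (Suc k)
    thus ?case using piece[of k] by (rule pa_cat)
  qed
  from this[of M] show ?thesis using assms by simp
qed

lemma simple_polygon_path:
  assumes "simple_polygon M V"
  shows "simple_path (pgon M V)" "pgon M V 0 = pgon M V 1"
proof -
  have M: "M \<ge> 1" and cl: "V M = V 0" using assms by (auto simp: simple_polygon_def)
  show ends: "pgon M V 0 = pgon M V 1" using pgon_vertex[OF M, of V 0] pgon_vertex[OF M, of V M] M cl by simp
  have main: "x = y" if xy: "0 \<le> x" "x < 1" "0 \<le> y" "y < 1" "pgon M V x = pgon M V y" for x y
  proof -
    obtain i s where i: "i < M" "0 \<le> s" "s < 1" "x = (real i + s) / real M" by (rule pgon_param[OF xy(1,2) M])
    obtain j t where j: "j < M" "0 \<le> t" "t < 1" "y = (real j + t) / real M" by (rule pgon_param[OF xy(3,4) M])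
    have "edge_pt V i s = edge_pt V j t" using xy(5) i j M pgon_edge[of s M V i] pgon_edge[of t M V j] by simp
    hence "i = j \<and> s = t" using assms i j unfolding simple_polygon_def by blast
    thus ?thesis using i j by simp
  qed
  show "simple_path (pgon M V)"
    unfolding simple_path_def loop_free_def
  proof (intro conjI ballI impI)
    show "path (pgon M V)" using pa_continuous[OF pa_pgon[OF M]] by (simp add: path_def)
    fix x y :: real assume xy: "x \<in> {0..1}" "y \<in> {0..1}" "pgon M V x = pgon M V y"
    consider "x < 1" "y < 1" | "x = 1" "y < 1" | "x < 1" "y = 1" | "x = 1" "y = 1" using xy by force
    thus "x = y \<or> x = 0 \<and> y = 1 \<or> x = 1 \<and> y = 0"
    proof cases
      case 1
      thus ?thesis using main[of x y] xy by auto
    next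
      case 2
      have "0 = y" by (rule main) (use xy 2 ends in simp_all)
      thus ?thesis using 2 by simp
    next
      case 3
      have "x = 0" by (rule main) (use xy 3 ends in simp_all)
      thus ?thesis using 3 by simp
    qed auto
  qed
qed

lemma simple_polygon_knot:
  fixes V :: "nat => space"
  assumes "simple_polygon M V"
  shows "polygonal_knot (pgon M V)"
  using simple_polygon_path[OF assms] assms
  by (auto simp: polygonal_knot_def piecewise_affine_iff_pa simple_polygon_def pathstart_def pathfinish_def intro: pa_pgon)

definition polygon_set :: "nat => (nat => space) => space set" where
  "polygon_set M V = pgon M V ` {0..1}"

lemma pgon_interpolate:
  "mix s (pgon M V t) (pgon M V' t) = pgon M (\<lambda>i. mix s (V i) (V' i)) t"
  by (simp add: pgon_def algebra_simps)

text \<open>The form of \<open>kiso_linear\<close> used from here on: an isotopy is a linear motion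
  of the vertices, and only simplicity at each time has to be checked.\<close>

lemma kiso_polygon:
  fixes V V' :: "nat => space"
  assumes "\<And>s. 0 \<le> s ==> s \<le> 1 ==> simple_polygon M (\<lambda>i. mix s (V i) (V' i))"
  shows "kiso (polygon_set M V) (polygon_set M V')"
proof -
  have s0: "simple_polygon M V" using assms[of 0] by simp
  have s1: "simple_polygon M V'" using assms[of 1] by simp
  have M: "M \<ge> 1" using s0 by (simp add: simple_polygon_def)
  show ?thesis unfolding polygon_set_def
  proof (rule kiso_linear)
    fix s :: real assume "s \<in> {0..1}"
    hence "simple_polygon M (\<lambda>i. mix s (V i) (V' i))" by (intro assms) auto
    thus "simple_path (\<lambda>t. mix s (pgon M V t) (pgon M V' t))"
      unfolding pgon_interpolate by (rule simple_polygon_path(1))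
  next
    show "pgon M V 0 = pgon M V 1" "pgon M V' 0 = pgon M V' 1"
      by (rule simple_polygon_path(2)[OF s0], rule simple_polygon_path(2)[OF s1])
  qed (rule pa_pgon[OF M])+
qed

lemma periodic_mod:
  assumes V: "\<And>i. V (i + M) = V i"
  shows "V (i mod M) = V i" "V (Suc (i mod M)) = V (Suc i)"
proof -
  have per: "V (i + k * M) = V i" for i k
  proof (induction k)
    case (Suc k)
    have "V (i + Suc k * M) = V ((i + k * M) + M)" by (simp add: algebra_simps)
    thus ?case using Suc V by simp
  qed simp
  have modV: "V (i mod M) = V i" for i using per[of "i mod M" "i div M"] by (simp add: mult.commute)
  show "V (i mod M) = V i" by (rule modV)
  show "V (Suc (i mod M)) = V (Suc i)" using modV[of "Suc (i mod M)"] modV[of "Suc i"] by (simp add: mod_Suc_eq)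
qed

lemma mod_add_inj:
  assumes "(x + c) mod M = (y + c) mod M" "x < M" "y < (M::nat)"
  shows "x = y"
proof -
  have aux: "x = y" if "(x + c) mod M = (y + c) mod M" "x \<le> y" "y < M" for x y
  proof -
    have "M dvd (y + c) - (x + c)" using that by (subst mod_eq_dvd_iff_nat[symmetric]) auto
    hence "M dvd y - x" by simp
    thus ?thesis using that nat_dvd_not_less[of "y - x" M] by (cases "y = x") auto
  qed
  show ?thesis using aux[of x y] aux[of y x] assms by (cases "x \<le> y") auto
qed

lemma polygon_set_shift:
  assumes "\<And>i. V (i + M) = V i" "M \<ge> 1"
  shows "polygon_set M (\<lambda>i. V (i + c)) = polygon_set M V"
proof -
  have modE: "edge_pt V (i mod M) s = edge_pt V i s" for i s
    by (simp add: edge_pt_def periodic_mod[of V M, OF assms(1)])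
  have sh: "edge_pt (\<lambda>i. V (i + c)) i s = edge_pt V (i + c) s" for i s by (simp add: edge_pt_def)
  have "(\<Union>i<M. edge_pt V (i + c) ` {0..1}) = (\<Union>i<M. edge_pt V i ` {0..1})"
  proof (intro equalityI UN_least)
    fix i assume "i \<in> {..<M}"
    have "edge_pt V (i + c) = edge_pt V ((i + c) mod M)" using modE by auto
    moreover have "(i + c) mod M \<in> {..<M}" using assms(2) by simp
    ultimately show "edge_pt V (i + c) ` {0..1} \<subseteq> (\<Union>i<M. edge_pt V i ` {0..1})"
      by (metis UN_upper)
  next
    fix i assume i: "i \<in> {..<M}"
    define j where "j = (i + M - c mod M) mod M"
    have "(j + c) mod M = (i + M - c mod M + c mod M) mod M" by (simp add: j_def mod_simps)
    also have "\<dots> = i" using i assms(2) mod_less_divisor[of M c]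
      by (simp add: less_imp_le_nat trans_le_add2)
    finally have e: "edge_pt V (j + c) = edge_pt V i" using modE[of "j + c"] by auto
    have "j \<in> {..<M}" using assms(2) by (simp add: j_def)
    hence "edge_pt V (j + c) ` {0..1} \<subseteq> (\<Union>i<M. edge_pt V (i + c) ` {0..1})" by (rule UN_upper)
    thus "edge_pt V i ` {0..1} \<subseteq> (\<Union>i<M. edge_pt V (i + c) ` {0..1})" by (simp only: e)
  qed
  thus ?thesis unfolding polygon_set_def pgon_image[OF assms(2)] sh .
qed


section \<open>Fans\<close>

text \<open>A fan is a closed polygon around the axis \<open>{0} \<times> \<real>\<close> whose vertices are
  \<open>(r i *\<^sub>R U i, a i)\<close> with signed radii \<open>r i\<close>, while the direction \<open>U i\<close> turns through half
  a revolution.\<close>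

definition fan_pt :: "(nat => complex) => (nat => real) => (nat => real) => nat => space" where
  "fan_pt U r a i = (r i *\<^sub>R U i, a i)"

definition sbetween :: "real => real => real => bool" where
  "sbetween x y z \<longleftrightarrow> x < z \<and> z < y \<or> y < z \<and> z < x"

text \<open>The conditions on radii and heights alone. Consecutive radii never have opposite signs,
  so the axis is met at vertices or along whole edges, and no further strand may lie inside such an
  edge. The minus sign in the closing condition compensates for the half turn of the
  direction.\<close>

definition fan_ok :: "nat => (nat => real) => (nat => real) => bool" where
  "fan_ok M r a \<longleftrightarrow> 3 \<le> M \<and> r M = - r 0 \<and> a M = a 0 \<and>
     (\<forall>i<M. r i * r (Suc i) \<ge> 0) \<and>
     (\<forall>i<M. \<forall>j<M. i \<noteq> j --> r i = 0 --> r j = 0 --> a i \<noteq> a j) \<and>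
     (\<forall>i<M. \<forall>j<M. r i = 0 --> r (Suc i) = 0 --> r j = 0 --> \<not> sbetween (a i) (a (Suc i)) (a j))"

text \<open>The second alternative admits vertices on opposite rays of one line. This occurs when
  both neighbours of a zero are turned into its direction; \<open>fan_dirs\<close> is the strict
  version, used for all other moves.\<close>

definition fan :: "nat => (nat => complex) => (nat => real) => (nat => real) => bool" where
  "fan M U r a \<longleftrightarrow> fan_ok M r a \<and> U M = - U 0 \<and> (\<forall>i\<le>M. U i \<noteq> 0) \<and>
     (\<forall>i<M. r i \<noteq> 0 --> r (Suc i) \<noteq> 0 --> cross (U i) (U (Suc i)) > 0) \<and>
     (\<forall>i j. i < j --> j < M --> r i \<noteq> 0 --> r j \<noteq> 0 -->
        cross (U i) (U j) > 0 \<or> (\<exists>\<kappa>>0. r j *\<^sub>R U j = - (\<kappa> *\<^sub>R (r i *\<^sub>R U i))))"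

definition fan_dirs :: "nat => (nat => complex) => bool" where
  "fan_dirs M U \<longleftrightarrow> U M = - U 0 \<and> (\<forall>i\<le>M. U i \<noteq> 0) \<and> (\<forall>i j. i < j --> j < M --> cross (U i) (U j) > 0)"

lemma fan_dirs_cross:
  assumes "fan_dirs M U" "i < j" "j \<le> M" "j < M \<or> 0 < i"
  shows "cross (U i) (U j) > 0"
proof (cases "j = M")
  case True
  hence "cross (U i) (U j) = cross (U 0) (U i)"
    using assms(1) by (simp add: fan_dirs_def cross_simps cross_commute[of "U i"])
  thus ?thesis using assms True by (auto simp: fan_dirs_def)
qed (use assms in "auto simp: fan_dirs_def")

lemma fan_dirs_fan:
  assumes "fan_dirs M U" "fan_ok M r a"
  shows "fan M U r a"
proof -
  have "3 \<le> M" using assms(2) by (simp add: fan_ok_def)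
  hence "cross (U i) (U (Suc i)) > 0" if "i < M" for i
    using fan_dirs_cross[OF assms(1), of i "Suc i"] that by (cases i) auto
  thus ?thesis using assms by (auto simp: fan_def fan_dirs_def)
qed

lemma mult_less_self: "s < 1 ==> 0 < d ==> s * d < (d::real)"
  using mult_strict_right_mono[of s 1 d] by simp

lemma sbetween_affine:
  fixes x y s :: real
  assumes "x \<noteq> y" "0 < s" "s < 1"
  shows "sbetween x y (x + s * (y - x))"
proof (cases "x < y")
  case True
  hence "s * (y - x) < y - x" "0 < s * (y - x)" using assms mult_less_self[of s "y - x"] by auto
  thus ?thesis by (simp add: sbetween_def)
next
  case False
  hence "s * (x - y) < x - y" "0 < s * (x - y)" using assms mult_less_self[of s "x - y"] by auto
  thus ?thesis by (simp add: sbetween_def algebra_simps)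
qed

lemma interval_disjoint:
  fixes p q p' q' :: real
  assumes "\<not> sbetween p q p'" "\<not> sbetween p q q'" "\<not> sbetween p' q' p" "\<not> sbetween p' q' q"
    "p \<noteq> p'" "q \<noteq> q'" "\<not> (p = q' \<and> q = p')" "p \<noteq> q" "p' \<noteq> q'"
    "0 \<le> s" "s < 1" "0 \<le> t" "t < 1"
  shows "rmix s p q \<noteq> rmix t p' q'"
proof -
  define m m' where "m = rmix s p q" and "m' = rmix t p' q'"
  have m: "m = p + s * (q - p)" "m' = p' + t * (q' - p')" by (simp_all add: m_def m'_def algebra_simps)
  have mid: "(p < q --> p \<le> p + s * (q - p) \<and> p + s * (q - p) < q) \<and> (q < p --> q < p + s * (q - p) \<and> p + s * (q - p) \<le> p)"
    if "0 \<le> s" "s < 1" for p q s :: real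
  proof (intro conjI impI)
    assume "p < q"
    hence "0 \<le> s * (q - p)" "s * (q - p) < q - p" using that mult_less_self[of s "q - p"] by auto
    thus "p \<le> p + s * (q - p)" "p + s * (q - p) < q" by linarith+
  next
    assume "q < p"
    hence "0 \<le> s * (p - q)" "s * (p - q) < p - q" using that mult_less_self[of s "p - q"] by auto
    thus "q < p + s * (q - p)" "p + s * (q - p) \<le> p" by (simp_all add: algebra_simps)
  qed
  note A = mid[OF assms(10,11), of p q, folded m(1)] and B = mid[OF assms(12,13), of p' q', folded m(2)]
  have "m \<noteq> m'" using A B assms(1-9) unfolding sbetween_def by (smt (verit))
  thus ?thesis by (simp add: m_def m'_def)
qed

lemma cross_parallel: "cross u w = 0 ==> cross v w = 0 ==> w \<noteq> 0 ==> cross u v = 0"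
  using cross_basis[of u v w] cross_commute[of w v] by auto

text \<open>Off the axis an edge lies, up to sign, in the sector spanned by its end directions. If
  two edges meet there, the cross product of the common point with itself expands into nonnegative
  terms, so all of them vanish. This leaves one contributing vertex for each edge. The two are
  opposite, which is absurd, or are the same vertex, and then the heights of the other ends on the
  axis decide. On the axis only the order of heights matters.\<close>

lemma fan_simple_polygon:
  assumes F: "fan M U r a"
  shows "simple_polygon M (fan_pt U r a)"
proof -
  have ok: "fan_ok M r a" and UM: "U M = - U 0" and U0: "\<And>i. i \<le> M ==> U i \<noteq> 0"
    and cons: "\<And>i. i < M ==> r i \<noteq> 0 ==> r (Suc i) \<noteq> 0 ==> cross (U i) (U (Suc i)) > 0"
    using F unfolding fan_def by blast+
  have M: "3 \<le> M" and rM: "r M = - r 0" and aM: "a M = a 0"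
    and sgn: "\<And>i. i < M ==> r i * r (Suc i) \<ge> 0"
    and dist0: "\<And>i j. i < M ==> j < M ==> i \<noteq> j ==> r i = 0 ==> r j = 0 ==> a i \<noteq> a j"
    and betw0: "\<And>i j. i < M ==> j < M ==> r i = 0 ==> r (Suc i) = 0 ==> r j = 0 ==> \<not> sbetween (a i) (a (Suc i)) (a j)"
    using ok unfolding fan_ok_def by blast+
  define W where "W i = r i *\<^sub>R U i" for i
  have WM: "W M = W 0" by (simp add: W_def rM UM)
  have opp: "cross (U x) (U y) > 0 \<or> cross (U x) (U y) = 0 \<and> (\<exists>\<kappa>>0. W y = - (\<kappa> *\<^sub>R W x))"
    if xy: "x < y" "y \<le> M" "y < M \<or> 0 < x" "r x \<noteq> 0" "r y \<noteq> 0" for x y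
  proof -
    have base: "cross (U x) (U y) > 0 \<or> cross (U x) (U y) = 0 \<and> (\<exists>\<kappa>>0. W y = - (\<kappa> *\<^sub>R W x))"
      if xy: "x < y" "y < M" "r x \<noteq> 0" "r y \<noteq> 0" for x y
    proof -
      have "cross (U x) (U y) > 0 \<or> (\<exists>\<kappa>>0. W y = - (\<kappa> *\<^sub>R W x))"
        using F xy unfolding fan_def W_def by blast
      moreover have "cross (U x) (U y) = 0" if "W y = - (\<kappa> *\<^sub>R W x)" for \<kappa>
      proof -
        have "cross (U x) (r y *\<^sub>R U y) = cross (U x) (- (\<kappa> *\<^sub>R r x *\<^sub>R U x))" using that by (simp add: W_def)
        thus ?thesis using xy by (simp add: cross_simps)
      qed
      ultimately show ?thesis by blast
    qed
    show ?thesis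
    proof (cases "y = M")
      case True
      hence x0: "0 < x" "x < M" "r 0 \<noteq> 0" using xy rM by auto
      have c: "cross (U x) (U M) = cross (U 0) (U x)"
        unfolding UM by (simp add: cross_simps cross_commute[of "U x"])
      from base[OF x0(1,2,3)] xy(4) consider "cross (U 0) (U x) > 0"
        | \<kappa> where "cross (U 0) (U x) = 0" "\<kappa> > 0" "W x = - (\<kappa> *\<^sub>R W 0)" by blast
      thus ?thesis
      proof cases
        case (2 \<kappa>)
        hence "W M = - ((1 / \<kappa>) *\<^sub>R W x)" unfolding WM by simp
        thus ?thesis using 2 c True by (auto intro!: exI[of _ "1 / \<kappa>"])
      qed (use c True in simp)
    qed (use base xy in auto)
  qed
  have esign: "\<exists>e. (e = 1 \<or> e = -1) \<and> e * r i = \<bar>r i\<bar> \<and> e * r (Suc i) = \<bar>r (Suc i)\<bar>" if "i < M" for i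
  proof (cases "r i \<ge> 0 \<and> r (Suc i) \<ge> 0")
    case False
    hence "r i \<le> 0 \<and> r (Suc i) \<le> 0" using sgn[OF that] by (auto simp: zero_le_mult_iff)
    thus ?thesis by (intro exI[of _ "-1"]) auto
  qed (auto intro!: exI[of _ 1])
  have fst_pt: "fst (edge_pt (fan_pt U r a) i s) = mix s (W i) (W (Suc i))"
    and snd_pt: "snd (edge_pt (fan_pt U r a) i s) = rmix s (a i) (a (Suc i))" for i s
    by (simp_all add: edge_pt_def fan_pt_def W_def)
  have zero: "mix s (W i) (W (Suc i)) = 0 \<longleftrightarrow> r i = 0 \<and> (s = 0 \<or> r (Suc i) = 0)"
    if "i < M" "0 \<le> s" "s < 1" for i s
  proof
    assume z: "mix s (W i) (W (Suc i)) = 0"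
    have U: "U i \<noteq> 0" "U (Suc i) \<noteq> 0" using U0 that by auto
    show "r i = 0 \<and> (s = 0 \<or> r (Suc i) = 0)"
    proof (cases "r i = 0")
      case True
      thus ?thesis using z U by (simp add: W_def)
    next
      case ri: False
      show ?thesis
      proof (cases "r (Suc i) = 0")
        case True
        thus ?thesis using z U ri that by (simp add: W_def)
      next
        case False
        have "cross (mix s (W i) (W (Suc i))) (U (Suc i)) = 0" using z by (simp add: cross_simps)
        hence "(1 - s) * r i * cross (U i) (U (Suc i)) = 0" by (simp add: W_def cross_simps)
        thus ?thesis using cons[OF that(1) ri False] ri that by simp
      qed
    qed
  qed (auto simp: W_def)
  have same_edge: "s = t"
    if i: "i < M" and st: "0 \<le> s" "s < 1" "0 \<le> t" "t < 1" and eq: "edge_pt (fan_pt U r a) i s = edge_pt (fan_pt U r a) i t" for i s t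
  proof -
    have w: "mix s (W i) (W (Suc i)) = mix t (W i) (W (Suc i))"
      and h: "rmix s (a i) (a (Suc i)) = rmix t (a i) (a (Suc i))"
      using arg_cong[OF eq, of fst] arg_cong[OF eq, of snd] unfolding fst_pt snd_pt by auto
    have U: "U i \<noteq> 0" "U (Suc i) \<noteq> 0" using U0 i by auto
    have w': "(t - s) *\<^sub>R (W i - W (Suc i)) = 0" using w by (simp add: algebra_simps)
    have h': "(t - s) * (a i - a (Suc i)) = 0" using h by (simp add: algebra_simps)
    show ?thesis
    proof (rule ccontr)
      assume "s \<noteq> t"
      hence WW: "W i = W (Suc i)" and aa: "a i = a (Suc i)" using w' h' by auto
      have "r i = 0 \<and> r (Suc i) = 0"
      proof (cases "r i = 0 \<or> r (Suc i) = 0")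
        case True
        thus ?thesis using WW U by (auto simp: W_def)
      next
        case False
        have "cross (U i) (W i) = cross (U i) (W (Suc i))" using WW by simp
        thus ?thesis using cons[OF i] False by (simp add: W_def cross_simps)
      qed
      thus False using aa dist0[of i "Suc i"] dist0[of i 0] i M aM rM
        by (cases "Suc i = M") auto
    qed
  qed
  have diff_edge: False
    if ij: "i < j" "j < M" and st: "0 \<le> s" "s < 1" "0 \<le> t" "t < 1"
      and eq: "edge_pt (fan_pt U r a) i s = edge_pt (fan_pt U r a) j t" for i j s t
  proof -
    have w: "mix s (W i) (W (Suc i)) = mix t (W j) (W (Suc j))"
      and h: "rmix s (a i) (a (Suc i)) = rmix t (a j) (a (Suc j))"
      using arg_cong[OF eq, of fst] arg_cong[OF eq, of snd] unfolding fst_pt snd_pt by auto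
    have iM: "i < M" using ij by simp
    show False
    proof (cases "mix s (W i) (W (Suc i)) = 0")
      case True
      hence zi: "r i = 0" "s = 0 \<or> r (Suc i) = 0" using zero[OF iM st(1,2)] by auto
      have zj: "r j = 0" "t = 0 \<or> r (Suc j) = 0" using zero[OF ij(2) st(3,4)] True w by auto
      have aij: "a i \<noteq> a j" using dist0[of i j] ij zi zj by auto
      \<comment> \<open>Vertex \<open>M\<close> repeats vertex 0; \<open>m\<close> replaces it,
        because distinctness of the zeros is stated for indices below \<open>M\<close>.\<close>
      define m where "m k = (if Suc k = M then 0 else Suc k)" for k
      have m: "m k < M" "a (Suc k) = a (m k)" "r (Suc k) = 0 \<longleftrightarrow> r (m k) = 0" if "k < M" for k
        using that M aM rM by (auto simp: m_def)
      have mk: "m i \<noteq> m j" "m i = j ==> m j \<noteq> i" "m i \<noteq> i" "m j \<noteq> j"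
        using ij M by (auto simp: m_def split: if_splits)
      have d1: "a (Suc i) \<noteq> a (Suc j)" if "r (Suc i) = 0" "r (Suc j) = 0"
        using dist0[of "m i" "m j"] m[OF iM] m[OF ij(2)] mk that by auto
      have d2: "a (Suc i) \<noteq> a i" if "r (Suc i) = 0" using dist0[of "m i" i] m[OF iM] mk that iM zi by auto
      have d3: "a (Suc j) \<noteq> a j" if "r (Suc j) = 0" using dist0[of "m j" j] m[OF ij(2)] mk that ij zj by auto
      have d4: "a (Suc i) = a j ==> m i = j" if "r (Suc i) = 0" using dist0[of "m i" j] m[OF iM] that ij zj by auto
      have d5: "a (Suc j) = a i ==> m j = i" if "r (Suc j) = 0" using dist0[of "m j" i] m[OF ij(2)] that ij zi by auto
      have b: "\<not> sbetween (a i) (a (Suc i)) (a k)" if "r (Suc i) = 0" "k < M" "r k = 0" for k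
        using betw0[OF iM that(2) zi(1)] that by auto
      have b': "\<not> sbetween (a j) (a (Suc j)) (a k)" if "r (Suc j) = 0" "k < M" "r k = 0" for k
        using betw0[OF ij(2) that(2) zj(1)] that by auto
      consider "s = 0" "t = 0" | "s = 0" "t \<noteq> 0" | "s \<noteq> 0" "t = 0" | "s \<noteq> 0" "t \<noteq> 0" by blast
      thus False
      proof cases
        case 1
        thus ?thesis using h aij by simp
      next
        case 2
        hence t: "0 < t" "t < 1" and r: "r (Suc j) = 0" using st zj by auto
        have ai: "a i = a j + t * (a (Suc j) - a j)" using h 2 by (simp add: algebra_simps)
        have "sbetween (a j) (a (Suc j)) (a i)"
          unfolding ai by (rule sbetween_affine) (use d3[OF r] t in auto)
        thus ?thesis using b'[OF r iM zi(1)] by blast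
      next
        case 3
        hence t: "0 < s" "s < 1" and r: "r (Suc i) = 0" using st zi by auto
        have ai: "a j = a i + s * (a (Suc i) - a i)" using h 3 by (simp add: algebra_simps)
        have "sbetween (a i) (a (Suc i)) (a j)"
          unfolding ai by (rule sbetween_affine) (use d2[OF r] t in auto)
        thus ?thesis using b[OF r ij(2) zj(1)] by blast
      next
        case 4
        hence ri: "r (Suc i) = 0" and rj: "r (Suc j) = 0" using zi zj by auto
        have "rmix s (a i) (a (Suc i)) \<noteq> rmix t (a j) (a (Suc j))"
        proof (rule interval_disjoint)
          show "\<not> sbetween (a i) (a (Suc i)) (a j)" by (rule b[OF ri ij(2) zj(1)])
          show "\<not> sbetween (a i) (a (Suc i)) (a (Suc j))"
            using b[OF ri m(1)[OF ij(2)]] m[OF ij(2)] rj by auto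
          show "\<not> sbetween (a j) (a (Suc j)) (a i)" by (rule b'[OF rj iM zi(1)])
          show "\<not> sbetween (a j) (a (Suc j)) (a (Suc i))"
            using b'[OF rj m(1)[OF iM]] m[OF iM] ri by auto
          show "\<not> (a i = a (Suc j) \<and> a (Suc i) = a j)" using d4[OF ri] d5[OF rj] mk by auto
        qed (use aij d1[OF ri rj] d2[OF ri] d3[OF rj] st in auto)
        thus ?thesis using h by blast
      qed
    next
      case False
      obtain e where e: "e = 1 \<or> e = -1" "e * r i = \<bar>r i\<bar>" "e * r (Suc i) = \<bar>r (Suc i)\<bar>" using esign[OF iM] by blast
      obtain e' where e': "e' = 1 \<or> e' = -1" "e' * r j = \<bar>r j\<bar>" "e' * r (Suc j) = \<bar>r (Suc j)\<bar>" using esign[OF ij(2)] by blast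
      \<comment> \<open>The weights of the four end vertices in the two representations of the
        common point; the sign of each edge is absorbed into \<open>e\<close> and
        \<open>e'\<close>.\<close>
      define A B A' B' where "A = (1 - s) * \<bar>r i\<bar>" and "B = s * \<bar>r (Suc i)\<bar>"
        and "A' = (1 - t) * \<bar>r j\<bar>" and "B' = t * \<bar>r (Suc j)\<bar>"
      have nn: "A \<ge> 0" "B \<ge> 0" "A' \<ge> 0" "B' \<ge> 0" using st by (auto simp: A_def B_def A'_def B'_def)
      have ew: "e *\<^sub>R (mix s (W i) (W (Suc i))) = A *\<^sub>R U i + B *\<^sub>R U (Suc i)"
        unfolding W_def A_def B_def e(2,3)[symmetric] by (simp add: scaleR_add_right mult.left_commute mult.assoc)
      have ew': "e' *\<^sub>R (mix t (W j) (W (Suc j))) = A' *\<^sub>R U j + B' *\<^sub>R U (Suc j)"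
        unfolding W_def A'_def B'_def e'(2,3)[symmetric] by (simp add: scaleR_add_right mult.left_commute mult.assoc)
      have "cross (A *\<^sub>R U i + B *\<^sub>R U (Suc i)) (A' *\<^sub>R U j + B' *\<^sub>R U (Suc j)) = 0"
        unfolding ew[symmetric] ew'[symmetric] w
        by (simp only: cross_scaleR_left cross_scaleR_right cross_self mult_zero_right)
      hence sum0: "A * A' * cross (U i) (U j) + A * B' * cross (U i) (U (Suc j))
          + B * A' * cross (U (Suc i)) (U j) + B * B' * cross (U (Suc i)) (U (Suc j)) = 0"
        by (simp add: cross_simps algebra_simps)
      have rA: "A \<noteq> 0 ==> r i \<noteq> 0" "B \<noteq> 0 ==> r (Suc i) \<noteq> 0" "A' \<noteq> 0 ==> r j \<noteq> 0" "B' \<noteq> 0 ==> r (Suc j) \<noteq> 0"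
        by (auto simp: A_def B_def A'_def B'_def)
      have c1: "A * A' \<noteq> 0 ==> cross (U i) (U j) > 0 \<or> cross (U i) (U j) = 0 \<and> (\<exists>\<kappa>>0. W j = - (\<kappa> *\<^sub>R W i))"
        using opp[of i j] ij rA by auto
      have c2: "A * B' \<noteq> 0 ==> \<not> (i = 0 \<and> Suc j = M) ==>
          cross (U i) (U (Suc j)) > 0 \<or> cross (U i) (U (Suc j)) = 0 \<and> (\<exists>\<kappa>>0. W (Suc j) = - (\<kappa> *\<^sub>R W i))"
        using opp[of i "Suc j"] ij rA by auto
      have c2': "i = 0 ==> Suc j = M ==> cross (U i) (U (Suc j)) = 0" using UM by (auto simp: cross_simps)
      have c3: "B * A' \<noteq> 0 ==> Suc i \<noteq> j ==>
          cross (U (Suc i)) (U j) > 0 \<or> cross (U (Suc i)) (U j) = 0 \<and> (\<exists>\<kappa>>0. W j = - (\<kappa> *\<^sub>R W (Suc i)))"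
        using opp[of "Suc i" j] ij rA by auto
      have c3': "Suc i = j ==> cross (U (Suc i)) (U j) = 0" by (auto simp: cross_simps)
      have c4: "B * B' \<noteq> 0 ==>
          cross (U (Suc i)) (U (Suc j)) > 0 \<or> cross (U (Suc i)) (U (Suc j)) = 0 \<and> (\<exists>\<kappa>>0. W (Suc j) = - (\<kappa> *\<^sub>R W (Suc i)))"
        using opp[of "Suc i" "Suc j"] ij rA by auto
      have ge: "A * A' * cross (U i) (U j) \<ge> 0" "A * B' * cross (U i) (U (Suc j)) \<ge> 0"
          "B * A' * cross (U (Suc i)) (U j) \<ge> 0" "B * B' * cross (U (Suc i)) (U (Suc j)) \<ge> 0"
      proof -
        have nnc: "x * c \<ge> 0" if "x \<ge> 0" "x \<noteq> 0 ==> c \<ge> 0" for x c :: real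
          using that by (cases "x = 0") auto
        show "A * A' * cross (U i) (U j) \<ge> 0"
          by (rule nnc) (use nn in simp, use c1 in linarith)
        show "A * B' * cross (U i) (U (Suc j)) \<ge> 0"
          by (rule nnc) (use nn in simp, use c2 c2' in linarith)
        show "B * A' * cross (U (Suc i)) (U j) \<ge> 0"
          by (rule nnc) (use nn in simp, use c3 c3' in linarith)
        show "B * B' * cross (U (Suc i)) (U (Suc j)) \<ge> 0"
          by (rule nnc) (use nn in simp, use c4 in linarith)
      qed
      have eq0: "A * A' * cross (U i) (U j) = 0" "A * B' * cross (U i) (U (Suc j)) = 0"
          "B * A' * cross (U (Suc i)) (U j) = 0" "B * B' * cross (U (Suc i)) (U (Suc j)) = 0"
        using sum0 ge by linarith+
      have opp1: "A * A' \<noteq> 0 ==> \<exists>\<kappa>>0. W j = - (\<kappa> *\<^sub>R W i)" using c1 eq0(1) by force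
      have opp2: "A * B' \<noteq> 0 ==> \<not> (i = 0 \<and> Suc j = M) ==> \<exists>\<kappa>>0. W (Suc j) = - (\<kappa> *\<^sub>R W i)" using c2 eq0(2) by force
      have opp3: "B * A' \<noteq> 0 ==> Suc i \<noteq> j ==> \<exists>\<kappa>>0. W j = - (\<kappa> *\<^sub>R W (Suc i))" using c3 eq0(3) by force
      have opp4: "B * B' \<noteq> 0 ==> \<exists>\<kappa>>0. W (Suc j) = - (\<kappa> *\<^sub>R W (Suc i))" using c4 eq0(4) by force
      have AB: "A \<noteq> 0 \<or> B \<noteq> 0" and AB': "A' \<noteq> 0 \<or> B' \<noteq> 0"
      proof -
        have "A *\<^sub>R U i + B *\<^sub>R U (Suc i) \<noteq> 0" unfolding ew[symmetric] using False e by auto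
        thus "A \<noteq> 0 \<or> B \<noteq> 0" by auto
        have "A' *\<^sub>R U j + B' *\<^sub>R U (Suc j) \<noteq> 0" unfolding ew'[symmetric] using False w e' by auto
        thus "A' \<noteq> 0 \<or> B' \<noteq> 0" by auto
      qed
      have contra: False if "W y = - (\<kappa> *\<^sub>R W x)" "\<kappa> > 0" "c > 0" "c' > 0"
        "mix s (W i) (W (Suc i)) = c *\<^sub>R W x" "mix t (W j) (W (Suc j)) = c' *\<^sub>R W y" for x y c c' \<kappa>
      proof -
        have "c *\<^sub>R W x = c' *\<^sub>R W y" using that(5,6) w by simp
        hence "(c + c' * \<kappa>) *\<^sub>R W x = 0" unfolding that(1) by (simp add: algebra_simps)
        moreover have "c + c' * \<kappa> > 0" using that by (simp add: add_pos_pos)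
        ultimately have "W x = 0" by simp
        thus False using that(5) False by simp
      qed
      have wA: "B = 0 ==> mix s (W i) (W (Suc i)) = (1 - s) *\<^sub>R W i" by (auto simp: B_def W_def)
      have wB: "A = 0 ==> mix s (W i) (W (Suc i)) = s *\<^sub>R W (Suc i)" by (auto simp: A_def W_def)
      have wA': "B' = 0 ==> mix t (W j) (W (Suc j)) = (1 - t) *\<^sub>R W j" by (auto simp: B'_def W_def)
      have wB': "A' = 0 ==> mix t (W j) (W (Suc j)) = t *\<^sub>R W (Suc j)" by (auto simp: A'_def W_def)
      have Wm: "i = 0 ==> Suc j = M ==> W (Suc j) = W i" using WM by simp
      have pos: "A \<noteq> 0 ==> 1 - s > 0" "B \<noteq> 0 ==> s > 0" "A' \<noteq> 0 ==> 1 - t > 0" "B' \<noteq> 0 ==> t > 0"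
        using st by (auto simp: B_def B'_def order_less_le)
      have Unz: "U i \<noteq> 0" "U (Suc i) \<noteq> 0" "U j \<noteq> 0" "U (Suc j) \<noteq> 0" using U0 ij by auto
      text \<open>Neither edge can contribute both of its ends: otherwise two consecutive
        nonzero vertices would be collinear with the axis.\<close>
      have notAB: "A = 0 \<or> B = 0"
      proof (rule ccontr)
        assume "\<not> (A = 0 \<or> B = 0)"
        hence "cross (U i) (U (Suc i)) = 0"
          using AB' eq0 cross_parallel[of "U i" "U j" "U (Suc i)"] cross_parallel[of "U i" "U (Suc j)" "U (Suc i)"] Unz by auto
        thus False using cons[OF iM] rA \<open>\<not> (A = 0 \<or> B = 0)\<close> by auto
      qed
      have notAB': "A' = 0 \<or> B' = 0"
      proof (rule ccontr)
        assume "\<not> (A' = 0 \<or> B' = 0)"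
        hence "cross (U j) (U (Suc j)) = 0"
          using AB eq0 cross_parallel[of "U j" "U i" "U (Suc j)"] cross_parallel[of "U j" "U (Suc i)" "U (Suc j)"] Unz
          by (auto simp: cross_commute[of "U j"] cross_commute[of "U (Suc j)" "U i"] cross_commute[of "U (Suc j)" "U (Suc i)"])
        thus False using cons[OF ij(2)] rA \<open>\<not> (A' = 0 \<or> B' = 0)\<close> by auto
      qed
      consider "A \<noteq> 0" "B = 0" "A' \<noteq> 0" "B' = 0" | "A \<noteq> 0" "B = 0" "A' = 0" "B' \<noteq> 0"
        | "A = 0" "B \<noteq> 0" "A' \<noteq> 0" "B' = 0" | "A = 0" "B \<noteq> 0" "A' = 0" "B' \<noteq> 0"
        using AB AB' notAB notAB' by blast
      thus False
      proof cases
        case 1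
        then obtain \<kappa> where "\<kappa> > 0" "W j = - (\<kappa> *\<^sub>R W i)" using opp1 by auto
        thus ?thesis using contra[of j \<kappa> i "1 - s" "1 - t"] wA wA' pos 1 by auto
      next
        case 2
        show ?thesis
        proof (cases "i = 0 \<and> Suc j = M")
          case False
          then obtain \<kappa> where "\<kappa> > 0" "W (Suc j) = - (\<kappa> *\<^sub>R W i)" using opp2 2 by auto
          thus ?thesis using contra[of "Suc j" \<kappa> i "1 - s" t] wA wB' pos 2 by auto
        next
          \<comment> \<open>First and last edge share vertex 0. Equality of the points forces
            \<open>1 - s = t\<close>, so both edges run to the axis, and their other ends would be
            zeros of equal height.\<close>
          case True
          hence "(1 - s) *\<^sub>R W i = t *\<^sub>R W i" using w wA wB' 2 Wm by simp
          moreover have "W i \<noteq> 0" using rA(1) 2 U0[of i] iM by (auto simp: W_def)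
          ultimately have st1: "1 - s = t" by simp
          hence "s > 0" using st by simp
          hence r1: "r (Suc i) = 0" using 2 by (simp add: B_def)
          have r2: "r j = 0" using 2 st by (simp add: A'_def)
          have "a (Suc i) \<noteq> a j" using dist0[of "Suc i" j] r1 r2 True M ij by auto
          moreover have "s * a (Suc i) = s * a j"
          proof -
            have st2: "1 - t = s" using st1 by simp
            have "t * a i + s * a (Suc i) = s * a j + t * a (Suc j)" using h unfolding st1 st2 .
            thus ?thesis using True aM by simp
          qed
          ultimately show False using \<open>s > 0\<close> by simp
        qed
      next
        case 3
        show ?thesis
        proof (cases "Suc i = j")
          case False
          then obtain \<kappa> where "\<kappa> > 0" "W j = - (\<kappa> *\<^sub>R W (Suc i))" using opp3 3 by auto
          thus ?thesis using contra[of j \<kappa> "Suc i" s "1 - t"] wB wA' pos 3 by auto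
        next
          case True
          have "s *\<^sub>R W (Suc i) = (1 - t) *\<^sub>R W j" using w wB[OF 3(1)] wA'[OF 3(4)] by metis
          hence "s *\<^sub>R W j = (1 - t) *\<^sub>R W j" using True by simp
          moreover have "W j \<noteq> 0" using rA(3) 3 U0[of j] ij by (auto simp: W_def)
          ultimately have st1: "s = 1 - t" by simp
          hence "t > 0" using st by simp
          hence r2: "r (Suc j) = 0" using 3 by (simp add: B'_def)
          have r1: "r i = 0" using 3 st by (simp add: A_def)
          have "a i \<noteq> a (Suc j)"
            using dist0[of i "Suc j"] dist0[of i 0] r1 r2 True M ij aM rM by (cases "Suc j = M") auto
          moreover have "t * a i + s * a j = s * a j + t * a (Suc j)"
          proof -
            have st2: "1 - s = t" using st1 by simp
            show ?thesis using h unfolding st2 st1[symmetric] using True by simp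
          qed
          ultimately show False using \<open>t > 0\<close> by simp
        qed
      next
        case 4
        then obtain \<kappa> where "\<kappa> > 0" "W (Suc j) = - (\<kappa> *\<^sub>R W (Suc i))" using opp4 by auto
        thus ?thesis using contra[of "Suc j" \<kappa> "Suc i" s t] wB wB' pos 4 by auto
      qed
    qed
  qed
  show ?thesis
    unfolding simple_polygon_def
  proof (intro conjI allI impI)
    show "1 \<le> M" using M by simp
    show "fan_pt U r a M = fan_pt U r a 0" using WM aM by (simp add: fan_pt_def W_def)
    fix i j s t assume *: "i < M" "j < M" "0 \<le> s" "s < (1::real)" "0 \<le> t" "t < (1::real)"
      "edge_pt (fan_pt U r a) i s = edge_pt (fan_pt U r a) j t"
    consider "i < j" | "j < i" | "i = j" by linarith
    hence ij: "i = j"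
      by cases (use diff_edge[of i j s t] diff_edge[of j i t s] * in auto)
    thus "i = j" .
    show "s = t" using same_edge[of i s t] * ij by auto
  qed
qed


section \<open>Elementary moves of fans\<close>

definition fiso :: "nat => (nat => complex) => (nat => real) => (nat => real) => (nat => real) => (nat => real) => bool" where
  "fiso M U r a r' a' \<longleftrightarrow> kiso (polygon_set M (fan_pt U r a)) (polygon_set M (fan_pt U r' a'))"

lemma fan_okD:
  assumes "fan_ok M r a"
  shows "3 \<le> M" "r M = - r 0" "a M = a 0" "\<And>i. i < M ==> r i * r (Suc i) \<ge> 0"
    "\<And>i j. i < M ==> j < M ==> i \<noteq> j ==> r i = 0 ==> r j = 0 ==> a i \<noteq> a j"
    "\<And>i j. i < M ==> j < M ==> r i = 0 ==> r (Suc i) = 0 ==> r j = 0 ==> \<not> sbetween (a i) (a (Suc i)) (a j)"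
  using assms unfolding fan_ok_def by blast+

lemma fiso_trans: "fiso M U r a r' a' ==> fiso M U r' a' r'' a'' ==> fiso M U r a r'' a''"
  unfolding fiso_def by (rule kiso_trans)

lemma fiso_sym: "fiso M U r a r' a' ==> fiso M U r' a' r a"
  unfolding fiso_def by (rule kiso_sym)

lemma interpolate_zero:
  fixes x y s :: real
  assumes "x * y \<ge> 0" "rmix s x y = 0" "0 < s" "s < 1"
  shows "x = 0 \<and> y = 0"
proof -
  consider "x \<ge> 0 \<and> y \<ge> 0" | "x \<le> 0 \<and> y \<le> 0" using assms(1) by (auto simp: zero_le_mult_iff)
  thus ?thesis
  proof cases
    case 1
    hence "(1 - s) * x \<ge> 0" "s * y \<ge> 0" using assms by auto
    hence "(1 - s) * x = 0" "s * y = 0" using assms(2) by linarith+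
    thus ?thesis using assms by auto
  next
    case 2
    hence "(1 - s) * x \<le> 0" "s * y \<le> 0" using assms by (auto simp: mult_le_0_iff)
    hence "(1 - s) * x = 0" "s * y = 0" using assms(2) by linarith+
    thus ?thesis using assms by auto
  qed
qed

lemma interpolate_less:
  fixes x y x' y' s :: real
  assumes "x < y" "x' < y'" "0 \<le> s" "s \<le> 1"
  shows "rmix s x x' < rmix s y y'"
proof (cases "s = 0")
  case False
  have "(1 - s) * x \<le> (1 - s) * y" using assms by (intro mult_left_mono) auto
  moreover have "s * x' < s * y'" using assms False by simp
  ultimately show ?thesis by linarith
qed (use assms in simp)

text \<open>The linear homotopy between two fans with compatible signs is a fan at all times: what has
  to be checked are the heights of the common zeros only.\<close>

lemma fan_radial:
  assumes U: "fan_dirs M U" and ok: "fan_ok M r a" and ok': "fan_ok M r' a'"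
    and h1: "\<And>i. i < M ==> r i * r' i \<ge> 0"
    and h2: "\<And>i. i < M ==> r i * r' (Suc i) \<ge> 0" "\<And>i. i < M ==> r' i * r (Suc i) \<ge> 0"
    and h3: "\<And>i j. i < M ==> j < M ==> r i = 0 ==> r' i = 0 ==> r j = 0 ==> r' j = 0 ==> a i < a j ==> a' i < a' j"
  shows "fiso M U r a r' a'"
proof -
  note M = fan_okD(1)[OF ok] and rM = fan_okD(2)[OF ok] fan_okD(2)[OF ok'] and aM = fan_okD(3)[OF ok] fan_okD(3)[OF ok']
    and sgn = fan_okD(4)[OF ok] fan_okD(4)[OF ok'] and dist = fan_okD(5)[OF ok] and betw = fan_okD(6)[OF ok]
  define m where "m k = (if k = M then 0 else k)" for k
  have m: "m k < M" "a (m k) = a k" "a' (m k) = a' k" "r (m k) = 0 \<longleftrightarrow> r k = 0" "r' (m k) = 0 \<longleftrightarrow> r' k = 0" if "k \<le> M" for k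
    using that M aM rM by (auto simp: m_def)
  have h3': "a' i < a' j" if "i \<le> M" "j \<le> M" "r i = 0" "r' i = 0" "r j = 0" "r' j = 0" "a i < a j" for i j
    using h3[of "m i" "m j"] m that by auto
  have step: "fan_ok M (\<lambda>i. rmix s (r i) (r' i)) (\<lambda>i. rmix s (a i) (a' i))" if s: "0 < s" "s < 1" for s
  proof -
    define R A where "R i = rmix s (r i) (r' i)" and "A i = rmix s (a i) (a' i)" for i
    have RM: "R M = - R 0" by (simp add: R_def rM algebra_simps)
    have R0: "r k = 0 \<and> r' k = 0" if "k \<le> M" "R k = 0" for k
    proof -
      have "R (m k) = 0" using that RM by (auto simp: m_def)
      hence "r (m k) = 0 \<and> r' (m k) = 0"
        using interpolate_zero[OF h1[OF m(1)[OF that(1)]] _ s] by (simp add: R_def)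
      thus ?thesis using m[OF that(1)] by simp
    qed
    have less: "A i < A j" if "i \<le> M" "j \<le> M" "R i = 0" "R j = 0" "a i < a j" for i j
      unfolding A_def using h3'[of i j] R0 that s by (intro interpolate_less) auto
    have less_iff: "A i < A j \<longleftrightarrow> a i < a j" if "i \<le> M" "j \<le> M" "R i = 0" "R j = 0" for i j
    proof -
      have z: "r i = 0" "r j = 0" using R0 that by auto
      consider "a i < a j" | "a j < a i" | "a i = a j" by linarith
      thus ?thesis
      proof cases
        case 3
        hence "m i = m j" using dist[of "m i" "m j"] m that z by auto
        hence "A i = A j" using m(2,3)[OF that(1)] m(2,3)[OF that(2)] by (simp add: A_def)
        thus ?thesis using 3 by simp
      qed (use less[of i j] less[of j i] that in auto)
    qed
    have "fan_ok M R A"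
      unfolding fan_ok_def
    proof (intro conjI allI impI)
      fix i assume i: "i < M"
      have "R i * R (Suc i) = (1 - s) * (1 - s) * (r i * r (Suc i)) + (1 - s) * s * (r i * r' (Suc i))
          + s * (1 - s) * (r' i * r (Suc i)) + s * s * (r' i * r' (Suc i))"
        by (simp add: R_def algebra_simps)
      also have "\<dots> \<ge> 0" using sgn[OF i] h2[OF i] s
        by (intro add_nonneg_nonneg mult_nonneg_nonneg[of "_ * _"]) auto
      finally show "R i * R (Suc i) \<ge> 0" .
    next
      fix i j assume ij: "i < M" "j < M" "i \<noteq> j" "R i = 0" "R j = 0"
      hence "a i \<noteq> a j" using dist[of i j] R0[of i] R0[of j] by auto
      thus "A i \<noteq> A j" using less[of i j] less[of j i] ij by (cases "a i < a j") auto
    next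
      fix i j assume ij: "i < M" "j < M" "R i = 0" "R (Suc i) = 0" "R j = 0"
      hence "\<not> sbetween (a i) (a (Suc i)) (a j)" using betw[of i j] R0[of i] R0[of "Suc i"] R0[of j] by auto
      thus "\<not> sbetween (A i) (A (Suc i)) (A j)"
        unfolding sbetween_def using less_iff[of i j] less_iff[of j i] less_iff[of "Suc i" j] less_iff[of j "Suc i"] ij by simp
    qed (use M RM aM in "simp_all add: A_def")
    thus ?thesis by (simp add: R_def[abs_def] A_def[abs_def])
  qed
  show ?thesis unfolding fiso_def
  proof (rule kiso_polygon)
    fix s :: real assume s: "0 \<le> s" "s \<le> 1"
    have eq: "(\<lambda>i. mix s (fan_pt U r a i) (fan_pt U r' a' i)) =
      fan_pt U (\<lambda>i. rmix s (r i) (r' i)) (\<lambda>i. rmix s (a i) (a' i))"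
      by (rule ext) (simp add: fan_pt_def algebra_simps)
    have "fan_ok M (\<lambda>i. rmix s (r i) (r' i)) (\<lambda>i. rmix s (a i) (a' i))"
    proof -
      consider "s = 0" | "s = 1" | "0 < s" "s < 1" using s by linarith
      thus ?thesis by cases (use ok ok' step in auto)
    qed
    thus "simple_polygon M (\<lambda>i. mix s (fan_pt U r a i) (fan_pt U r' a' i))"
      unfolding eq by (intro fan_simple_polygon fan_dirs_fan[OF U])
  qed
qed

lemma fiso_refl: "fan_dirs M U ==> fan_ok M r a ==> fiso M U r a r a"
  by (rule fan_radial) (auto simp: fan_ok_def)

text \<open>Only zeros change, so the push removes conditions on heights and adds none; the sign
  condition sends each vertex to the side of its neighbours.\<close>

lemma fan_push:
  assumes U: "fan_dirs M U" and ok: "fan_ok M r a"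
    and r': "\<And>i. i \<le> M ==> r i \<noteq> 0 ==> r' i = r i" "r' M = - r' 0" "\<And>i. i < M ==> r' i * r' (Suc i) \<ge> 0"
  shows "fan_ok M r' a \<and> fiso M U r a r' a"
proof -
  have z: "r i = 0" if "r' i = 0" "i \<le> M" for i using r'(1)[of i] that by auto
  have ok': "fan_ok M r' a"
    unfolding fan_ok_def
  proof (intro conjI allI impI)
    show "3 \<le> M" "r' M = - r' 0" "a M = a 0" using fan_okD(1,3)[OF ok] r'(2) by auto
    show "r' i * r' (Suc i) \<ge> 0" if "i < M" for i by (rule r'(3)[OF that])
    show "a i \<noteq> a j" if "i < M" "j < M" "i \<noteq> j" "r' i = 0" "r' j = 0" for i j
      by (rule fan_okD(5)[OF ok]) (use that z in auto)
    show "\<not> sbetween (a i) (a (Suc i)) (a j)" if "i < M" "j < M" "r' i = 0" "r' (Suc i) = 0" "r' j = 0" for i j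
      by (rule fan_okD(6)[OF ok]) (use that z in auto)
  qed
  moreover have "fiso M U r a r' a"
  proof (rule fan_radial[OF U ok ok'])
    fix i assume i: "i < M"
    show "r i * r' i \<ge> 0" using r'(1)[of i] i by (cases "r i = 0") auto
    show "r i * r' (Suc i) \<ge> 0" using r'(1)[of i] r'(3)[OF i] i by (cases "r i = 0") auto
    show "r' i * r (Suc i) \<ge> 0" using r'(1)[of "Suc i"] r'(3)[OF i] i by (cases "r (Suc i) = 0") auto
  qed
  ultimately show ?thesis by blast
qed

definition block_heights :: "(nat => real) => nat => nat => nat => real" where
  "block_heights a i j l = (if i < l \<and> l < j then a i + (real l - real i) / (real j - real i) * (a j - a i) else a l)"

text \<open>The block is first pulled flat onto the axis, as \<open>r1\<close>, with heights
  interpolated between those of its ends, and then pushed out on the other side. By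
  \<open>adj\<close> no other strand is in the way.\<close>

lemma fan_flip:
  assumes U: "fan_dirs M U" and ok: "fan_ok M r a"
    and ij: "i < j" "Suc j < M" "r i = 0" "r j = 0"
    and nz: "\<And>l. i < l ==> l < j ==> r l \<noteq> 0"
    and adj: "\<And>l. l < M ==> r l = 0 ==> \<not> sbetween (a i) (a j) (a l)"
  defines "r' \<equiv> \<lambda>l. if i < l \<and> l < j then - r l else r l"
  defines "a' \<equiv> block_heights a i j"
  shows "fan_ok M r' a'" "fiso M U r a r' a'"
proof -
  note M = fan_okD(1)[OF ok] and rM = fan_okD(2)[OF ok] and aM = fan_okD(3)[OF ok]
    and sgn = fan_okD(4)[OF ok] and dist = fan_okD(5)[OF ok] and betw = fan_okD(6)[OF ok]
  have aij: "a i \<noteq> a j" using dist[of i j] ij by auto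
  define f where "f l = a i + (real l - real i) / (real j - real i) * (a j - a i)" for l
  have fi: "f i = a i" and fj: "f j = a j" using ij by (auto simp: f_def)
  have a'f: "a' l = f l" if "i \<le> l" "l \<le> j" for l
    using that fi fj by (auto simp: a'_def block_heights_def f_def)
  have a'o: "a' l = a l" if "\<not> (i < l \<and> l < j)" for l using that by (auto simp: a'_def block_heights_def)
  have fmono: "sbetween (f l1) (f l3) (f l2)" if "l1 < l2" "l2 < l3" for l1 l2 l3
  proof -
    have d: "real j - real i > 0" using ij by simp
    have diff: "f x - f y = (real x - real y) / (real j - real i) * (a j - a i)" for x y
      by (simp add: f_def diff_divide_distrib[symmetric] algebra_simps)
    consider "a j - a i > 0" | "a j - a i < 0" using aij by linarith
    thus ?thesis
    proof cases
      case 1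
      have "f l2 - f l1 > 0" "f l3 - f l2 > 0" unfolding diff using that d 1 by simp_all
      thus ?thesis by (simp add: sbetween_def)
    next
      case 2
      have "f l2 - f l1 < 0" "f l3 - f l2 < 0" unfolding diff using that d 2
        by (simp_all add: mult_pos_neg divide_neg_pos)
      thus ?thesis by (simp add: sbetween_def)
    qed
  qed
  have finj: "f l \<noteq> f l'" if ll: "l \<noteq> l'" for l l'
    using fmono[of l l' "Suc l'"] fmono[of l' l "Suc l"] ll
    by (cases l l' rule: linorder_cases) (auto simp: sbetween_def)
  define r1 where "r1 l = (if i < l \<and> l < j then 0 else r l)" for l
  have inside: "sbetween (a i) (a j) (a' l)" if "i < l" "l < j" for l
    using fmono[OF that] a'f[of l] that by (simp add: fi fj)
  have r1z: "i < l \<and> l < j \<or> r l = 0 \<and> \<not> (i < l \<and> l < j)" if "r1 l = 0" for l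
    using that by (auto simp: r1_def split: if_splits)
  have ok1: "fan_ok M r1 a'"
    unfolding fan_ok_def
  proof (intro conjI allI impI)
    show "r1 M = - r1 0" "a' M = a' 0" using rM aM ij by (auto simp: r1_def a'o)
    show "r1 k * r1 (Suc k) \<ge> 0" if "k < M" for k using sgn[OF that] by (auto simp: r1_def)
  next
    fix k l assume kl: "k < M" "l < M" "k \<noteq> l" "r1 k = 0" "r1 l = 0"
    have two: "a' k \<noteq> a' l" if "i < k" "k < j" "r l = 0" "\<not> (i < l \<and> l < j)" "l < M" for k l
      using inside[OF that(1,2)] adj[OF that(5,3)] a'o[OF that(4)] by auto
    consider "i < k \<and> k < j" "i < l \<and> l < j" | "i < k \<and> k < j" "r l = 0" "\<not> (i < l \<and> l < j)"
      | "i < l \<and> l < j" "r k = 0" "\<not> (i < k \<and> k < j)" | "r k = 0" "\<not> (i < k \<and> k < j)" "r l = 0" "\<not> (i < l \<and> l < j)"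
      using r1z[OF kl(4)] r1z[OF kl(5)] by blast
    thus "a' k \<noteq> a' l"
    proof cases
      case 1
      thus ?thesis using finj[OF kl(3)] a'f by simp
    next
      case 2
      thus ?thesis using two[of k l] kl by auto
    next
      case 3
      thus ?thesis using two[of l k] kl by auto
    next
      case 4
      thus ?thesis using dist[OF kl(1-3)] a'o by auto
    qed
  next
    fix k l assume kl: "k < M" "l < M" "r1 k = 0" "r1 (Suc k) = 0" "r1 l = 0"
    show "\<not> sbetween (a' k) (a' (Suc k)) (a' l)"
    proof (cases "i \<le> k \<and> k < j")
      case True
      hence ak: "a' k = f k" "a' (Suc k) = f (Suc k)" using a'f by auto
      show ?thesis
      proof (cases "i \<le> l \<and> l \<le> j")
        case T2: True
        hence al: "a' l = f l" using a'f by auto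
        consider "l < k" | "l = k" | "l = Suc k" | "Suc k < l" by linarith
        thus ?thesis
          by cases (use fmono[of l k "Suc k"] fmono[of k "Suc k" l] ak al in "auto simp: sbetween_def")
      next
        case False
        hence "r l = 0" using r1z[OF kl(5)] by auto
        hence nb: "\<not> sbetween (f i) (f j) (a' l)" using adj[OF kl(2)] a'o[of l] False fi fj by auto
        have "k = i \<or> sbetween (f i) (f j) (f k)" "Suc k = j \<or> sbetween (f i) (f j) (f (Suc k))"
          using fmono[of i k j] fmono[of i "Suc k" j] True by (cases "k = i", auto, cases "Suc k = j", auto)
        thus ?thesis using nb unfolding ak sbetween_def by auto
      qed
    next
      case False
      hence k: "\<not> (i < k \<and> k < j)" "\<not> (i < Suc k \<and> Suc k < j)" by auto
      hence rk: "r k = 0" "r (Suc k) = 0" using r1z[OF kl(3)] r1z[OF kl(4)] by auto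
      have ak: "a' k = a k" "a' (Suc k) = a (Suc k)" using k a'o by auto
      show ?thesis
      proof (cases "i < l \<and> l < j")
        case False
        hence "r l = 0" using r1z[OF kl(5)] by auto
        thus ?thesis using betw[OF kl(1,2) rk] ak a'o[OF False] by simp
      next
        case True
        define k' where "k' = (if Suc k = M then 0 else Suc k)"
        have k': "k' < M" "r k' = 0" "a k' = a (Suc k)" using kl(1) rk rM aM M by (auto simp: k'_def)
        have n1: "\<not> sbetween (a i) (a j) (a k)" "\<not> sbetween (a i) (a j) (a (Suc k))"
          using adj[OF kl(1) rk(1)] adj[OF k'(1,2)] k'(3) by auto
        have n2: "\<not> sbetween (a k) (a (Suc k)) (a i)" "\<not> sbetween (a k) (a (Suc k)) (a j)"
          using betw[OF kl(1) _ rk] ij by auto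
        have "\<not> (a k = a i \<and> a (Suc k) = a j)" "\<not> (a k = a j \<and> a (Suc k) = a i)"
        proof -
          have "k = i" if "a k = a i" using dist[of k i] that kl(1) rk(1) ij by auto
          moreover have "k' = j" if "a (Suc k) = a j" using dist[of k' j] that k' ij by auto
          moreover have "k = j" if "a k = a j" using dist[of k j] that kl(1) rk(1) ij by auto
          moreover have "k' = i" if "a (Suc k) = a i" using dist[of k' i] that k' ij by auto
          ultimately show "\<not> (a k = a i \<and> a (Suc k) = a j)" "\<not> (a k = a j \<and> a (Suc k) = a i)"
            using ij False M by (auto simp: k'_def split: if_splits)
        qed
        thus ?thesis
          using n1 n2 inside[of l] True unfolding ak sbetween_def by (smt (verit))
      qed
    qed
  qed (rule M)
  show ok': "fan_ok M r' a'"
    unfolding fan_ok_def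
  proof (intro conjI allI impI)
    show "r' M = - r' 0" "a' M = a' 0" using rM aM ij by (auto simp: r'_def a'o)
    show "r' k * r' (Suc k) \<ge> 0" if "k < M" for k
    proof -
      have "k = i \<or> k = j \<or> Suc k = i \<or> Suc k = j \<or> ((i < k \<and> k < j) = (i < Suc k \<and> Suc k < j))" by auto
      thus ?thesis using sgn[OF that] ij by (auto simp: r'_def)
    qed
    have z: "r1 l = 0" if "r' l = 0" for l using that by (auto simp: r'_def r1_def split: if_splits)
    show "a' k \<noteq> a' l" if "k < M" "l < M" "k \<noteq> l" "r' k = 0" "r' l = 0" for k l
      using ok1 that z unfolding fan_ok_def by blast
    show "\<not> sbetween (a' k) (a' (Suc k)) (a' l)" if "k < M" "l < M" "r' k = 0" "r' (Suc k) = 0" "r' l = 0" for k l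
      using ok1 that z unfolding fan_ok_def by blast
  qed (rule M)
  have zo: "\<not> (i < l \<and> l < j)" if "r l = 0" for l using nz[of l] that by auto
  have edge: "k = i \<or> k = j \<or> Suc k = i \<or> Suc k = j \<or> ((i < k \<and> k < j) = (i < Suc k \<and> Suc k < j))" for k by auto
  have 1: "fiso M U r a r1 a'"
  proof (rule fan_radial[OF U ok ok1])
    fix k assume k: "k < M"
    show "r k * r1 k \<ge> 0" by (simp add: r1_def)
    show "r k * r1 (Suc k) \<ge> 0" "r1 k * r (Suc k) \<ge> 0" using sgn[OF k] by (simp_all add: r1_def)
  next
    fix k l assume "r k = 0" "r l = 0" "a k < a l"
    thus "a' k < a' l" using a'o[OF zo] by simp
  qed
  have 2: "fiso M U r1 a' r' a'"
  proof (rule fan_radial[OF U ok1 ok'])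
    fix k assume k: "k < M"
    show "r1 k * r' k \<ge> 0" by (auto simp: r1_def r'_def)
    show "r1 k * r' (Suc k) \<ge> 0" "r' k * r1 (Suc k) \<ge> 0"
      using sgn[OF k] edge[of k] ij by (auto simp: r1_def r'_def)
  qed auto
  show "fiso M U r a r' a'" by (rule fiso_trans[OF 1 2])
qed


definition fdir :: "nat => nat => complex" where
  "fdir M i = cis (pi * real i / real M)"

lemma cross_cis: "cross (cis x) (cis y) = sin (y - x)"
  by (simp add: cross_eq sin_diff)

lemma fan_dirs_fdir:
  assumes "M \<ge> 1"
  shows "fan_dirs M (fdir M)"
  unfolding fan_dirs_def
proof (intro conjI allI impI)
  show "fdir M M = - fdir M 0" using assms by (simp add: fdir_def cis_pi)
  show "fdir M i \<noteq> 0" for i by (simp add: fdir_def)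
  fix i j assume ij: "i < j" "j < M"
  have "pi * real j / real M - pi * real i / real M = pi * (real j - real i) / real M"
    by (simp add: diff_divide_distrib right_diff_distrib)
  moreover have "0 < pi * (real j - real i) / real M" using ij by simp
  moreover have "pi * (real j - real i) / real M < pi"
  proof -
    have "real j - real i < real M" using ij by linarith
    thus ?thesis using ij by (simp add: divide_less_eq)
  qed
  ultimately show "0 < cross (fdir M i) (fdir M j)"
    unfolding fdir_def cross_cis by (simp add: sin_gt_zero)
qed

text \<open>\<open>fan_radial\<close> sees only the signs of the radii and the heights of common
  zeros; everything else in a fan can be chosen at will.\<close>

lemma fan_rescale:
  assumes U: "fan_dirs M U" and ok: "fan_ok M r a"
    and r': "\<And>i. i \<le> M ==> sgn (r' i) = sgn (r i)" "r' M = - r' 0"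
    and a': "\<And>i. i \<le> M ==> r i = 0 ==> a' i = a i" "a' M = a' 0"
  shows "fan_ok M r' a' \<and> fiso M U r a r' a'"
proof -
  have z: "r' i = 0 \<longleftrightarrow> r i = 0" if "i \<le> M" for i using r'(1)[OF that] by (metis sgn_0_0)
  have mul: "x' * y' \<ge> 0" if "x * y \<ge> 0" "sgn x' = sgn x" "sgn y' = sgn y" for x y x' y' :: real
  proof -
    have "sgn (x' * y') = sgn (x * y)" using that by (simp add: sgn_mult)
    thus ?thesis using that(1) by (metis sgn_less less_le_not_le not_le)
  qed
  note D = fan_okD[OF ok]
  have ok': "fan_ok M r' a'"
    unfolding fan_ok_def
  proof (intro conjI allI impI)
    show "r' i * r' (Suc i) \<ge> 0" if "i < M" for i by (rule mul[OF D(4)[OF that]]) (use r' that in auto)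
    show "a' i \<noteq> a' j" if "i < M" "j < M" "i \<noteq> j" "r' i = 0" "r' j = 0" for i j
      using D(5)[of i j] that z a' by auto
    show "\<not> sbetween (a' i) (a' (Suc i)) (a' j)" if "i < M" "j < M" "r' i = 0" "r' (Suc i) = 0" "r' j = 0" for i j
      using D(6)[of i j] that z[of i] z[of "Suc i"] z[of j] a'(1)[of i] a'(1)[of "Suc i"] a'(1)[of j] by auto
  qed (use D(1) r' a' in auto)
  moreover have "fiso M U r a r' a'"
  proof (rule fan_radial[OF U ok ok'])
    fix i assume i: "i < M"
    show "r i * r' i \<ge> 0" by (rule mul[of "r i" "r i"]) (use r' i in auto)
    show "r i * r' (Suc i) \<ge> 0" by (rule mul[OF D(4)[OF i]]) (use r' i in auto)
    show "r' i * r (Suc i) \<ge> 0" by (rule mul[OF D(4)[OF i]]) (use r' i in auto)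
  qed (use a' in auto)
  ultimately show ?thesis by blast
qed

lemma replace_vertex:
  assumes sp: "simple_polygon M V" and l: "0 < l" "l < M"
    and d1: "\<And>j s t. j < M ==> j \<noteq> l - 1 ==> j \<noteq> l ==> 0 < s ==> s < 1 ==> 0 \<le> t ==> t < 1 ==>
      (1 - s) *\<^sub>R V (l - 1) + s *\<^sub>R X \<noteq> edge_pt V j t"
    and d2: "\<And>j s t. j < M ==> j \<noteq> l - 1 ==> j \<noteq> l ==> 0 \<le> s ==> s < 1 ==> 0 \<le> t ==> t < 1 ==>
      (1 - s) *\<^sub>R X + s *\<^sub>R V (Suc l) \<noteq> edge_pt V j t"
    and c: "\<And>s t. 0 \<le> s ==> s < 1 ==> 0 \<le> t ==> t < 1 ==> mix s (V (l - 1)) X \<noteq> mix t X (V (Suc l))"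
    and n: "X \<noteq> V (l - 1)" "X \<noteq> V (Suc l)"
  shows "simple_polygon M (V(l := X))"
proof -
  let ?V = "V(l := X)"
  have e1: "edge_pt ?V (l - 1) s = mix s (V (l - 1)) X" for s
    using l by (auto simp: edge_pt_def)
  have e2: "edge_pt ?V l s = mix s X (V (Suc l))" for s by (simp add: edge_pt_def)
  have e3: "edge_pt ?V j s = edge_pt V j s" if "j \<noteq> l - 1" "j \<noteq> l" for j s
    using that l by (auto simp: edge_pt_def)
  have inj: "s = t" if "mix s p q = mix t p q" "p \<noteq> q" for s t and p q :: 'a
  proof -
    have "(s - t) *\<^sub>R (q - p) = 0" using that(1) by (simp add: algebra_simps)
    thus ?thesis using that(2) by auto
  qed
  have cross1: False if "j < M" "j \<noteq> l - 1" "0 \<le> s" "s < 1" "0 \<le> t" "t < 1" "edge_pt ?V (l - 1) s = edge_pt ?V j t" for j s t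
  proof (cases "j = l")
    case True
    thus False using that c[of s t] e1[of s] e2[of t] by metis
  next
    case False
    show False
    proof (cases "s = 0")
      case True
      hence "edge_pt V (l - 1) 0 = edge_pt V j t" using that e1[of s] e3[OF that(2) False] by simp
      hence "l - 1 = j" using sp l that unfolding simple_polygon_def by (metis less_imp_diff_less order_refl zero_less_one)
      thus False using that by simp
    next
      case s: False
      thus False using that d1[of j s t] e1[of s] e3[OF that(2) False, of t] False by auto
    qed
  qed
  have cross2: False if "j < M" "j \<noteq> l" "0 \<le> s" "s < 1" "0 \<le> t" "t < 1" "edge_pt ?V l s = edge_pt ?V j t" for j s t
  proof (cases "j = l - 1")
    case True
    thus False using that c[of t s] e1[of t] e2[of s] by metis
  next
    case False
    thus False using that d2[of j s t] e2[of s] e3[OF False that(2), of t] by auto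
  qed
  show ?thesis
    unfolding simple_polygon_def
  proof (intro conjI allI impI)
    show "1 \<le> M" "?V M = ?V 0" using sp l by (auto simp: simple_polygon_def)
    fix i j s t assume a: "i < M" "j < M" "0 \<le> s" "s < (1::real)" "0 \<le> t" "t < (1::real)" "edge_pt ?V i s = edge_pt ?V j t"
    have "i = j \<and> s = t"
    proof -
      consider "i \<noteq> l - 1" "i \<noteq> l" "j \<noteq> l - 1" "j \<noteq> l" | "i = l - 1" "j \<noteq> l - 1" | "i \<noteq> l - 1" "j = l - 1"
        | "i = l" "j \<noteq> l" | "i \<noteq> l" "j = l" | "i = l - 1" "j = l - 1" | "i = l" "j = l" by blast
      thus ?thesis
      proof cases
        case 1
        hence "edge_pt V i s = edge_pt V j t" using a(7) e3 by simp
        thus ?thesis using sp a unfolding simple_polygon_def by blast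
      next
        case 6
        hence "s = t" using a(7) e1 by (intro inj[of s "V (l - 1)" X]) (use n in auto)
        thus ?thesis using 6 by simp
      next
        case 7
        hence "s = t" using a(7) e2 by (intro inj[of s X "V (Suc l)"]) (use n in auto)
        thus ?thesis using 7 by simp
      qed (use cross1[of j s t] cross1[of i t s] cross2[of j s t] cross2[of i t s] a in auto)
    qed
    thus "i = j" "s = t" by blast+
  qed
qed


text \<open>The lowest strand through the axis can be swung around below all the others, lifted far away from the
  axis, and brought back above all of them. In the coordinates \<open>x = e \<bullet> w\<close>, \<open>y = cross e w\<close> the
  strand moves to the point \<open>(0, 2)\<close>, where it is separated from the rest by the lines
  \<open>\<plusminus>k x + y = 2\<close>.\<close>

lemma fan_swing:
  assumes ok: "fan_ok M r a" and l: "2 \<le> l" "l + 2 \<le> M"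
    and rl: "r l = 0" "r (l - 1) * r (Suc l) < 0"
    and low: "\<And>i. i < M ==> i \<noteq> l ==> r i = 0 ==> a l < a i"
    and high: "\<And>i. i < M ==> r i = 0 ==> a i < H"
  shows "fan_ok M r (a(l := H)) \<and> fiso M (fdir M) r a r (a(l := H))"
proof -
  define U where "U = fdir M"
  have M: "4 \<le> M" using l by simp
  have Ud: "fan_dirs M U" unfolding U_def using M by (intro fan_dirs_fdir) simp
  note D = fan_okD[OF ok]
  define L where "L = a l"
  have LH: "L < H" using high[of l] rl l by (simp add: L_def)
  define \<theta> where "\<theta> = pi / real M"
  have \<theta>: "0 < \<theta>" "\<theta> \<le> pi / 4" using M by (auto simp: \<theta>_def field_simps)
  have sc: "sin \<theta> > 0" "cos \<theta> > 0" using \<theta> by (auto intro!: sin_gt_zero cos_gt_zero)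
  have sin1: "sin \<theta> < 1"
  proof -
    have "(sin \<theta>)\<^sup>2 + (cos \<theta>)\<^sup>2 = 1" by simp
    moreover have "(cos \<theta>)\<^sup>2 > 0" using sc by simp
    ultimately have "(sin \<theta>)\<^sup>2 < 1" by linarith
    thus ?thesis using sc by (simp add: abs_square_less_1)
  qed
  \<comment> \<open>The slope for which the line \<open>k x + y = 2\<close> through
    \<open>(0, 2)\<close> contains the neighbour of the strand at
    \<open>(2 cos \<theta>, 2 sin \<theta>)\<close>.\<close>
  define k where "k = (1 - sin \<theta>) / cos \<theta>"
  have kc: "k * cos \<theta> = 1 - sin \<theta>" using sc by (simp add: k_def)
  have k0: "0 \<le> k" using sc sin1 by (simp add: k_def)
  have k1: "k < 1"
  proof -
    have "(1 - sin \<theta>) * (1 - sin \<theta>) < (1 - sin \<theta>) * (1 + sin \<theta>)" using sc sin1 by (intro mult_strict_left_mono) auto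
    also have "\<dots> = (cos \<theta>)\<^sup>2" by (simp add: cos_squared_eq power2_eq_square algebra_simps)
    finally have "(1 - sin \<theta>)\<^sup>2 < (cos \<theta>)\<^sup>2" by (simp add: power2_eq_square)
    hence "1 - sin \<theta> < cos \<theta>" by (rule power2_less_imp_less) (use sc in simp)
    thus ?thesis using sc by (simp add: k_def)
  qed
  define \<sigma> where "\<sigma> = sgn (r (Suc l))"
  have r1: "r (Suc l) \<noteq> 0" "r (l - 1) \<noteq> 0" using rl(2) by auto
  have \<sigma>: "\<sigma> = 1 \<or> \<sigma> = -1" using r1 by (auto simp: \<sigma>_def sgn_real_def)
  have \<sigma>': "sgn (r (l - 1)) = - \<sigma>" using rl(2) by (auto simp: \<sigma>_def sgn_real_def mult_less_0_iff)
  define e where "e = \<sigma> *\<^sub>R U l"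
  have ne: "norm e = 1" using \<sigma> by (auto simp: e_def U_def fdir_def)
  define x where "x w = e \<bullet> w" for w
  define y where "y w = cross e w" for w
  have x_lin: "x (p *\<^sub>R w + q *\<^sub>R w') = p * x w + q * x w'" for p q w w'
    by (simp add: x_def inner_add_right)
  have y_lin: "y (p *\<^sub>R w + q *\<^sub>R w') = p * y w + q * y w'" for p q w w'
    by (simp add: y_def cross_simps)
  \<comment> \<open>A normalised picture: the two neighbours of the strand at distance 2 from the
    axis, all other vertices in the unit disc.\<close>
  define r0 where "r0 i = (if i = l - 1 \<or> i = Suc l then 2 else 1) * sgn (r i)" for i
  \<comment> \<open>The neighbours move at height \<open>h\<close>, and the other vertices off the
    axis wait halfway between \<open>L\<close> and \<open>H\<close>. Thus at the levels
    \<open>L\<close> and \<open>H\<close> the edges at the strand meet nothing else.\<close>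
  define hts where "hts g h i = (if r i = 0 then (if i = l then g else a i) else if i = l - 1 \<or> i = Suc l then h else (L + H) / 2)" for g h i
  have li: "l - 1 \<noteq> l" "Suc l \<noteq> l" "l - 1 \<noteq> Suc l" "l \<noteq> 0" "l - 1 \<noteq> 0" "l < M" "l - 1 < M" "Suc l < M" "Suc (l - 1) = l" using l by auto
  have r0s: "sgn (r0 i) = sgn (r i)" for i by (simp add: r0_def sgn_mult)
  have r0M: "r0 M = - r0 0" using li D(2) by (simp add: r0_def sgn_minus)
  have rM0: "r M = 0 \<longleftrightarrow> r 0 = 0" using D(2) by simp
  have htsM: "hts g h M = hts g h 0" for g h using li rM0 D(3) by (auto simp: hts_def)
  have base: "fan_ok M r0 (hts L h) \<and> fiso M U r a r0 (hts L h)" for h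
    by (rule fan_rescale[OF Ud ok r0s r0M _ htsM]) (auto simp: hts_def L_def)
  have high': "a i < H" if i: "i \<le> M" "r i = 0" for i
  proof (cases "i = M")
    case True
    thus ?thesis using high[of 0] i D(3) rM0 M by simp
  qed (use high[of i] i in auto)
  have up: "fan_ok M r (a(l := H))"
    unfolding fan_ok_def
  proof (intro conjI allI impI)
    show "r i * r (Suc i) \<ge> 0" if "i < M" for i by (rule D(4)[OF that])
    show "(a(l := H)) M = (a(l := H)) 0" using D(3) li by auto
    fix i j assume ij: "i < M" "j < M"
    show "(a(l := H)) i \<noteq> (a(l := H)) j" if "i \<noteq> j" "r i = 0" "r j = 0"
      using D(5)[OF ij that] high[OF ij(1) that(2)] high[OF ij(2) that(3)] that(1) by auto
    show "\<not> sbetween ((a(l := H)) i) ((a(l := H)) (Suc i)) ((a(l := H)) j)" if z: "r i = 0" "r (Suc i) = 0" "r j = 0"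
    proof -
      have il: "i \<noteq> l" "Suc i \<noteq> l" using z r1 by auto
      have "a i < H" "a (Suc i) < H" using high'[of i] high'[of "Suc i"] z ij by auto
      thus ?thesis using il D(6)[OF ij z] by (auto simp: sbetween_def)
    qed
  qed (rule D)+
  define Vx where "Vx Q h = (fan_pt U r0 (hts L h))(l := (Q, h))" for Q h
  have fst_V: "fst (fan_pt U r0 b i) = r0 i *\<^sub>R U i" for b i by (simp add: fan_pt_def)
  have Ul: "U (Suc l) = U l * cis \<theta>" "U (l - 1) = U l * cis (- \<theta>)"
    unfolding U_def fdir_def cis_mult \<theta>_def using l by (simp_all add: field_simps of_nat_diff)
  have cl: "x (\<sigma> *\<^sub>R (U l * w)) = Re w" "y (\<sigma> *\<^sub>R (U l * w)) = Im w" for w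
  proof -
    have "cnj e * (\<sigma> *\<^sub>R (U l * w)) = (cnj e * e) * w" by (simp add: e_def)
    also have "cnj e * e = 1" using ne by (simp add: complex_norm_square[symmetric] mult.commute)
    finally have c: "cnj e * (\<sigma> *\<^sub>R (U l * w)) = w" by simp
    show "y (\<sigma> *\<^sub>R (U l * w)) = Im w" unfolding y_def cross_def c ..
    have "x v = Re (cnj e * v)" for v by (simp add: x_def inner_complex_def)
    thus "x (\<sigma> *\<^sub>R (U l * w)) = Re w" by (simp only: c)
  qed
  have A: "x (r0 (Suc l) *\<^sub>R U (Suc l)) = 2 * cos \<theta>" "y (r0 (Suc l) *\<^sub>R U (Suc l)) = 2 * sin \<theta>"
    and B: "x (r0 (l - 1) *\<^sub>R U (l - 1)) = - (2 * cos \<theta>)" "y (r0 (l - 1) *\<^sub>R U (l - 1)) = 2 * sin \<theta>"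
  proof -
    have "r0 (Suc l) *\<^sub>R U (Suc l) = 2 *\<^sub>R (\<sigma> *\<^sub>R (U l * cis \<theta>)) + 0 *\<^sub>R 0" by (simp add: Ul r0_def \<sigma>_def)
    thus "x (r0 (Suc l) *\<^sub>R U (Suc l)) = 2 * cos \<theta>" "y (r0 (Suc l) *\<^sub>R U (Suc l)) = 2 * sin \<theta>"
      by (simp_all only: x_lin y_lin cl) simp_all
    have "r0 (l - 1) *\<^sub>R U (l - 1) = (-2) *\<^sub>R (\<sigma> *\<^sub>R (U l * cis (- \<theta>))) + 0 *\<^sub>R 0"
      using Ul(2) \<sigma>' by (simp add: r0_def)
    thus "x (r0 (l - 1) *\<^sub>R U (l - 1)) = - (2 * cos \<theta>)" "y (r0 (l - 1) *\<^sub>R U (l - 1)) = 2 * sin \<theta>"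
      by (simp_all only: x_lin y_lin cl) simp_all
  qed
  define P where "P = 2 *\<^sub>R (\<sigma> *\<^sub>R (U l * \<i>))"
  have P: "x (s *\<^sub>R P) = 0" "y (s *\<^sub>R P) = 2 * s" for s
  proof -
    have "s *\<^sub>R P = (2 * s) *\<^sub>R (\<sigma> *\<^sub>R (U l * \<i>)) + 0 *\<^sub>R 0" by (simp add: P_def)
    thus "x (s *\<^sub>R P) = 0" "y (s *\<^sub>R P) = 2 * s" by (simp_all only: x_lin y_lin cl) simp_all
  qed
  have small: "\<bar>x (r0 i *\<^sub>R U i)\<bar> \<le> 1 \<and> \<bar>y (r0 i *\<^sub>R U i)\<bar> \<le> 1" if "i \<noteq> l - 1" "i \<noteq> Suc l" for i
  proof -
    have n: "norm (r0 i *\<^sub>R U i) \<le> 1" using that by (simp add: r0_def U_def fdir_def sgn_real_def)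
    have "\<bar>x w\<bar> \<le> norm w" "\<bar>y w\<bar> \<le> norm w" for w
      using Cauchy_Schwarz_ineq2[of e w] ne abs_Im_le_cmod[of "cnj e * w"] by (simp_all add: x_def y_def cross_def norm_mult)
    thus ?thesis using n order_trans by blast
  qed
  have fstE: "fst (edge_pt V j t) = mix t (fst (V j)) (fst (V (Suc j)))" and
    sndE: "snd (edge_pt V j t) = rmix t (snd (V j)) (snd (V (Suc j)))" for V :: "nat => space" and j t
    by (simp_all add: edge_pt_def)
  have simp_Vx: "simple_polygon M (Vx Q h)"
    if Q: "x Q = 0" and L: "(h = L \<or> h = H) \<or> Q = P \<and> L \<le> h \<and> h \<le> H" for Q h
    unfolding Vx_def
  proof (rule replace_vertex)
    let ?V = "fan_pt U r0 (hts L h)"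
    show "simple_polygon M ?V" using base by (intro fan_simple_polygon fan_dirs_fan[OF Ud]) blast
    have xb: "x (fst (?V (l - 1))) = - (2 * cos \<theta>)" "x (fst (?V (Suc l))) = 2 * cos \<theta>" using A B by (simp_all add: fst_V)
    have zb: "snd (?V (l - 1)) = h" "snd (?V (Suc l)) = h" using r1 by (simp_all add: fan_pt_def hts_def)
    \<comment> \<open>\<open>\<epsilon>\<close> selects the bottom or the top level. In both cases
      all vertices other than the strand and its neighbours lie strictly on one side of it.\<close>
    have lev: False if gh: "\<epsilon> = 1 \<and> h = L \<or> \<epsilon> = -1 \<and> h = H" and jj: "j < M" "j \<noteq> l - 1" "j \<noteq> l" "0 \<le> t" "t < 1"
      and eq: "snd (edge_pt ?V j t) = h" and na: "\<not> (j = Suc l \<and> t = 0)" for \<epsilon> :: real and j t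
    proof -
      have ge: "\<epsilon> * snd (?V i) > \<epsilon> * h" if "i \<le> M" "i \<noteq> l - 1" "i \<noteq> Suc l" "i \<noteq> l" for i
      proof -
        have "L < a i \<and> a i < H" if "r i = 0"
        proof (cases "i = M")
          case True
          hence "L < a 0 \<and> a 0 < H" using low[of 0] high[of 0] that rM0 li by (simp add: L_def)
          thus ?thesis using True D(3) by simp
        next
          case False
          thus ?thesis using low[of i] high[of i] that \<open>i \<le> M\<close> \<open>i \<noteq> l\<close> by (simp add: L_def)
        qed
        hence "L < hts L h i \<and> hts L h i < H" using that LH by (auto simp: hts_def)
        thus ?thesis using gh by (auto simp: fan_pt_def)
      qed
      have ge': "\<epsilon> * snd (?V i) \<ge> \<epsilon> * h" if "i \<le> M" "i \<noteq> l" for i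
        using ge[of i] zb that by (cases "i = l - 1 \<or> i = Suc l") auto
      have sl: "Suc j \<noteq> l" using jj by auto
      have "\<epsilon> * h = rmix t (\<epsilon> * snd (?V j)) (\<epsilon> * snd (?V (Suc j)))"
      proof -
        have "\<epsilon> * h = \<epsilon> * (rmix t (snd (?V j)) (snd (?V (Suc j))))" unfolding sndE[symmetric] eq ..
        also have "\<dots> = rmix t (\<epsilon> * snd (?V j)) (\<epsilon> * snd (?V (Suc j)))" by (simp add: algebra_simps)
        finally show ?thesis .
      qed
      moreover have "rmix t (\<epsilon> * snd (?V j)) (\<epsilon> * snd (?V (Suc j))) > rmix t (\<epsilon> * h) (\<epsilon> * h)"
      proof (cases "j = Suc l")
        case False
        hence "(1 - t) * (\<epsilon> * snd (?V j)) > (1 - t) * (\<epsilon> * h)" using jj ge[of j] by simp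
        moreover have "t * (\<epsilon> * snd (?V (Suc j))) \<ge> t * (\<epsilon> * h)" using jj ge'[of "Suc j"] sl by (intro mult_left_mono[of "\<epsilon> * h"]) auto
        ultimately show ?thesis by linarith
      next
        case True
        hence "t > 0" using na jj by auto
        moreover have "\<epsilon> * snd (?V (Suc j)) > \<epsilon> * h" using jj ge[of "Suc j"] True li by auto
        ultimately have "t * (\<epsilon> * snd (?V (Suc j))) > t * (\<epsilon> * h)" by simp
        moreover have "(1 - t) * (\<epsilon> * snd (?V j)) \<ge> (1 - t) * (\<epsilon> * h)" using jj ge'[of j] by (intro mult_left_mono[of "\<epsilon> * h"]) auto
        ultimately show ?thesis by linarith
      qed
      ultimately show False by (simp add: algebra_simps)
    qed
    \<comment> \<open>\<open>\<epsilon> k x + y\<close> is at most 2 on the remaining vertices, with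
      equality only at a neighbour of the strand, whereas the moving edge on the corresponding side
      has the constant value 2.\<close>
    have far: False if g: "\<epsilon> = 1 \<or> \<epsilon> = -1" and jj: "j < M" "j \<noteq> l - 1" "j \<noteq> l" "0 \<le> t" "t < 1"
      and eq: "\<epsilon> * k * x (fst (edge_pt ?V j t)) + y (fst (edge_pt ?V j t)) = 2"
      and na: "\<not> (\<epsilon> = 1 \<and> j = Suc l \<and> t = 0)" for \<epsilon> :: real and j t
    proof -
      define f where "f w = \<epsilon> * k * x w + y w" for w
      have f_lin: "f (p *\<^sub>R w + q *\<^sub>R w') = p * f w + q * f w'" for p q w w'
        by (simp add: f_def x_lin y_lin algebra_simps)
      have lt0: "f (fst (?V i)) < 2" if "i \<noteq> l - 1" "i \<noteq> Suc l" for i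
      proof -
        have b: "\<bar>x (fst (?V i))\<bar> \<le> 1" "\<bar>y (fst (?V i))\<bar> \<le> 1" using small[OF that] by (simp_all add: fst_V)
        have "\<epsilon> * k * x (fst (?V i)) \<le> \<bar>\<epsilon> * k * x (fst (?V i))\<bar>" by simp
        also have "\<dots> = k * \<bar>x (fst (?V i))\<bar>" using g k0 by (auto simp: abs_mult)
        also have "\<dots> \<le> k * 1" using b k0 by (intro mult_left_mono) auto
        finally show ?thesis using b k1 by (simp add: f_def)
      qed
      have fB: "f (fst (?V (l - 1))) = \<epsilon> * (- 2 * (1 - sin \<theta>)) + 2 * sin \<theta>"
        and fA: "f (fst (?V (Suc l))) = \<epsilon> * (2 * (1 - sin \<theta>)) + 2 * sin \<theta>"
        unfolding f_def fst_V A B kc[symmetric] by simp_all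
      have le: "f (fst (?V i)) \<le> 2" for i
        using lt0[of i] fA fB sin1 g by (cases "i = l - 1 \<or> i = Suc l") auto
      have "f (fst (edge_pt ?V j t)) = rmix t (f (fst (?V j))) (f (fst (?V (Suc j))))"
        unfolding fstE f_lin ..
      moreover have "rmix t (f (fst (?V j))) (f (fst (?V (Suc j)))) < rmix t 2 2"
      proof (cases "f (fst (?V j)) < 2")
        case True
        hence "(1 - t) * f (fst (?V j)) < (1 - t) * 2" using jj True by (intro mult_strict_left_mono) auto
        moreover have "t * f (fst (?V (Suc j))) \<le> t * 2" using le jj by (intro mult_left_mono) auto
        ultimately show ?thesis by linarith
      next
        case False
        hence "j = Suc l" using lt0[of j] jj by auto
        moreover have "\<epsilon> = 1" using False g fA sin1 \<open>j = Suc l\<close> by auto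
        ultimately have "t > 0" "f (fst (?V (Suc j))) < 2" using na jj lt0[of "Suc j"] li by auto
        hence "t * f (fst (?V (Suc j))) < t * 2" by (intro mult_strict_left_mono)
        moreover have "(1 - t) * f (fst (?V j)) \<le> (1 - t) * 2" using le jj by (intro mult_left_mono) auto
        ultimately show ?thesis by linarith
      qed
      ultimately have "f (fst (edge_pt ?V j t)) < 2" by simp
      thus False using eq by (simp add: f_def)
    qed
    show "0 < l" "l < M" using li by auto
    show "mix s (?V (l - 1)) (Q, h) \<noteq> edge_pt ?V j t"
      if jj: "j < M" "j \<noteq> l - 1" "j \<noteq> l" and s: "0 < s" "s < 1" and t: "0 \<le> t" "t < 1" for j s t
    proof
      assume eq: "mix s (?V (l - 1)) (Q, h) = edge_pt ?V j t"
      have f: "fst (edge_pt ?V j t) = mix s (fst (?V (l - 1))) Q"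
        and h: "snd (edge_pt ?V j t) = h"
        using zb unfolding eq[symmetric] by (simp_all add: algebra_simps)
      have xs: "x (fst (edge_pt ?V j t)) < 0"
        unfolding f x_lin xb Q using s sc by (simp add: mult_pos_pos)
      have na: "\<not> (j = Suc l \<and> t = 0)" using xs xb sc by auto
      show False
      proof (cases "h = L \<or> h = H")
        case True
        thus False using lev[of 1 j t] lev[of "-1" j t] jj t h na by auto
      next
        case False
        hence QP: "Q = P" using L by auto
        have "-1 * k * x (fst (edge_pt ?V j t)) + y (fst (edge_pt ?V j t)) = 2"
        proof -
          have X: "x (fst (edge_pt ?V j t)) = (1 - s) * - (2 * cos \<theta>)" unfolding f x_lin xb Q by simp
          have Y: "y (fst (edge_pt ?V j t)) = rmix s (2 * sin \<theta>) 2"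
            unfolding f y_lin fst_V B using P(2)[of 1] by (simp add: QP)
          have K: "- 1 * k * ((1 - s) * - (2 * cos \<theta>)) = (1 - s) * (2 * (1 - sin \<theta>))"
            unfolding kc[symmetric] by simp
          show ?thesis unfolding X Y K by (simp add: algebra_simps)
        qed
        thus False using far[of "-1" j t] jj t by auto
      qed
    qed
    show "mix s (Q, h) (?V (Suc l)) \<noteq> edge_pt ?V j t"
      if jj: "j < M" "j \<noteq> l - 1" "j \<noteq> l" and s: "0 \<le> s" "s < 1" and t: "0 \<le> t" "t < 1" for j s t
    proof
      assume eq: "mix s (Q, h) (?V (Suc l)) = edge_pt ?V j t"
      have f: "fst (edge_pt ?V j t) = mix s Q (fst (?V (Suc l)))"
        and h: "snd (edge_pt ?V j t) = h"
        using zb unfolding eq[symmetric] by (simp_all add: algebra_simps)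
      have xs: "x (fst (edge_pt ?V j t)) < 2 * cos \<theta>"
        unfolding f x_lin xb Q using s sc by simp
      have na: "\<not> (j = Suc l \<and> t = 0)" using xs xb sc by auto
      show False
      proof (cases "h = L \<or> h = H")
        case True
        thus False using lev[of 1 j t] lev[of "-1" j t] jj t h na by auto
      next
        case False
        hence QP: "Q = P" using L by auto
        have "1 * k * x (fst (edge_pt ?V j t)) + y (fst (edge_pt ?V j t)) = 2"
        proof -
          have X: "x (fst (edge_pt ?V j t)) = s * (2 * cos \<theta>)" unfolding f x_lin xb Q by simp
          have Y: "y (fst (edge_pt ?V j t)) = s * (2 * sin \<theta>) + (1 - s) * 2"
            unfolding f y_lin fst_V A using P(2)[of 1] by (simp add: QP)
          have K: "1 * k * (s * (2 * cos \<theta>)) = s * (2 * (1 - sin \<theta>))"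
            unfolding kc[symmetric] by simp
          show ?thesis unfolding X Y K by (simp add: algebra_simps)
        qed
        thus False using far[of 1 j t] jj t na by auto
      qed
    qed
    show "mix s (?V (l - 1)) (Q, h) \<noteq> mix t (Q, h) (?V (Suc l))"
      if s: "0 \<le> s" "s < 1" and t: "0 \<le> t" "t < 1" for s t
    proof
      assume "mix s (?V (l - 1)) (Q, h) = mix t (Q, h) (?V (Suc l))"
      from arg_cong[OF this, of "\<lambda>p. x (fst p)"]
      have "x (mix s (fst (?V (l - 1))) Q) = x (mix t Q (fst (?V (Suc l))))" by simp
      hence "(1 - s) * - (2 * cos \<theta>) = t * (2 * cos \<theta>)" unfolding x_lin xb Q by simp
      moreover have "(1 - s) * - (2 * cos \<theta>) < 0" using s sc by (simp add: mult_pos_pos)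
      moreover have "t * (2 * cos \<theta>) \<ge> 0" using t sc by simp
      ultimately show False by linarith
    qed
    have "x (fst (Q, h)) \<noteq> x (fst (?V (l - 1)))" "x (fst (Q, h)) \<noteq> x (fst (?V (Suc l)))"
      unfolding xb fst_conv Q using sc by auto
    thus "(Q, h) \<noteq> ?V (l - 1)" "(Q, h) \<noteq> ?V (Suc l)" by metis+
  qed
  have Vx_int: "(\<lambda>i. mix s (Vx Q h i) (Vx Q' h' i)) = Vx (mix s Q Q') (rmix s h h')" for s Q Q' h h'
  proof
    fix i
    show "mix s (Vx Q h i) (Vx Q' h' i) = Vx (mix s Q Q') (rmix s h h') i"
      by (cases "i = l") (simp_all add: Vx_def fan_pt_def hts_def algebra_simps)
  qed
  \<comment> \<open>Three stages: out to \<open>P\<close> at the bottom level, up at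
    \<open>P\<close>, and back to the axis at the top level.\<close>
  have st1: "kiso (polygon_set M (Vx 0 L)) (polygon_set M (Vx P L))"
  proof (rule kiso_polygon)
    fix s :: real assume "0 \<le> s" "s \<le> 1"
    show "simple_polygon M (\<lambda>i. mix s (Vx 0 L i) (Vx P L i))"
      unfolding Vx_int by (rule simp_Vx) (use P(1)[of s] in "simp_all add: algebra_simps")
  qed
  have st2: "kiso (polygon_set M (Vx P L)) (polygon_set M (Vx P H))"
  proof (rule kiso_polygon)
    fix s :: real assume s: "0 \<le> s" "s \<le> 1"
    have PP: "mix s P P = P" by simp
    have "L \<le> rmix s L H" "rmix s L H \<le> H"
      using s LH mult_left_mono[of L H s] mult_left_mono[of L H "1 - s"] by (simp_all add: algebra_simps)
    thus "simple_polygon M (\<lambda>i. mix s (Vx P L i) (Vx P H i))"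
      unfolding Vx_int PP by (intro simp_Vx) (use P(1)[of 1] in auto)
  qed
  have st3: "kiso (polygon_set M (Vx P H)) (polygon_set M (Vx 0 H))"
  proof (rule kiso_polygon)
    fix s :: real assume "0 \<le> s" "s \<le> 1"
    show "simple_polygon M (\<lambda>i. mix s (Vx P H i) (Vx 0 H i))"
      unfolding Vx_int by (rule simp_Vx) (use P(1)[of "1 - s"] in "simp_all add: algebra_simps")
  qed
  have V0: "Vx 0 L = fan_pt U r0 (hts L L)" "Vx 0 H = fan_pt U r0 (hts H H)"
    by (auto simp: Vx_def fun_eq_iff fan_pt_def hts_def r0_def rl)
  have last: "fan_ok M r0 (hts H H) \<and> fiso M U r (a(l := H)) r0 (hts H H)"
    by (rule fan_rescale[OF Ud up r0s r0M _ htsM]) (auto simp: hts_def)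
  have "fiso M U r0 (hts L L) r0 (hts H H)"
    unfolding fiso_def V0[symmetric] by (rule kiso_trans[OF kiso_trans[OF st1 st2] st3])
  hence "fiso M U r a r (a(l := H))"
    by (rule fiso_trans[OF fiso_trans[OF conjunct2[OF base[of L]]] fiso_sym[OF conjunct2[OF last]]])
  thus ?thesis using up by (simp add: U_def)
qed


section \<open>Reducing the number of strands\<close>

text \<open>An exclusive or, hence additive in the pair of ends (\<open>sep_trans\<close>), which
  turns arguments about separation into propositional logic. It agrees with \<open>sbetween\<close>
  unless \<open>x\<close> is an end.\<close>

definition sep :: "real => real => real => bool" where
  "sep p q x \<longleftrightarrow> (p < x) \<noteq> (q < x)"

lemma sep_sbetween: "x \<noteq> p ==> x \<noteq> q ==> sep p q x \<longleftrightarrow> sbetween p q x"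
  by (auto simp: sep_def sbetween_def)

lemma sep_swap:
  assumes "p \<noteq> x" "p \<noteq> y" "q \<noteq> x" "q \<noteq> y"
  shows "(sep p q x \<longleftrightarrow> sep p q y) \<longleftrightarrow> (sep x y p \<longleftrightarrow> sep x y q)"
proof -
  have "p < x \<longleftrightarrow> \<not> x < p" "p < y \<longleftrightarrow> \<not> y < p" "q < x \<longleftrightarrow> \<not> x < q" "q < y \<longleftrightarrow> \<not> y < q"
    using assms by auto
  thus ?thesis unfolding sep_def by blast
qed

lemma sep_trans: "sep p s x \<longleftrightarrow> (sep p q x \<noteq> sep q s x)"
  unfolding sep_def by blast

text \<open>Zeros in the interior are allowed, so a chain of consecutive blocks on one side is again
  an arc; this is what lets noncrossing survive pushes and flips.\<close>

definition fan_arc :: "(nat => real) => real => nat => nat => bool" where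
  "fan_arc r \<sigma> i j \<longleftrightarrow> i < j \<and> r i = 0 \<and> r j = 0 \<and> (\<forall>l. i \<le> l --> l \<le> j --> \<sigma> * r l \<ge> 0)"

text \<open>Arcs on the same side of the axis do not cross: the ends of one do not separate the
  ends of the other.\<close>

definition noncross :: "nat => (nat => real) => (nat => real) => bool" where
  "noncross k r a \<longleftrightarrow> (\<forall>\<sigma> i j i' j'. (\<sigma> = 1 \<or> \<sigma> = -1) --> fan_arc r \<sigma> i j --> fan_arc r \<sigma> i' j' --> j \<le> k --> j' \<le> k -->
     (j < i' \<or> j' < i) --> (sep (a i) (a j) (a i') \<longleftrightarrow> sep (a i) (a j) (a j')))"

lemma noncrossD:
  "noncross k r a ==> \<sigma> = 1 \<or> \<sigma> = -1 ==> fan_arc r \<sigma> i j ==> fan_arc r \<sigma> i' j' ==> j \<le> k ==> j' \<le> k ==>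
     j < i' \<or> j' < i ==> sep (a i) (a j) (a i') \<longleftrightarrow> sep (a i) (a j) (a j')"
  unfolding noncross_def by blast

text \<open>No zero appears, so every arc of the new fan was an arc of the old one.\<close>

lemma noncross_push:
  assumes nc: "noncross k r a" and r': "\<And>i. i \<le> k ==> r i \<noteq> 0 ==> r' i = r i"
  shows "noncross k r' a"
proof -
  have arc: "fan_arc r \<sigma> i j" if A: "fan_arc r' \<sigma> i j" "j \<le> k" for \<sigma> i j
    unfolding fan_arc_def
  proof (intro conjI allI impI)
    have z: "r l = 0" if "r' l = 0" "l \<le> k" for l using r'[of l] that by auto
    show "i < j" "r i = 0" "r j = 0" using A z[of i] z[of j] by (auto simp: fan_arc_def)
    show "\<sigma> * r l \<ge> 0" if "i \<le> l" "l \<le> j" for l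
    proof (cases "r l = 0")
      case False
      hence "r' l = r l" using r'[of l] that A by simp
      thus ?thesis using A that by (auto simp: fan_arc_def)
    qed simp
  qed
  show ?thesis unfolding noncross_def using noncrossD[OF nc] arc by blast
qed

text \<open>An arc of the new fan avoids the inside of the block or contains the block entirely. In
  the latter case it is composed of old arcs and the flipped block, whose ends no other strand
  separates, and \<open>sep_trans\<close> adds up the contributions.\<close>

lemma noncross_flip:
  assumes nc: "noncross k r a" and ok: "fan_ok M r a" and kM: "k < M"
    and b: "i0 < j0" "j0 \<le> k" "r i0 = 0" "r j0 = 0" "\<And>l. i0 < l ==> l < j0 ==> r l \<noteq> 0"
    and adj: "\<And>l. l < M ==> r l = 0 ==> \<not> sbetween (a i0) (a j0) (a l)"
    and r': "r' = (\<lambda>l. if i0 < l \<and> l < j0 then - r l else r l)"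
    and a': "\<And>l. r l = 0 ==> a' l = a l"
  shows "noncross k r' a'"
proof -
  have z: "r' l = 0 \<longleftrightarrow> r l = 0" for l by (simp add: r')
  have dist: "a i \<noteq> a j" if "r i = 0" "r j = 0" "i \<noteq> j" "i \<le> k" "j \<le> k" for i j
    using fan_okD(5)[OF ok, of i j] that kM by auto
  have sub: "fan_arc r \<sigma> i j" if "i < j" "r i = 0" "r j = 0" "\<forall>l. i \<le> l --> l \<le> j --> \<sigma> * r' l \<ge> 0" "j \<le> i0 \<or> j0 \<le> i" for \<sigma> i j
    unfolding fan_arc_def
  proof (intro conjI allI impI)
    fix l assume l: "i \<le> l" "l \<le> j"
    hence "r' l = r l" using that(5) by (auto simp: r')
    thus "\<sigma> * r l \<ge> 0" using that(4) l by metis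
  qed (use that in auto)
  have cases: "j \<le> i0 \<or> j0 \<le> i \<or> i \<le> i0 \<and> j0 \<le> j" if "fan_arc r' \<sigma> i j" for \<sigma> i j
    using that b(5)[of i] b(5)[of j] z[of i] z[of j] unfolding fan_arc_def by force
  have inside: "sep (a i) (a j) (a i') \<longleftrightarrow> sep (a i) (a j) (a j')"
    if \<sigma>: "\<sigma> = 1 \<or> \<sigma> = -1" and A: "fan_arc r' \<sigma> i j" and A': "fan_arc r' \<sigma> i' j'" and jk: "j \<le> k" "j' \<le> k"
      and dj: "j < i' \<or> j' < i" and inc: "i \<le> i0 \<and> j0 \<le> j" for \<sigma> i j i' j'
  proof -
    have rz: "r i = 0" "r j = 0" "r i' = 0" "r j' = 0" "i < j" "i' < j'" using A A' z by (auto simp: fan_arc_def)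
    have B': "fan_arc r \<sigma> i' j'"
      by (rule sub) (use rz A' dj inc b(1) in "auto simp: fan_arc_def")
    have s1: "sep (a i) (a i0) (a i') \<longleftrightarrow> sep (a i) (a i0) (a j')"
    proof (cases "i = i0")
      case False
      have "fan_arc r \<sigma> i i0" by (rule sub) (use False inc rz b A in "auto simp: fan_arc_def")
      thus ?thesis using noncrossD[OF nc \<sigma> _ B'] jk dj inc b by auto
    qed (simp add: sep_def)
    have s3: "sep (a j0) (a j) (a i') \<longleftrightarrow> sep (a j0) (a j) (a j')"
    proof (cases "j = j0")
      case False
      have "fan_arc r \<sigma> j0 j" by (rule sub) (use False inc rz b A in "auto simp: fan_arc_def")
      thus ?thesis using noncrossD[OF nc \<sigma> _ B'] jk dj inc b by auto
    qed (simp add: sep_def)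
    have no: "\<not> sep (a i0) (a j0) (a l)" if "r l = 0" "l \<le> k" "l \<noteq> i0" "l \<noteq> j0" for l
      using sep_sbetween[of "a l" "a i0" "a j0"] dist[of l i0] dist[of l j0] adj[of l] that b kM by auto
    have "\<not> sep (a i0) (a j0) (a i')" "\<not> sep (a i0) (a j0) (a j')"
      by (rule no; use rz jk dj inc b(1) in auto)+
    thus ?thesis using s1 s3 sep_trans[of "a i" "a j" _ "a i0"] sep_trans[of "a i0" "a j" _ "a j0"] by blast
  qed
  show ?thesis
    unfolding noncross_def
  proof (intro allI impI)
    fix \<sigma> :: real and i j i' j'
    assume \<sigma>: "\<sigma> = 1 \<or> \<sigma> = -1" and A: "fan_arc r' \<sigma> i j" and A': "fan_arc r' \<sigma> i' j'" and jk: "j \<le> k" "j' \<le> k"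
      and dj: "j < i' \<or> j' < i"
    have rz: "r i = 0" "r j = 0" "r i' = 0" "r j' = 0" "i < j" "i' < j'" using A A' z by (auto simp: fan_arc_def)
    have "sep (a i) (a j) (a i') \<longleftrightarrow> sep (a i) (a j) (a j')"
    proof (cases "i \<le> i0 \<and> j0 \<le> j")
      case True
      thus ?thesis using inside[OF \<sigma> A A' jk dj] by blast
    next
      case F1: False
      show ?thesis
      proof (cases "i' \<le> i0 \<and> j0 \<le> j'")
        case True
        have "sep (a i') (a j') (a i) \<longleftrightarrow> sep (a i') (a j') (a j)"
          using inside[OF \<sigma> A' A jk(2,1) _ True] dj by blast
        moreover have "a i \<noteq> a i'" "a i \<noteq> a j'" "a j \<noteq> a i'" "a j \<noteq> a j'"
          by (rule dist; use rz jk dj in auto)+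
        ultimately show ?thesis using sep_swap[of "a i" "a i'" "a j'" "a j"] by blast
      next
        case F2: False
        have "fan_arc r \<sigma> i j" by (rule sub) (use rz A cases[OF A] F1 in "auto simp: fan_arc_def")
        moreover have "fan_arc r \<sigma> i' j'" by (rule sub) (use rz A' cases[OF A'] F2 in "auto simp: fan_arc_def")
        ultimately show ?thesis using noncrossD[OF nc \<sigma>] jk dj by blast
      qed
    qed
    thus "sep (a' i) (a' j) (a' i') \<longleftrightarrow> sep (a' i) (a' j) (a' j')" using a' rz by simp
  qed
qed

lemma next_zero:
  fixes r :: "nat => real"
  assumes "l < k" "r k = 0"
  obtains j where "l < j" "j \<le> k" "r j = 0" "\<And>m. l < m ==> m < j ==> r m \<noteq> 0"
proof -
  define j where "j = (LEAST j. l < j \<and> r j = 0)"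
  have "l < j \<and> r j = 0" unfolding j_def by (rule LeastI[of _ k]) (use assms in auto)
  moreover have "j \<le> k" unfolding j_def by (rule Least_le) (use assms in auto)
  moreover have "r m \<noteq> 0" if "l < m" "m < j" for m
    using not_less_Least[of m "\<lambda>j. l < j \<and> r j = 0"] that by (auto simp: j_def)
  ultimately show thesis using that by blast
qed

lemma prev_zero:
  fixes r :: "nat => real"
  assumes "0 < l" "r 0 = 0"
  obtains i where "i < l" "r i = 0" "\<And>m. i < m ==> m < l ==> r m \<noteq> 0"
proof -
  let ?S = "{i. i < l \<and> r i = 0}"
  have fin: "finite ?S" and ne: "?S \<noteq> {}" using assms by auto
  have m: "Max ?S \<in> ?S" by (rule Max_in[OF fin ne])
  have "r m \<noteq> 0" if "Max ?S < m" "m < l" for m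
    using Max_ge[OF fin, of m] that(1) that(2) by (metis (mono_tags, lifting) mem_Collect_eq not_le)
  thus thesis using m that[of "Max ?S"] by blast
qed

lemma block_sign:
  assumes ok: "fan_ok M r a" and ij: "i < m" "m < j" "j \<le> M" and nz: "\<And>l. i < l ==> l < j ==> r l \<noteq> 0"
    and m': "i < m'" "m' < j"
  shows "r m * r m' > 0"
proof -
  have from_first: "r (Suc i) * r l > 0" if l: "Suc i \<le> l" "l < j" for l
    using l
  proof (induction l rule: dec_induct)
    case base
    thus ?case using nz[of "Suc i"] by (simp add: zero_less_mult_iff) linarith
  next
    case (step l)
    have "r (Suc i) * r l > 0" using step by simp
    moreover have "r l * r (Suc l) \<ge> 0" using fan_okD(4)[OF ok, of l] step ij by simp
    moreover have "r (Suc l) \<noteq> 0" "r l \<noteq> 0" using nz step by auto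
    ultimately show ?case by (auto simp: zero_less_mult_iff zero_le_mult_iff)
  qed
  have "r (Suc i) * r m > 0" "r (Suc i) * r m' > 0" using from_first ij m' by auto
  thus ?thesis by (auto simp: zero_less_mult_iff)
qed

definition rstate :: "nat => nat => nat => (nat => real) => (nat => real) => bool" where
  "rstate M k n r a \<longleftrightarrow> fan_ok M r a \<and> 0 < k \<and> Suc k < M \<and> r 0 = 0 \<and> r k = 0 \<and> noncross k r a \<and>
     (\<forall>l<M. r l = 0 --> l \<noteq> k --> a l < a k) \<and> (\<forall>l. k < l --> l < M --> r l = 0 --> a l < a 0) \<and>
     (\<forall>l<k. r l = 0 --> r (Suc l) \<noteq> 0) \<and> card {l. 0 < l \<and> l < k \<and> r l = 0 \<and> a l < a 0} \<le> n"

lemma rstate_push: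
  assumes st: "rstate M k n r a" and l: "0 < l" "l < k" "r l = 0" "r (l - 1) * r (Suc l) > 0"
  shows "rstate M k n (r(l := r (Suc l))) a \<and> fiso M (fdir M) r a (r(l := r (Suc l))) a"
proof -
  have S: "fan_ok M r a" "Suc k < M" "r 0 = 0" "r k = 0" "noncross k r a" "0 < k"
    "\<forall>l<M. r l = 0 --> l \<noteq> k --> a l < a k" "\<forall>l. k < l --> l < M --> r l = 0 --> a l < a 0"
    "\<forall>l<k. r l = 0 --> r (Suc l) \<noteq> 0" "card {l. 0 < l \<and> l < k \<and> r l = 0 \<and> a l < a 0} \<le> n"
    using st unfolding rstate_def by blast+
  let ?r = "r(l := r (Suc l))"
  have sl: "r (Suc l) \<noteq> 0" using l(4) by auto
  have push: "fan_ok M ?r a \<and> fiso M (fdir M) r a ?r a"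
  proof (rule fan_push[OF fan_dirs_fdir S(1)])
    show "?r i = r i" if "r i \<noteq> 0" for i using that l by auto
    show "?r M = - ?r 0" using fan_okD(2)[OF S(1)] l S by auto
    show "?r i * ?r (Suc i) \<ge> 0" if i: "i < M" for i
    proof -
      consider "i = l" | "Suc i = l" | "i \<noteq> l" "Suc i \<noteq> l" by blast
      thus ?thesis
      proof cases
        case 2
        thus ?thesis using l(4) by auto
      qed (use fan_okD(4)[OF S(1) i] in auto)
    qed
  qed (use S in auto)
  have z: "r m = 0" if "?r m = 0" for m using that l by (auto split: if_splits)
  have nc: "noncross k ?r a" by (rule noncross_push[OF S(5)]) (use l in auto)
  have "card {m. 0 < m \<and> m < k \<and> ?r m = 0 \<and> a m < a 0} \<le> card {m. 0 < m \<and> m < k \<and> r m = 0 \<and> a m < a 0}"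
    by (rule card_mono) (use z in auto)
  hence cd: "card {m. 0 < m \<and> m < k \<and> ?r m = 0 \<and> a m < a 0} \<le> n" using S(10) by simp
  have nn: "\<forall>m<k. ?r m = 0 --> ?r (Suc m) \<noteq> 0" using S(9) sl by auto
  show ?thesis
    unfolding rstate_def using push nc cd nn S(2,3,4,6,7,8) l sl by auto
qed

lemma rstate_flip:
  assumes st: "rstate M k n r a" and ij: "i < j" "j \<le> k" "r i = 0" "r j = 0"
    and nz: "\<And>l. i < l ==> l < j ==> r l \<noteq> 0"
    and adj: "\<And>l. l < M ==> r l = 0 ==> \<not> sbetween (a i) (a j) (a l)"
  defines "r' \<equiv> \<lambda>l. if i < l \<and> l < j then - r l else r l"
  shows "rstate M k n r' (block_heights a i j) \<and> fiso M (fdir M) r a r' (block_heights a i j)"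
proof -
  have S: "fan_ok M r a" "Suc k < M" "r 0 = 0" "r k = 0" "noncross k r a" "0 < k"
    "\<forall>l<M. r l = 0 --> l \<noteq> k --> a l < a k" "\<forall>l. k < l --> l < M --> r l = 0 --> a l < a 0"
    "\<forall>l<k. r l = 0 --> r (Suc l) \<noteq> 0" "card {l. 0 < l \<and> l < k \<and> r l = 0 \<and> a l < a 0} \<le> n"
    using st unfolding rstate_def by blast+
  let ?a = "block_heights a i j"
  have flip: "fan_ok M r' ?a" "fiso M (fdir M) r a r' ?a"
    unfolding r'_def by (rule fan_flip[OF fan_dirs_fdir S(1) ij(1) _ ij(3,4) nz adj]; use S ij in auto)+
  have z: "r' l = 0 \<longleftrightarrow> r l = 0" for l by (simp add: r'_def)
  have az: "?a l = a l" if "r l = 0" for l using nz[of l] that by (auto simp: block_heights_def)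
  have nc: "noncross k r' ?a"
    by (rule noncross_flip[OF S(5,1) _ ij nz adj]) (use S az in "auto simp: r'_def")
  have eq: "{l. 0 < l \<and> l < k \<and> r' l = 0 \<and> ?a l < ?a 0} = {l. 0 < l \<and> l < k \<and> r l = 0 \<and> a l < a 0}"
    using az z S(3) by auto
  show ?thesis
    unfolding rstate_def eq using flip nc S az z by auto
qed

text \<open>Induction on the zeros of the remaining strand. A zero where the axis is merely touched
  is pushed off. A block with both ends at \<open>a 0\<close> or above, other than the whole strand,
  is flipped, which turns one of its ends into a touching. If neither exists, then unless there are
  no zeros at all, every outer zero and vertex 0 is followed by a zero below \<open>a 0\<close>.
  These successors are distinct, so there are at most \<open>n - 1\<close> outer zeros.\<close>

lemma rstate_reduce:
  assumes "rstate M k n r a" "n \<ge> 1"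
  shows "\<exists>r' a'. fan_ok M r' a' \<and> fiso M (fdir M) r a r' a' \<and> (\<forall>l\<le>M. r' l = 0 --> r l = 0) \<and>
    card {l. 0 < l \<and> l < k \<and> r' l = 0} < 2 * n"
  using assms(1)
proof (induction "card {l. 0 < l \<and> l < k \<and> r l = 0}" arbitrary: r a rule: less_induct)
  case less
  note st = less.prems
  have S: "fan_ok M r a" "Suc k < M" "r 0 = 0" "r k = 0" "noncross k r a" "0 < k"
    "\<forall>l<M. r l = 0 --> l \<noteq> k --> a l < a k" "\<forall>l. k < l --> l < M --> r l = 0 --> a l < a 0"
    "\<forall>l<k. r l = 0 --> r (Suc l) \<noteq> 0" "card {l. 0 < l \<and> l < k \<and> r l = 0 \<and> a l < a 0} \<le> n"
    using st unfolding rstate_def by blast+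
  have top: "a l < a k" if "l < k" "r l = 0" for l using S(2,7) that by auto
  have dist: "a l \<noteq> a m" if "r l = 0" "r m = 0" "l \<noteq> m" "l \<le> k" "m \<le> k" for l m
    using fan_okD(5)[OF S(1), of l m] that S(2) by auto
  have push: ?case if st': "rstate M k n r1 a1" and iso: "fiso M (fdir M) r a r1 a1" and z1: "\<And>m. r1 m = 0 \<longleftrightarrow> r m = 0"
    and l: "0 < l" "l < k" "r1 l = 0" "r1 (l - 1) * r1 (Suc l) > 0" for r1 a1 l
  proof -
    let ?r = "r1(l := r1 (Suc l))"
    note p = rstate_push[OF st' l]
    have sl: "r1 (Suc l) \<noteq> 0" using l by auto
    have "{m. 0 < m \<and> m < k \<and> ?r m = 0} \<subset> {m. 0 < m \<and> m < k \<and> r m = 0}"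
      using l sl z1 by auto
    hence "card {m. 0 < m \<and> m < k \<and> ?r m = 0} < card {m. 0 < m \<and> m < k \<and> r m = 0}"
      by (intro psubset_card_mono) auto
    from less.hyps[OF this conjunct1[OF p]] obtain r' a' where
      *: "fan_ok M r' a'" "fiso M (fdir M) ?r a1 r' a'" "\<forall>l\<le>M. r' l = 0 --> ?r l = 0"
      "card {l. 0 < l \<and> l < k \<and> r' l = 0} < 2 * n" by blast
    have "fiso M (fdir M) r a r' a'" by (rule fiso_trans[OF fiso_trans[OF iso conjunct2[OF p]] *(2)])
    moreover have "\<forall>m\<le>M. r' m = 0 --> r m = 0" using *(3) z1 l(3) by (metis fun_upd_apply)
    ultimately show ?case using * by blast
  qed
  show ?case
  proof (cases "\<exists>l. 0 < l \<and> l < k \<and> r l = 0 \<and> r (l - 1) * r (Suc l) > 0")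
    case True
    then obtain l where "0 < l" "l < k" "r l = 0" "r (l - 1) * r (Suc l) > 0" by blast
    moreover have "fiso M (fdir M) r a r a" using S(1,2) by (intro fiso_refl fan_dirs_fdir) auto
    ultimately show ?thesis using push[OF st, of l] by blast
  next
    case no_touch: False
    have genuine: "r (l - 1) * r (Suc l) < 0" if l: "0 < l" "l < k" "r l = 0" for l
    proof -
      have "r (Suc l) \<noteq> 0" using S(9) l by auto
      moreover have "r (l - 1) \<noteq> 0" using S(9)[rule_format, of "l - 1"] l by (auto simp: less_imp_diff_less)
      ultimately have "r (l - 1) * r (Suc l) \<noteq> 0" by simp
      thus ?thesis using no_touch l by (metis linorder_neqE_linordered_idom)
    qed
    \<comment> \<open>The candidates for a flip. The block from 0 to \<open>k\<close> is excluded
      because both of its ends must remain zeros.\<close>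
    define C where "C = (\<lambda>(i, j). i < j \<and> j \<le> k \<and> r i = 0 \<and> r j = 0 \<and> (\<forall>m. i < m --> m < j --> r m \<noteq> 0) \<and>
      a 0 \<le> a i \<and> a 0 \<le> a j \<and> \<not> (i = 0 \<and> j = k))"
    define \<mu> where "\<mu> = (\<lambda>(i, j). card {m. m \<le> k \<and> r m = 0 \<and> sbetween (a i) (a j) (a m)})"
    show ?thesis
    proof (cases "\<exists>p. C p")
      case True
      \<comment> \<open>A candidate with the fewest strands between its ends. A strand in between
        would produce a candidate nested inside it with fewer, so the ends are neighbours on the
        axis.\<close>
      define p where "p = arg_min \<mu> C"
      have "C p" and pmin: "\<And>q. C q ==> \<mu> p \<le> \<mu> q"
        unfolding p_def using True by (auto intro: arg_min_natI arg_min_nat_le)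
      obtain i j where pij: "p = (i, j)" by fastforce
      have ij: "i < j" "j \<le> k" "r i = 0" "r j = 0" "\<And>m. i < m ==> m < j ==> r m \<noteq> 0"
        "a 0 \<le> a i" "a 0 \<le> a j" "\<not> (i = 0 \<and> j = k)"
        using \<open>C p\<close> by (auto simp: C_def pij)
      have ij2: "Suc i < j" using S(9) ij(1-4) by (metis Suc_lessI less_le_trans)
      define \<sigma> where "\<sigma> = sgn (r (Suc i))"
      have ri: "r (Suc i) \<noteq> 0" using ij(5)[of "Suc i"] ij2 by auto
      have \<sigma>: "\<sigma> = 1 \<or> \<sigma> = -1" using ri by (auto simp: \<sigma>_def sgn_real_def)
      have s_pos: "\<sigma> * x > 0 \<longleftrightarrow> r (Suc i) * x > 0" for x
        by (auto simp: \<sigma>_def sgn_real_def zero_less_mult_iff)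
      have blk: "\<sigma> * r m > 0" if "i < m" "m < j" for m
        unfolding s_pos by (rule block_sign[OF S(1), of i _ j]) (use that ij ij2 S(2) in auto)
      have arc_of: "fan_arc r \<sigma> i1 j1" if "i1 < j1" "r i1 = 0" "r j1 = 0" "\<And>m. i1 < m ==> m < j1 ==> \<sigma> * r m > 0" for i1 j1
        unfolding fan_arc_def
      proof (intro conjI allI impI)
        fix l assume "i1 \<le> l" "l \<le> j1"
        thus "\<sigma> * r l \<ge> 0" using that by (cases "l = i1 \<or> l = j1") (auto intro: less_imp_le)
      qed (use that in auto)
      have adjR: "\<not> sbetween (a i) (a j) (a l)" if l: "l \<le> k" "r l = 0" for l
      proof
        assume bt: "sbetween (a i) (a j) (a l)"
        have "a i < a k" using top[of i] ij(1-3) by simp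
        moreover have "a j \<le> a k" using top[of j] ij(2,4) by (cases "j = k") auto
        ultimately have "a l \<noteq> a 0" "a l < a k" using bt ij(6,7) by (auto simp: sbetween_def)
        hence l0: "0 < l" "l < k" using l(1) by (metis gr0I, metis le_neq_implies_less less_irrefl)
        have lij: "l \<noteq> i" "l \<noteq> j" using bt by (auto simp: sbetween_def)
        \<comment> \<open>At a genuine zero the strand changes sides, so one of the two blocks
          meeting there is on the side of the chosen block and can be compared with it by
          noncrossing.\<close>
        have "\<exists>i' j'. i' < j' \<and> j' \<le> k \<and> r i' = 0 \<and> r j' = 0 \<and> (\<forall>m. i' < m --> m < j' --> r m \<noteq> 0) \<and> (l = i' \<or> l = j') \<and>
            (\<forall>m. i' < m --> m < j' --> \<sigma> * r m > 0)"
        proof -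
          have g: "r (l - 1) * r (Suc l) < 0" by (rule genuine[OF l0 l(2)])
          have "\<sigma> * r (l - 1) > 0 \<or> \<sigma> * r (Suc l) > 0"
            using g \<sigma> by (auto simp: mult_less_0_iff)
          thus ?thesis
          proof
            assume s: "\<sigma> * r (Suc l) > 0"
            obtain j' where j': "l < j'" "j' \<le> k" "r j' = 0" "\<And>m. l < m ==> m < j' ==> r m \<noteq> 0"
              using next_zero[of l k r] l0 S(4) by blast
            have "\<sigma> * r m > 0" if m: "l < m" "m < j'" for m
            proof -
              have "r (Suc l) * r m > 0" by (rule block_sign[OF S(1), of l _ j']) (use m j' S(2) in auto)
              thus ?thesis using s by (auto simp: zero_less_mult_iff)
            qed
            thus ?thesis using j' l by blast
          next
            assume s: "\<sigma> * r (l - 1) > 0"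
            obtain i' where i': "i' < l" "r i' = 0" "\<And>m. i' < m ==> m < l ==> r m \<noteq> 0"
              using prev_zero[of l r] l0 S(3) by blast
            have "i' \<noteq> l - 1" using s i'(2) by auto
            hence "i' < l - 1" using i'(1) by linarith
            have "\<sigma> * r m > 0" if m: "i' < m" "m < l" for m
            proof -
              have "r (l - 1) * r m > 0" by (rule block_sign[OF S(1), of i' _ l]) (use m i' \<open>i' < l - 1\<close> S(2) l0 in auto)
              thus ?thesis using s by (auto simp: zero_less_mult_iff)
            qed
            thus ?thesis using i' l l0 by (metis less_imp_le)
          qed
        qed
        then obtain i' j' where ij': "i' < j'" "j' \<le> k" "r i' = 0" "r j' = 0" "\<And>m. i' < m ==> m < j' ==> r m \<noteq> 0"
          "l = i' \<or> l = j'" "\<And>m. i' < m ==> m < j' ==> \<sigma> * r m > 0" by blast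
        have ij2': "Suc i' < j'" using S(9) ij'(1-4) by (metis Suc_lessI less_le_trans)
        have "j \<le> i' \<or> j' \<le> i"
        proof (rule ccontr)
          assume "\<not> (j \<le> i' \<or> j' \<le> i)"
          hence "i' < j" "i < j'" by auto
          moreover have "\<not> (i < i' \<and> i' < j)" "\<not> (i < j' \<and> j' < j)" "\<not> (i' < i \<and> i < j')" "\<not> (i' < j \<and> j < j')"
            using ij(5) ij'(5) ij(3,4) ij'(3,4) by blast+
          ultimately show False using lij ij'(6) ij(1) ij'(1) by auto
        qed
        moreover have "j \<noteq> i'"
        proof
          assume e: "j = i'"
          hence g: "r (j - 1) * r (Suc j) < 0" using ij(1) ij'(1,2,3) by (intro genuine) auto
          have "\<sigma> * r (j - 1) > 0" "\<sigma> * r (Suc j) > 0" using blk[of "j - 1"] ij'(7)[of "Suc j"] ij2 ij2' e by auto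
          thus False using g \<sigma> by (auto simp: mult_less_0_iff)
        qed
        moreover have "j' \<noteq> i"
        proof
          assume e: "j' = i"
          hence g: "r (i - 1) * r (Suc i) < 0" using ij(1,2) ij'(1,4) by (intro genuine) auto
          have "\<sigma> * r (i - 1) > 0" "\<sigma> * r (Suc i) > 0" using blk[of "Suc i"] ij'(7)[of "i - 1"] ij2 ij2' e by auto
          thus False using g \<sigma> by (auto simp: mult_less_0_iff)
        qed
        ultimately have dj: "j < i' \<or> j' < i" by auto
        have sp: "sep (a i) (a j) (a i') \<longleftrightarrow> sep (a i) (a j) (a j')"
          by (rule noncrossD[OF S(5) \<sigma> _ _ ij(2) ij'(2) dj]) (use arc_of ij ij' blk in auto)
        have ne: "a i' \<noteq> a i" "a i' \<noteq> a j" "a j' \<noteq> a i" "a j' \<noteq> a j"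
          by (rule dist; use ij ij' dj in auto)+
        have both: "sbetween (a i) (a j) (a i')" "sbetween (a i) (a j) (a j')"
          using sp bt ij'(6) sep_sbetween ne by metis+
        have "a 0 \<le> a i'" "a 0 \<le> a j'" using both ij(6,7) by (auto simp: sbetween_def)
        hence "C (i', j')" using ij' l0 by (auto simp: C_def)
        hence "\<mu> p \<le> \<mu> (i', j')" by (rule pmin)
        moreover have "{m. m \<le> k \<and> r m = 0 \<and> sbetween (a i') (a j') (a m)} \<subset> {m. m \<le> k \<and> r m = 0 \<and> sbetween (a i) (a j) (a m)}"
        proof (intro psubsetI subsetI)
          fix m assume "m \<in> {m. m \<le> k \<and> r m = 0 \<and> sbetween (a i') (a j') (a m)}"
          thus "m \<in> {m. m \<le> k \<and> r m = 0 \<and> sbetween (a i) (a j) (a m)}"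
            using both by (auto simp: sbetween_def)
        next
          have "l \<notin> {m. m \<le> k \<and> r m = 0 \<and> sbetween (a i') (a j') (a m)}" using ij'(6) by (auto simp: sbetween_def)
          thus "{m. m \<le> k \<and> r m = 0 \<and> sbetween (a i') (a j') (a m)} \<noteq> {m. m \<le> k \<and> r m = 0 \<and> sbetween (a i) (a j) (a m)}"
            using l bt by blast
        qed
        hence "\<mu> (i', j') < \<mu> p" unfolding \<mu>_def pij by (auto intro: psubset_card_mono)
        ultimately show False by simp
      qed
      have adj: "\<not> sbetween (a i) (a j) (a l)" if l: "l < M" "r l = 0" for l
      proof (cases "l \<le> k")
        case False
        hence "a l < a 0" using S(8) l by auto
        thus ?thesis using ij(6,7) by (auto simp: sbetween_def)
      qed (use adjR l in blast)
      define r1 where "r1 l = (if i < l \<and> l < j then - r l else r l)" for l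
      note fl = rstate_flip[OF st ij(1-5) adj, folded r1_def[abs_def]]
      have z1: "r1 m = 0 \<longleftrightarrow> r m = 0" for m by (simp add: r1_def)
      have st1: "rstate M k n r1 (block_heights a i j)" "fiso M (fdir M) r a r1 (block_heights a i j)"
        using fl unfolding r1_def[abs_def] by blast+
      show ?thesis
      \<comment> \<open>The new touching is removed at \<open>i\<close>, unless
        \<open>i = 0\<close>, which must stay a zero; then it is removed at \<open>j\<close>, which
        differs from \<open>k\<close> by the exclusion in \<open>C\<close>.\<close>
      proof (cases "i = 0")
        case False
        have "r (i - 1) * r (Suc i) < 0" by (rule genuine) (use False ij in auto)
        hence "r1 (i - 1) * r1 (Suc i) > 0" using False ij2 by (simp add: r1_def)
        thus ?thesis using push[OF st1 z1, of i] False ij z1 by auto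
      next
        case True
        hence jk: "j < k" using ij(2,8) by auto
        have "r (j - 1) * r (Suc j) < 0" by (rule genuine) (use jk ij in auto)
        moreover have "i < j - 1" using ij2 by auto
        ultimately have "r1 (j - 1) * r1 (Suc j) > 0" using ij2 by (simp add: r1_def)
        thus ?thesis using push[OF st1 z1, of j] jk ij z1 by auto
      qed
    next
      case noC: False
      define Hit where "Hit = {l. 0 < l \<and> l < k \<and> r l = 0 \<and> a l < a 0}"
      define Ext where "Ext = {l. 0 < l \<and> l < k \<and> r l = 0 \<and> \<not> a l < a 0}"
      have fin: "finite Hit" "finite Ext" by (auto simp: Hit_def Ext_def)
      have split: "{l. 0 < l \<and> l < k \<and> r l = 0} = Hit \<union> Ext" by (auto simp: Hit_def Ext_def)
      have le: "card {l. 0 < l \<and> l < k \<and> r l = 0} \<le> card Hit + card Ext" unfolding split by (rule card_Un_le)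
      have "card {l. 0 < l \<and> l < k \<and> r l = 0} < 2 * n"
      proof (cases "Hit \<union> Ext = {}")
        case True
        thus ?thesis unfolding split using assms(2) by simp
      next
        case False
        define nx where "nx l = (SOME j. l < j \<and> j \<le> k \<and> r j = 0 \<and> (\<forall>m. l < m --> m < j --> r m \<noteq> 0))" for l
        have nx: "l < nx l \<and> nx l \<le> k \<and> r (nx l) = 0 \<and> (\<forall>m. l < m --> m < nx l --> r m \<noteq> 0)" if lk: "l < k" for l
        proof -
          obtain j where "l < j" "j \<le> k" "r j = 0" "\<And>m. l < m ==> m < j ==> r m \<noteq> 0"
            using next_zero[of l k r] lk S(4) by blast
          thus ?thesis unfolding nx_def by (intro someI_ex[of "\<lambda>j. l < j \<and> j \<le> k \<and> r j = 0 \<and> (\<forall>m. l < m --> m < j --> r m \<noteq> 0)"]) blast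
        qed
        have hit: "nx l \<in> Hit" if l: "l \<in> insert 0 Ext" for l
        proof -
          have l': "l < k" "r l = 0" "a 0 \<le> a l" using l S(3,6) by (auto simp: Ext_def)
          note n = nx[OF l'(1)]
          have not0k: "\<not> (l = 0 \<and> nx l = k)"
          proof
            assume e: "l = 0 \<and> nx l = k"
            obtain z where "0 < z" "z < k" "r z = 0" using False by (auto simp: Hit_def Ext_def)
            thus False using n e by auto
          qed
          have "\<not> C (l, nx l)" using noC by blast
          hence "a (nx l) < a 0" using n l' not0k by (auto simp: C_def not_le)
          moreover have "nx l \<noteq> k" using \<open>a (nx l) < a 0\<close> top[of 0] S(3,6) by auto
          ultimately show ?thesis using n by (auto simp: Hit_def)
        qed
        have "inj_on nx (insert 0 Ext)"
        proof (rule linorder_inj_onI)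
          fix x y assume xy: "x < y" "x \<in> insert 0 Ext" "y \<in> insert 0 Ext"
          have "x < k" "y < k" "r y = 0" using xy S(3,6) by (auto simp: Ext_def)
          hence "nx x \<le> y" "y < nx y" using nx[of x] nx[of y] xy(1) by (metis not_le)+
          thus "nx x \<noteq> nx y" by simp
        qed auto
        \<comment> \<open>Counting vertex 0 among the predecessors gives the strict inequality: the
          total is at most \<open>2 * n - 1\<close>.\<close>
        hence "card (insert 0 Ext) \<le> card Hit" using hit fin by (intro card_inj_on_le) auto
        moreover have "card (insert 0 Ext) = Suc (card Ext)" using fin by (subst card_insert_disjoint) (auto simp: Ext_def)
        ultimately show ?thesis using le S(10) by (simp add: Hit_def)
      qed
      moreover have "fiso M (fdir M) r a r a" using S(1,2) by (intro fiso_refl fan_dirs_fdir) auto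
      ultimately show ?thesis using S(1) by blast
    qed
  qed
qed


section \<open>Joining the two ends of the axis through infinity\<close>

lemma fan_swing_any:
  assumes ok: "fan_ok M r a" and l: "2 \<le> l" "l + 2 \<le> M"
    and rl: "r l = 0" "r (l - 1) \<noteq> 0" "r (Suc l) \<noteq> 0"
    and low: "\<And>i. i < M ==> i \<noteq> l ==> r i = 0 ==> a l < a i"
    and high: "\<And>i. i < M ==> r i = 0 ==> a i < H"
  shows "fan_ok M r (a(l := H)) \<and> fiso M (fdir M) r a r (a(l := H))"
proof (cases "r (l - 1) * r (Suc l) < 0")
  case True
  show ?thesis by (rule fan_swing[OF ok l rl(1) True low high])
next
  case False
  \<comment> \<open>The strand only touches the axis: it is pushed off, its height becomes free, and
    it is brought back at height \<open>H\<close>.\<close>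
  hence pos: "r (l - 1) * r (Suc l) > 0" using rl by (metis linorder_neqE_linordered_idom mult_eq_0_iff)
  have Ud: "fan_dirs M (fdir M)" using l by (intro fan_dirs_fdir) simp
  note D = fan_okD[OF ok]
  let ?r = "r(l := r (Suc l))" and ?a = "a(l := H)"
  have pr: "?r i = r i" if "r i \<noteq> 0" for i using that rl by auto
  have pM: "?r M = - ?r 0" using D(2) l by auto
  have ps: "?r i * ?r (Suc i) \<ge> 0" if i: "i < M" for i
  proof -
    consider "i = l" | "Suc i = l" | "i \<noteq> l" "Suc i \<noteq> l" by blast
    thus ?thesis
    proof cases
      case 2
      thus ?thesis using pos by auto
    qed (use D(4)[OF i] in auto)
  qed
  have p1: "fan_ok M ?r a \<and> fiso M (fdir M) r a ?r a"
    by (rule fan_push[OF Ud ok]) (use pr pM ps in blast)+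
  have p2: "fan_ok M ?r ?a \<and> fiso M (fdir M) ?r a ?r ?a"
    by (rule fan_rescale[OF Ud conjunct1[OF p1]]) (use pM rl D(3) l in "auto split: if_splits")
  have rM0: "r M = 0 \<longleftrightarrow> r 0 = 0" using D(2) by simp
  have high': "a i < H" if i: "i \<le> M" "r i = 0" for i
  proof (cases "i = M")
    case True
    thus ?thesis using high[of 0] i D(3) rM0 l by simp
  qed (use high[of i] i in auto)
  have ok': "fan_ok M r ?a"
    unfolding fan_ok_def
  proof (intro conjI allI impI)
    show "r i * r (Suc i) \<ge> 0" if "i < M" for i by (rule D(4)[OF that])
    show "?a M = ?a 0" using D(3) l by auto
    fix i j assume ij: "i < M" "j < M"
    show "?a i \<noteq> ?a j" if "i \<noteq> j" "r i = 0" "r j = 0"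
      using D(5)[OF ij that] high[OF ij(1) that(2)] high[OF ij(2) that(3)] that(1) by auto
    show "\<not> sbetween (?a i) (?a (Suc i)) (?a j)" if z: "r i = 0" "r (Suc i) = 0" "r j = 0"
    proof -
      have il: "i \<noteq> l" "Suc i \<noteq> l" using z rl by auto
      have "a i < H" "a (Suc i) < H" using high'[of i] high'[of "Suc i"] z ij by auto
      thus ?thesis using il D(6)[OF ij z] by (auto simp: sbetween_def)
    qed
  qed (rule D)+
  have p3: "fan_ok M ?r ?a \<and> fiso M (fdir M) r ?a ?r ?a"
    by (rule fan_push[OF Ud ok']) (use pr pM ps in blast)+
  show ?thesis
    using ok' fiso_trans[OF fiso_trans[OF conjunct2[OF p1] conjunct2[OF p2]] fiso_sym[OF conjunct2[OF p3]]] by blast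
qed

definition lift_below :: "(nat => real) => (nat => real) => real => real => nat => real" where
  "lift_below r a B c m = (if r m = 0 \<and> a m < c then a m + B else a m)"

text \<open>The strands below \<open>c\<close> go up one at a time, the lowest first: the induction
  hypothesis is applied at the height of the highest of them, which is then the lowest strand left.
  As all of them rise by the same \<open>B\<close>, which exceeds every difference of heights, their
  order is preserved.\<close>

lemma fan_swing_all:
  assumes ok: "fan_ok M r a"
    and low: "\<And>l. l < M ==> r l = 0 ==> a l < c ==> 2 \<le> l \<and> l + 2 \<le> M \<and> r (l - 1) \<noteq> 0 \<and> r (Suc l) \<noteq> 0"
    and B: "\<And>l m. l < M ==> m < M ==> r l = 0 ==> r m = 0 ==> a m < a l + B"
  shows "fan_ok M r (lift_below r a B c) \<and> fiso M (fdir M) r a r (lift_below r a B c)"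
  using low
proof (induction "card {m. m < M \<and> r m = 0 \<and> a m < c}" arbitrary: c rule: less_induct)
  case less
  note D = fan_okD[OF ok]
  have Ud: "fan_dirs M (fdir M)" using D(1) by (intro fan_dirs_fdir) simp
  have rM0: "r M = 0 \<longleftrightarrow> r 0 = 0" using D(2) by simp
  have liftM: "lift_below r a B c M = lift_below r a B c 0" for c using rM0 D(3) by (simp add: lift_below_def)
  show ?case
  proof (cases "{m. m < M \<and> r m = 0 \<and> a m < c} = {}")
    case True
    have e: "lift_below r a B c i = a i" if "i \<le> M" "r i = 0" for i
    proof (cases "i = M")
      case T: True
      hence "\<not> a 0 < c" using True that rM0 D(1) by auto
      thus ?thesis using T D(3) by (simp add: lift_below_def)
    qed (use True that in "auto simp: lift_below_def")
    show ?thesis by (rule fan_rescale[OF Ud ok refl D(2) e liftM])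
  next
    case False
    let ?S = "{m. m < M \<and> r m = 0 \<and> a m < c}"
    have fin: "finite ?S" by simp
    have "Max (a ` ?S) \<in> a ` ?S" using fin False by (intro Max_in) auto
    then obtain l where l: "l \<in> ?S" "a l = Max (a ` ?S)" by force
    have lmax: "a m \<le> a l" if "m \<in> ?S" for m unfolding l(2) using fin that by (intro Max_ge) auto
    have "{m. m < M \<and> r m = 0 \<and> a m < a l} \<subset> ?S" using l(1) by auto
    hence cd: "card {m. m < M \<and> r m = 0 \<and> a m < a l} < card ?S" by (intro psubset_card_mono) auto
    have "fan_ok M r (lift_below r a B (a l)) \<and> fiso M (fdir M) r a r (lift_below r a B (a l))"
      by (rule less.hyps[OF cd]) (use less.prems l(1) in auto)
    note IH = conjunct1[OF this] conjunct2[OF this]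
    have lc: "2 \<le> l" "l + 2 \<le> M" "r (l - 1) \<noteq> 0" "r (Suc l) \<noteq> 0" using less.prems[of l] l(1) by auto
    have ll: "lift_below r a B (a l) l = a l" by (simp add: lift_below_def)
    have sw: "fan_ok M r ((lift_below r a B (a l))(l := a l + B)) \<and>
        fiso M (fdir M) r (lift_below r a B (a l)) r ((lift_below r a B (a l))(l := a l + B))"
    proof (rule fan_swing_any[OF IH(1) lc(1,2) _ lc(3,4)])
      fix i assume i: "i < M" "r i = 0"
      show "lift_below r a B (a l) l < lift_below r a B (a l) i" if "i \<noteq> l"
        using B[of i l] i that l(1) D(5)[of i l] by (auto simp: ll lift_below_def)
      show "lift_below r a B (a l) i < a l + B" using B[of l i] i l(1) by (auto simp: lift_below_def)
    qed (use l(1) in auto)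
    have "fan_ok M r (lift_below r a B c) \<and>
        fiso M (fdir M) r ((lift_below r a B (a l))(l := a l + B)) r (lift_below r a B c)"
    proof (rule fan_rescale[OF Ud conjunct1[OF sw] refl D(2) _ liftM])
      fix i assume i: "i \<le> M" "r i = 0"
      define i' where "i' = (if i = M then 0 else i)"
      have i': "i' < M" "r i' = 0" "a i' = a i" using i D(1,3) rM0 by (auto simp: i'_def)
      have "a i < c \<longleftrightarrow> a i < a l \<or> i = l"
        using lmax[of i'] l(1) i' D(5)[of i' l] lc by (auto simp: i'_def split: if_splits)
      thus "lift_below r a B c i = ((lift_below r a B (a l))(l := a l + B)) i"
        using i by (auto simp: lift_below_def)
    qed
    thus ?thesis using fiso_trans[OF fiso_trans[OF IH(2) conjunct2[OF sw]]] by blast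
  qed
qed

text \<open>Stacking the lower part of the axis on top of the upper one preserves the cyclic order.
  Whether a pair separates \<open>x\<close> changes by a term independent of \<open>x\<close>, so
  comparing two points gives the same result as before.\<close>

lemma noncross_lift:
  assumes nc: "noncross k r a" and B: "\<And>l m. l \<le> k ==> m \<le> k ==> r l = 0 ==> r m = 0 ==> a m < a l + B"
  shows "noncross k r (lift_below r a B c)"
proof -
  let ?a = "lift_below r a B c"
  have less: "?a p < ?a x \<longleftrightarrow> ((a p < a x) \<noteq> ((a p < c) \<noteq> (a x < c)))"
    if "p \<le> k" "x \<le> k" "r p = 0" "r x = 0" for p x
    using B[of p x] B[of x p] that by (auto simp: lift_below_def)
  have s: "sep (?a i) (?a j) (?a x) \<longleftrightarrow> (sep (a i) (a j) (a x) \<noteq> ((a i < c) \<noteq> (a j < c)))"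
    if "i \<le> k" "j \<le> k" "x \<le> k" "r i = 0" "r j = 0" "r x = 0" for i j x
    unfolding sep_def less[OF that(1,3,4,6)] less[OF that(2,3,5,6)] by blast
  show ?thesis
    unfolding noncross_def
  proof (intro allI impI)
    fix \<sigma> :: real and i j i' j'
    assume *: "\<sigma> = 1 \<or> \<sigma> = -1" "fan_arc r \<sigma> i j" "fan_arc r \<sigma> i' j'" "j \<le> k" "j' \<le> k" "j < i' \<or> j' < i"
    have b: "i \<le> k" "i' \<le> k" "r i = 0" "r j = 0" "r i' = 0" "r j' = 0" using * by (auto simp: fan_arc_def)
    show "sep (?a i) (?a j) (?a i') \<longleftrightarrow> sep (?a i) (?a j) (?a j')"
      unfolding s[OF b(1) *(4) b(2) b(3,4,5)] s[OF b(1) *(4) *(5) b(3,4,6)]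
      using noncrossD[OF nc *] by blast
  qed
qed

text \<open>The situation read off from the diagram, with the coordinate along the line as height:
  the straight strand runs from vertex \<open>k\<close> at the left end of the segment to vertex 0
  at the right end, hence \<open>a k < a 0\<close>.\<close>

definition pstate :: "nat => nat => nat => (nat => real) => (nat => real) => bool" where
  "pstate M k n r a \<longleftrightarrow> fan_ok M r a \<and> 0 < k \<and> Suc k < M \<and> r 0 = 0 \<and> r k = 0 \<and> noncross k r a \<and>
     (\<forall>l<M. r l = 0 --> r (Suc l) \<noteq> 0) \<and> a k < a 0 \<and>
     (\<forall>l. k < l --> l < M --> r l = 0 --> a k < a l \<and> a l < a 0) \<and>
     card {l. 0 < l \<and> l < k \<and> r l = 0 \<and> a k < a l \<and> a l < a 0} \<le> n"

text \<open>All zeros up to the height of \<open>k\<close> are swung to the top. This stacks the ray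
  left of the segment above the ray on its right and makes \<open>k\<close> the highest strand,
  which is the situation of \<open>rstate\<close>.\<close>

lemma pstate_reduce:
  assumes ps: "pstate M k n r a" and n: "n \<ge> 1"
  shows "\<exists>r' a'. fan_ok M r' a' \<and> fiso M (fdir M) r a r' a' \<and> (\<forall>l\<le>M. r' l = 0 --> r l = 0) \<and>
    card {l. 0 < l \<and> l < k \<and> r' l = 0} < 2 * n"
proof -
  have S: "fan_ok M r a" "0 < k" "Suc k < M" "r 0 = 0" "r k = 0" "noncross k r a"
    "\<And>l. l < M ==> r l = 0 ==> r (Suc l) \<noteq> 0" "a k < a 0"
    "\<And>l. k < l ==> l < M ==> r l = 0 ==> a k < a l \<and> a l < a 0"
    "card {l. 0 < l \<and> l < k \<and> r l = 0 \<and> a k < a l \<and> a l < a 0} \<le> n"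
    using ps unfolding pstate_def by blast+
  note D = fan_okD[OF S(1)]
  define Z where "Z = {l. l < M \<and> r l = 0}"
  have Z: "finite Z" "0 \<in> Z" "k \<in> Z" using S by (auto simp: Z_def)
  define B where "B = Max (a ` Z) - Min (a ` Z) + 1"
  have B: "a m < a l + B" if "l < M" "m < M" "r l = 0" "r m = 0" for l m
  proof -
    have "a m \<le> Max (a ` Z)" "Min (a ` Z) \<le> a l" using Z that by (auto simp: Z_def)
    thus ?thesis by (simp add: B_def)
  qed
  define W where "W = {x \<in> a ` Z. a k < x}"
  have W: "finite W" "a 0 \<in> W" using Z S(8) by (auto simp: W_def)
  \<comment> \<open>The lowest zero above \<open>a k\<close>, so that \<open>k\<close> itself is
    among the strands to be lifted.\<close>
  define c where "c = Min W"
  have "c \<in> W" unfolding c_def using W by (intro Min_in) auto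
  hence ck: "a k < c" by (simp add: W_def)
  have cle: "c \<le> x" if "x \<in> W" for x unfolding c_def using W that by auto
  have lowc: "a l < c \<longleftrightarrow> a l \<le> a k" if "l < M" "r l = 0" for l
  proof
    assume "a l < c"
    hence "a l \<notin> W" using cle[of "a l"] by auto
    thus "a l \<le> a k" using that by (auto simp: W_def Z_def)
  qed (use ck in simp)
  have lowcond: "2 \<le> l \<and> l + 2 \<le> M \<and> r (l - 1) \<noteq> 0 \<and> r (Suc l) \<noteq> 0" if l: "l < M" "r l = 0" "a l < c" for l
  proof -
    have ak: "a l \<le> a k" using lowc l by blast
    have "l \<noteq> 0" using ak S(8) by (metis not_le)
    moreover have "l \<noteq> 1" using S(7)[of 0] S(3,4) l by auto
    moreover have "l \<le> k" using S(9)[of l] ak l by force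
    moreover have "r (l - 1) \<noteq> 0" using S(7)[of "l - 1"] l \<open>l \<noteq> 0\<close> by (auto simp: less_imp_diff_less)
    ultimately show ?thesis using S(3) S(7)[OF l(1,2)] by auto
  qed
  let ?a = "lift_below r a B c"
  have sw: "fan_ok M r ?a \<and> fiso M (fdir M) r a r ?a"
    by (rule fan_swing_all[OF S(1) lowcond B])
  have a0: "?a 0 = a 0" using lowc[of 0] S(2,3,4,8) by (simp add: lift_below_def)
  have ak: "?a k = a k + B" using ck S(5) by (simp add: lift_below_def)
  have st: "rstate M k n r ?a"
    unfolding rstate_def
  proof (intro conjI allI impI)
    show "fan_ok M r ?a" using sw by blast
    show "noncross k r ?a" by (rule noncross_lift[OF S(6) B]) (use S(3) in auto)
    show "?a l < ?a k" if "l < M" "r l = 0" "l \<noteq> k" for l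
      using B[of k l] that S(3,5) lowc[of l] D(5)[of l k] unfolding ak by (auto simp: lift_below_def)
    show "?a l < ?a 0" if "k < l" "l < M" "r l = 0" for l
      using S(9)[OF that] lowc[of l] that unfolding a0 by (simp add: lift_below_def)
    have "{l. 0 < l \<and> l < k \<and> r l = 0 \<and> ?a l < ?a 0} \<subseteq> {l. 0 < l \<and> l < k \<and> r l = 0 \<and> a k < a l \<and> a l < a 0}"
    proof
      fix l assume "l \<in> {l. 0 < l \<and> l < k \<and> r l = 0 \<and> ?a l < ?a 0}"
      hence l: "0 < l" "l < k" "r l = 0" "?a l < a 0" by (auto simp: a0)
      have "\<not> a l < c"
      proof
        assume "a l < c"
        hence "?a l = a l + B" using l by (simp add: lift_below_def)
        thus False using B[of l 0] l S(3,4) by simp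
      qed
      thus "l \<in> {l. 0 < l \<and> l < k \<and> r l = 0 \<and> a k < a l \<and> a l < a 0}"
        using l lowc[of l] S(3) by (auto simp: lift_below_def)
    qed
    hence "card {l. 0 < l \<and> l < k \<and> r l = 0 \<and> ?a l < ?a 0} \<le> card {l. 0 < l \<and> l < k \<and> r l = 0 \<and> a k < a l \<and> a l < a 0}"
      by (intro card_mono) auto
    thus "card {l. 0 < l \<and> l < k \<and> r l = 0 \<and> ?a l < ?a 0} \<le> n" using S(10) by simp
  qed (use S in auto)
  from rstate_reduce[OF st n] obtain r' a' where
    *: "fan_ok M r' a'" "fiso M (fdir M) r ?a r' a'" "\<forall>l\<le>M. r' l = 0 --> r l = 0" "card {l. 0 < l \<and> l < k \<and> r' l = 0} < 2 * n" by blast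
  show ?thesis using * fiso_trans[OF conjunct2[OF sw] *(2)] by blast
qed


section \<open>Petals\<close>

lemma components_of_disjoint_closed:
  fixes X :: "'a::metric_space set"
  assumes fin: "finite \<P>" and X: "X = \<Union>\<P>"
    and con: "\<And>P. P \<in> \<P> ==> connected P" "\<And>P. P \<in> \<P> ==> P \<noteq> {}"
    and cl: "\<And>P. P \<in> \<P> ==> closedin (top_of_set X) P"
    and dis: "\<And>P Q. P \<in> \<P> ==> Q \<in> \<P> ==> P \<noteq> Q ==> P \<inter> Q = {}"
  shows "components X = \<P>"
proof -
  have comp: "P \<in> components X" if P: "P \<in> \<P>" for P
    unfolding in_components_maximal
  proof (intro conjI allI impI)
    show "P \<noteq> {}" "P \<subseteq> X" "connected P" using con P X by auto
    fix D assume D: "D \<noteq> {} \<and> P \<subseteq> D \<and> D \<subseteq> X \<and> connected D"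
    have "closedin (top_of_set X) (\<Union>(\<P> - {P}))" using fin cl by (intro closedin_Union) auto
    moreover have "\<Union>(\<P> - {P}) = X - P" using dis P unfolding X by blast
    ultimately have "openin (top_of_set X) P"
      using P X by (metis Diff_Diff_Int Union_upper inf.absorb_iff2 openin_diff openin_subtopology_self topspace_euclidean_subtopology)
    hence "openin (top_of_set D) P" using D by (metis openin_subset_trans)
    moreover have "closedin (top_of_set D) P" using cl[OF P] D by (metis closedin_subset_trans)
    ultimately have "P = {} \<or> P = D" using D connected_clopen by blast
    thus "D = P" using con(2)[OF P] by blast
  qed
  show ?thesis
  proof (intro equalityI subsetI)
    fix C assume C: "C \<in> components X"
    then obtain x where "x \<in> C" "x \<in> X" using in_components_nonempty in_components_subset by blast
    then obtain P where P: "P \<in> \<P>" "x \<in> P" using X by blast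
    hence "C = P" using components_nonoverlap[OF C comp[OF P(1)]] \<open>x \<in> C\<close> by blast
    thus "C \<in> \<P>" using P by simp
  qed (rule comp)
qed

text \<open>The default 1 closes the last petal at the end of the parameter interval.\<close>

definition next_time :: "real set => real => real" where
  "next_time T t = Min {x \<in> insert 1 T. t < x}"

text \<open>Each interval between consecutive zero times gives a connected piece whose closure adds
  only the origin. By injectivity the pieces are disjoint, and they are relatively closed, so they
  are the components.\<close>

lemma petal_components:
  fixes g :: "real => complex"
  assumes cont: "continuous_on {0..1} g" and T: "finite T" "0 \<in> T" "T \<subseteq> {0..<1}"
    and zero: "\<And>t. t \<in> {0..1} ==> g t = 0 \<longleftrightarrow> t \<in> insert 1 T"
    and inj: "\<And>s t. s \<in> {0..1} ==> t \<in> {0..1} ==> g s \<noteq> 0 ==> g s = g t ==> s = t"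
  shows "components (g ` {0..1} - {0}) = (\<lambda>t. g ` {t<..<next_time T t}) ` T"
    and "inj_on (\<lambda>t. g ` {t<..<next_time T t}) T"
    and "\<And>t. t \<in> T ==> closed (insert 0 (g ` {t<..<next_time T t}))"
proof -
  define nx where "nx = next_time T"
  have nx: "t < nx t \<and> nx t \<in> insert 1 T \<and> nx t \<le> 1 \<and> (\<forall>x\<in>insert 1 T. t < x --> nx t \<le> x)" if t: "t \<in> T" for t
  proof -
    let ?S = "{x \<in> insert 1 T. t < x}"
    have fin: "finite ?S" using T by auto
    have one: "1 \<in> ?S" using T t by auto
    have "nx t \<in> ?S" unfolding nx_def next_time_def by (rule Min_in[OF fin]) (use one in blast)
    moreover have "nx t \<le> x" if "x \<in> ?S" for x unfolding nx_def next_time_def by (rule Min_le[OF fin that])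
    ultimately show ?thesis using one by blast
  qed
  have sub: "{t<..<nx t} \<subseteq> {0..1}" "{t..nx t} \<subseteq> {0..1}" if "t \<in> T" for t using nx[OF that] T that by auto
  have nz: "g x \<noteq> 0" if "t \<in> T" "x \<in> {t<..<nx t}" for t x
  proof -
    have "x \<notin> insert 1 T" using nx[OF that(1)] that(2) by force
    thus ?thesis using zero[of x] sub[OF that(1)] that(2) by blast
  qed
  have disj: "{s<..<nx s} \<inter> {t<..<nx t} = {}" if "s \<in> T" "t \<in> T" "s < t" for s t
    using nx[OF that(1)] that by auto
  define Q where "Q t = g ` {t<..<nx t}" for t
  have Qne: "Q t \<noteq> {}" if "t \<in> T" for t using nx[OF that] by (auto simp: Q_def)
  have Qdisj: "Q s \<inter> Q t = {}" if st: "s \<in> T" "t \<in> T" "s \<noteq> t" for s t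
  proof (rule ccontr)
    assume "Q s \<inter> Q t \<noteq> {}"
    then obtain w where w: "w \<in> Q s" "w \<in> Q t" by blast
    obtain x where x: "x \<in> {s<..<nx s}" "w = g x" using w(1) unfolding Q_def by (rule imageE)
    obtain y where y: "y \<in> {t<..<nx t}" "w = g y" using w(2) unfolding Q_def by (rule imageE)
    have "x = y"
    proof (rule inj)
      show "x \<in> {0..1}" "y \<in> {0..1}" using sub(1)[OF st(1)] sub(1)[OF st(2)] x(1) y(1) by blast+
      show "g x \<noteq> 0" by (rule nz[OF st(1) x(1)])
      show "g x = g y" using x y by simp
    qed
    note xy = x(1) y(1)[folded this]
    show False using disj[of s t] disj[of t s] st xy by (cases "s < t") auto
  qed
  have "inj_on Q T"
  proof (rule inj_onI, rule ccontr)
    fix s t assume "s \<in> T" "t \<in> T" "Q s = Q t" "s \<noteq> t"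
    thus False using Qdisj[of s t] Qne[of s] by simp
  qed
  thus "inj_on (\<lambda>t. g ` {t<..<next_time T t}) T" by (simp only: Q_def[abs_def] nx_def)
  have closure: "insert 0 (Q t) = g ` {t..nx t}" if t: "t \<in> T" for t
  proof -
    have "g t = 0" "g (nx t) = 0" using zero[of t] zero[of "nx t"] t T nx[OF t] by auto
    moreover have "{t..nx t} = {t<..<nx t} \<union> {t, nx t}" using nx[OF t] by auto
    ultimately show ?thesis by (auto simp: Q_def)
  qed
  have cmp: "compact (insert 0 (Q t))" if "t \<in> T" for t
    unfolding closure[OF that] by (intro compact_continuous_image continuous_on_subset[OF cont] sub(2)[OF that] compact_Icc)
  show "closed (insert 0 (g ` {t<..<next_time T t}))" if "t \<in> T" for t
    using cmp[OF that] by (simp add: Q_def nx_def compact_imp_closed)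
  have un: "g ` {0..1} - {0} = \<Union>(Q ` T)"
  proof (intro equalityI subsetI)
    fix w assume "w \<in> g ` {0..1} - {0}"
    then obtain x where x: "x \<in> {0..1}" "w = g x" "g x \<noteq> 0" by auto
    hence xT: "x \<notin> insert 1 T" using zero by auto
    define t where "t = Max {s \<in> T. s \<le> x}"
    have fin: "finite {s \<in> T. s \<le> x}" using T by auto
    have "t \<in> {s \<in> T. s \<le> x}" unfolding t_def by (rule Max_in[OF fin]) (use T x in auto)
    moreover have tmax: "s \<le> t" if "s \<in> T" "s \<le> x" for s unfolding t_def using fin that by (intro Max_ge) auto
    ultimately have t: "t \<in> T" "t < x" using xT by (auto simp: order_less_le)
    have "x < nx t"
    proof (rule ccontr)
      assume "\<not> x < nx t"
      hence "nx t \<le> x" by simp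
      moreover have "nx t \<noteq> 1" using \<open>nx t \<le> x\<close> x xT by auto
      ultimately have "nx t \<le> t" using nx[OF t(1)] tmax by auto
      thus False using nx[OF t(1)] by simp
    qed
    hence "x \<in> {t<..<nx t}" using t by simp
    hence "w \<in> Q t" unfolding Q_def x(2) by (rule imageI)
    thus "w \<in> \<Union>(Q ` T)" using t by blast
  next
    fix w assume "w \<in> \<Union>(Q ` T)"
    then obtain t x where t: "t \<in> T" "x \<in> {t<..<nx t}" "w = g x" by (auto simp: Q_def)
    hence "x \<in> {0..1}" "g x \<noteq> 0" using nz[OF t(1,2)] sub(1)[OF t(1)] by blast+
    thus "w \<in> g ` {0..1} - {0}" unfolding t(3) by simp
  qed
  have "components (g ` {0..1} - {0}) = Q ` T"
  proof (rule components_of_disjoint_closed[OF _ un])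
    show "finite (Q ` T)" using T by simp
    fix P assume "P \<in> Q ` T"
    then obtain t where t: "t \<in> T" "P = Q t" by blast
    show "connected P" unfolding t(2) Q_def
      by (intro connected_continuous_image continuous_on_subset[OF cont] sub(1)[OF t(1)] connected_Ioo)
    show "P \<noteq> {}" using t Qne by simp
    have "Q t \<subseteq> g ` {0..1} - {0}" unfolding un using t(1) by blast
    hence "P = (g ` {0..1} - {0}) \<inter> insert 0 (Q t)" unfolding t(2) by blast
    thus "closedin (top_of_set (g ` {0..1} - {0})) P"
      using compact_imp_closed[OF cmp[OF t(1)]] by (metis closedin_closed_Int)
    fix P' assume "P' \<in> Q ` T" "P \<noteq> P'"
    thus "P \<inter> P' = {}" using t Qdisj by auto
  qed
  thus "components (g ` {0..1} - {0}) = (\<lambda>t. g ` {t<..<next_time T t}) ` T"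
    by (simp add: Q_def[abs_def] nx_def)
qed

lemma inside_unit_disc:
  fixes S :: "complex set"
  assumes "closed S" "S \<subseteq> cball 0 1"
  shows "inside S \<subseteq> ball 0 1"
proof -
  have "- cball 0 1 \<subseteq> outside S" using assms(2) by (intro outside_subset_convex) auto
  hence "inside S \<subseteq> cball 0 1" using inside_Int_outside[of S] by blast
  hence "inside S \<subseteq> interior (cball 0 1)" using open_inside[OF assms(1)] by (rule interior_maximal)
  thus ?thesis by simp
qed

text \<open>The inside of a closed set within the unit disc lies in the open disc, so the point
  \<open>u\<close> of \<open>B\<close> on the circle is outside. As \<open>B\<close> is connected
  and misses the loop, it cannot also reach the inside.\<close>

lemma petals_not_nested:
  fixes A B :: "complex set"
  assumes "closed (insert 0 A)" "insert 0 A \<subseteq> cball 0 1" "connected B" "B \<inter> insert 0 A = {}" "u \<in> B" "norm u = 1"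
  shows "B \<inter> inside (insert 0 A) = {}"
proof (rule ccontr)
  assume ne: "B \<inter> inside (insert 0 A) \<noteq> {}"
  have "u \<notin> inside (insert 0 A)" using inside_unit_disc[OF assms(1,2)] assms(6) by auto
  hence "u \<in> outside (insert 0 A)" using assms(4,5) inside_Un_outside[of "insert 0 A"] by blast
  hence "insert 0 A \<inter> B \<noteq> {}"
    using inside_outside_intersect_connected[OF assms(3), of "insert 0 A"] ne assms(5) by blast
  thus False using assms(4) by blast
qed

lemma simple_polygon_rotate:
  assumes sp: "simple_polygon M V" and V: "\<And>i. V (i + M) = V i"
  shows "simple_polygon M (\<lambda>i. V (i + c))"
proof -
  have M: "M \<ge> 1" using sp by (simp add: simple_polygon_def)
  have modE: "edge_pt V (i mod M) s = edge_pt V i s" for i s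
    by (simp add: edge_pt_def periodic_mod[of V M, OF V])
  have sh: "edge_pt (\<lambda>i. V (i + c)) i s = edge_pt V (i + c) s" for i s by (simp add: edge_pt_def)
  show ?thesis
    unfolding simple_polygon_def
  proof (intro conjI allI impI)
    show "1 \<le> M" by (rule M)
    show "V (M + c) = V (0 + c)" using V[of c] by (simp add: add.commute)
    fix i j s t assume *: "i < M" "j < M" "0 \<le> s" "s < (1::real)" "0 \<le> t" "t < (1::real)"
      "edge_pt (\<lambda>i. V (i + c)) i s = edge_pt (\<lambda>i. V (i + c)) j t"
    have "edge_pt V ((i + c) mod M) s = edge_pt V ((j + c) mod M) t" using *(7) unfolding sh modE .
    hence "(i + c) mod M = (j + c) mod M \<and> s = t"
      using sp * M unfolding simple_polygon_def by (meson mod_less_divisor less_le_trans zero_less_one)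
    thus "i = j" "s = t" using mod_add_inj *(1,2) by blast+
  qed
qed


lemma nat_frac_eq:
  assumes "real i + s = real j" "0 \<le> s" "s < 1"
  shows "s = 0" "i = j"
proof -
  have "real i \<le> real j" "real j < real i + 1" using assms by linarith+
  thus ij: "i = j" by linarith
  show "s = 0" using assms(1) unfolding ij by simp
qed

text \<open>The knot starts at vertex 1, because vertex 0 projects to the multi-crossing and the
  start must not. Petals are counted in the unshifted parametrisation \<open>g\<close>, whose first
  parameter is a zero. Condition \<open>opp\<close> makes the strands straight at the axis, and
  vertices of norm 1 make every petal reach the unit circle, which excludes nesting.\<close>

lemma petal_polygon:
  fixes V :: "nat => space" and M :: nat
  defines "Z \<equiv> {i. i < M \<and> fst (V i) = 0}"
  defines "\<gamma> \<equiv> pgon M (\<lambda>i. V (i + 1))"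
  assumes sp: "simple_polygon M V" and per: "\<And>i. V (i + M) = V i"
    and z0: "fst (V 0) = 0" and nz: "\<And>i. i < M ==> fst (V i) = 0 ==> fst (V (Suc i)) \<noteq> 0"
    and nrm: "\<And>i. i < M ==> fst (V i) = 0 \<or> norm (fst (V i)) = 1"
    and enz: "\<And>i s. i < M ==> 0 < s ==> s < 1 ==> fst (edge_pt V i s) \<noteq> 0"
    and inj: "\<And>i j s t. i < M ==> j < M ==> 0 \<le> s ==> s < 1 ==> 0 \<le> t ==> t < 1 ==>
        fst (edge_pt V i s) = fst (edge_pt V j t) ==> fst (edge_pt V i s) \<noteq> 0 ==> i = j \<and> s = t"
    and opp: "\<And>i. i < M ==> fst (V (Suc i)) = 0 ==> fst (V i) = - fst (V (Suc (Suc i)))"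
    and trans: "\<And>i j. i < M ==> j < M ==> i \<noteq> j ==> fst (V i) = 0 ==> fst (V j) = 0 ==>
        cross (fst (V (Suc i))) (fst (V (Suc j))) \<noteq> 0"
    and two: "card Z \<ge> 2"
  shows "petal_projection \<gamma> 0" "card (petals \<gamma> 0) = card Z" "\<gamma> ` {0..1} = polygon_set M V"
proof -
  have M: "M \<ge> 1" using sp by (simp add: simple_polygon_def)
  have VM: "V M = V 0" using per[of 0] by simp
  define W where "W i = V (i + 1)" for i
  have Wsp: "simple_polygon M W" unfolding W_def[abs_def] by (rule simple_polygon_rotate[OF sp per])
  have \<gamma>W: "\<gamma> = pgon M W" by (simp add: \<gamma>_def W_def[abs_def])
  have pk: "polygonal_knot \<gamma>" unfolding \<gamma>W by (rule simple_polygon_knot[OF Wsp])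
  show img: "\<gamma> ` {0..1} = polygon_set M V"
    using polygon_set_shift[of V M 1, OF per M] unfolding \<gamma>_def polygon_set_def[of M "\<lambda>i. V (i + 1)"] by simp
  have Wedge: "edge_pt W i s = edge_pt V (Suc i mod M) s" for i s
    using periodic_mod[of V M "Suc i", OF per] by (simp add: edge_pt_def W_def)
  have Wm: "Suc i mod M < M" for i using M by simp
  have g_at: "shadow \<gamma> ((real i + s) / real M) = fst (edge_pt V (Suc i mod M) s)" if "0 \<le> s" "s < 1" for i s
    unfolding shadow_def o_def \<gamma>W by (simp add: pgon_edge[OF that M] Wedge)
  define g where "g t = fst (pgon M V t)" for t
  have g_at': "g ((real i + s) / real M) = fst (edge_pt V i s)" if "0 \<le> s" "s < 1" for i s
    unfolding g_def by (simp add: pgon_edge[OF that M])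
  have g_vert: "g (real i / real M) = fst (V i)" for i
    unfolding g_def by (simp add: pgon_vertex[OF M])
  have ends: "g 1 = 0" using g_vert[of M] VM z0 M by simp
  have edge0: "fst (edge_pt V i s) = 0 \<longleftrightarrow> s = 0 \<and> fst (V i) = 0" if "i < M" "0 \<le> s" "s < 1" for i s
    using enz[of i s] that by (cases "s = 0") auto
  define T where "T = (\<lambda>i. real i / real M) ` Z"
  have Zfin: "finite Z" by (simp add: Z_def)
  have cardT: "card T = card Z"
    unfolding T_def by (rule card_image) (use M in "auto simp: inj_on_def")
  have T: "finite T" "0 \<in> T" "T \<subseteq> {0..<1}"
    using Zfin M z0 by (auto simp: T_def Z_def image_iff intro!: bexI[of _ 0])
  have gzero: "g t = 0 \<longleftrightarrow> t \<in> insert 1 T" if t: "t \<in> {0..1}" for t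
  proof (cases "t = 1")
    case False
    then obtain i s where i: "i < M" "0 \<le> s" "s < 1" "t = (real i + s) / real M"
      using pgon_param[of t M] t M by auto
    have "g t = 0 \<longleftrightarrow> s = 0 \<and> fst (V i) = 0" unfolding i(4) g_at'[OF i(2,3)] by (rule edge0[OF i(1-3)])
    also have "\<dots> \<longleftrightarrow> t \<in> T"
    proof
      assume "s = 0 \<and> fst (V i) = 0"
      thus "t \<in> T" using i by (auto simp: T_def Z_def)
    next
      assume "t \<in> T"
      then obtain j where j: "j < M" "fst (V j) = 0" "t = real j / real M" by (auto simp: T_def Z_def)
      hence "real i + s = real j" using i(4) M by simp
      from nat_frac_eq[OF this i(2,3)] have "s = 0" "i = j" by auto
      thus "s = 0 \<and> fst (V i) = 0" using j by simp
    qed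
    finally show ?thesis using False by simp
  qed (use ends in simp)
  have ginj: "s = t" if st: "s \<in> {0..1}" "t \<in> {0..1}" "g s \<noteq> 0" "g s = g t" for s t
  proof -
    have "s \<noteq> 1" "t \<noteq> 1" using st ends by auto
    then obtain i s' j t' where i: "i < M" "0 \<le> s'" "s' < 1" "s = (real i + s') / real M"
      and j: "j < M" "0 \<le> t'" "t' < 1" "t = (real j + t') / real M"
      using pgon_param[of s M] pgon_param[of t M] st(1,2) M by (metis atLeastAtMost_iff order_less_le)
    hence "i = j \<and> s' = t'"
      using st(3,4) unfolding i(4) j(4) g_at'[OF i(2,3)] g_at'[OF j(2,3)] by (intro inj)
    thus ?thesis using i j by simp
  qed
  have cg: "continuous_on {0..1} g"
    unfolding g_def using pa_continuous[OF pa_fst[OF pa_pgon[OF M]]] .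
  have PC1: "components (g ` {0..1} - {0}) = (\<lambda>t. g ` {t<..<next_time T t}) ` T"
    by (rule petal_components(1)[OF cg T gzero ginj])
  have PC2: "inj_on (\<lambda>t. g ` {t<..<next_time T t}) T"
    by (rule petal_components(2)[OF cg T gzero ginj])
  have PC3: "closed (insert 0 (g ` {t<..<next_time T t}))" if tT: "t \<in> T" for t
    by (rule petal_components(3)[OF cg T gzero ginj tT])
  have X: "path_image (shadow \<gamma>) = g ` {0..1}"
  proof -
    have "path_image (shadow \<gamma>) = fst ` (\<gamma> ` {0..1})" by (simp add: path_image_def shadow_def image_comp)
    also have "\<dots> = fst ` (pgon M V ` {0..1})" unfolding img polygon_set_def ..
    also have "\<dots> = g ` {0..1}" by (simp add: g_def[abs_def] image_image)
    finally show ?thesis .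
  qed
  have pet: "petals \<gamma> 0 = (\<lambda>t. g ` {t<..<next_time T t}) ` T"
    unfolding petals_def X by (rule PC1)
  show "card (petals \<gamma> 0) = card Z"
    unfolding pet cardT[symmetric] by (rule card_image[OF PC2])
  have shadow0: "shadow \<gamma> t = 0 \<longleftrightarrow> (\<exists>i<M. t = real i / real M \<and> fst (V (Suc i mod M)) = 0)" if t: "t \<in> {0..<1}" for t
  proof -
    obtain i s where i: "i < M" "0 \<le> s" "s < 1" "t = (real i + s) / real M"
      using pgon_param[of t M] t M by auto
    have e: "shadow \<gamma> t = 0 \<longleftrightarrow> s = 0 \<and> fst (V (Suc i mod M)) = 0"
      unfolding i(4) g_at[OF i(2,3)] by (rule edge0[OF Wm i(2,3)])
    show ?thesis
    proof
      assume "shadow \<gamma> t = 0"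
      thus "\<exists>i<M. t = real i / real M \<and> fst (V (Suc i mod M)) = 0" using e i by auto
    next
      assume "\<exists>i<M. t = real i / real M \<and> fst (V (Suc i mod M)) = 0"
      then obtain j where j: "j < M" "t = real j / real M" "fst (V (Suc j mod M)) = 0" by blast
      hence "real i + s = real j" using i(4) M by simp
      from nat_frac_eq[OF this i(2,3)] have "s = 0" "i = j" by auto
      thus "shadow \<gamma> t = 0" using e j by simp
    qed
  qed
  have passes0: "passes \<gamma> 0 = {t. \<exists>i<M. t = real i / real M \<and> fst (V (Suc i mod M)) = 0}" (is "_ = ?P")
  proof (intro equalityI subsetI)
    fix t assume "t \<in> passes \<gamma> 0"
    thus "t \<in> ?P" using shadow0[of t] by (auto simp: passes_def)
  next
    fix t assume t: "t \<in> ?P"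
    then obtain i where i: "i < M" "t = real i / real M" by blast
    have "t \<in> {0..<1}" using i M by simp
    thus "t \<in> passes \<gamma> 0" using shadow0[of t] t by (auto simp: passes_def)
  qed
  have fin: "finite (passes \<gamma> 0)"
    by (rule finite_subset[of _ "(\<lambda>i. real i / real M) ` {..<M}"]) (auto simp: passes0)
  have fst1: "fst (V 1) \<noteq> 0" using nz[of 0] z0 M by simp
  have "Z \<subseteq> {..<M}" by (auto simp: Z_def)
  hence "card Z \<le> card {..<M}" by (intro card_mono) auto
  hence M2: "M \<ge> 2" using two by simp
  have start: "shadow \<gamma> 0 \<noteq> 0"
    using g_at[of 0 0] fst1 M2 by simp
  have crossing: "crossings \<gamma> = {0}"
  proof (intro equalityI subsetI)
    fix c assume "c \<in> crossings \<gamma>"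
    then obtain s t where st: "s \<in> {0..<1}" "t \<in> {0..<1}" "shadow \<gamma> s = c" "shadow \<gamma> t = c" "s \<noteq> t"
      by (auto simp: crossings_def passes_def)
    obtain i s' where i: "i < M" "0 \<le> s'" "s' < 1" "s = (real i + s') / real M"
      using pgon_param[of s M] st M by auto
    obtain j t' where j: "j < M" "0 \<le> t'" "t' < 1" "t = (real j + t') / real M"
      using pgon_param[of t M] st M by auto
    have "c = 0"
    proof (rule ccontr)
      assume c: "c \<noteq> 0"
      have "Suc i mod M = Suc j mod M \<and> s' = t'"
      proof (rule inj[OF Wm Wm i(2,3) j(2,3)])
        show "fst (edge_pt V (Suc i mod M) s') = fst (edge_pt V (Suc j mod M) t')"
          using st(3,4) unfolding i(4) j(4) g_at[OF i(2,3)] g_at[OF j(2,3)] by simp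
        show "fst (edge_pt V (Suc i mod M) s') \<noteq> 0" using st(3) c unfolding i(4) g_at[OF i(2,3)] by simp
      qed
      hence "i = j" using i(1) j(1) by (auto simp: mod_Suc split: if_splits)
      thus False using st(5) i j \<open>_ \<and> s' = t'\<close> by simp
    qed
    thus "c \<in> {0}" by simp
  next
    fix c :: complex assume "c \<in> {0}"
    have "\<exists>i\<in>Z. \<exists>j\<in>Z. i \<noteq> j"
      using two Zfin by (metis (full_types) card_le_Suc0_iff_eq not_less_eq_eq numeral_2_eq_2)
    then obtain i j where ij: "i \<in> Z" "j \<in> Z" "i \<noteq> j" by blast
    define p where "p i = (if i = 0 then M - 1 else i - 1)" for i
    have p: "p i < M" "Suc (p i) mod M = i" if iZ: "i \<in> Z" for i
      using iZ M by (auto simp: p_def Z_def)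
    have "real (p i) / real M \<in> passes \<gamma> 0" "real (p j) / real M \<in> passes \<gamma> 0"
      using p[OF ij(1)] p[OF ij(2)] ij by (auto simp: passes0 Z_def)
    moreover have "real (p i) / real M \<noteq> real (p j) / real M"
      using p[OF ij(1)] p[OF ij(2)] ij(3) M by auto
    ultimately show "c \<in> crossings \<gamma>" using \<open>c \<in> {0}\<close> unfolding crossings_def by blast
  qed
  have deriv: "(shadow \<gamma> has_vector_derivative (real M *\<^sub>R fst (V (Suc (Suc i mod M))))) (at (real i / real M))"
    if i: "i < M" "fst (V (Suc i mod M)) = 0" for i
  proof -
    define d where "d = fst (V (Suc (Suc i mod M)))"
    define t0 where "t0 = real i / real M"
    have i0: "i \<noteq> 0" using i fst1 M2 by (intro notI) simp
    \<comment> \<open>Before and after \<open>t0\<close> the strand follows different edges;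
      \<open>opp\<close> makes both affine with the same velocity.\<close>
    have loc: "shadow \<gamma> t = (real M * (t - t0)) *\<^sub>R d" if t: "t \<in> ball t0 (1 / real M)" for t
    proof (cases "t0 \<le> t")
      case True
      define s where "s = real M * (t - t0)"
      have s: "0 \<le> s" "s < 1" using True t M by (auto simp: s_def dist_real_def field_simps)
      have "t = (real i + s) / real M" using M by (simp add: s_def t0_def field_simps)
      hence "shadow \<gamma> t = mix s (fst (V (Suc i mod M))) d"
        using g_at[OF s, of i] by (simp add: edge_pt_def d_def)
      thus ?thesis using i(2) by (simp add: s_def)
    next
      case False
      define s where "s = 1 + real M * (t - t0)"
      have s: "0 \<le> s" "s < 1" using False t M by (auto simp: s_def dist_real_def field_simps)
      have "t = (real (i - 1) + s) / real M" using M i0 by (simp add: s_def t0_def field_simps of_nat_diff)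
      hence "shadow \<gamma> t = fst (edge_pt V (Suc (i - 1) mod M) s)" using g_at[OF s, of "i - 1"] by simp
      also have "Suc (i - 1) mod M = i" using i i0 by simp
      also have "fst (edge_pt V i s) = mix s (fst (V i)) (fst (V (Suc i)))" by (simp add: edge_pt_def)
      also have VS: "V (Suc i) = V (Suc i mod M)" using periodic_mod(1)[of V M "Suc i", OF per] by simp
      also have "fst (V i) = - d"
      proof -
        have "V (Suc (Suc i)) = V (Suc (Suc i mod M))" using periodic_mod(2)[of V M "Suc i", OF per] by simp
        thus ?thesis using opp[OF i(1)] i(2) VS by (simp add: d_def)
      qed
      finally show ?thesis using i(2) by (simp add: s_def)
    qed
    have "((\<lambda>t. (real M * (t - t0)) *\<^sub>R d) has_vector_derivative (real M *\<^sub>R d)) (at t0)"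
      by (auto intro!: derivative_eq_intros)
    hence "(shadow \<gamma> has_vector_derivative (real M *\<^sub>R d)) (at t0)"
      by (rule has_vector_derivative_transform_within_open[of _ _ _ "ball t0 (1 / real M)"]) (use M loc in auto)
    thus ?thesis by (simp add: d_def t0_def)
  qed
  have tr: "transverse_at \<gamma> 0"
    unfolding transverse_at_def
  proof (intro ballI impI)
    fix s t assume st: "s \<in> passes \<gamma> 0" "t \<in> passes \<gamma> 0" "s \<noteq> t"
    obtain i where i: "i < M" "s = real i / real M" "fst (V (Suc i mod M)) = 0" using st(1) by (auto simp: passes0)
    obtain j where j: "j < M" "t = real j / real M" "fst (V (Suc j mod M)) = 0" using st(2) by (auto simp: passes0)
    define d e where "d = fst (V (Suc (Suc i mod M)))" and "e = fst (V (Suc (Suc j mod M)))"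
    have "Suc i mod M \<noteq> Suc j mod M" using i(1,2) j(1,2) st(3) by (auto simp: mod_Suc split: if_splits)
    hence cde: "cross d e \<noteq> 0" unfolding d_def e_def by (intro trans[OF Wm Wm] i(3) j(3))
    have "\<not> collinear {0, real M *\<^sub>R d, real M *\<^sub>R e}"
    proof
      assume "collinear {0, real M *\<^sub>R d, real M *\<^sub>R e}"
      then consider "real M *\<^sub>R d = 0" | "real M *\<^sub>R e = 0" | c where "real M *\<^sub>R e = c *\<^sub>R (real M *\<^sub>R d)"
        unfolding collinear_lemma by blast
      hence "cross (real M *\<^sub>R d) (real M *\<^sub>R e) = 0"
        by cases (simp_all only: cross_0_left cross_0_right cross_scaleR_right cross_scaleR_left cross_self mult_zero_right)
      thus False using cde M by (simp add: cross_simps)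
    qed
    thus "\<exists>d e. (shadow \<gamma> has_vector_derivative d) (at s) \<and> (shadow \<gamma> has_vector_derivative e) (at t) \<and> \<not> collinear {0, d, e}"
      using deriv[OF i(1,3)] deriv[OF j(1,3)] unfolding i(2) j(2) d_def e_def by blast
  qed
  have nest: "B \<inter> inside (insert 0 A) = {}" if AB: "A \<in> petals \<gamma> 0" "B \<in> petals \<gamma> 0" "A \<noteq> B" for A B
  proof -
    have comps: "A \<in> components (g ` {0..1} - {0})" "B \<in> components (g ` {0..1} - {0})"
      using AB unfolding petals_def X by auto
    obtain t where t: "t \<in> T" "A = g ` {t<..<next_time T t}" using AB(1) unfolding pet by blast
    obtain u where u: "u \<in> T" "B = g ` {u<..<next_time T u}" using AB(2) unfolding pet by blast
    obtain i where i: "i < M" "fst (V i) = 0" "u = real i / real M" using u(1) by (auto simp: T_def Z_def)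
    have n1: "norm (fst (V k)) \<le> 1" for k
      using nrm[of "k mod M"] periodic_mod(1)[of V M k, OF per] M by auto
    have disc: "g x \<in> cball 0 1" if x: "x \<in> {0..1}" for x
    proof (cases "x = 1")
      case False
      then obtain k s where k: "k < M" "0 \<le> s" "s < 1" "x = (real k + s) / real M"
        using pgon_param[of x M] x M by auto
      have "norm (g x) \<le> norm ((1 - s) *\<^sub>R fst (V k)) + norm (s *\<^sub>R fst (V (Suc k)))"
        unfolding k(4) g_at'[OF k(2,3)] by (simp only: edge_pt_def fst_add fst_scaleR norm_triangle_ineq)
      also have "\<dots> \<le> rmix s 1 1"
        using k n1 by (intro add_mono) (auto intro!: mult_left_le)
      finally show ?thesis by simp
    qed (simp add: ends)
    have SiM: "Suc i < M"
    proof -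
      have "Suc i \<noteq> M" using nz[OF i(1,2)] VM z0 by auto
      thus ?thesis using i(1) by simp
    qed
    \<comment> \<open>Hence the petal \<open>B\<close> contains the vertex after its initial zero,
      which lies on the unit circle.\<close>
    have "real (Suc i) / real M < next_time T u"
    proof -
      let ?S = "{x \<in> insert 1 T. u < x}"
      have finS: "finite ?S" using T by auto
      have "1 \<in> ?S" using i M by simp
      hence m: "next_time T u \<in> ?S" unfolding next_time_def by (intro Min_in[OF finS]) auto
      then consider "next_time T u = 1" | j where "j \<in> Z" "next_time T u = real j / real M" by (auto simp: T_def)
      thus ?thesis
      proof cases
        case 1
        thus ?thesis using SiM M by (simp add: divide_less_eq)
      next
        case (2 j)
        hence "real i < real j" using m i(3) M by (simp add: divide_less_cancel)
        moreover have "j \<noteq> Suc i" using nz[OF i(1,2)] 2 by (auto simp: Z_def)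
        ultimately have "Suc i < j" by simp
        thus ?thesis using 2 M by (simp add: divide_strict_right_mono)
      qed
    qed
    moreover have "u < real (Suc i) / real M" using i(3) M by (simp add: divide_strict_right_mono)
    ultimately have "g (real (Suc i) / real M) \<in> B" unfolding u(2) by simp
    hence uB: "fst (V (Suc i)) \<in> B" unfolding g_vert .
    show ?thesis
    proof (rule petals_not_nested[OF _ _ _ _ uB])
      show "closed (insert 0 A)" unfolding t(2) by (rule PC3[OF t(1)])
      have "A \<subseteq> g ` {0..1}" using comps(1) in_components_subset by blast
      thus "insert 0 A \<subseteq> cball 0 1" using disc by auto
      show "connected B" by (rule in_components_connected[OF comps(2)])
      have "A \<inter> B = {}" using components_nonoverlap[OF comps] AB(3) by blast
      moreover have "0 \<notin> B" using in_components_subset[OF comps(2)] by blast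
      ultimately show "B \<inter> insert 0 A = {}" by blast
      show "norm (fst (V (Suc i))) = 1" using nrm[OF SiM] nz[OF i(1,2)] by blast
    qed
  qed
  show "petal_projection \<gamma> 0"
    unfolding petal_projection_def using pk crossing start fin tr nest by blast
qed


section \<open>Straight passages through the axis\<close>

lemma fan_dirs_cross_nonneg:
  assumes "fan_dirs M U" "i \<le> j" "j \<le> M"
  shows "cross (U i) (U j) \<ge> 0"
proof (cases "i = j \<or> i = 0 \<and> j = M")
  case True
  thus ?thesis using assms(1) by (auto simp: fan_dirs_def cross_simps)
next
  case False
  hence "cross (U i) (U j) > 0" using assms by (intro fan_dirs_cross) auto
  thus ?thesis by simp
qed

text \<open>Zeros occur only at multiples of 3, so any other vertex is next to at most one zero,
  whose direction it is to take.\<close>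

definition near_zero :: "(nat => real) => nat => nat" where
  "near_zero r i = (if 3 dvd i then i else if r (Suc i) = 0 then Suc i else if r (i - 1) = 0 then i - 1 else i)"

lemma near_zero_less:
  assumes z: "\<And>l. l \<le> M ==> r l = 0 ==> 3 dvd l" and ij: "i < j" "j < M" "r i \<noteq> 0" "r j \<noteq> 0" "r 0 = 0"
  shows "near_zero r i < near_zero r j \<or> near_zero r i = Suc i \<and> near_zero r j = Suc i \<and> j = Suc (Suc i) \<and> r (Suc i) = 0"
proof -
  have i0: "i \<noteq> 0" using ij by metis
  consider "j = Suc i" | "j = Suc (Suc i)" | "Suc (Suc i) < j" using ij by linarith
  thus ?thesis
  proof cases
    case 1
    have "near_zero r i \<le> i" "j \<le> near_zero r j" using ij 1 unfolding near_zero_def by auto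
    thus ?thesis using 1 by simp
  next
    case 2
    have "near_zero r i \<le> i \<or> near_zero r i = Suc i \<and> r (Suc i) = 0" "j - 1 \<le> near_zero r j"
      unfolding near_zero_def by auto
    thus ?thesis using 2 by (auto simp: le_less)
  next
    case 3
    thus ?thesis using i0 unfolding near_zero_def by auto
  qed
qed

lemma near_zero_bounds:
  assumes "i < M" "0 < i" 
  shows "i - 1 \<le> near_zero r i" "near_zero r i \<le> Suc i" "near_zero r i \<le> M"
  using assms unfolding near_zero_def by auto

lemma near_zero_ends:
  assumes i: "0 < i" "i < M" "3 dvd M" "r i \<noteq> 0"
  shows "near_zero r i = 0 ==> i = 1 \<and> r 0 = 0" "near_zero r i = M ==> i = M - 1 \<and> r M = 0"
proof -
  show "i = 1 \<and> r 0 = 0" if "near_zero r i = 0"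
    using that i unfolding near_zero_def by (auto split: if_splits simp: le_Suc_eq)
  show "i = M - 1 \<and> r M = 0" if "near_zero r i = M"
    using that i unfolding near_zero_def by (auto split: if_splits)
qed

text \<open>Turning the neighbours of each zero into the direction of the zero makes all strands pass straight
  through the axis.\<close>

lemma fan_align:
  assumes U: "fan_dirs M U" and ok: "fan_ok M r a" and M: "3 dvd M" "9 \<le> M" and r0: "r 0 = 0"
    and z: "\<And>l. l \<le> M ==> r l = 0 ==> 3 dvd l"
    and gen: "\<And>l. 0 < l ==> l < M ==> r l = 0 ==> r (l - 1) * r (Suc l) < 0"
    and gen0: "r (M - 1) * r 1 > 0" and s: "0 \<le> s" "s \<le> 1"
  shows "fan M (\<lambda>i. mix s (U i) (U (near_zero r i))) r a"
proof -
  define N where "N = near_zero r"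
  define W where "W i = mix s (U i) (U (N i))" for i
  have UM: "U M = - U 0" and Unz: "\<And>i. i \<le> M ==> U i \<noteq> 0" using U unfolding fan_dirs_def by auto
  note cn = fan_dirs_cross_nonneg[OF U]
  have rM: "r M = 0" using fan_okD(2)[OF ok] r0 by simp
  have Wz: "W i = U i" if "N i = i" for i unfolding W_def that by (simp add: scaleR_left_distrib[symmetric])
  have N3: "N i = i" if "3 dvd i" for i using that by (simp add: N_def near_zero_def)
  have exp: "cross (W i) (W j) = (1 - s)^2 * cross (U i) (U j) + (1 - s) * s * (cross (U i) (U (N j)) + cross (U (N i)) (U j))
      + s^2 * cross (U (N i)) (U (N j))" for i j
    unfolding W_def by (simp add: cross_simps power2_eq_square algebra_simps)
  \<comment> \<open>For \<open>s < 1\<close> the expansion \<open>exp\<close> has a strictly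
    positive first term and no negative one. At \<open>s = 1\<close> two vertices can become
    collinear only if they flank the same zero; for the zero 0, which is also \<open>M\<close>,
    these are 1 and \<open>M - 1\<close>.\<close>
  have main: "cross (W i) (W j) > 0 \<or> s = 1 \<and> (N i = N j \<and> j = Suc (Suc i) \<and> r (Suc i) = 0 \<or> N i = 0 \<and> N j = M \<and> i = 1 \<and> j = M - 1)"
    if ij: "i < j" "j < M" "r i \<noteq> 0" "r j \<noteq> 0" for i j
  proof -
    have i0: "0 < i" using r0 ij by (cases i) auto
    have L: "N i < N j \<or> N i = Suc i \<and> N j = Suc i \<and> j = Suc (Suc i) \<and> r (Suc i) = 0"
      unfolding N_def by (rule near_zero_less[OF z ij r0])
    have b: "i - 1 \<le> N i" "N i \<le> Suc i" "N i \<le> M" "j - 1 \<le> N j" "N j \<le> M"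
      unfolding N_def using near_zero_bounds[of i M r] near_zero_bounds[of j M r] ij i0 by auto
    have c1: "cross (U i) (U j) > 0" using fan_dirs_cross[OF U, of i j] ij by simp
    have c2: "cross (U i) (U (N j)) \<ge> 0" by (rule cn) (use b ij in auto)
    have c3: "cross (U (N i)) (U j) \<ge> 0" by (rule cn) (use b ij in auto)
    have c4: "cross (U (N i)) (U (N j)) \<ge> 0" by (rule cn) (use b L in auto)
    show ?thesis
    proof (cases "s = 1")
      case False
      hence "(1 - s)^2 * cross (U i) (U j) > 0" using c1 by simp
      moreover have "(1 - s) * s * (cross (U i) (U (N j)) + cross (U (N i)) (U j)) \<ge> 0" using c2 c3 s by simp
      moreover have "s^2 * cross (U (N i)) (U (N j)) \<ge> 0" using c4 by simp
      ultimately show ?thesis unfolding exp by linarith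
    next
      case True
      have e: "cross (W i) (W j) = cross (U (N i)) (U (N j))" unfolding exp True by simp
      consider "N i < N j" "N j < M \<or> 0 < N i" | "N i = 0" "N j = M" | "N i = N j" "j = Suc (Suc i)" "r (Suc i) = 0"
        using L b by fastforce
      thus ?thesis
      proof cases
        case 1
        thus ?thesis unfolding e using fan_dirs_cross[OF U, of "N i" "N j"] b by simp
      next
        case 2
        have "i = 1" by (rule near_zero_ends(1)[of i M r, THEN conjunct1]) (use 2 ij i0 M in "auto simp: N_def")
        moreover have "j = M - 1" by (rule near_zero_ends(2)[of j M r, THEN conjunct1]) (use 2 ij i0 M in "auto simp: N_def")
        ultimately show ?thesis using True 2 by simp
      next
        case 3
        thus ?thesis using True by simp
      qed
    qed
  qed
  have "fan M W r a"
    unfolding fan_def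
  proof (intro conjI allI impI)
    show "fan_ok M r a" by (rule ok)
    show "W M = - W 0" using Wz[OF N3[OF M(1)]] Wz[OF N3, of 0] UM by simp
    show "W i \<noteq> 0" if "i \<le> M" for i
    proof (cases "N i = i")
      case True
      thus ?thesis using Wz Unz that by simp
    next
      case False
      hence "\<not> 3 dvd i" using N3 by auto
      hence i: "0 < i" "i < M" using that M(1) by (auto intro!: Nat.gr0I le_neq_implies_less)
      have "N i = Suc i \<or> N i = i - 1" using False unfolding N_def near_zero_def by (auto split: if_splits)
      hence "cross (U i) (U (N i)) \<noteq> 0"
      proof
        assume "N i = Suc i"
        thus ?thesis using fan_dirs_cross[OF U, of i "Suc i"] i by simp
      next
        assume "N i = i - 1"
        thus ?thesis using fan_dirs_cross[OF U, of "i - 1" i] i cross_commute[of "U i" "U (i - 1)"] by simp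
      qed
      moreover have "cross (U i) (W i) = s * cross (U i) (U (N i))" unfolding W_def by (simp add: cross_simps)
      moreover have "W i = U i" if s: "s = 0" unfolding W_def s by simp
      ultimately show ?thesis using Unz[OF that] by (cases "s = 0") (auto simp: cross_eq dest: arg_cong[of "W i" 0 "cross (U i)"])
    qed
    show "cross (W i) (W (Suc i)) > 0" if i: "i < M" "r i \<noteq> 0" "r (Suc i) \<noteq> 0" for i
    proof -
      have "Suc i \<noteq> M" using rM i by auto
      thus ?thesis using main[of i "Suc i"] i M by auto
    qed
    show "cross (W i) (W j) > 0 \<or> (\<exists>\<kappa>>0. r j *\<^sub>R W j = - (\<kappa> *\<^sub>R r i *\<^sub>R W i))"
      if ij: "i < j" "j < M" "r i \<noteq> 0" "r j \<noteq> 0" for i j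
    proof -
      consider "cross (W i) (W j) > 0" | "s = 1" "N i = N j" "j = Suc (Suc i)" "r (Suc i) = 0"
        | "s = 1" "N i = 0" "N j = M" "i = 1" "j = M - 1" using main[OF ij] by argo
      thus ?thesis
      proof cases
        case 2
        have "r i * r j < 0" using gen[of "Suc i"] 2 ij by simp
        hence "- (r j / r i) > 0" using ij by (auto simp: divide_less_0_iff mult_less_0_iff)
        moreover have "r j *\<^sub>R W j = - ((- (r j / r i)) *\<^sub>R r i *\<^sub>R W i)" using 2 ij by (simp add: W_def)
        ultimately show ?thesis by blast
      next
        case 3
        have "r i * r j > 0" using gen0 3 by (simp add: mult.commute)
        hence "r j / r i > 0" using ij by (auto simp: zero_less_divide_iff zero_less_mult_iff)
        moreover have "r j *\<^sub>R W j = - ((r j / r i) *\<^sub>R r i *\<^sub>R W i)" using 3 ij UM by (simp add: W_def)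
        ultimately show ?thesis by blast
      qed blast
    qed
  qed
  thus ?thesis unfolding W_def[abs_def] N_def .
qed

text \<open>Heights of vertices off the axis are free, so a double point of the shadow of a fan off the axis
  could be lifted to a double point of a fan.\<close>

lemma fan_shadow_inj:
  assumes F: "fan M U r a" and nz: "\<And>i. i < M ==> r i = 0 ==> r (Suc i) \<noteq> 0"
    and nz2: "\<And>i. Suc i < M ==> r (Suc i) \<noteq> 0 ==> r i = 0 ==> r (Suc (Suc i)) \<noteq> 0"
    and r0: "r 0 = 0"
    and ij: "i < M" "j < M" "0 \<le> s" "s < 1" "0 \<le> t" "t < 1"
    and eq: "fst (edge_pt (fan_pt U r a) i s) = fst (edge_pt (fan_pt U r a) j t)"
    and ne: "fst (edge_pt (fan_pt U r a) i s) \<noteq> 0"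
  shows "i = j \<and> s = t"
proof -
  have ok: "fan_ok M r a" using F by (simp add: fan_def)
  note D = fan_okD[OF ok]
  have rM: "r M = 0" using D(2) r0 by simp
  have cons: "cross (U i) (U (Suc i)) > 0" if "i < M" "r i \<noteq> 0" "r (Suc i) \<noteq> 0" for i
    using F that unfolding fan_def by blast
  define W where "W i = r i *\<^sub>R U i" for i
  have W0: "W l = 0" if "r l = 0" for l using that by (simp add: W_def)
  have fe: "fst (edge_pt (fan_pt U r a) i s) = mix s (W i) (W (Suc i))" for i s
    by (simp add: edge_pt_def fan_pt_def W_def)
  have fan': "fan M U r a'" if "\<And>l. r l = 0 ==> a' l = a l" for a'
  proof -
    have "fan_ok M r a'"
      using ok that[of 0] that[of M] r0 rM unfolding fan_ok_def by (simp add: that cong: conj_cong imp_cong) 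
    thus ?thesis using F unfolding fan_def by blast
  qed
  have lift: "i = j \<and> s = t"
    if "\<And>l. r l = 0 ==> a' l = a l" "rmix s (a' i) (a' (Suc i)) = 0" "rmix t (a' j) (a' (Suc j)) = 0" for a'
  proof -
    have "simple_polygon M (fan_pt U r a')" by (intro fan_simple_polygon fan' that)
    moreover have "edge_pt (fan_pt U r a') i s = edge_pt (fan_pt U r a') j t"
      using eq that(2,3) by (simp add: edge_pt_def fan_pt_def)
    ultimately show ?thesis using ij unfolding simple_polygon_def by blast
  qed
  have Wdist: "W l \<noteq> W (Suc l)" "r l \<noteq> 0 \<or> r (Suc l) \<noteq> 0" if "l < M" for l
  proof -
    show "r l \<noteq> 0 \<or> r (Suc l) \<noteq> 0" using nz[OF that] by auto
    show "W l \<noteq> W (Suc l)"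
    proof
      assume e: "W l = W (Suc l)"
      have "cross (W l) (W (Suc l)) = r l * r (Suc l) * cross (U l) (U (Suc l))" by (simp add: W_def cross_simps)
      hence "r l * r (Suc l) * cross (U l) (U (Suc l)) = 0" using e by (simp add: cross_simps)
      hence "r l = 0 \<or> r (Suc l) = 0" using cons[OF that] by fastforce
      moreover have "U l \<noteq> 0" "U (Suc l) \<noteq> 0" using F that unfolding fan_def by auto
      ultimately have "W l = 0" "W l \<noteq> 0" using e nz[OF that] by (auto simp: W_def)
      thus False by simp
    qed
  qed
  \<comment> \<open>Consecutive edges with a common vertex off the axis share a free height, so
    \<open>h\<close> below cannot serve both. If one of the other ends is on the axis, the cross
    product decides; otherwise all free heights can be set to 0.\<close>
  have shared: False
    if "Suc i = j" "r j \<noteq> 0" "i < M" "j < M" "0 \<le> s" "s < 1" "0 \<le> t" "t < 1"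
      "mix s (W i) (W (Suc i)) = mix t (W j) (W (Suc j))"
      and lf: "\<not> (\<exists>a'. (\<forall>l. r l = 0 --> a' l = a l) \<and> rmix s (a' i) (a' (Suc i)) = 0 \<and> rmix t (a' j) (a' (Suc j)) = 0)"
    for i j s t
  proof -
    have Wj: "W j \<noteq> 0" using F that unfolding fan_def W_def by auto
    consider "r i = 0" | "r i \<noteq> 0" "r (Suc j) = 0" | "r i \<noteq> 0" "r (Suc j) \<noteq> 0" by blast
    thus False
    proof cases
      case 1
      hence j': "r (Suc j) \<noteq> 0" using nz2[of i] that by auto
      have e: "s *\<^sub>R W j = mix t (W j) (W (Suc j))" using that 1 W0 by auto
      hence "cross (W j) (s *\<^sub>R W j) = cross (W j) (mix t (W j) (W (Suc j)))" by simp
      hence "t * (r j * r (Suc j) * cross (U j) (U (Suc j))) = 0" by (auto simp: W_def cross_simps)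
      hence "t = 0" using cons[of j] j' that by fastforce
      hence "s *\<^sub>R W j = 1 *\<^sub>R W j" using e by simp
      thus False using Wj that by (simp only: scaleR_cancel_right) simp
    next
      case 2
      have e: "mix s (W i) (W j) = (1 - t) *\<^sub>R W j" using that 2 W0 by auto
      hence "cross (W j) (mix s (W i) (W j)) = cross (W j) ((1 - t) *\<^sub>R W j)" by simp
      hence "(1 - s) * (r j * r i * cross (U j) (U i)) = 0" by (auto simp: W_def cross_simps)
      thus False using cons[of i] cross_commute[of "U j" "U i"] 2 that by auto
    next
      case 3
      define a' where "a' l = (if r l = 0 then a l else 0)" for l
      have "(\<forall>l. r l = 0 --> a' l = a l) \<and> rmix s (a' i) (a' (Suc i)) = 0 \<and> rmix t (a' j) (a' (Suc j)) = 0"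
        using 3 that by (simp add: a'_def)
      thus False using lf by blast
    qed
  qed
  show ?thesis
  proof (cases "i = j")
    case True
    have "(s - t) *\<^sub>R (W (Suc i) - W i) = 0" using eq unfolding fe True by (simp add: algebra_simps)
    thus ?thesis using True Wdist(1)[OF ij(1)] by simp
  next
    case False
    show ?thesis
    proof (cases "Suc i = j \<and> r j \<noteq> 0 \<or> Suc j = i \<and> r i \<noteq> 0")
      case True
      thus ?thesis
      proof
        assume "Suc i = j \<and> r j \<noteq> 0"
        thus ?thesis using shared[of i j s t] ij eq lift unfolding fe by blast
      next
        assume "Suc j = i \<and> r i \<noteq> 0"
        thus ?thesis using shared[of j i t s] ij eq[symmetric] lift unfolding fe by blast
      qed
    next
      case ns: False
      \<comment> \<open>The height of the free end that gives height 0 to the point of the edge at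
        parameter \<open>s\<close>.\<close>
      define h where "h i s = (if r i = 0 then - ((1 - s) * a i / s) else if r (Suc i) = 0 then - (s * a (Suc i) / (1 - s)) else 0)"
        for i s
      define a' where "a' l = (if r l = 0 then a l else if l = i \<or> l = Suc i then h i s else if l = j \<or> l = Suc j then h j t else 0)" for l
      have s0: "s \<noteq> 0" if "r i = 0" using ne that unfolding fe by (auto simp: W0)
      have t0: "t \<noteq> 0" if "r j = 0" using ne that unfolding eq unfolding fe by (auto simp: W0)
      have ai: "rmix s (a' i) (a' (Suc i)) = 0"
        using Wdist(2)[OF ij(1)] s0 ij(4) by (auto simp: a'_def h_def)
      have aj: "rmix t (a' j) (a' (Suc j)) = 0"
        using Wdist(2)[OF ij(2)] t0 ij(6) ns False by (auto simp: a'_def h_def)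
      have "a' l = a l" if "r l = 0" for l using that by (simp add: a'_def)
      thus ?thesis by (rule lift[OF _ ai aj])
    qed
  qed
qed


text \<open>Replacing radii by their signs puts the vertices off the axis on the unit circle, and
  \<open>fan_align\<close> straightens the strands. A change of sign at a zero means that the axis
  is passed and not just touched (\<open>gen\<close>); at vertex 0 the sign is opposite
  (\<open>gen0\<close>) because \<open>U M = - U 0\<close>.\<close>

lemma fan_petals:
  assumes U: "fan_dirs M U" and nU: "\<And>i. i \<le> M ==> norm (U i) = 1"
    and ok: "fan_ok M r a" and M: "3 dvd M" "9 \<le> M" and r0: "r 0 = 0"
    and z: "\<And>l. l \<le> M ==> r l = 0 ==> 3 dvd l"
    and gen: "\<And>l. 0 < l ==> l < M ==> r l = 0 ==> r (l - 1) * r (Suc l) < 0"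
    and gen0: "r (M - 1) * r 1 > 0" and two: "card {l. l < M \<and> r l = 0} \<ge> 2"
  shows "\<exists>\<gamma>. petal_projection \<gamma> 0 \<and> kiso (polygon_set M (fan_pt U r a)) (\<gamma> ` {0..1}) \<and>
    card (petals \<gamma> 0) = card {l. l < M \<and> r l = 0}"
proof -
  define \<rho> where "\<rho> i = sgn (r i)" for i
  have rM: "r M = 0" using fan_okD(2)[OF ok] r0 by simp
  have \<rho>z: "\<rho> i = 0 \<longleftrightarrow> r i = 0" for i by (simp add: \<rho>_def sgn_0_0)
  have \<rho>1: "\<bar>\<rho> i\<bar> = 1" if "r i \<noteq> 0" for i using that by (simp add: \<rho>_def abs_sgn_eq)
  have R: "fan_ok M \<rho> a \<and> fiso M U r a \<rho> a"
    by (rule fan_rescale[OF U ok]) (use r0 rM fan_okD(3)[OF ok] in "auto simp: \<rho>_def")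
  have gen': "\<rho> (l - 1) = - \<rho> (Suc l)" if "0 < l" "l < M" "r l = 0" for l
    using gen[OF that] by (auto simp: \<rho>_def sgn_if mult_less_0_iff)
  have gen0': "\<rho> (M - 1) = \<rho> 1" using gen0 by (auto simp: \<rho>_def sgn_if zero_less_mult_iff)
  define N where "N = near_zero \<rho>"
  have F: "fan M (\<lambda>i. mix s (U i) (U (N i))) \<rho> a" if "0 \<le> s" "s \<le> 1" for s
    unfolding N_def
  proof (rule fan_align[OF U _ M])
    show "\<rho> (l - 1) * \<rho> (Suc l) < 0" if "0 < l" "l < M" "\<rho> l = 0" for l
      using gen[of l] that \<rho>z by (simp add: \<rho>_def sgn_mult[symmetric])
    show "\<rho> (M - 1) * \<rho> 1 > 0" using gen0 by (simp add: \<rho>_def sgn_mult[symmetric])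
  qed (use R r0 z \<rho>z that in auto)
  define U' where "U' i = U (N i)" for i
  have F1: "fan M U' \<rho> a" using F[of 1] by (simp add: U'_def[abs_def])
  have iso: "kiso (polygon_set M (fan_pt U r a)) (polygon_set M (fan_pt U' \<rho> a))"
  proof (rule kiso_trans)
    show "kiso (polygon_set M (fan_pt U r a)) (polygon_set M (fan_pt U \<rho> a))" using R by (simp add: fiso_def)
    show "kiso (polygon_set M (fan_pt U \<rho> a)) (polygon_set M (fan_pt U' \<rho> a))"
    proof (rule kiso_polygon)
      fix s :: real assume s: "0 \<le> s" "s \<le> 1"
      have "fan_pt (\<lambda>i. mix s (U i) (U (N i))) \<rho> a = (\<lambda>i. mix s (fan_pt U \<rho> a i) (fan_pt U' \<rho> a i))"
        by (auto simp: fan_pt_def U'_def algebra_simps)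
      thus "simple_polygon M (\<lambda>i. mix s (fan_pt U \<rho> a i) (fan_pt U' \<rho> a i))"
        using fan_simple_polygon[OF F[OF s]] by simp
    qed
  qed
  define P where "P = fan_pt U' \<rho> a"
  have P0: "fst (P i) = 0 \<longleftrightarrow> r i = 0" if "i \<le> M" for i
    using F1 that \<rho>z by (auto simp: P_def fan_pt_def fan_def)
  have fP: "fst (P i) = \<rho> i *\<^sub>R U' i" for i by (simp add: P_def fan_pt_def)
  have spP: "simple_polygon M P" unfolding P_def by (rule fan_simple_polygon[OF F1])
  hence PM: "P M = P 0" unfolding simple_polygon_def by blast
  define V where "V i = P (i mod M)" for i
  have per: "V (i + M) = V i" for i by (simp add: V_def)
  have Vi: "V i = P i" if "i \<le> M" for i using that PM by (cases "i = M") (auto simp: V_def)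
  have eV: "edge_pt V i s = edge_pt P i s" if "i < M" for i s using Vi[of i] Vi[of "Suc i"] that by (simp add: edge_pt_def)
  have set: "polygon_set M V = polygon_set M P"
  proof -
    have "1 \<le> M" using M by simp
    thus ?thesis unfolding polygon_set_def by (simp add: pgon_image eV)
  qed
  have spV: "simple_polygon M V"
  proof -
    have "V M = V 0" using Vi[of M] Vi[of 0] PM by simp
    moreover have "i = j \<and> s = t" if "i < M" "j < M" "0 \<le> s" "s < 1" "0 \<le> t" "t < 1" "edge_pt V i s = edge_pt V j t" for i j s t
    proof -
      have "edge_pt P i s = edge_pt P j t" using that eV by simp
      thus ?thesis using spP that(1-6) unfolding simple_polygon_def by blast
    qed
    moreover have "1 \<le> M" using M by simp
    ultimately show ?thesis unfolding simple_polygon_def by blast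
  qed
  have N3: "N i = i" if "3 dvd i" for i using that by (simp add: N_def near_zero_def)
  have step: "r (Suc i) \<noteq> 0" "r (Suc (Suc i)) \<noteq> 0" "Suc (Suc i) \<le> M" "\<not> 3 dvd Suc i" if "i < M" "r i = 0" for i
  proof -
    have i3: "3 dvd i" using z[of i] that by simp
    thus i2: "Suc (Suc i) \<le> M" "\<not> 3 dvd Suc i" using that(1) M by presburger+
    have "\<not> 3 dvd Suc (Suc i)" using i3 by presburger
    thus "r (Suc i) \<noteq> 0" "r (Suc (Suc i)) \<noteq> 0" using z[of "Suc i"] z[of "Suc (Suc i)"] i2 by auto
  qed
  have Nn: "N (Suc i) = i" if "i < M" "r i = 0" for i
    using step[OF that] that(2) \<rho>z by (simp add: N_def near_zero_def)
  have Np: "N i = Suc i" if "Suc i \<le> M" "r (Suc i) = 0" for i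
  proof -
    have "3 dvd Suc i" by (rule z[OF that])
    hence "\<not> 3 dvd i" by presburger
    thus ?thesis using that \<rho>z by (simp add: N_def near_zero_def)
  qed
  note nz = step(1)
  have nz2: "\<rho> (Suc (Suc i)) \<noteq> 0" if "Suc i < M" "\<rho> i = 0" for i
    using step(2)[of i] that \<rho>z by simp
  have cons: "cross (U' i) (U' (Suc i)) > 0" if "i < M" "r i \<noteq> 0" "r (Suc i) \<noteq> 0" for i
    using F1 that \<rho>z unfolding fan_def by blast
  define \<gamma> where "\<gamma> = pgon M (\<lambda>i. V (i + 1))"
  have Zeq: "{i. i < M \<and> fst (V i) = 0} = {l. l < M \<and> r l = 0}" using Vi P0 by auto
  have h0: "fst (V 0) = 0" using Vi[of 0] P0[of 0] r0 by simp
  have h1: "fst (V (Suc i)) \<noteq> 0" if "i < M" "fst (V i) = 0" for i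
    using nz[of i] that Vi[of i] Vi[of "Suc i"] P0[of i] P0[of "Suc i"] by simp
  have h2: "fst (V i) = 0 \<or> norm (fst (V i)) = 1" if "i < M" for i
  proof (cases "r i = 0")
    case False
    have "N i \<le> M" using that near_zero_bounds(3)[of i M \<rho>] N3[of 0] by (cases "i = 0") (auto simp: N_def)
    thus ?thesis using that False by (simp add: Vi fP U'_def \<rho>1 nU)
  qed (use that Vi P0 in simp)
  have h3: "fst (edge_pt V i s) \<noteq> 0" if i: "i < M" and s: "0 < s" "s < 1" for i s
  proof
    assume "fst (edge_pt V i s) = 0"
    hence e: "mix s (fst (P i)) (fst (P (Suc i))) = 0"
      unfolding eV[OF i] by (simp add: edge_pt_def)
    consider "r i = 0" | "r (Suc i) = 0" | "r i \<noteq> 0" "r (Suc i) \<noteq> 0" by blast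
    thus False
    proof cases
      case 1
      thus False using e s nz[OF i] P0[of i] P0[of "Suc i"] i by simp
    next
      case 2
      thus False using e s nz[OF i] P0[of i] P0[of "Suc i"] i by auto
    next
      case 3
      have "cross (fst (P i)) (mix s (fst (P i)) (fst (P (Suc i)))) = s * (\<rho> i * \<rho> (Suc i) * cross (U' i) (U' (Suc i)))"
        by (simp add: fP cross_simps)
      hence "s * (\<rho> i * \<rho> (Suc i) * cross (U' i) (U' (Suc i))) = 0" unfolding e by (simp add: cross_eq)
      thus False using s 3 \<rho>z cons[OF i 3] by auto
    qed
  qed
  have h4: "i = j \<and> s = t"
    if "i < M" "j < M" "0 \<le> s" "s < 1" "0 \<le> t" "t < 1" "fst (edge_pt V i s) = fst (edge_pt V j t)" "fst (edge_pt V i s) \<noteq> 0"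
    for i j s t
  proof (rule fan_shadow_inj[OF F1])
    show "\<rho> 0 = 0" using r0 \<rho>z by simp
    show "\<rho> (Suc i) \<noteq> 0" if "i < M" "\<rho> i = 0" for i using nz[of i] that \<rho>z by simp
    show "\<rho> (Suc (Suc i)) \<noteq> 0" if "Suc i < M" "\<rho> (Suc i) \<noteq> 0" "\<rho> i = 0" for i using nz2 that by simp
  qed (use that in "simp_all add: eV P_def")
  have h5: "fst (V i) = - fst (V (Suc (Suc i)))" if i: "i < M" "fst (V (Suc i)) = 0" for i
  proof -
    have ri: "r (Suc i) = 0" using i Vi[of "Suc i"] P0[of "Suc i"] by simp
    have Ui: "U' i = U (Suc i)" using Np[of i] ri i by (simp add: U'_def)
    show ?thesis
    proof (cases "Suc i = M")
      case True
      have "V (Suc (Suc i)) = P 1" using True M by (simp add: V_def mod_Suc)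
      moreover have "U' 1 = U 0" using Nn[of 0] r0 M by (simp add: U'_def)
      moreover have "U (Suc i) = - U 0" using U True by (simp add: fan_dirs_def)
      moreover have "\<rho> i = \<rho> 1" using gen0' True by auto
      ultimately show ?thesis using Vi[of i] i by (simp add: fP Ui)
    next
      case False
      hence "V (Suc (Suc i)) = P (Suc (Suc i))" using Vi[of "Suc (Suc i)"] i by simp
      moreover have "U' (Suc (Suc i)) = U (Suc i)" using Nn[of "Suc i"] ri False i by (simp add: U'_def)
      moreover have "\<rho> i = - \<rho> (Suc (Suc i))" using gen'[of "Suc i"] False i ri by simp
      ultimately show ?thesis using Vi[of i] i by (simp add: fP Ui)
    qed
  qed
  have h6: "cross (fst (V (Suc i))) (fst (V (Suc j))) \<noteq> 0"
    if ij: "i < M" "j < M" "i \<noteq> j" "fst (V i) = 0" "fst (V j) = 0" for i j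
  proof -
    have r: "r i = 0" "r j = 0" using ij Vi P0 by auto
    have "fst (V (Suc i)) = \<rho> (Suc i) *\<^sub>R U i" "fst (V (Suc j)) = \<rho> (Suc j) *\<^sub>R U j"
      using Vi[of "Suc i"] Vi[of "Suc j"] ij Nn r by (simp_all add: fP U'_def)
    moreover have "cross (U i) (U j) \<noteq> 0"
      using U ij cross_commute[of "U i" "U j"] unfolding fan_dirs_def by (cases i j rule: linorder_cases) force+
    moreover have "\<rho> (Suc i) \<noteq> 0" "\<rho> (Suc j) \<noteq> 0" using nz[of i] nz[of j] r ij \<rho>z by auto
    ultimately show ?thesis by (simp add: cross_simps)
  qed
  have h7: "card {i. i < M \<and> fst (V i) = 0} \<ge> 2" unfolding Zeq by (rule two)
  have "petal_projection \<gamma> 0" "card (petals \<gamma> 0) = card {i. i < M \<and> fst (V i) = 0}" "\<gamma> ` {0..1} = polygon_set M V"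
    unfolding \<gamma>_def
    by (rule petal_polygon[where M = M and V = V]; fact spV per h0 h1 h2 h3 h4 h5 h6 h7)+
  hence "petal_projection \<gamma> 0 \<and> kiso (polygon_set M (fan_pt U r a)) (\<gamma> ` {0..1}) \<and>
      card (petals \<gamma> 0) = card {l. l < M \<and> r l = 0}"
    using iso unfolding Zeq set P_def by simp
  thus ?thesis by blast
qed


text \<open>A single strand is no multi-crossing. In this case the vertices 3 and 6, for which
  \<open>9 \<le> M\<close> leaves room, are placed on the axis at new heights and the block between
  them is flipped. This adds a curl and gives three petals, whence the \<open>max 3\<close>.\<close>

lemma fan_petals_few:
  assumes U: "fan_dirs M U" and nU: "\<And>i. i \<le> M ==> norm (U i) = 1"
    and ok: "fan_ok M r a" and M: "3 dvd M" "9 \<le> M" and r0: "r 0 = 0"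
    and z: "\<And>l. l \<le> M ==> r l = 0 ==> 3 dvd l"
    and gen: "\<And>l. 0 < l ==> l < M ==> r l = 0 ==> r (l - 1) * r (Suc l) < 0"
    and gen0: "r (M - 1) * r 1 > 0"
  shows "\<exists>\<gamma>. petal_projection \<gamma> 0 \<and> kiso (polygon_set M (fan_pt U r a)) (\<gamma> ` {0..1}) \<and>
    card (petals \<gamma> 0) \<le> max 3 (card {l. l < M \<and> r l = 0})"
proof (cases "card {l. l < M \<and> r l = 0} \<ge> 2")
  case True
  have "\<exists>\<gamma>. petal_projection \<gamma> 0 \<and> kiso (polygon_set M (fan_pt U r a)) (\<gamma> ` {0..1}) \<and>
      card (petals \<gamma> 0) = card {l. l < M \<and> r l = 0}"
    by (rule fan_petals; fact U nU ok M r0 z gen gen0 True)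
  thus ?thesis by (metis max.cobounded2)
next
  case False
  have nz: "r l \<noteq> 0" if "0 < l" "l < M" for l
  proof
    assume "r l = 0"
    hence "{0, l} \<subseteq> {l. l < M \<and> r l = 0}" using that r0 M by auto
    hence "card {0, l} \<le> card {l. l < M \<and> r l = 0}" by (intro card_mono) auto
    thus False using False that by simp
  qed
  note D = fan_okD[OF ok]
  have rM: "r M = 0" using D(2) r0 by simp
  define \<sigma> where "\<sigma> = sgn (r 1)"
  have \<sigma>: "\<sigma> \<noteq> 0" using nz[of 1] M by (simp add: \<sigma>_def sgn_0_0)
  have sg: "sgn (r l) = \<sigma>" if "0 < l" "l < M" for l
    using that
  proof (induction l rule: nat_induct_non_zero)
    case (Suc l)
    hence "r l * r (Suc l) \<ge> 0" "r l \<noteq> 0" "r (Suc l) \<noteq> 0" using D(4)[of l] nz by auto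
    hence "sgn (r l) = sgn (r (Suc l))" by (auto simp: sgn_if zero_le_mult_iff)
    thus ?case using Suc by simp
  qed (simp add: \<sigma>_def)
  define b where "b l = (if l = 3 then a 0 + 1 else if l = 6 then a 0 + 2 else a l)" for l
  define q where "q l = (if l = 3 \<or> l = 6 then 0 else r l)" for l
  have qz: "q l = 0 \<longleftrightarrow> l = 0 \<or> l = 3 \<or> l = 6 \<or> l = M" if "l \<le> M" for l
    using that nz[of l] r0 rM by (cases "l = 0"; cases "l = M") (auto simp: q_def)
  have bM: "b M = b 0" using M D(3) by (simp add: b_def)
  have b0: "b 0 = a 0" "b 3 = a 0 + 1" "b 6 = a 0 + 2" by (simp_all add: b_def)
  have okq: "fan_ok M q b"
    unfolding fan_ok_def
  proof (intro conjI allI impI)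
    show "3 \<le> M" "b M = b 0" using M bM by auto
    show "q M = - q 0" using qz[of M] qz[of 0] by simp
    show "q i * q (Suc i) \<ge> 0" if "i < M" for i using D(4)[OF that] by (simp add: q_def)
    show "b i \<noteq> b j" if "i < M" "j < M" "i \<noteq> j" "q i = 0" "q j = 0" for i j
      using that qz[of i] qz[of j] b0 by auto
    show "\<not> sbetween (b i) (b (Suc i)) (b j)" if "i < M" "j < M" "q i = 0" "q (Suc i) = 0" "q j = 0" for i j
      using that qz[of i] qz[of "Suc i"] M by auto
  qed
  have i1: "fan_ok M r b \<and> fiso M U r a r b"
  proof (rule fan_rescale[OF U ok])
    show "b i = a i" if "i \<le> M" "r i = 0" for i
      using that nz[of i] M by (auto simp: b_def)
    show "r M = - r 0" "b M = b 0" by (rule D(2), rule bM)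
  qed simp
  have i2: "fan_ok M r b \<and> fiso M U q b r b"
  proof (rule fan_push[OF U okq])
    show "r i = q i" if "q i \<noteq> 0" for i using that by (auto simp: q_def split: if_splits)
  qed (use D in auto)
  define q' where "q' l = (if 3 < l \<and> l < 6 then - q l else q l)" for l :: nat
  define b' where "b' = block_heights b 3 6"
  have fl: "fan_ok M q' b'" "fiso M U q b q' b'"
  proof -
    have ij: "3 < (6::nat)" "Suc 6 < M" "q 3 = 0" "q 6 = 0" using M by (auto simp: q_def)
    have nzq: "q l \<noteq> 0" if "3 < l" "l < 6" for l using qz[of l] that M by auto
    have adj: "\<not> sbetween (b 3) (b 6) (b l)" if "l < M" "q l = 0" for l
      using that qz[of l] b0 by (auto simp: sbetween_def)
    show "fan_ok M q' b'" unfolding q'_def[abs_def] b'_def by (rule fan_flip(1)[OF U okq ij nzq adj])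
    show "fiso M U q b q' b'" unfolding q'_def[abs_def] b'_def by (rule fan_flip(2)[OF U okq ij nzq adj])
  qed
  have q'z: "q' l = 0 \<longleftrightarrow> l = 0 \<or> l = 3 \<or> l = 6 \<or> l = M" if "l \<le> M" for l
    using qz[OF that] by (simp add: q'_def)
  have iso: "kiso (polygon_set M (fan_pt U r a)) (polygon_set M (fan_pt U q' b'))"
    using fiso_trans[OF conjunct2[OF i1] fiso_trans[OF fiso_sym[OF conjunct2[OF i2]] fl(2)]] by (simp add: fiso_def)
  have Z: "{l. l < M \<and> q' l = 0} = {0, 3, 6}" using q'z M by auto
  have pos: "r i * r j > 0" if "0 < i" "i < M" "0 < j" "j < M" for i j
  proof -
    have "sgn (r i * r j) = \<sigma> * \<sigma>" using sg that by (simp add: sgn_mult)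
    moreover have "\<sigma> * \<sigma> > 0" using \<sigma> by (auto simp: zero_less_mult_iff)
    ultimately show ?thesis by (metis sgn_greater)
  qed
  have "\<exists>\<gamma>. petal_projection \<gamma> 0 \<and> kiso (polygon_set M (fan_pt U q' b')) (\<gamma> ` {0..1}) \<and>
    card (petals \<gamma> 0) = card {l. l < M \<and> q' l = 0}"
  proof (rule fan_petals[OF U nU fl(1) M])
    show "q' 0 = 0" using q'z[of 0] by simp
    show "3 dvd l" if "l \<le> M" "q' l = 0" for l using that q'z[of l] M by auto
    show "q' (l - 1) * q' (Suc l) < 0" if "0 < l" "l < M" "q' l = 0" for l
    proof -
      have "l = 3 \<or> l = 6" using that q'z[of l] by auto
      moreover have "r 2 * r 4 > 0" "r 5 * r 7 > 0" by (rule pos; use M in simp)+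
      ultimately show ?thesis by (auto simp: q'_def q_def)
    qed
    have "M - 1 > 6" "M - 1 < M" using M by auto
    thus "q' (M - 1) * q' 1 > 0" using pos[of "M - 1" 1] by (simp add: q'_def q_def)
    show "card {l. l < M \<and> q' l = 0} \<ge> 2" unfolding Z by simp
  qed simp
  then obtain \<gamma> where "petal_projection \<gamma> 0" "kiso (polygon_set M (fan_pt U q' b')) (\<gamma> ` {0..1})"
    "card (petals \<gamma> 0) = 3" unfolding Z by auto
  thus ?thesis using kiso_trans[OF iso] by auto
qed

lemma fdir_add: "M \<ge> 1 ==> fdir M (i + M) = - fdir M i"
proof -
  assume "M \<ge> 1"
  hence "pi * real (i + M) / real M = pi * real i / real M + pi" by (simp add: field_simps)
  thus ?thesis by (simp add: fdir_def cis_mult[symmetric] cis_pi)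
qed

lemma fan_dirs_fdir_shift:
  assumes "M \<ge> 1"
  shows "fan_dirs M (\<lambda>i. fdir M (i + c))"
proof -
  have e: "fdir M (i + c) = fdir M i * fdir M c" for i
    by (simp add: fdir_def cis_mult add_divide_distrib distrib_left)
  have "cross (z * w) (z' * w) = (norm w)^2 * cross z z'" for z z' w
    unfolding cmod_power2 by (simp add: cross_eq algebra_simps power2_eq_square)
  thus ?thesis using fan_dirs_fdir[OF assms] unfolding fan_dirs_def e by (simp add: fdir_def)
qed

text \<open>A fan continues past its end by reversing the signs, so it may be started at any vertex.\<close>

lemma fan_petal_projection:
  assumes ok: "fan_ok M r a" and M: "3 dvd M" "9 \<le> M" and z: "\<And>l. l \<le> M ==> r l = 0 ==> 3 dvd l"
  shows "\<exists>\<gamma> c. petal_projection \<gamma> c \<and> kiso (polygon_set M (fan_pt (fdir M) r a)) (\<gamma> ` {0..1}) \<and>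
    card (petals \<gamma> c) \<le> max 3 (card {l. l < M \<and> r l = 0})"
proof -
  have M1: "1 \<le> M" using M by simp
  note U = fan_dirs_fdir[OF M1]
  note D = fan_okD[OF ok]
  \<comment> \<open>Touching zeros are pushed off. Before vertex 0 comes vertex \<open>M - 1\<close>
    with reversed sign, so a touching at 0 shows as a negative product.\<close>
  define q0 where "q0 = (if r 0 = 0 \<and> r (M - 1) * r 1 < 0 then r 1 else r 0)"
  define q where "q l = (if l = 0 then q0 else if l = M then - q0
     else if r l = 0 \<and> r (l - 1) * r (Suc l) > 0 then r (Suc l) else r l)" for l
  have M3: "\<not> 3 dvd M - 1" using M by presburger
  have nb: "r (Suc l) \<noteq> 0" "l > 0 ==> r (l - 1) \<noteq> 0" if "r l = 0" "l < M" for l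
  proof -
    have l3: "3 dvd l" using z[of l] that by simp
    have n3: "\<not> 3 dvd Suc l" using l3 by presburger
    thus "r (Suc l) \<noteq> 0" using z[of "Suc l"] that by auto
    show "r (l - 1) \<noteq> 0" if "l > 0"
    proof -
      have "\<not> 3 dvd l - 1" using l3 that by presburger
      moreover have "l - 1 \<le> M" using \<open>l < M\<close> by simp
      ultimately show ?thesis using z by blast
    qed
  qed
  have rM1: "r (M - 1) \<noteq> 0" using z[of "M - 1"] M3 by auto
  have r1: "r 1 \<noteq> 0" using z[of 1] M1 by auto
  have q_eq: "q l = r l" if "r l \<noteq> 0" "l \<le> M" for l
    using that D(2) by (auto simp: q_def q0_def)
  have qz: "r l = 0" if "q l = 0" "l \<le> M" for l using q_eq[of l] that by auto
  have P: "fan_ok M q a \<and> fiso M (fdir M) r a q a"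
  proof (rule fan_push[OF U ok])
    show "q M = - q 0" using M by (simp add: q_def)
    show "q i * q (Suc i) \<ge> 0" if i: "i < M" for i
    proof (cases "r i = 0")
      case True
      have e: "q (Suc i) = r (Suc i)" using nb[OF True i] q_eq[of "Suc i"] i by simp
      show ?thesis
      proof (cases "i = 0")
        case i0: True
        have "r 0 = 0" using True i0 by simp
        hence "q0 * r 1 \<ge> 0" by (auto simp: q0_def)
        thus ?thesis unfolding e using i0 by (simp add: q_def)
      next
        case False
        thus ?thesis using e i True by (auto simp: q_def)
      qed
    next
      case False
      have e: "q i = r i" using False q_eq[of i] i by simp
      have "Suc i = M ==> ?thesis"
      proof -
        assume iM: "Suc i = M"
        hence i': "i = M - 1" by arith
        have "q (Suc i) = - q0" using M unfolding iM by (simp add: q_def)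
        moreover have "r i * - q0 \<ge> 0"
        proof (cases "r 0 = 0 \<and> r (M - 1) * r 1 < 0")
          case True
          thus ?thesis unfolding i' by (simp add: q0_def)
        next
          case False
          hence "q0 = r 0" by (auto simp: q0_def)
          thus ?thesis using D(4)[OF i] D(2) unfolding iM by simp
        qed
        ultimately show ?thesis using e by simp
      qed
      moreover have "Suc i \<noteq> M ==> ?thesis"
        using e D(4)[OF i] by (auto simp: q_def mult.commute)
      ultimately show ?thesis by blast
    qed
  qed (rule q_eq)
  define R where "R i = (-1) ^ (i div M) * q (i mod M)" for i
  define A where "A i = a (i mod M)" for i
  have RM: "R (i + M) = - R i" and AM: "A (i + M) = A i" for i using M by (auto simp: R_def A_def)
  have qM: "q M = - q 0" using fan_okD(2) P by blast
  have Rq: "R i = q i" "A i = a i" if "i \<le> M" for i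
    using that qM D(3) M by (cases "i = M"; simp add: R_def A_def)+
  have red: "\<exists>i'<M. R i * R (Suc i) = R i' * R (Suc i') \<and> R i * R (Suc (Suc i)) = R i' * R (Suc (Suc i')) \<and>
      (R (Suc i) = 0 --> R (Suc i') = 0)" for i
  proof (induction i rule: less_induct)
    case (less i)
    show ?case
    proof (cases "i < M")
      case False
      then obtain k where k: "i = k + M" by (metis add.commute le_add_diff_inverse not_less)
      have "R (k + M) = - R k" "R (Suc (k + M)) = - R (Suc k)" "R (Suc (Suc (k + M))) = - R (Suc (Suc k))"
        using RM[of k] RM[of "Suc k"] RM[of "Suc (Suc k)"] by simp_all
      moreover have "k < i" using k M by simp
      ultimately show ?thesis using less[of k] unfolding k by simp
    qed auto
  qed
  have Rsgn: "R i * R (Suc i) \<ge> 0" for i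
  proof -
    obtain i' where i': "i' < M" "R i * R (Suc i) = R i' * R (Suc i')" using red[of i] by blast
    hence "R i * R (Suc i) = q i' * q (Suc i')" using Rq[of i'] Rq[of "Suc i'"] by simp
    thus ?thesis using fan_okD(4)[OF conjunct1[OF P] i'(1)] by simp
  qed
  have Rz: "3 dvd i" if "R i = 0" for i
  proof -
    have "q (i mod M) = 0" using that by (simp add: R_def)
    hence "3 dvd i mod M" using z[of "i mod M"] qz[of "i mod M"] M1 by simp
    thus ?thesis using M(1) by (metis dvd_mod_iff)
  qed
  have Rgen: "R i * R (Suc (Suc i)) < 0" if Rs: "R (Suc i) = 0" for i
  proof -
    obtain i' where i': "i' < M" "R i * R (Suc (Suc i)) = R i' * R (Suc (Suc i'))" "R (Suc i') = 0"
      using red[of i] Rs by blast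
    have "R i' * R (Suc (Suc i')) < 0"
    proof (cases "Suc i' = M")
      case True
      hence i'M: "i' = M - 1" by simp
      have q0: "q M = 0" using i'(3) Rq(1)[of M] True by simp
      hence q00: "q0 = 0" using M by (simp add: q_def)
      hence r0: "r 0 = 0" "\<not> r (M - 1) * r 1 < 0" using r1 by (auto simp: q0_def split: if_splits)
      have "R (Suc (Suc i')) = - R 1" using RM[of 1] True by simp
      moreover have "R 1 = r 1" "R i' = r (M - 1)" using Rq q_eq M r1 rM1 i'M by simp_all
      ultimately show ?thesis using r0 r1 rM1 by (auto simp: linorder_neq_iff not_less mult_le_0_iff zero_le_mult_iff zero_less_mult_iff)
    next
      case False
      hence l: "Suc i' < M" using i' by simp
      hence qq: "q (Suc i') = 0" using i'(3) Rq(1)[of "Suc i'"] by simp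
      hence rr: "r (Suc i') = 0" using qz l by simp
      note n = nb[OF rr l]
      have "\<not> r i' * r (Suc (Suc i')) > 0" using qq n(1) l rr by (auto simp: q_def)
      hence "r i' * r (Suc (Suc i')) < 0" using n by (auto simp: linorder_neq_iff not_less mult_le_0_iff mult_less_0_iff)
      moreover have "R i' = r i'" "R (Suc (Suc i')) = r (Suc (Suc i'))" using Rq q_eq n l by simp_all
      ultimately show ?thesis by simp
    qed
    thus ?thesis using i'(2) by simp
  qed
  \<comment> \<open>Without zeros all radii would have one sign, contrary to
    \<open>q M = - q 0\<close>.\<close>
  have "\<exists>c<M. q c = 0"
  proof (rule ccontr)
    assume "\<not> ?thesis"
    hence n: "q c \<noteq> 0" if "c < M" for c using that by blast
    have "q l * q 0 > 0" if "l \<le> M" for l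
      using that
    proof (induction l)
      case 0
      thus ?case using n[of 0] M by (auto simp: zero_less_mult_iff)
    next
      case (Suc l)
      have "q (Suc l) \<noteq> 0" using n[of "Suc l"] n[of 0] qM Suc.prems M by (cases "Suc l = M") auto
      moreover have "q l * q (Suc l) \<ge> 0" using fan_okD(4)[OF conjunct1[OF P], of l] Suc.prems by simp
      moreover have "q l * q 0 > 0" using Suc by simp
      ultimately show ?case by (auto simp: zero_less_mult_iff zero_le_mult_iff)
    qed
    from this[of M] show False using qM by (auto simp: zero_less_mult_iff)
  qed
  then obtain c where c: "c < M" "q c = 0" by blast
  have Rc: "R c = 0" using Rq(1)[of c] c by simp
  have RcM: "R (M + c) = 0" using RM[of c] Rc by (simp add: add.commute)
  define U' r' a' where "U' = (\<lambda>i. fdir M (i + c))" and "r' = (\<lambda>i. R (i + c))" and "a' = (\<lambda>i. A (i + c))"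
  have qR: "q (i mod M) = 0" if "R i = 0" for i using that by (simp add: R_def)
  have ok': "fan_ok M r' a'"
    unfolding fan_ok_def
  proof (intro conjI allI impI)
    show "3 \<le> M" using M by simp
    show "r' M = - r' 0" "a' M = a' 0" using RM[of c] AM[of c] by (simp_all add: r'_def a'_def add.commute)
    show "r' i * r' (Suc i) \<ge> 0" for i using Rsgn[of "i + c"] by (simp add: r'_def)
    show "a' i \<noteq> a' j" if "i < M" "j < M" "i \<noteq> j" "r' i = 0" "r' j = 0" for i j
      unfolding a'_def A_def
    proof (rule fan_okD(5)[OF conjunct1[OF P]])
      show "(i + c) mod M < M" "(j + c) mod M < M" using M1 by simp_all
      show "(i + c) mod M \<noteq> (j + c) mod M" using mod_add_inj[of i c M j] that by blast
      show "q ((i + c) mod M) = 0" "q ((j + c) mod M) = 0" using qR[of "i + c"] qR[of "j + c"] that by (simp_all add: r'_def)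
    qed
    show "\<not> sbetween (a' i) (a' (Suc i)) (a' j)" if "r' i = 0" "r' (Suc i) = 0" for i j
    proof -
      have "3 dvd i + c" "3 dvd Suc (i + c)" using Rz[of "i + c"] Rz[of "Suc (i + c)"] that by (simp_all add: r'_def)
      thus ?thesis by presburger
    qed
  qed
  have "\<exists>\<gamma>. petal_projection \<gamma> 0 \<and> kiso (polygon_set M (fan_pt U' r' a')) (\<gamma> ` {0..1}) \<and>
    card (petals \<gamma> 0) \<le> max 3 (card {l. l < M \<and> r' l = 0})"
  proof (rule fan_petals_few[OF _ _ ok' M])
    show "fan_dirs M U'" unfolding U'_def by (rule fan_dirs_fdir_shift[OF M1])
    show "norm (U' i) = 1" for i by (simp add: U'_def fdir_def)
    show "r' 0 = 0" using Rc by (simp add: r'_def)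
    have c3: "3 dvd c" by (rule Rz[OF Rc])
    show "3 dvd l" if "r' l = 0" for l
    proof -
      have "3 dvd l + c" using Rz[of "l + c"] that by (simp add: r'_def)
      thus ?thesis using c3 by (metis dvd_add_left_iff)
    qed
    show "r' (l - 1) * r' (Suc l) < 0" if "0 < l" "r' l = 0" for l
      using Rgen[of "l - 1 + c"] that by (simp add: r'_def)
    have "R (M - 1 + c) * R (Suc (Suc (M - 1 + c))) < 0" by (rule Rgen) (use RcM M1 in simp)
    moreover have "Suc (Suc (M - 1 + c)) = Suc c + M" using M1 by simp
    ultimately have "R (M - 1 + c) * - R (Suc c) < 0" using RM[of "Suc c"] by (simp only:)
    thus "r' (M - 1) * r' 1 > 0" by (simp add: r'_def)
  qed
  then obtain \<gamma> where \<gamma>: "petal_projection \<gamma> 0" "kiso (polygon_set M (fan_pt U' r' a')) (\<gamma> ` {0..1})"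
    "card (petals \<gamma> 0) \<le> max 3 (card {l. l < M \<and> r' l = 0})" by blast
  have "card {l. l < M \<and> r' l = 0} \<le> card {l. l < M \<and> r l = 0}"
  proof (rule card_inj_on_le)
    show "inj_on (\<lambda>l. (l + c) mod M) {l. l < M \<and> r' l = 0}" by (auto intro!: inj_onI elim: mod_add_inj)
    show "(\<lambda>l. (l + c) mod M) ` {l. l < M \<and> r' l = 0} \<subseteq> {l. l < M \<and> r l = 0}"
    proof
      fix x assume "x \<in> (\<lambda>l. (l + c) mod M) ` {l. l < M \<and> r' l = 0}"
      then obtain l where l: "x = (l + c) mod M" "R (l + c) = 0" by (auto simp: r'_def)
      have "x < M" using l(1) M1 by simp
      moreover have "q x = 0" using qR[OF l(2)] l(1) by simp
      ultimately show "x \<in> {l. l < M \<and> r l = 0}" using qz[of x] by simp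
    qed
  qed simp
  moreover have "kiso (polygon_set M (fan_pt (fdir M) r a)) (polygon_set M (fan_pt U' r' a'))"
  proof -
    define V where "V i = (R i *\<^sub>R fdir M i, A i)" for i
    have "V (i + M) = V i" for i using RM AM fdir_add[OF M1] by (simp add: V_def)
    hence "polygon_set M (\<lambda>i. V (i + c)) = polygon_set M V" by (rule polygon_set_shift) (rule M1)
    moreover have "(\<lambda>i. V (i + c)) = fan_pt U' r' a'" by (auto simp: V_def fan_pt_def U'_def r'_def a'_def)
    moreover have "polygon_set M V = polygon_set M (fan_pt (fdir M) q a)"
    proof -
      have "edge_pt V i = edge_pt (fan_pt (fdir M) q a) i" if "i < M" for i
        using that Rq[of i] Rq[of "Suc i"] by (auto simp: V_def fan_pt_def edge_pt_def)
      thus ?thesis unfolding polygon_set_def pgon_image[OF M1] by simp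
    qed
    ultimately show ?thesis using P by (simp add: fiso_def)
  qed
  ultimately show ?thesis using \<gamma> kiso_trans by (meson le_trans max.mono order_refl)
qed


section \<open>From a straight strand to a fan\<close>

text \<open>A polygon in the plane starting with the remaining strand, from vertex 0 to vertex \<open>k\<close>; the vertices
  from \<open>k\<close> to \<open>M\<close> form the straight strand.\<close>

definition line_diagram :: "nat => nat => (nat => complex) => bool" where
  "line_diagram M k W \<longleftrightarrow> 0 < k \<and> k < M \<and> W M = W 0 \<and> (\<forall>i. k \<le> i --> i \<le> M --> Im (W i) = 0) \<and>
     (\<forall>i. k \<le> i --> i < M --> Re (W i) < Re (W (Suc i))) \<and>
     (\<forall>i<k. \<forall>j<k. \<forall>s t. 0 \<le> s --> s \<le> 1 --> 0 \<le> t --> t \<le> 1 -->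
        edge_pt W i s = edge_pt W j t --> real i + s = real j + t) \<and>
     (\<forall>i<k. \<forall>j<M. k \<le> j --> (\<forall>s t. 0 \<le> s --> s < 1 --> 0 \<le> t --> t < 1 -->
        edge_pt W i s = edge_pt W j t --> s = 0 \<and> t = 0)) \<and>
     (\<forall>i<k. Im (W i) * Im (W (Suc i)) \<ge> 0)"

lemma line_diagramD:
  assumes "line_diagram M k W"
  shows "0 < k" "k < M" "W M = W 0" "\<And>i. k \<le> i ==> i \<le> M ==> Im (W i) = 0"
    "\<And>i. k \<le> i ==> i < M ==> Re (W i) < Re (W (Suc i))"
    "\<And>i j s t. i < k ==> j < k ==> 0 \<le> s ==> s \<le> 1 ==> 0 \<le> t ==> t \<le> 1 ==> edge_pt W i s = edge_pt W j t ==> real i + s = real j + t"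
    "\<And>i j s t. i < k ==> j < M ==> k \<le> j ==> 0 \<le> s ==> s < 1 ==> 0 \<le> t ==> t < 1 ==> edge_pt W i s = edge_pt W j t ==> s = 0 \<and> t = 0"
    "\<And>i. i < k ==> Im (W i) * Im (W (Suc i)) \<ge> 0"
  using assms unfolding line_diagram_def by blast+

lemma nat_frac_eq2:
  assumes "real i + s = real j + t" "0 \<le> s" "s < 1" "0 \<le> t" "t < 1"
  shows "i = j \<and> s = t"
proof -
  have "real i < real j + 1" "real j < real i + 1" using assms by linarith+
  hence "i = j" by linarith
  thus ?thesis using assms(1) by simp
qed

lemma line_diagram_mono:
  assumes L: "line_diagram M k W" and "k \<le> i" "i < j" "j \<le> M"
  shows "Re (W i) < Re (W j)"
  using assms(3,4)
proof (induction j)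
  case (Suc j)
  have "Re (W j) < Re (W (Suc j))" using line_diagramD(5)[OF L] Suc.prems assms(2) by simp
  thus ?case using Suc by (cases "i = j") auto
qed simp

lemma line_diagram_strand:
  assumes L: "line_diagram M k W" and "k \<le> i" "i < M" "k \<le> j" "j < M" "0 \<le> s" "s < 1" "0 \<le> t" "t < 1"
    and e: "rmix s (Re (W i)) (Re (W (Suc i))) = rmix t (Re (W j)) (Re (W (Suc j)))"
  shows "i = j \<and> s = t"
proof -
  note D = line_diagramD[OF L]
  have aux: False
    if "k \<le> i" "i < j" "j < M" "0 \<le> s" "s < 1" "0 \<le> t"
      "rmix s (Re (W i)) (Re (W (Suc i))) = rmix t (Re (W j)) (Re (W (Suc j)))" for i j s t
  proof -
    have "Re (W i) < Re (W (Suc i))" "Re (W j) < Re (W (Suc j))" using D(5) that by auto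
    hence "s * (Re (W (Suc i)) - Re (W i)) < Re (W (Suc i)) - Re (W i)" "0 \<le> t * (Re (W (Suc j)) - Re (W j))"
      using that mult_less_self by auto
    moreover have "Re (W (Suc i)) \<le> Re (W j)"
      using line_diagram_mono[OF L, of "Suc i" j] that by (cases "Suc i = j") auto
    ultimately show False using that(7) by (simp add: algebra_simps)
  qed
  have ij: "i = j" using aux[of i j s t] aux[of j i t s] assms by (cases i j rule: linorder_cases) auto
  have "(s - t) * (Re (W (Suc i)) - Re (W i)) = 0" using e unfolding ij by (simp add: algebra_simps)
  thus ?thesis using ij D(5)[of i] assms by auto
qed

lemma line_diagram_crossing:
  assumes L: "line_diagram M k W" and ij: "i < k" "k \<le> j" "j < M" and e: "W i = W j"
  shows "0 < i" "k < j"
proof -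
  note D = line_diagramD[OF L]
  show "0 < i"
  proof (rule ccontr)
    assume "\<not> 0 < i"
    hence "W j = W M" using e D(3) by simp
    thus False using line_diagram_mono[OF L, of j M] ij by simp
  qed
  show "k < j"
  proof (rule ccontr)
    assume "\<not> k < j"
    hence "edge_pt W i 0 = edge_pt W (k - 1) 1" using e ij by simp
    hence "real i + 0 = real (k - 1) + 1" by (intro D(6)) (use ij in auto)
    hence "real i = real k" using ij by simp
    thus False using ij by simp
  qed
qed

lemma line_diagram_simple:
  assumes L: "line_diagram M k W" and H: "H M = H 0"
    and cr: "\<And>i j. 0 < i ==> i < k ==> k < j ==> j < M ==> W i = W j ==> H i \<noteq> H j"
  shows "simple_polygon M (\<lambda>i. (W i, H i))"
  unfolding simple_polygon_def
proof (intro conjI allI impI)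
  note D = line_diagramD[OF L]
  show "1 \<le> M" "(W M, H M) = (W 0, H 0)" using D H by auto
  let ?V = "\<lambda>i. (W i, H i)"
  have f: "fst (edge_pt ?V i s) = edge_pt W i s" and h: "snd (edge_pt ?V i 0) = H i" for i s
    by (auto simp: edge_pt_def)
  have RS: False if "i < k" "k \<le> j" "j < M" "0 \<le> s" "s < 1" "0 \<le> t" "t < 1" "edge_pt ?V i s = edge_pt ?V j t" for i j s t
  proof -
    have e: "edge_pt W i s = edge_pt W j t" using arg_cong[OF that(8), of fst] f by simp
    hence st: "s = 0" "t = 0" using D(7)[of i j s t] that by auto
    hence "W i = W j" "H i = H j" using that(8) by auto
    thus False using line_diagram_crossing[OF L that(1-3)] cr[of i j] that by auto
  qed
  have "i = j \<and> s = t"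
    if ij: "i < M" "j < M" "0 \<le> s" "s < 1" "0 \<le> t" "t < 1" "edge_pt ?V i s = edge_pt ?V j t" for i j s t
  proof -
    have e: "edge_pt W i s = edge_pt W j t" using arg_cong[OF ij(7), of fst] f by simp
    consider "i < k" "j < k" | "k \<le> i" "k \<le> j" | "i < k" "k \<le> j" | "j < k" "k \<le> i" by linarith
    thus ?thesis
    proof cases
      case 1
      thus ?thesis using D(6)[OF 1 _ _ _ _ e] ij nat_frac_eq2[of i s j t] by simp
    next
      case 2
      have "rmix s (Re (W i)) (Re (W (Suc i))) = rmix t (Re (W j)) (Re (W (Suc j)))"
        using arg_cong[OF e, of Re] by (simp add: edge_pt_def)
      thus ?thesis by (intro line_diagram_strand[OF L]) (use 2 ij in auto)
    next
      case 3
      thus ?thesis using RS[of i j s t] ij by auto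
    next
      case 4
      thus ?thesis using RS[of j i t s] ij by auto
    qed
  qed
  thus "i = j" "s = t"
    if "i < M" "j < M" "0 \<le> s" "s < 1" "0 \<le> t" "t < 1" "edge_pt ?V i s = edge_pt ?V j t" for i j s t
    using that by blast+
qed

text \<open>Over a fixed shadow an intersection can arise only at a crossing, and there both height
  functions give the same order.\<close>

lemma line_diagram_heights:
  assumes L: "line_diagram M k W" and H: "H M = H 0" "H' M = H' 0"
    and cr: "\<And>i j. 0 < i ==> i < k ==> k < j ==> j < M ==> W i = W j ==> H i < H j \<and> H' i < H' j \<or> H j < H i \<and> H' j < H' i"
  shows "kiso (polygon_set M (\<lambda>i. (W i, H i))) (polygon_set M (\<lambda>i. (W i, H' i)))"
proof (rule kiso_polygon)
  fix s :: real assume s: "0 \<le> s" "s \<le> 1"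
  have "(\<lambda>i. mix s (W i, H i) (W i, H' i)) = (\<lambda>i. (W i, (1 - s) * H i + s * H' i))"
    by (simp add: scaleR_left_distrib[symmetric])
  moreover have "simple_polygon M (\<lambda>i. (W i, (1 - s) * H i + s * H' i))"
  proof (rule line_diagram_simple[OF L])
    show "rmix s (H M) (H' M) = rmix s (H 0) (H' 0)" using H by simp
    show "rmix s (H i) (H' i) \<noteq> rmix s (H j) (H' j)"
      if "0 < i" "i < k" "k < j" "j < M" "W i = W j" for i j
      using cr[OF that] interpolate_less[OF _ _ s, of "H i" "H j" "H' i" "H' j"]
        interpolate_less[OF _ _ s, of "H j" "H i" "H' j" "H' i"] by force
  qed
  ultimately show "simple_polygon M (\<lambda>i. mix s (W i, H i) (W i, H' i))" by simp
qed

lemma edge_pt_linear: "linear A ==> edge_pt (\<lambda>i. A (V i)) i s = A (edge_pt V i s)"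
  by (simp add: edge_pt_def linear_add linear_scale)

lemma simple_polygon_linear:
  assumes sp: "simple_polygon M V" and A: "linear A" "\<And>v. A v = 0 ==> v = 0"
  shows "simple_polygon M (\<lambda>i. A (V i))"
proof -
  have "inj A" using A by (simp add: linear_injective_0)
  hence "edge_pt V i s = edge_pt V j t" if "edge_pt (\<lambda>i. A (V i)) i s = edge_pt (\<lambda>i. A (V i)) j t" for i j s t
    using that unfolding edge_pt_linear[OF A(1)] by (simp add: inj_eq)
  thus ?thesis using sp unfolding simple_polygon_def by metis
qed

lemma kiso_linear_map:
  fixes L :: "space => space"
  assumes sp: "simple_polygon M V" and L: "linear L"
    and inj: "\<And>s v. 0 \<le> s ==> s \<le> 1 ==> mix s v (L v) = 0 ==> v = 0"
  shows "kiso (polygon_set M V) (polygon_set M (\<lambda>i. L (V i)))"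
proof (rule kiso_polygon)
  fix s :: real assume s: "0 \<le> s" "s \<le> 1"
  have "linear (\<lambda>v. mix s v (L v))"
    by (intro linear_compose_add linear_compose_scale_right linear_id[unfolded id_def] L)
  thus "simple_polygon M (\<lambda>i. mix s (V i) (L (V i)))"
    by (rule simple_polygon_linear[OF sp]) (rule inj[OF s])
qed

text \<open>A cyclic permutation of the coordinates, that is, a third of a turn about the diagonal;
  it takes the line of the straight strand to the vertical axis.\<close>

definition book :: "space => space" where
  "book v = (Complex (Im (fst v)) (snd v), Re (fst v))"

lemma linear_book: "linear book"
  by (rule linearI) (auto simp: book_def complex_eq_iff)

text \<open>The interpolation with the identity has determinant \<open>(1 - s)^3 + s^3\<close>,
  which is positive for \<open>s\<close> between 0 and 1.\<close>

lemma book_isotopy: "simple_polygon M V ==> kiso (polygon_set M V) (polygon_set M (\<lambda>i. book (V i)))"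
proof (rule kiso_linear_map[OF _ linear_book])
  fix s :: real and v :: space assume s: "0 \<le> s" "s \<le> 1" and e: "mix s v (book v) = 0"
  define x y z where "x = Re (fst v)" and "y = Im (fst v)" and "z = snd v"
  have eq: "rmix s x y = 0" "rmix s y z = 0" "rmix s z x = 0"
    using arg_cong[OF e, of "\<lambda>v. Re (fst v)"] arg_cong[OF e, of "\<lambda>v. Im (fst v)"] arg_cong[OF e, of snd]
    by (simp_all add: book_def x_def y_def z_def)
  have pos: "(1 - s)^3 + s^3 > 0"
  proof (cases "s = 0")
    case False
    hence "s^3 > 0" "(1 - s)^3 \<ge> 0" using s by auto
    thus ?thesis by linarith
  qed simp
  have zero: "p = 0" if "rmix s p q = 0" "rmix s q w = 0" "rmix s w p = 0" for p q w :: real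
  proof -
    have "((1 - s)^3 + s^3) * p = (1 - s)^2 * (rmix s p q) - s * (1 - s) * (rmix s q w)
        + s^2 * (rmix s w p)"
      by (simp add: power3_eq_cube power2_eq_square algebra_simps)
    hence "((1 - s)^3 + s^3) * p = 0" unfolding that by simp
    thus ?thesis using pos by simp
  qed
  have "x = 0" "y = 0" "z = 0" using zero eq by blast+
  thus "v = 0" by (simp add: x_def y_def z_def prod_eq_iff complex_eq_iff)
qed

definition spin :: "real => space => space" where
  "spin \<phi> v = (cis \<phi> * fst v, snd v)"

lemma linear_spin: "linear (spin \<phi>)"
  by (rule linearI) (auto simp: spin_def algebra_simps)

text \<open>The interpolated factor \<open>(1 - s) + s * cis \<phi>\<close> runs along the chord
  from 1 to \<open>cis \<phi>\<close>, which misses 0 when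
  \<open>cos \<phi> \<ge> 0\<close>.\<close>

lemma spin_isotopy:
  assumes "simple_polygon M V" "cos \<phi> \<ge> 0"
  shows "kiso (polygon_set M V) (polygon_set M (\<lambda>i. spin \<phi> (V i)))"
proof (rule kiso_linear_map[OF assms(1) linear_spin])
  fix s :: real and v :: space assume s: "0 \<le> s" "s \<le> 1" and e: "mix s v (spin \<phi> v) = 0"
  have "((1 - s) + s * cis \<phi>) * fst v = 0" "snd v = 0"
    using arg_cong[OF e, of fst] arg_cong[OF e, of snd] by (simp_all add: spin_def scaleR_conv_of_real algebra_simps)
  moreover have "(1 - s) + s * cis \<phi> \<noteq> 0"
  proof
    assume z: "(1 - s) + s * cis \<phi> = 0"
    have "(1 - s) + s * cos \<phi> = 0" "s * sin \<phi> = 0" using arg_cong[OF z, of Re] arg_cong[OF z, of Im] by simp_all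
    moreover have "s * cos \<phi> \<ge> 0" using s assms(2) by simp
    moreover from calculation have "s = 1" using s by linarith
    ultimately have "cos \<phi> = 0" "sin \<phi> = 0" by auto
    thus False using sin_cos_squared_add[of \<phi>] by simp
  qed
  ultimately show "v = 0" by (simp add: prod_eq_iff)
qed

text \<open>Around the line, the remaining strand stays in the double cone
  \<open>\<bar>Z\<bar> \<le> c * \<bar>Y\<bar>\<close> and the straight strand strictly in its
  complement, on the side given by the sign of \<open>q\<close>, except where it is on the line. So
  the two can meet only on the line; this would be a crossing of the diagram, where \<open>q\<close>
  is nonzero.\<close>

lemma line_diagram_cone_simple:
  fixes q :: "nat => real"
  assumes L: "line_diagram M k W" and c: "c \<ge> 0"
    and R: "\<And>i. i \<le> k ==> Y i = Im (W i)" "\<And>i. i \<le> k ==> \<bar>Z i\<bar> \<le> c * \<bar>Y i\<bar>"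
    and q: "\<And>j. k \<le> j ==> j < M ==> q j * q (Suc j) \<ge> 0" "\<And>j. k \<le> j ==> j < M ==> q j = 0 ==> q (Suc j) \<noteq> 0"
    and S: "\<And>j. k \<le> j ==> j \<le> M ==> q j = 0 ==> Y j = 0 \<and> Z j = 0"
      "\<And>j. k \<le> j ==> j \<le> M ==> q j > 0 ==> Z j > c * \<bar>Y j\<bar>" "\<And>j. k \<le> j ==> j \<le> M ==> q j < 0 ==> - Z j > c * \<bar>Y j\<bar>"
    and cr: "\<And>i j. 0 < i ==> i < k ==> k < j ==> j < M ==> W i = W j ==> q j \<noteq> 0"
    and cl: "Y M = Y 0" "Z M = Z 0"
  shows "simple_polygon M (\<lambda>i. (Complex (Y i) (Z i), Re (W i)))"
  unfolding simple_polygon_def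
proof (intro conjI allI impI)
  note D = line_diagramD[OF L]
  let ?V = "\<lambda>i. (Complex (Y i) (Z i), Re (W i))"
  show "1 \<le> M" "?V M = ?V 0" using D cl by auto
  have V: "Re (fst (edge_pt ?V i s)) = rmix s (Y i) (Y (Suc i))" "Im (fst (edge_pt ?V i s)) = rmix s (Z i) (Z (Suc i))"
    "snd (edge_pt ?V i s) = rmix s (Re (W i)) (Re (W (Suc i)))" for i s by (simp_all add: edge_pt_def)
  have WR: "Im (edge_pt W i s) = rmix s (Y i) (Y (Suc i))" if "i < k" for i s
    using R(1)[of i] R(1)[of "Suc i"] that by (simp add: edge_pt_def)
  have WRe: "Re (edge_pt W i s) = rmix s (Re (W i)) (Re (W (Suc i)))" for i s by (simp add: edge_pt_def)
  have RS: False if ij: "i < k" "k \<le> j" "j < M" "0 \<le> s" "s < 1" "0 \<le> t" "t < 1" and e: "edge_pt ?V i s = edge_pt ?V j t" for i j s t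
  proof -
    define y z where "y = rmix s (Y i) (Y (Suc i))" and "z = rmix s (Z i) (Z (Suc i))"
    have yz: "y = rmix t (Y j) (Y (Suc j))" "z = rmix t (Z j) (Z (Suc j))"
      using arg_cong[OF e, of "\<lambda>p. Re (fst p)"] arg_cong[OF e, of "\<lambda>p. Im (fst p)"] unfolding V by (simp_all add: y_def z_def)
    have s1: "0 \<le> 1 - s" "0 < 1 - t" using ij by auto
    have "Y i * Y (Suc i) \<ge> 0" using D(8)[OF ij(1)] R(1)[of i] R(1)[of "Suc i"] ij(1) by simp
    then consider "Y i \<ge> 0" "Y (Suc i) \<ge> 0" | "Y i \<le> 0" "Y (Suc i) \<le> 0" by (auto simp: zero_le_mult_iff)
    hence ay: "\<bar>y\<bar> = rmix s \<bar>Y i\<bar> \<bar>Y (Suc i)\<bar>"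
    proof cases
      case 1
      thus ?thesis using s1 ij(4) by (simp add: y_def)
    next
      case 2
      hence "y \<le> 0" unfolding y_def using s1 ij(4) by (intro add_nonpos_nonpos mult_nonneg_nonpos)
      thus ?thesis using 2 by (simp add: y_def)
    qed
    have "\<bar>z\<bar> \<le> rmix s \<bar>Z i\<bar> \<bar>Z (Suc i)\<bar>"
      unfolding z_def using abs_triangle_ineq[of "(1 - s) * Z i" "s * Z (Suc i)"] s1 ij(4) by (simp add: abs_mult)
    also have "\<dots> \<le> rmix s (c * \<bar>Y i\<bar>) (c * \<bar>Y (Suc i)\<bar>)"
      using R(2)[of i] R(2)[of "Suc i"] ij s1 by (intro add_mono mult_left_mono) auto
    also have "\<dots> = c * \<bar>y\<bar>" unfolding ay by (simp add: algebra_simps)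
    finally have zR: "\<bar>z\<bar> \<le> c * \<bar>y\<bar>" .
    have "\<exists>\<tau>. (\<tau> = 1 \<or> \<tau> = -1) \<and> \<tau> * q j \<ge> 0 \<and> \<tau> * q (Suc j) \<ge> 0"
      using q(1)[OF ij(2,3)] by (auto simp: zero_le_mult_iff)
    then obtain \<tau> :: real where \<tau>: "\<tau> = 1 \<or> \<tau> = -1" "\<tau> * q j \<ge> 0" "\<tau> * q (Suc j) \<ge> 0" by blast
    have w: "\<tau> * Z l \<ge> c * \<bar>Y l\<bar>" "q l \<noteq> 0 ==> \<tau> * Z l > c * \<bar>Y l\<bar>" if l: "k \<le> l" "l \<le> M" "\<tau> * q l \<ge> 0" for l
      using S[OF l(1,2)] \<tau>(1) l(3) by (cases "q l" "0::real" rule: linorder_cases; force)+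
    have A: "(1 - t) * (\<tau> * Z j) \<ge> (1 - t) * (c * \<bar>Y j\<bar>)" "t * (\<tau> * Z (Suc j)) \<ge> t * (c * \<bar>Y (Suc j)\<bar>)"
      using w(1)[of j] w(1)[of "Suc j"] \<tau> ij s1 by (simp_all add: mult_left_mono)
    have "\<bar>y\<bar> \<le> rmix t \<bar>Y j\<bar> \<bar>Y (Suc j)\<bar>"
      unfolding yz using abs_triangle_ineq[of "(1 - t) * Y j" "t * Y (Suc j)"] s1 ij by (simp add: abs_mult)
    hence B: "c * \<bar>y\<bar> \<le> rmix t (c * \<bar>Y j\<bar>) (c * \<bar>Y (Suc j)\<bar>)"
      using mult_left_mono[OF _ c] by (fastforce simp: algebra_simps)
    have C: "\<tau> * z = rmix t (\<tau> * Z j) (\<tau> * Z (Suc j))" unfolding yz by (simp add: algebra_simps)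
    have D': "\<tau> * z \<le> \<bar>z\<bar>" using \<tau>(1) by auto
    have qj: "q j = 0"
    proof (rule ccontr)
      assume "q j \<noteq> 0"
      hence "(1 - t) * (\<tau> * Z j) > (1 - t) * (c * \<bar>Y j\<bar>)" using w(2)[of j] \<tau> ij s1 by simp
      thus False using A B C D' zR by linarith
    qed
    have t0: "t = 0"
    proof (rule ccontr)
      assume "t \<noteq> 0"
      hence "t * (\<tau> * Z (Suc j)) > t * (c * \<bar>Y (Suc j)\<bar>)"
        using w(2)[of "Suc j"] q(2)[OF ij(2,3) qj] \<tau> ij by simp
      thus False using A B C D' zR by linarith
    qed
    have "Y j = 0" using S(1)[of j] qj ij by simp
    hence "Im (edge_pt W i s) = Im (edge_pt W j t)"
      using yz(1) t0 D(4)[of j] ij unfolding WR[OF ij(1)] by (simp add: y_def)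
    moreover have "Re (edge_pt W i s) = Re (edge_pt W j t)" using arg_cong[OF e, of snd] unfolding V WRe .
    ultimately have we: "edge_pt W i s = edge_pt W j t" by (simp add: complex_eq_iff)
    hence "s = 0" using D(7)[of i j s t] ij by auto
    hence "W i = W j" using we t0 by simp
    thus False using line_diagram_crossing[OF L ij(1-3)] cr[of i j] ij qj by auto
  qed
  have "i = j \<and> s = t"
    if ij: "i < M" "j < M" "0 \<le> s" "s < 1" "0 \<le> t" "t < 1" "edge_pt ?V i s = edge_pt ?V j t" for i j s t
  proof -
    note ex = arg_cong[OF ij(7), of snd, unfolded V]
    consider "i < k" "j < k" | "k \<le> i" "k \<le> j" | "i < k" "k \<le> j" | "j < k" "k \<le> i" by linarith
    thus ?thesis
    proof cases
      case 1
      have "edge_pt W i s = edge_pt W j t"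
        using ex arg_cong[OF ij(7), of "\<lambda>p. Re (fst p)", unfolded V] by (simp add: complex_eq_iff WR WRe 1)
      thus ?thesis using D(6)[OF 1, of s t] ij nat_frac_eq2[of i s j t] by simp
    next
      case 2
      show ?thesis by (rule line_diagram_strand[OF L _ _ _ _ _ _ _ _ ex]) (use 2 ij in auto)
    next
      case 3
      thus ?thesis using RS[of i j s t] ij by auto
    next
      case 4
      thus ?thesis using RS[of j i t s] ij by auto
    qed
  qed
  thus "i = j" "s = t"
    if "i < M" "j < M" "0 \<le> s" "s < 1" "0 \<le> t" "t < 1" "edge_pt ?V i s = edge_pt ?V j t" for i j s t
    using that by blast+
qed


lemma polygon_set_cong:
  assumes "1 \<le> M" "\<And>i. i \<le> M ==> V i = V' i"
  shows "polygon_set M V = polygon_set M V'"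
proof -
  have "edge_pt V i = edge_pt V' i" if "i < M" for i using assms(2)[of i] assms(2)[of "Suc i"] that by (auto simp: edge_pt_def)
  thus ?thesis unfolding polygon_set_def pgon_image[OF assms(1)] by simp
qed

text \<open>The coordinate along the line becomes the height of a fan. The remaining strand stays in its shadow and
  is turned into the pages of an open book within an angle \<open>\<phi>\<close> of the plane of the diagram; the
  straight strand takes the other pages.\<close>

lemma line_diagram_fan:
  fixes q :: "nat => real"
  assumes L: "line_diagram M k W" and M3: "3 \<le> M" and H: "H M = H 0" and qk: "q k = 0" "q M = 0"
    and q: "\<And>j. k \<le> j ==> j < M ==> q j * q (Suc j) \<ge> 0" "\<And>j. k \<le> j ==> j < M ==> q j = 0 ==> q (Suc j) \<noteq> 0"
    and cr: "\<And>i j. 0 < i ==> i < k ==> k < j ==> j < M ==> W i = W j ==> q j > 0 \<and> H i < H j \<or> q j < 0 \<and> H j < H i"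
  shows "\<exists>r. fan_ok M r (\<lambda>i. Re (W i)) \<and>
    kiso (polygon_set M (\<lambda>i. (W i, H i))) (polygon_set M (fan_pt (fdir M) r (\<lambda>i. Re (W i)))) \<and>
    (\<forall>i\<le>k. \<exists>c>0. r i = c * Im (W i)) \<and> (\<forall>i. k \<le> i --> r i = q i)"
proof -
  note D = line_diagramD[OF L]
  \<comment> \<open>The pages 0 to \<open>k\<close> of the remaining strand fill an angle
    \<open>2 * \<phi>\<close>; \<open>\<alpha>\<close> measures angles from its bisector, the plane
    of the diagram.\<close>
  define \<phi> where "\<phi> = pi * real k / (2 * real M)"
  define \<alpha> where "\<alpha> i = pi * real i / real M - \<phi>" for i
  have \<phi>: "0 < \<phi>" "\<phi> < pi / 2" using D(1,2) by (auto simp: \<phi>_def field_simps)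
  have \<phi>2: "2 * \<phi> = pi * real k / real M" by (simp add: \<phi>_def)
  have cs: "cos \<phi> > 0" "sin \<phi> > 0" using \<phi> by (auto intro!: cos_gt_zero sin_gt_zero)
  have ang: "0 \<le> pi * real i / real M" "pi * real i / real M \<le> 2 * \<phi>" if "i \<le> k" for i
    unfolding \<phi>2 using that D(2) by (auto intro!: divide_right_mono)
  have cosa: "cos (\<alpha> i) > 0" if "i \<le> k" for i
    unfolding \<alpha>_def using ang[OF that] \<phi> by (intro cos_gt_zero_pi; linarith)
  \<comment> \<open>Dividing by the cosine keeps the coordinate
    \<open>r i * cos (\<alpha> i) = Im (W i)\<close>, hence the shadow, while the vertex moves
    vertically into its page.\<close>
  define r where "r i = (if i < k then Im (W i) / cos (\<alpha> i) else q i)" for i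
  define x where "x i = Re (W i)" for i
  \<comment> \<open>At \<open>s = 0\<close> the straight strand lies in the plane through the line
    perpendicular to the diagram, at \<open>s = 1\<close> in its own pages.\<close>
  define Y where "Y s i = (if i \<le> k then Im (W i) else s * (q i * cos (\<alpha> i)))" for s i
  define Z where "Z i = (if i \<le> k then Im (W i) * tan (\<alpha> i) else q i * sin (\<alpha> i))" for i
  have ImW: "Im (W 0) = 0" "Im (W k) = 0" using D(2,3) D(4)[of M] D(4)[of k] by auto
  have ZM: "Z M = Z 0" "Y s M = Y s 0" for s using ImW D(2) qk by (simp_all add: Z_def Y_def)
  have sinS: "sin (\<alpha> j) > tan \<phi> * \<bar>cos (\<alpha> j)\<bar>" if "k < j" "j < M" for j
  proof -
    have e: "\<alpha> j - \<phi> = pi * (real j - real k) / real M" "\<alpha> j + \<phi> = pi * real j / real M"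
      using \<phi>2 by (simp_all add: \<alpha>_def right_diff_distrib diff_divide_distrib)
    have sg: "sin (pi * x / real M) > 0" if "0 < x" "x < real M" for x
      by (rule sin_gt_zero) (use that in "simp_all add: divide_less_eq")
    have "sin (\<alpha> j - \<phi>) > 0" "sin (\<alpha> j + \<phi>) > 0" unfolding e using that by (intro sg; simp)+
    hence "sin (\<alpha> j) * cos \<phi> > sin \<phi> * \<bar>cos (\<alpha> j)\<bar>" by (auto simp: sin_diff sin_add abs_if mult.commute)
    thus ?thesis using cs by (simp add: tan_def field_simps)
  qed
  have sinS0: "sin (\<alpha> j) > 0" if "k < j" "j < M" for j
  proof -
    have "0 \<le> tan \<phi> * \<bar>cos (\<alpha> j)\<bar>" using cs by (simp add: tan_def)
    thus ?thesis using sinS[OF that] by linarith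
  qed
  have tanR: "\<bar>tan (\<alpha> i)\<bar> \<le> tan \<phi>" if "i \<le> k" for i
  proof -
    have e: "\<phi> - \<alpha> i = 2 * \<phi> - pi * real i / real M" "\<phi> + \<alpha> i = pi * real i / real M"
      by (simp_all add: \<alpha>_def)
    have "sin (\<phi> - \<alpha> i) \<ge> 0" "sin (\<phi> + \<alpha> i) \<ge> 0" unfolding e
      by (rule sin_ge_zero; use ang[OF that] \<phi> in linarith)+
    hence "\<bar>sin (\<alpha> i)\<bar> * cos \<phi> \<le> sin \<phi> * cos (\<alpha> i)" by (auto simp: sin_diff sin_add abs_if mult.commute)
    hence "\<bar>sin (\<alpha> i)\<bar> \<le> sin \<phi> * cos (\<alpha> i) / cos \<phi>" using cs by (simp add: pos_le_divide_eq)
    hence "\<bar>sin (\<alpha> i)\<bar> \<le> tan \<phi> * cos (\<alpha> i)" by (simp add: tan_def)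
    moreover have "\<bar>tan (\<alpha> i)\<bar> = \<bar>sin (\<alpha> i)\<bar> / cos (\<alpha> i)" using cosa[OF that] by (simp add: tan_def)
    ultimately show ?thesis using cosa[OF that] by (simp add: pos_divide_le_eq)
  qed
  have crq: "q j \<noteq> 0" if "0 < i" "i < k" "k < j" "j < M" "W i = W j" for i j
    using cr[OF that] by auto
  have sim: "simple_polygon M (\<lambda>i. (Complex (Y s i) (Z i), x i))" if s: "0 \<le> s" "s \<le> 1" for s
    unfolding x_def
  proof (rule line_diagram_cone_simple[OF L, where c = "tan \<phi>" and q = q])
    show "tan \<phi> \<ge> 0" using cs by (simp add: tan_def)
    show "Y s i = Im (W i)" if "i \<le> k" for i using that by (simp add: Y_def)
    show "\<bar>Z i\<bar> \<le> tan \<phi> * \<bar>Y s i\<bar>" if "i \<le> k" for i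
      using mult_right_mono[OF tanR[OF that], of "\<bar>Im (W i)\<bar>"] that by (simp add: Y_def Z_def abs_mult mult.commute)
    show "q j * q (Suc j) \<ge> 0" "q j = 0 ==> q (Suc j) \<noteq> 0" if "k \<le> j" "j < M" for j using q that by auto
    show "Y s j = 0 \<and> Z j = 0" if "k \<le> j" "j \<le> M" "q j = 0" for j
      using that ImW by (auto simp: Y_def Z_def)
    have pos: "sin (\<alpha> j) * p > tan \<phi> * \<bar>s * (p * cos (\<alpha> j))\<bar>" if "k < j" "j < M" "p > 0" for j p
    proof -
      have "s * \<bar>cos (\<alpha> j)\<bar> \<le> 1 * \<bar>cos (\<alpha> j)\<bar>" using s by (intro mult_right_mono) auto
      hence "tan \<phi> * (s * \<bar>cos (\<alpha> j)\<bar>) \<le> tan \<phi> * \<bar>cos (\<alpha> j)\<bar>" using cs by (simp add: tan_def divide_right_mono)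
      hence "tan \<phi> * (s * \<bar>cos (\<alpha> j)\<bar>) < sin (\<alpha> j)" using sinS[OF that(1,2)] by linarith
      hence "tan \<phi> * (s * \<bar>cos (\<alpha> j)\<bar>) * p < sin (\<alpha> j) * p" using that(3) by (rule mult_strict_right_mono)
      thus ?thesis using that s by (simp add: abs_mult ac_simps)
    qed
    have ends: "k < j" "j < M" if "k \<le> j" "j \<le> M" "q j \<noteq> 0" for j using that qk by (auto intro: le_neq_implies_less)
    show "Z j > tan \<phi> * \<bar>Y s j\<bar>" if "k \<le> j" "j \<le> M" "q j > 0" for j
      using pos[of j "q j"] ends[of j] that by (simp add: Y_def Z_def mult.commute)
    show "- Z j > tan \<phi> * \<bar>Y s j\<bar>" if "k \<le> j" "j \<le> M" "q j < 0" for j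
      using pos[of j "- q j"] ends[of j] that by (simp add: Y_def Z_def mult.commute)
    show "q j \<noteq> 0" if "0 < i" "i < k" "k < j" "j < M" "W i = W j" for i j by (rule crq[OF that])
  qed (rule ZM)+
  define P where "P s = (\<lambda>i. (Complex (Y s i) (Z i), x i))" for s
  have M1: "1 \<le> M" using M3 by simp
  \<comment> \<open>At a crossing the remaining strand gets height 0 and the straight strand a
    height with the sign of \<open>q j\<close>, which agrees with the order under
    \<open>H\<close>.\<close>
  have k1: "kiso (polygon_set M (\<lambda>i. (W i, H i))) (polygon_set M (\<lambda>i. (W i, Z i)))"
  proof (rule line_diagram_heights[OF L H ZM(1)])
    fix i j assume ij: "0 < i" "i < k" "k < j" "j < M" "W i = W j"
    have "Im (W i) = 0" using D(4)[of j] ij by simp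
    hence "Z i = 0" using ij by (simp add: Z_def)
    moreover have "Z j = q j * sin (\<alpha> j)" using ij by (simp add: Z_def)
    ultimately show "H i < H j \<and> Z i < Z j \<or> H j < H i \<and> Z j < Z i"
      using cr[OF ij] sinS0[of j] ij by (auto simp: mult_neg_pos)
  qed
  have sW: "simple_polygon M (\<lambda>i. (W i, Z i))"
  proof (rule line_diagram_simple[OF L ZM(1)])
    fix i j assume ij: "0 < i" "i < k" "k < j" "j < M" "W i = W j"
    have "Im (W i) = 0" using D(4)[of j] ij by simp
    thus "Z i \<noteq> Z j" using ij sinS0[of j] crq[OF ij] by (simp add: Z_def)
  qed
  have bk: "book (W i, Z i) = P 0 i" if "i \<le> M" for i
    using D(4)[of i] that by (auto simp: book_def P_def Y_def x_def)
  have k2: "kiso (polygon_set M (\<lambda>i. (W i, Z i))) (polygon_set M (P 0))"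
    using book_isotopy[OF sW] polygon_set_cong[OF M1 bk] by simp
  have k3: "kiso (polygon_set M (P 0)) (polygon_set M (P 1))"
  proof (rule kiso_polygon)
    fix s :: real assume s: "0 \<le> s" "s \<le> 1"
    have "(\<lambda>i. mix s (P 0 i) (P 1 i)) = P s"
      by (auto simp: P_def Y_def complex_eq_iff algebra_simps)
    thus "simple_polygon M (\<lambda>i. mix s (P 0 i) (P 1 i))" using sim[OF s] by (simp add: P_def)
  qed
  have sp: "spin \<phi> (P 1 i) = fan_pt (fdir M) r x i" if "i \<le> M" for i
  proof -
    have f: "fdir M i = cis \<phi> * cis (\<alpha> i)" by (simp add: fdir_def \<alpha>_def cis_mult)
    have "Complex (Y 1 i) (Z i) = r i *\<^sub>R cis (\<alpha> i)"
    proof (cases "i \<le> k")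
      case True
      have "r k = 0" using qk by (simp add: r_def)
      thus ?thesis using True cosa[OF True] ImW by (cases "i = k") (auto simp: Y_def Z_def r_def complex_eq_iff tan_def)
    qed (simp add: Y_def Z_def r_def complex_eq_iff)
    thus ?thesis by (simp add: spin_def P_def fan_pt_def f)
  qed
  have "kiso (polygon_set M (P 1)) (polygon_set M (\<lambda>i. spin \<phi> (P 1 i)))"
    by (rule spin_isotopy) (use sim[of 1] cs in "auto simp: P_def")
  hence k4: "kiso (polygon_set M (P 1)) (polygon_set M (fan_pt (fdir M) r x))"
    using polygon_set_cong[OF M1 sp] by simp
  have k: "kiso (polygon_set M (\<lambda>i. (W i, H i))) (polygon_set M (fan_pt (fdir M) r x))"
    by (rule kiso_trans[OF k1 kiso_trans[OF k2 kiso_trans[OF k3 k4]]])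
  have rk: "r k = 0" "r M = 0" "r 0 = 0" using qk D(1,2) ImW by (auto simp: r_def)
  have rpos: "\<exists>c>0. r i = c * Im (W i)" if "i \<le> k" for i
  proof (cases "i = k")
    case True
    thus ?thesis using rk ImW by (intro exI[of _ 1]) simp
  next
    case False
    thus ?thesis using that cosa[OF that] by (intro exI[of _ "1 / cos (\<alpha> i)"]) (simp add: r_def)
  qed
  have r0: "Im (W i) = 0" if "i \<le> M" "r i = 0" for i
    using rpos[of i] D(4)[of i] that by (cases "i \<le> k") auto
  have Wz: "W i = W j" if "i \<le> M" "j \<le> M" "r i = 0" "r j = 0" "x i = x j" for i j
    using r0 that by (auto simp: complex_eq_iff x_def)
  have RX: "q j \<noteq> 0" if "i < k" "k \<le> j" "j < M" "W i = W j" for i j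
    using line_diagram_crossing[OF L that] crq[of i j] that by auto
  have dist: False if "i < j" "j < M" "r i = 0" "r j = 0" "x i = x j" for i j
  proof -
    have w: "W i = W j" using Wz that by auto
    consider "j < k" | "i < k" "k \<le> j" | "k \<le> i" using that by linarith
    thus False
    proof cases
      case 1
      have "real i + 0 = real j + 0" by (rule D(6)) (use 1 that w in auto)
      thus False using that by simp
    next
      case 2
      thus False using RX[OF 2 that(2) w] that by (simp add: r_def)
    next
      case 3
      thus False using line_diagram_mono[OF L 3 that(1)] that w by simp
    qed
  qed
  have "fan_ok M r x"
    unfolding fan_ok_def
  proof (intro conjI allI impI)
    show "r M = - r 0" "x M = x 0" using rk D(3) by (auto simp: x_def)
    show "r i * r (Suc i) \<ge> 0" if "i < M" for i
    proof (cases "i < k")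
      case True
      then obtain c d where "c > 0" "d > 0" "r i = c * Im (W i)" "r (Suc i) = d * Im (W (Suc i))"
        using rpos[of i] rpos[of "Suc i"] by auto
      moreover have "(c * d) * (Im (W i) * Im (W (Suc i))) \<ge> 0" if "c > 0" "d > 0" for c d
        using D(8)[OF True] that by simp
      ultimately show ?thesis by (metis mult.assoc mult.left_commute)
    qed (use that q(1)[of i] in "simp add: r_def")
    show "x i \<noteq> x j" if "i < M" "j < M" "i \<noteq> j" "r i = 0" "r j = 0" for i j
      using dist[of i j] dist[of j i] that by (cases i j rule: linorder_cases) auto
    show "\<not> sbetween (x i) (x (Suc i)) (x j)" if ij: "i < M" "j < M" "r i = 0" "r (Suc i) = 0" "r j = 0" for i j
    proof
      assume b: "sbetween (x i) (x (Suc i)) (x j)"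
      have ik: "i < k" using q(2)[of i] ij by (auto simp: r_def split: if_splits)
      define s where "s = (x j - x i) / (x (Suc i) - x i)"
      have s: "0 < s" "s < 1" "x j = x i + s * (x (Suc i) - x i)"
        using b by (auto simp: s_def sbetween_def divide_simps)
      have "edge_pt W i s = W j"
        using s(3) r0[of i] r0[of "Suc i"] r0[of j] ij by (simp add: edge_pt_def complex_eq_iff x_def algebra_simps)
      hence e: "edge_pt W i s = edge_pt W j 0" by simp
      show False
      proof (cases "j < k")
        case True
        hence "real i + s = real j + 0" by (intro D(6) e) (use ik s in auto)
        thus False using nat_frac_eq[of i s j] s by simp
      next
        case False
        thus False using D(7)[OF ik ij(2) _ _ _ _ _ e] s by simp
      qed
    qed
  qed (rule M3)
  thus ?thesis using k rpos unfolding x_def r_def by (intro exI[of _ r]) (auto simp: r_def[abs_def])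
qed


section \<open>Noncrossing of arcs in a half plane\<close>

lemma half_plane_interlace:
  fixes f g :: "real => complex" and \<sigma> :: real
  assumes p: "path f" "path g" and \<sigma>: "\<sigma> \<noteq> 0"
    and half: "\<And>z. z \<in> path_image f \<union> path_image g ==> \<sigma> * Im z \<ge> 0"
    and ends: "Im (pathstart f) = 0" "Im (pathfinish f) = 0" "Im (pathstart g) = 0" "Im (pathfinish g) = 0"
    and order: "Re (pathstart f) < Re (pathstart g)" "Re (pathstart g) < Re (pathfinish f)" "Re (pathfinish f) < Re (pathfinish g)"
  shows "path_image f \<inter> path_image g \<noteq> {}"
proof -
  \<comment> \<open>Passage to \<open>real^2\<close> for the Fashoda meet theorem, with the end
    points on the bottom of a box; the factor \<open>\<sigma>\<close> turns the lower half plane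
    into the upper one if necessary.\<close>
  define h :: "complex => real^2" where "h z = vector [Re z, \<sigma> * Im z]" for z
  have h: "h z $ 1 = Re z" "h z $ 2 = \<sigma> * Im z" for z by (simp_all add: h_def)
  have "linear h" by (rule linearI) (auto simp: vec_eq_iff forall_2 h algebra_simps)
  hence cont: "continuous_on X h" for X by (rule linear_continuous_on[OF linear_conv_bounded_linear[THEN iffD1]])
  have "bounded (path_image f \<union> path_image g)" using p by (simp add: bounded_path_image)
  then obtain B where B: "\<And>z. z \<in> path_image f \<union> path_image g ==> norm (h z) \<le> B"
    using bounded_linear_image[of _ h] \<open>linear h\<close> unfolding linear_conv_bounded_linear bounded_iff by blast
  define a b :: "real^2" where "a = vector [-B, 0]" and "b = vector [B, B]"
  have box: "h z \<in> cbox a b" if "z \<in> path_image f \<union> path_image g" for z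
    using B[OF that] half[OF that] component_le_norm_cart[of "h z" 1] component_le_norm_cart[of "h z" 2]
    by (auto simp: mem_box_cart forall_2 a_def b_def h)
  obtain z where "z \<in> path_image (h \<circ> f)" "z \<in> path_image (h \<circ> g)"
  proof (rule fashoda_interlace[of "h \<circ> f" "h \<circ> g" a b])
    show "path (h \<circ> f)" "path (h \<circ> g)" using p cont by (auto intro: path_continuous_image)
    show "path_image (h \<circ> f) \<subseteq> cbox a b" "path_image (h \<circ> g) \<subseteq> cbox a b" using box by (auto simp: path_image_compose)
  qed (use ends order in "auto simp: pathstart_compose pathfinish_compose h a_def")
  moreover have "inj h" using \<sigma> by (auto simp: inj_def vec_eq_iff forall_2 h complex_eq_iff)
  ultimately show ?thesis by (auto simp: path_image_compose inj_eq)
qed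

text \<open>If exactly one end of \<open>g\<close> is between the ends of \<open>f\<close>, then
  after reversing paths and possibly exchanging them the ends interlace as in
  \<open>half_plane_interlace\<close>, and the paths would meet.\<close>

lemma half_plane_sep:
  fixes f g :: "real => complex" and \<sigma> :: real
  assumes p: "path f" "path g" and \<sigma>: "\<sigma> \<noteq> 0"
    and half: "\<And>z. z \<in> path_image f \<union> path_image g ==> \<sigma> * Im z \<ge> 0"
    and ends: "Im (pathstart f) = 0" "Im (pathfinish f) = 0" "Im (pathstart g) = 0" "Im (pathfinish g) = 0"
    and disj: "path_image f \<inter> path_image g = {}"
  shows "sep (Re (pathstart f)) (Re (pathfinish f)) (Re (pathstart g)) \<longleftrightarrow> sep (Re (pathstart f)) (Re (pathfinish f)) (Re (pathfinish g))"
proof (rule ccontr)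
  assume ns: "\<not> ?thesis"
  have key: False
    if pf: "path f'" "path g'" "path_image f' = path_image f" "path_image g' = path_image g"
      "Im (pathstart f') = 0" "Im (pathfinish f') = 0" "Im (pathstart g') = 0" "Im (pathfinish g') = 0"
      "Re (pathstart f') \<le> Re (pathfinish f')" "Re (pathstart f') < Re (pathstart g')" "Re (pathstart g') \<le> Re (pathfinish f')"
      "Re (pathfinish g') \<le> Re (pathstart f') \<or> Re (pathfinish f') < Re (pathfinish g')" for f' g'
  proof -
    have ne: "pathstart f' \<noteq> pathfinish g'" "pathfinish f' \<noteq> pathstart g'"
      using disj pathstart_in_path_image pathfinish_in_path_image pf(3,4) by (metis disjoint_iff)+
    hence ne': "Re (pathstart f') \<noteq> Re (pathfinish g')" "Re (pathfinish f') \<noteq> Re (pathstart g')"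
      using pf(5-8) by (auto simp: complex_eq_iff)
    show False
    proof (cases "Re (pathfinish f') < Re (pathfinish g')")
      case True
      have "path_image f' \<inter> path_image g' \<noteq> {}"
        by (rule half_plane_interlace[OF pf(1,2) \<sigma>]) (use half pf ne' True in auto)
      thus False using disj pf(3,4) by simp
    next
      case False
      have "path_image (reversepath g') \<inter> path_image f' \<noteq> {}"
        by (rule half_plane_interlace[OF _ pf(1) \<sigma>]) (use half pf ne' False in auto)
      thus False using disj pf(3,4) by auto
    qed
  qed
  let ?p = "Re (pathstart f)" and ?q = "Re (pathfinish f)" and ?p' = "Re (pathstart g)" and ?q' = "Re (pathfinish g)"
  consider "?p \<le> ?q" "sep ?p ?q ?p'" "\<not> sep ?p ?q ?q'" | "?p \<le> ?q" "\<not> sep ?p ?q ?p'" "sep ?p ?q ?q'"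
    | "?q \<le> ?p" "sep ?p ?q ?p'" "\<not> sep ?p ?q ?q'" | "?q \<le> ?p" "\<not> sep ?p ?q ?p'" "sep ?p ?q ?q'"
    using ns by linarith
  thus False
  proof cases
    case 1
    thus False using key[of f g] p ends by (auto simp: sep_def)
  next
    case 2
    thus False using key[of f "reversepath g"] p ends by (auto simp: sep_def)
  next
    case 3
    thus False using key[of "reversepath f" g] p ends by (auto simp: sep_def)
  next
    case 4
    thus False using key[of "reversepath f" "reversepath g"] p ends by (auto simp: sep_def)
  qed
qed

lemma pgon_segment:
  assumes "i < j" "1 \<le> M" "real i / real M \<le> t" "t \<le> real j / real M"
  obtains l s where "i \<le> l" "l < j" "0 \<le> s" "s \<le> 1" "t = (real l + s) / real M"
proof (cases "t = real j / real M")
  case True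
  show thesis by (rule that[of "j - 1" 1]) (use assms True in "auto simp: of_nat_diff")
next
  case False
  define l where "l = nat \<lfloor>real M * t\<rfloor>"
  have Mt: "real i \<le> real M * t" "real M * t < real j" using assms False by (auto simp: field_simps)
  hence l: "real l = of_int \<lfloor>real M * t\<rfloor>" by (simp add: l_def)
  show thesis
  proof (rule that[of l "real M * t - real l"])
    show "0 \<le> real M * t - real l" "real M * t - real l \<le> 1" unfolding l by linarith+
    have "real l \<le> real M * t" "real M * t < real l + 1" unfolding l by linarith+
    hence "real l < real j" "real i < real l + 1" using Mt by linarith+
    thus "i \<le> l" "l < j" by linarith+
    show "t = (real l + (real M * t - real l)) / real M" using assms(2) by simp
  qed
qed

text \<open>Sub-arcs of the remaining strand on one side of the line are disjoint, so their ends cannot interlace.\<close>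

lemma line_diagram_noncross:
  assumes L: "line_diagram M k W" and r: "\<And>i. i \<le> k ==> \<exists>c>0. r i = c * Im (W i)"
  shows "noncross k r (\<lambda>i. Re (W i))"
  unfolding noncross_def
proof (intro allI impI)
  fix \<sigma> :: real and i j i' j'
  assume \<sigma>: "\<sigma> = 1 \<or> \<sigma> = -1" and A: "fan_arc r \<sigma> i j" "fan_arc r \<sigma> i' j'" and jk: "j \<le> k" "j' \<le> k" and ord: "j < i' \<or> j' < i"
  note D = line_diagramD[OF L]
  have M: "1 \<le> M" using D(2) by simp
  have cont: "continuous_on X (pgon M W)" if "X \<subseteq> {0..1}" for X
    using pa_continuous[OF pa_pgon[OF M, of W]] that continuous_on_subset by blast
  have sgn: "\<sigma> * Im (W l) \<ge> 0" if l: "\<sigma> * r l \<ge> 0" "l \<le> k" for l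
  proof -
    obtain c where "c > 0" "r l = c * Im (W l)" using r[OF l(2)] by blast
    hence "c * (\<sigma> * Im (W l)) \<ge> 0" using l(1) by (simp add: mult.left_commute)
    thus ?thesis using \<open>c > 0\<close> by (simp add: zero_le_mult_iff)
  qed
  have zero: "Im (W l) = 0" if "r l = 0" "l \<le> k" for l using r[OF that(2)] that(1) by auto
  define f where "f i j = subpath (real i / real M) (real j / real M) (pgon M W)" for i j
  have dom: "real i / real M \<in> {0..1}" "real j / real M \<in> {0..1}" "real i / real M \<le> real j / real M" if "i < j" "j \<le> k" for i j
    using that D(2) by (auto simp: divide_right_mono)
  have img: "path_image (f i j) = pgon M W ` {real i / real M..real j / real M}" if "i < j" "j \<le> k" for i j
    using dom[OF that] by (simp add: f_def path_image_subpath)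
  have pt: "\<exists>l s. i \<le> l \<and> l < j \<and> 0 \<le> s \<and> s \<le> 1 \<and> z = edge_pt W l s" if z: "z \<in> path_image (f i j)" and ij: "i < j" "j \<le> k" for z i j
  proof -
    obtain t where t: "real i / real M \<le> t" "t \<le> real j / real M" "z = pgon M W t" using z unfolding img[OF ij] by auto
    obtain l s where "i \<le> l" "l < j" "0 \<le> s" "s \<le> 1" "t = (real l + s) / real M" using pgon_segment[OF ij(1) M t(1,2)] .
    thus ?thesis using pgon_edge'[OF _ _ M, of s W l] t(3) by blast
  qed
  have pth: "path (f i j)" if "i < j" "j \<le> k" for i j
    unfolding f_def by (rule path_subpath) (use dom[OF that] cont in "auto simp: path_def")
  have st: "pathstart (f i j) = W i" "pathfinish (f i j) = W j" for i j
    by (simp_all add: f_def pathstart_subpath pathfinish_subpath pgon_vertex[OF M])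
  have half: "\<sigma> * Im z \<ge> 0" if a: "fan_arc r \<sigma> i j" and jk: "j \<le> k" and z: "z \<in> path_image (f i j)" for i j z
  proof -
    have ij: "i < j" using a by (simp add: fan_arc_def)
    obtain l s where l: "i \<le> l" "l < j" "0 \<le> s" "s \<le> 1" "z = edge_pt W l s" using pt[OF z ij jk] by blast
    have "\<sigma> * Im (W l) \<ge> 0" "\<sigma> * Im (W (Suc l)) \<ge> 0"
      by (rule sgn; use a l jk in "auto simp: fan_arc_def")+
    hence "rmix s (\<sigma> * Im (W l)) (\<sigma> * Im (W (Suc l))) \<ge> 0" using l by simp
    thus ?thesis unfolding l(5) by (simp add: edge_pt_def algebra_simps)
  qed
  have disj: "path_image (f i j) \<inter> path_image (f i' j') = {}"
    if o: "i < j" "j < i'" "i' < j'" "j' \<le> k" for i j i' j'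
  proof (rule ccontr)
    assume "\<not> ?thesis"
    then obtain z where z: "z \<in> path_image (f i j)" "z \<in> path_image (f i' j')" by blast
    obtain l s where l: "i \<le> l" "l < j" "0 \<le> s" "s \<le> 1" "z = edge_pt W l s" using pt[OF z(1)] o by auto
    obtain l' s' where l': "i' \<le> l'" "l' < j'" "0 \<le> s'" "s' \<le> 1" "z = edge_pt W l' s'" using pt[OF z(2)] o by auto
    have "real l + s = real l' + s'" by (rule D(6)) (use l l' o in auto)
    moreover have "real l + 1 \<le> real j" "real j + 1 \<le> real i'" "real i' \<le> real l'" using l l' o by linarith+
    ultimately show False using l l' by linarith
  qed
  have ij: "i < j" "i' < j'" using A by (auto simp: fan_arc_def)
  have "sep (Re (pathstart (f i j))) (Re (pathfinish (f i j))) (Re (pathstart (f i' j'))) \<longleftrightarrow>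
      sep (Re (pathstart (f i j))) (Re (pathfinish (f i j))) (Re (pathfinish (f i' j')))"
  proof (rule half_plane_sep)
    show "path_image (f i j) \<inter> path_image (f i' j') = {}" using ord disj[of i j i' j'] disj[of i' j' i j] ij jk by auto
    show "\<sigma> * Im z \<ge> 0" if "z \<in> path_image (f i j) \<union> path_image (f i' j')" for z
      using that half[OF A(1) jk(1)] half[OF A(2) jk(2)] by blast
  qed (use \<sigma> pth ij jk A zero in "auto simp: st fan_arc_def")
  thus "sep (Re (W i)) (Re (W j)) (Re (W i')) \<longleftrightarrow> sep (Re (W i)) (Re (W j)) (Re (W j'))" unfolding st .
qed


section \<open>Vertices of the knot at breaks and crossings\<close>

lemma fine_times:
  fixes B :: "real set"
  assumes B: "finite B" "a \<in> B" "b \<in> B" "a < b" "B \<subseteq> {a..b}"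
  shows "\<exists>m t. (\<forall>i<9 * m. t i < t (Suc i)) \<and> t 0 = a \<and> t (9 * m) = b \<and> (\<forall>x\<in>B. \<exists>p\<le>m. x = t (9 * p))"
proof -
  define L where "L = sorted_list_of_set B"
  have L: "set L = B" "sorted_wrt (<) L" using B(1) by (simp_all add: L_def)
  define m where "m = length L - 1"
  have len: "length L = Suc m" using L(1) B(2) by (cases L) (auto simp: m_def)
  have less: "L ! p < L ! q" if "p < q" "q \<le> m" for p q using sorted_wrt_nth_less[OF L(2) that(1)] that len by simp
  have idx: "\<exists>p\<le>m. x = L ! p" if "x \<in> B" for x using that L(1) len by (metis in_set_conv_nth less_Suc_eq_le)
  have mem: "L ! p \<in> B" if "p \<le> m" for p using that L(1) len by (metis le_imp_less_Suc nth_mem)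
  have ends: "L ! 0 = a" "L ! m = b"
  proof -
    obtain p q where pq: "p \<le> m" "a = L ! p" "q \<le> m" "b = L ! q" using idx B(2,3) by metis
    have "L ! 0 \<le> a" using less[of 0 p] pq by (cases p) auto
    thus "L ! 0 = a" using mem[of 0] B(5) by force
    have "b \<le> L ! m" using less[of q m] pq by (cases "q = m") auto
    thus "L ! m = b" using mem[of m] B(5) by force
  qed
  \<comment> \<open>The points of \<open>B\<close> get the indices divisible by 9, with eight
    equidistant points between neighbours.\<close>
  define t where "t i = L ! (i div 9) + real (i mod 9) / 9 * (L ! Suc (i div 9) - L ! (i div 9))" for i
  have "t i < t (Suc i)" if "i < 9 * m" for i
  proof -
    have p: "i div 9 < m" using that by (simp add: less_mult_imp_div_less mult.commute)
    hence d: "0 < L ! Suc (i div 9) - L ! (i div 9)" using less[of "i div 9" "Suc (i div 9)"] by simp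
    show ?thesis
    proof (cases "i mod 9 = 8")
      case True
      hence "Suc i mod 9 = 0" "Suc i div 9 = Suc (i div 9)" by (simp_all add: mod_Suc div_Suc)
      thus ?thesis using True d by (simp add: t_def field_simps)
    next
      case False
      hence "Suc i mod 9 = Suc (i mod 9)" "Suc i div 9 = i div 9" by (auto simp: mod_Suc div_Suc)
      thus ?thesis using d by (simp add: t_def field_simps)
    qed
  qed
  moreover have "t (9 * p) = L ! p" for p by (simp add: t_def)
  ultimately show ?thesis using ends idx by (intro exI[of _ m] exI[of _ t]) (metis mult_0_right)
qed

lemma increasing_cover:
  fixes t :: "nat => real"
  assumes "t 0 \<le> x" "x \<le> t M" "1 \<le> M"
  shows "\<exists>i<M. t i \<le> x \<and> x \<le> t (Suc i)"
  using assms(3,2)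
proof (induction M rule: dec_induct)
  case base
  thus ?case using assms(1) by auto
next
  case (step M)
  thus ?case by (cases "x \<le> t M") (auto intro: less_SucI)
qed

lemma piecewise_affine_edge:
  assumes "\<And>a b. 0 \<le> a \<and> a < b \<and> b \<le> 1 \<and> S \<inter> {a<..<b} = {} --> (\<forall>t\<in>{a..b}. f t = linepath (f a) (f b) ((t - a) / (b - a)))"
    and "0 \<le> a" "a < b" "b \<le> 1" "S \<inter> {a<..<b} = {}" "0 \<le> s" "s \<le> 1"
  shows "f (rmix s a b) = mix s (f a) (f b)"
proof -
  have e: "rmix s a b = a + s * (b - a)" by (simp add: algebra_simps)
  have "s * (b - a) \<le> b - a" using assms(3,6,7) by (simp add: mult_left_le_one_le)
  moreover have "0 \<le> s * (b - a)" using assms(3,6,7) by simp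
  ultimately have "a \<le> rmix s a b" "rmix s a b \<le> b" unfolding e by (simp, linarith)
  moreover have "(rmix s a b - a) / (b - a) = s" unfolding e using assms(3) by simp
  ultimately have *: "rmix s a b \<in> {a..b}" "(rmix s a b - a) / (b - a) = s" by auto
  have "f (rmix s a b) = linepath (f a) (f b) ((rmix s a b - a) / (b - a))"
    using assms(1)[of a b] assms(2-5) *(1) by blast
  thus ?thesis unfolding *(2) linepath_def .
qed

text \<open>The vertices include the breaks of the knot, the zeros of the second coordinate, and the crossings; every edge is cut
  into nine, to make room for the zeros that a fan needs between crossings and for straight passages through the axis.\<close>

lemma normal_state_line_diagram:
  assumes N: "normal_state \<gamma> u n"
  obtains M k W H where "line_diagram M k W" "9 dvd M" "9 dvd k" "H M = H 0" "\<gamma> ` {0..1} = polygon_set M (\<lambda>i. (W i, H i))"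
    "\<And>i j. 0 < i ==> i < k ==> k < j ==> j < M ==> W i = W j ==> H i \<noteq> H j \<and> 9 dvd j"
    "card {l. 0 < l \<and> l < k \<and> Im (W l) = 0 \<and> Re (W k) < Re (W l) \<and> Re (W l) < Re (W 0)} \<le> n"
    "\<And>l. l < k ==> \<not> 9 dvd l ==> Im (W l) = 0 ==> Im (W (l - 1)) = 0 \<and> Im (W (Suc l)) = 0"
    "\<And>l. \<forall>t\<in>{u..1}. Im (shadow \<gamma> t) = 0 --> shadow \<gamma> t \<in> shadow \<gamma> ` {0..u} ==> 0 < l ==> l < k ==> Im (W l) = 0 ==>
      Re (W k) < Re (W l) \<and> Re (W l) < Re (W 0)"
proof -
  define z where "z = shadow \<gamma>"
  define T where "T = {t \<in> {u<..<1}. z t \<in> z ` {0..u}}"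
  have st: "polygonal_knot \<gamma>" "0 < u" "u < 1" "inj_on z {0..u}" "inj_on z {u..1}" "finite T" "card T \<le> n"
    using N unfolding normal_state_def straight_state_def z_def T_def by auto
  obtain f where f: "strict_mono_on {0..u} f" "\<And>t. t \<in> {0..u} ==> z t = of_real (f t)"
    using N unfolding normal_state_def z_def by blast
  have sim: "simple_path \<gamma>" and cl: "\<gamma> 1 = \<gamma> 0" and pa\<gamma>: "pa 0 1 \<gamma>"
    using st(1) by (auto simp: polygonal_knot_def pathstart_def pathfinish_def piecewise_affine_iff_pa)
  have paI: "pa 0 1 (\<lambda>t. \<bar>Im (z t)\<bar>)" unfolding z_def shadow_def o_def by (intro pa_abs pa_Im pa_fst pa\<gamma>)
  obtain S1 where S1: "finite S1" "\<And>a b. 0 \<le> a \<and> a < b \<and> b \<le> 1 \<and> S1 \<inter> {a<..<b} = {} --> (\<forall>t\<in>{a..b}. \<gamma> t = linepath (\<gamma> a) (\<gamma> b) ((t - a) / (b - a)))"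
    using pa\<gamma> unfolding piecewise_affine_iff_pa[symmetric] piecewise_affine_def by blast
  \<comment> \<open>Breaks of the absolute value and not of the imaginary part itself: between them
    the sign cannot change, so no edge passes the line in its interior.\<close>
  obtain S2 where S2: "finite S2" "\<And>a b. 0 \<le> a \<and> a < b \<and> b \<le> 1 \<and> S2 \<inter> {a<..<b} = {} --> (\<forall>t\<in>{a..b}. \<bar>Im (z t)\<bar> = linepath \<bar>Im (z a)\<bar> \<bar>Im (z b)\<bar> ((t - a) / (b - a)))"
    using paI unfolding piecewise_affine_iff_pa[symmetric] piecewise_affine_def by blast
  have contz: "continuous_on {0..1} z"
    unfolding z_def shadow_def o_def by (intro pa_continuous pa_fst pa\<gamma>)
  \<comment> \<open>\<open>T\<close> and \<open>T'\<close> are the times of the mutual crossings on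
    the remaining and on the straight strand.\<close>
  define T' where "T' = {t \<in> {0..u}. z t \<in> z ` T}"
  have "finite T'"
    unfolding T'_def using finite_vimage_IntI[of "z ` T" z "{0..u}"] st(4,6) by (simp add: vimage_def Int_def conj_commute)
  define B0 where "B0 = ({0, u, 1} \<union> S1 \<union> S2 \<union> T \<union> T') \<inter> {0..1}"
  have B0: "finite B0" using S1(1) S2(1) st(6) \<open>finite T'\<close> by (simp add: B0_def)
  \<comment> \<open>Time is shifted to run from \<open>u\<close> to \<open>1 + u\<close>: the
    remaining strand comes first and the straight strand follows after time 1.\<close>
  define B where "B = (B0 \<inter> {u..1}) \<union> (\<lambda>x. x + 1) ` (B0 \<inter> {0..u})"
  have inB: "u \<in> B" "1 \<in> B" "1 + u \<in> B" using st(2,3) by (auto simp: B_def B0_def)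
  have "\<exists>m t. (\<forall>i<9 * m. t i < t (Suc i)) \<and> t 0 = u \<and> t (9 * m) = 1 + u \<and> (\<forall>x\<in>B. \<exists>p\<le>m. x = t (9 * p))"
    by (rule fine_times) (use B0 inB st(2,3) in "auto simp: B_def")
  then obtain m t where t: "\<And>i. i < 9 * m ==> t i < t (Suc i)" "t 0 = u" "t (9 * m) = 1 + u" "\<And>x. x \<in> B ==> \<exists>p\<le>m. x = t (9 * p)" by blast
  define M where "M = 9 * m"
  have tl: "t i < t j" if "i < j" "j \<le> M" for i j
    using that
  proof (induction j)
    case (Suc j)
    thus ?case using t(1)[of j] by (cases "i = j") (auto simp: M_def)
  qed simp
  have tle: "t i \<le> t j" if "i \<le> j" "j \<le> M" for i j using tl[of i j] that by (cases "i = j") auto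
  have tinv: "i < j" if "t i < t j" "i \<le> M" "j \<le> M" for i j using tle[of j i] that by (cases "i < j") auto
  have idx: "\<exists>i\<le>M. x = t i \<and> 9 dvd i" if x: "x \<in> B" for x using t(4)[OF x] unfolding M_def by (metis dvd_triv_left mult_le_mono2)
  obtain k where k: "k \<le> M" "t k = 1" "9 dvd k" using idx[OF inB(2)] by metis
  have tM: "t M = 1 + u" using t(3) by (simp add: M_def)
  have k0: "0 < k" "k < M" using tinv[of 0 k] tinv[of k M] k t(2) tM st(2,3) by auto
  have noB: "x \<notin> B" if "t i < x" "x < t (Suc i)" "i < M" for x i
  proof
    assume "x \<in> B"
    then obtain j where j: "j \<le> M" "x = t j" using idx by blast
    hence "i < j" "j < Suc i" using tinv[of i j] tinv[of j "Suc i"] that by auto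
    thus False by simp
  qed
  have B9: "9 dvd i" if "t i \<in> B" "i \<le> M" for i
    using idx[OF that(1)] that(2) tl[of i] tl[of _ i] by (metis less_irrefl linorder_neqE_nat)
  define g where "g x = (if x \<le> 1 then \<gamma> x else \<gamma> (x - 1))" for x
  have g2: "g x = \<gamma> (x - 1)" if "1 \<le> x" for x using that cl by (cases "x = 1") (auto simp: g_def)
  define W where "W i = fst (g (t i))" for i
  define H where "H i = snd (g (t i))" for i
  have tk: "t i \<le> 1" "u \<le> t i" if "i \<le> k" for i using tle[of i k] tle[of 0 i] that k t(2) by auto
  have kt: "1 \<le> t i" "t i \<le> 1 + u" if "k \<le> i" "i \<le> M" for i using tle[of k i] tle[of i M] that k tM by auto
  have WR: "W i = z (t i)" if "i \<le> k" for i using tk[OF that] by (simp add: W_def g_def z_def shadow_def)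
  have WS: "W i = z (t i - 1)" if "k \<le> i" "i \<le> M" for i using kt[OF that] by (simp add: W_def g2 z_def shadow_def)
  define \<tau> where "\<tau> i s = rmix s (t i) (t (Suc i))" for i s
  have \<tau>b: "t i \<le> \<tau> i s" "\<tau> i s \<le> t (Suc i)" if "i < M" "0 \<le> s" "s \<le> 1" for i s
  proof -
    have d: "0 < t (Suc i) - t i" using tl[of i "Suc i"] that by simp
    have e: "\<tau> i s = t i + s * (t (Suc i) - t i)" by (simp add: \<tau>_def algebra_simps)
    have "s * (t (Suc i) - t i) \<le> 1 * (t (Suc i) - t i)" "0 \<le> s * (t (Suc i) - t i)" using that d by (auto intro: mult_right_mono)
    thus "t i \<le> \<tau> i s" "\<tau> i s \<le> t (Suc i)" unfolding e by auto
  qed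
  have \<tau>s: "s = 0" if "\<tau> i s = t i" "i < M" for i s
  proof -
    have "s * (t (Suc i) - t i) = 0" using that(1) by (simp add: \<tau>_def algebra_simps)
    thus ?thesis using tl[of i "Suc i"] that by simp
  qed
  have \<tau>1: "s = 1" if "\<tau> i s = t (Suc i)" "i < M" for i s
  proof -
    have "(1 - s) * (t (Suc i) - t i) = 0" using that(1) by (simp add: \<tau>_def algebra_simps)
    thus ?thesis using tl[of i "Suc i"] that by simp
  qed
  have \<tau>inj: "real i + s = real j + s'" if "\<tau> i s = \<tau> j s'" "i < M" "j < M" "0 \<le> s" "s \<le> 1" "0 \<le> s'" "s' \<le> 1" for i j s s'
  proof -
    have aux: "real i + s = real j + s'" if h: "\<tau> i s = \<tau> j s'" "i < j" "j < M" "0 \<le> s" "s \<le> 1" "0 \<le> s'" "s' \<le> 1" for i j s s'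
    proof -
      have "\<tau> i s \<le> t (Suc i)" "t j \<le> \<tau> j s'" "t (Suc i) \<le> t j" using \<tau>b[of i s] \<tau>b[of j s'] tle[of "Suc i" j] h by auto
      hence e: "\<tau> i s = t (Suc i)" "\<tau> j s' = t j" "t (Suc i) = t j" using h(1) by auto
      have "Suc i = j" using e(3) tl[of "Suc i" j] h by (cases "Suc i = j") auto
      moreover have "s = 1" "s' = 0" using \<tau>1[of i s] \<tau>s[of j s'] e h by auto
      ultimately show ?thesis by auto
    qed
    show ?thesis
    proof (cases i j rule: linorder_cases)
      case equal
      have "(s - s') * (t (Suc i) - t i) = 0" using that(1) unfolding equal by (simp add: \<tau>_def algebra_simps)
      thus ?thesis using tl[of i "Suc i"] that equal by simp
    qed (use aux[of i s j s'] aux[of j s' i s] that in auto)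
  qed
  have eR: "0 \<le> t i" "t i < t (Suc i)" "t (Suc i) \<le> 1" "S1 \<inter> {t i<..<t (Suc i)} = {}" "S2 \<inter> {t i<..<t (Suc i)} = {}" if "i < k" for i
  proof -
    show *: "0 \<le> t i" "t i < t (Suc i)" "t (Suc i) \<le> 1" using tk[of i] tk[of "Suc i"] tl[of i "Suc i"] that k0 st(2) by auto
    have "x \<notin> B0" if "t i < x" "x < t (Suc i)" for x
      using noB[of i x] that \<open>i < k\<close> k0 * tk[of i] by (auto simp: B_def)
    thus "S1 \<inter> {t i<..<t (Suc i)} = {}" "S2 \<inter> {t i<..<t (Suc i)} = {}" using * by (auto simp: B0_def)
  qed
  have eS: "0 \<le> t i - 1" "t i - 1 < t (Suc i) - 1" "t (Suc i) - 1 \<le> 1" "S1 \<inter> {t i - 1<..<t (Suc i) - 1} = {}" if "k \<le> i" "i < M" for i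
  proof -
    show *: "0 \<le> t i - 1" "t i - 1 < t (Suc i) - 1" "t (Suc i) - 1 \<le> 1" using kt[of i] kt[of "Suc i"] tl[of i "Suc i"] that st(3) by auto
    have "x \<notin> B0" if "t i - 1 < x" "x < t (Suc i) - 1" for x
      using noB[of i "x + 1"] that \<open>k \<le> i\<close> \<open>i < M\<close> * kt[of "Suc i"] by (auto simp: B_def)
    thus "S1 \<inter> {t i - 1<..<t (Suc i) - 1} = {}" using * by (auto simp: B0_def)
  qed
  have edge: "edge_pt (\<lambda>i. g (t i)) i s = g (\<tau> i s)" if i: "i < M" and s: "0 \<le> s" "s \<le> 1" for i s
  proof (cases "i < k")
    case True
    have "g (t i) = \<gamma> (t i)" "g (t (Suc i)) = \<gamma> (t (Suc i))" "g (\<tau> i s) = \<gamma> (\<tau> i s)"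
      using tk[of i] tk[of "Suc i"] True \<tau>b[OF i s] by (auto simp: g_def)
    thus ?thesis using piecewise_affine_edge[OF S1(2) eR(1-4)[OF True] s] by (simp add: edge_pt_def \<tau>_def)
  next
    case False
    have e: "\<tau> i s - 1 = rmix s (t i - 1) (t (Suc i) - 1)" by (simp add: \<tau>_def algebra_simps)
    have "g (t i) = \<gamma> (t i - 1)" "g (t (Suc i)) = \<gamma> (t (Suc i) - 1)" "g (\<tau> i s) = \<gamma> (\<tau> i s - 1)"
      using kt[of i] kt[of "Suc i"] False i \<tau>b[OF i s] by (auto simp: g2)
    thus ?thesis using piecewise_affine_edge[OF S1(2) eS[of i] s] False i unfolding e by (simp add: edge_pt_def)
  qed
  have Wedge: "edge_pt W i s = fst (g (\<tau> i s))" if "i < M" "0 \<le> s" "s \<le> 1" for i s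
    using arg_cong[OF edge[OF that], of fst] by (simp add: edge_pt_def W_def)
  have WeR: "edge_pt W i s = z (\<tau> i s)" "u \<le> \<tau> i s" "\<tau> i s \<le> 1" if "i < k" "0 \<le> s" "s \<le> 1" for i s
    using Wedge[of i s] \<tau>b[of i s] tk[of i] tk[of "Suc i"] that k0 by (auto simp: g_def z_def shadow_def)
  have WeS: "edge_pt W i s = z (\<tau> i s - 1)" "1 \<le> \<tau> i s" "\<tau> i s \<le> 1 + u" if "k \<le> i" "i < M" "0 \<le> s" "s \<le> 1" for i s
    using Wedge[of i s] \<tau>b[of i s] kt[of i] kt[of "Suc i"] that by (auto simp: g2 z_def shadow_def)
  have cross_time: "v \<in> T \<and> v \<in> B \<and> w + 1 \<in> B" if v: "u \<le> v" "v < 1" "0 \<le> w" "w < u" "z v = z w" for v w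
  proof -
    have "v \<noteq> u" using inj_onD[OF st(4), of u w] v st(2) by auto
    hence "v \<in> T" using v by (auto simp: T_def)
    moreover have "w \<in> T'" using v \<open>v \<in> T\<close> unfolding T'_def by (auto intro: image_eqI[of _ _ v])
    ultimately show ?thesis using v st by (auto simp: B_def B0_def T_def)
  qed
  \<comment> \<open>Equality in the triangle inequality at the midpoint excludes opposite
    signs.\<close>
  have half: "\<bar>Im ((1/2) *\<^sub>R p + (1/2) *\<^sub>R q)\<bar> = 1/2 * \<bar>Im p\<bar> + 1/2 * \<bar>Im q\<bar> ==> Im p * Im q \<ge> 0" for p q
    by (auto simp: abs_if zero_le_mult_iff split: if_splits)
  have ld: "line_diagram M k W"
    unfolding line_diagram_def
  proof (intro conjI allI impI)
    show "0 < k" "k < M" by (rule k0)+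
    show "W M = W 0" using WS[of M] WR[of 0] k0 tM t(2) by simp
    show "Im (W i) = 0" if "k \<le> i" "i \<le> M" for i using WS[OF that] f(2)[of "t i - 1"] kt[OF that] by simp
    show "Re (W i) < Re (W (Suc i))" if "k \<le> i" "i < M" for i
      using WS[of i] WS[of "Suc i"] f(2)[of "t i - 1"] f(2)[of "t (Suc i) - 1"] kt[of i] kt[of "Suc i"] that
        strict_mono_onD[OF f(1), of "t i - 1" "t (Suc i) - 1"] tl[of i "Suc i"] by simp
    show "real i + s = real j + s'" if "i < k" "j < k" "0 \<le> s" "s \<le> 1" "0 \<le> s'" "s' \<le> 1" "edge_pt W i s = edge_pt W j s'" for i j s s'
    proof (rule \<tau>inj)
      show "\<tau> i s = \<tau> j s'" using inj_onD[OF st(5), of "\<tau> i s" "\<tau> j s'"] WeR[of i s] WeR[of j s'] that by auto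
    qed (use that k0 in auto)
    have X: "s = 0 \<and> s' = 0" if h: "i < k" "j < M" "k \<le> j" "0 \<le> s" "s < 1" "0 \<le> s'" "s' < 1" "edge_pt W i s = edge_pt W j s'" for i j s s'
    proof -
      have "\<tau> i s \<noteq> t (Suc i)" "\<tau> j s' \<noteq> t (Suc j)" using \<tau>1[of i s] \<tau>1[of j s'] h k0 by auto
      hence b: "t i \<le> \<tau> i s" "\<tau> i s < t (Suc i)" "t j \<le> \<tau> j s'" "\<tau> j s' < t (Suc j)"
        using \<tau>b[of i s] \<tau>b[of j s'] h k0 by auto
      have c: "\<tau> i s \<in> B \<and> (\<tau> j s' - 1) + 1 \<in> B"
        using cross_time[of "\<tau> i s" "\<tau> j s' - 1"] WeR[of i s] WeS[of j s'] tk[of "Suc i"] kt[of "Suc j"] b h by auto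
      have "\<tau> i s = t i" "\<tau> j s' = t j"
        using noB[of i "\<tau> i s"] noB[of j "\<tau> j s'"] b c h k0 by force+
      thus ?thesis using \<tau>s h k0 by auto
    qed
    show "s = 0" "s' = 0" if "i < k" "j < M" "k \<le> j" "0 \<le> s" "s < 1" "0 \<le> s'" "s' < 1" "edge_pt W i s = edge_pt W j s'" for i j s s'
      using X[OF that] by auto
    show "Im (W i) * Im (W (Suc i)) \<ge> 0" if "i < k" for i
    proof (rule half)
      have "\<bar>Im (z ((1 - 1/2) * t i + 1/2 * t (Suc i)))\<bar> = (1 - 1/2) *\<^sub>R \<bar>Im (z (t i))\<bar> + (1/2) *\<^sub>R \<bar>Im (z (t (Suc i)))\<bar>"
        by (rule piecewise_affine_edge[OF S2(2) eR(1,2,3,5)[OF that]]) auto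
      moreover have "edge_pt W i (1/2) = z ((1 - 1/2) * t i + 1/2 * t (Suc i))" using WeR(1)[of i "1/2"] that by (simp add: \<tau>_def)
      ultimately show "\<bar>Im ((1/2) *\<^sub>R W i + (1/2) *\<^sub>R W (Suc i))\<bar> = 1/2 * \<bar>Im (W i)\<bar> + 1/2 * \<bar>Im (W (Suc i))\<bar>"
        using WR[of i] WR[of "Suc i"] that by (simp add: edge_pt_def)
    qed
  qed
  have HM: "H M = H 0" using tM t(2) st(2,3) by (simp add: H_def g2) (simp add: g_def)
  have img: "\<gamma> ` {0..1} = polygon_set M (\<lambda>i. (W i, H i))"
  proof -
    have M1: "1 \<le> M" using k0 by simp
    have "(\<Union>i<M. edge_pt (\<lambda>i. g (t i)) i ` {0..1}) = g ` {u..1 + u}"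
    proof (intro equalityI subsetI)
      fix p assume "p \<in> (\<Union>i<M. edge_pt (\<lambda>i. g (t i)) i ` {0..1})"
      then obtain i s where "i < M" "0 \<le> s" "s \<le> 1" "p = edge_pt (\<lambda>i. g (t i)) i s" by auto
      thus "p \<in> g ` {u..1 + u}" using edge[of i s] \<tau>b[of i s] tle[of 0 i] tle[of "Suc i" M] t(2) tM by auto
    next
      fix p assume "p \<in> g ` {u..1 + u}"
      then obtain x where x: "t 0 \<le> x" "x \<le> t M" "p = g x" using t(2) tM by auto
      obtain i where i: "i < M" "t i \<le> x" "x \<le> t (Suc i)" using increasing_cover[OF x(1,2) M1] by blast
      have d: "0 < t (Suc i) - t i" using tl[of i "Suc i"] i by simp
      define s where "s = (x - t i) / (t (Suc i) - t i)"
      have "\<tau> i s = t i + s * (t (Suc i) - t i)" by (simp add: \<tau>_def algebra_simps)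
      also have "s * (t (Suc i) - t i) = x - t i" using d by (simp add: s_def)
      finally have s: "0 \<le> s" "s \<le> 1" "\<tau> i s = x" using d i by (simp_all add: s_def)
      thus "p \<in> (\<Union>i<M. edge_pt (\<lambda>i. g (t i)) i ` {0..1})" using edge[OF i(1) s(1,2)] i(1) x(3) by force
    qed
    moreover have "g ` {u..1 + u} = \<gamma> ` {0..1}"
    proof (intro equalityI subsetI)
      fix p assume "p \<in> g ` {u..1 + u}"
      thus "p \<in> \<gamma> ` {0..1}" using st(2,3) by (auto simp: g_def)
    next
      fix p assume "p \<in> \<gamma> ` {0..1}"
      then obtain x where x: "0 \<le> x" "x \<le> 1" "p = \<gamma> x" by auto
      show "p \<in> g ` {u..1 + u}"
      proof (cases "x \<le> u")
        case True
        thus ?thesis using x g2[of "x + 1"] st by (intro image_eqI[of _ _ "x + 1"]) auto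
      qed (use x st in "auto simp: g_def intro!: image_eqI[of _ _ x]")
    qed
    moreover have "(\<lambda>i. (W i, H i)) = (\<lambda>i. g (t i))" by (simp add: W_def H_def)
    ultimately show ?thesis unfolding polygon_set_def pgon_image[OF M1] by simp
  qed
  have crs: "H i \<noteq> H j \<and> 9 dvd j" if h: "0 < i" "i < k" "k < j" "j < M" "W i = W j" for i j
  proof -
    have b: "u < t i" "t i < 1" "1 < t j" "t j < 1 + u" using tl[of 0 i] tl[of i k] tl[of k j] tl[of j M] h k t(2) tM k0 by auto
    have w: "z (t i) = z (t j - 1)" using h WR[of i] WS[of j] by simp
    hence "t j \<in> B" using cross_time[of "t i" "t j - 1"] b by auto
    moreover have "H i \<noteq> H j"
    proof
      assume "H i = H j"
      hence "\<gamma> (t i) = \<gamma> (t j - 1)" using h(5) b by (simp add: W_def H_def g_def prod_eq_iff)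
      thus False using simple_pathD[OF sim, of "t i" "t j - 1"] b st(2,3) by auto
    qed
    ultimately show ?thesis using B9[of j] h by simp
  qed
  have WkE: "W k = z 0" "W 0 = z u" using WS[of k] WR[of 0] k k0 t(2) by auto
  define Q where "Q = {l. 0 < l \<and> l < k \<and> Im (W l) = 0 \<and> Re (W k) < Re (W l) \<and> Re (W l) < Re (W 0)}"
  \<comment> \<open>By the intermediate value theorem the straight strand passes through every
    vertex on the open segment, so the time of such a vertex belongs to \<open>T\<close>.\<close>
  have "card Q \<le> card T"
  proof (rule card_inj_on_le[of t])
    show "inj_on t Q"
    proof (rule inj_onI)
      fix i j assume "i \<in> Q" "j \<in> Q" "t i = t j"
      thus "i = j" using tl[of i j] tl[of j i] k0 by (cases i j rule: linorder_cases) (auto simp: Q_def)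
    qed
    show "t ` Q \<subseteq> T"
    proof
      fix x assume "x \<in> t ` Q"
      then obtain l where l: "x = t l" "0 < l" "l < k" "Im (W l) = 0" "Re (W k) < Re (W l)" "Re (W l) < Re (W 0)" by (auto simp: Q_def)
      have "continuous_on {0..u} (\<lambda>t. Re (z t))"
        by (intro continuous_intros continuous_on_subset[OF contz]) (use st in auto)
      then obtain v where v: "0 \<le> v" "v \<le> u" "Re (z v) = Re (W l)"
        using IVT'[of "\<lambda>t. Re (z t)" 0 "Re (W l)" u] l WkE st by auto
      have "z v = W l" using v f(2)[of v] l by (simp add: complex_eq_iff)
      moreover have "u < t l" "t l < 1" using tl[of 0 l] tl[of l k] l k t(2) k0 by auto
      ultimately show "x \<in> T" using l(1) v(1,2) WR[of l] l(3) by (auto simp: T_def intro!: image_eqI[of _ _ v])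
    qed
  qed (rule st(6))
  hence cardQ: "card Q \<le> n" using st(7) by simp
  \<comment> \<open>At an auxiliary vertex there is no break: the absolute value is affine across
    it, and a zero there forces zeros at both neighbours, so the strand runs along the line.\<close>
  have nine: "Im (W (l - 1)) = 0 \<and> Im (W (Suc l)) = 0" if l: "l < k" "\<not> 9 dvd l" "Im (W l) = 0" for l
  proof -
    have l0: "0 < l" using l(2) by (cases l) auto
    define a b where "a = t (l - 1)" and "b = t (Suc l)"
    have "l - 1 \<le> k" using l by simp
    hence ab: "a < t l" "t l < b" "0 \<le> a" "b \<le> 1" using tl[of "l - 1" l] tl[of l "Suc l"] tk[of "l - 1"] tk[of "Suc l"] l l0 k0 st(2)
      by (auto simp: a_def b_def)
    have "t l \<notin> B" using B9[of l] l k0 by auto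
    hence "t l \<notin> S2" using tk[of l] l st(2) by (auto simp: B_def B0_def)
    moreover have "S2 \<inter> {a<..<t l} = {}" "S2 \<inter> {t l<..<b} = {}"
      using eR(5)[of "l - 1"] eR(5)[of l] l l0 by (simp_all add: a_def b_def)
    moreover have "{a<..<b} \<subseteq> {a<..<t l} \<union> {t l} \<union> {t l<..<b}" by auto
    ultimately have S: "S2 \<inter> {a<..<b} = {}" by blast
    define s where "s = (t l - a) / (b - a)"
    have "rmix s a b = a + s * (b - a)" by (simp add: algebra_simps)
    also have "s * (b - a) = t l - a" using ab by (simp add: s_def)
    finally have s: "0 < s" "s < 1" "rmix s a b = t l" using ab by (simp_all add: s_def)
    have "\<bar>Im (z (rmix s a b))\<bar> = mix s \<bar>Im (z a)\<bar> \<bar>Im (z b)\<bar>"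
      by (rule piecewise_affine_edge[OF S2(2) ab(3) _ ab(4) S]) (use s ab in auto)
    hence "rmix s \<bar>Im (z a)\<bar> \<bar>Im (z b)\<bar> = 0" using s(3) l WR[of l] by simp
    hence "\<bar>Im (z a)\<bar> = 0 \<and> \<bar>Im (z b)\<bar> = 0" by (intro interpolate_zero[of _ _ s]) (use s in auto)
    thus ?thesis using WR[of "l - 1"] WR[of "Suc l"] l l0 by (simp add: a_def b_def)
  qed
  have cont: "Re (W k) < Re (W l) \<and> Re (W l) < Re (W 0)"
    if c: "\<forall>t\<in>{u..1}. Im (z t) = 0 --> z t \<in> z ` {0..u}" and l: "0 < l" "l < k" "Im (W l) = 0" for l
  proof -
    have b: "u < t l" "t l < 1" using tl[of 0 l] tl[of l k] l k t(2) k0 by auto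
    have "z (t l) \<in> z ` {0..u}" using c b l WR[of l] by simp
    then obtain v where v: "0 \<le> v" "v \<le> u" "z (t l) = z v" by auto
    have "z 0 = z 1" using cl by (simp add: z_def shadow_def)
    hence "v \<noteq> u" "v \<noteq> 0"
      using inj_onD[OF st(5), of "t l" u] inj_onD[OF st(5), of "t l" 1] v(3) b st by auto
    hence "f 0 < f v" "f v < f u" using strict_mono_onD[OF f(1)] v st(2) by auto
    thus ?thesis using WkE WR[of l] l v f(2) st(2) by simp
  qed
  show thesis
  proof (rule that[of M k W H])
    show "9 dvd M" by (simp add: M_def)
    show "card {l. 0 < l \<and> l < k \<and> Im (W l) = 0 \<and> Re (W k) < Re (W l) \<and> Re (W l) < Re (W 0)} \<le> n"
      using cardQ by (simp add: Q_def)
  qed (use ld k(3) HM img crs nine cont in "unfold z_def; blast")+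
qed


text \<open>The straight strand of the fan lies on the side of the axis prescribed by the crossings; going along it, the side changes
  at most once between consecutive crossings.\<close>

lemma strand_sides:
  assumes k: "9 dvd k" "9 dvd M" "k < M" and X: "\<forall>x\<in>X. k < x \<and> x < M \<and> 9 dvd x" and sg: "\<And>x. sg x = 1 \<or> sg x = (-1::real)"
  obtains q where "q k = 0" "q M = 0" "\<And>j. k \<le> j ==> j < M ==> q j * q (Suc j) \<ge> 0"
    "\<And>j. k \<le> j ==> j < M ==> q j = 0 ==> q (Suc j) \<noteq> 0" "\<And>x. x \<in> X ==> q x = sg x"
    "\<And>j. k \<le> j ==> j \<le> M ==> q j = 0 ==> 3 dvd j" "card {j. k < j \<and> j < M \<and> q j = 0} \<le> card X - 1"
proof -
  have "x \<le> M" if "x \<in> X" for x using bspec[OF X that] by simp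
  hence "X \<subseteq> {..M}" by blast
  hence finX: "finite X" by (rule finite_subset) simp
  \<comment> \<open>The last crossing up to \<open>b\<close>, or the very first one when none
    precedes. Its side \<open>e b\<close> is kept until the next crossing.\<close>
  define c where "c b = (if {x \<in> X. x \<le> b} \<noteq> {} then Max {x \<in> X. x \<le> b} else Min X)" for b
  define e where "e b = (if X = {} then 1 else sg (c b))" for b
  have e: "e b = 1 \<or> e b = -1" for b using sg by (auto simp: e_def)
  have eX: "e x = sg x" if "x \<in> X" for x
  proof -
    have "Max {y \<in> X. y \<le> x} = x" using that finX by (intro Max_eqI) auto
    moreover have "{y \<in> X. y \<le> x} \<noteq> {}" "X \<noteq> {}" using that by auto
    ultimately show ?thesis by (simp add: e_def c_def)
  qed
  \<comment> \<open>Within a group of nine edges the old side is kept for the first three vertices;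
    the fourth lies on the axis if the sides differ, and from then on the side required at
    \<open>b + 9\<close> is taken.\<close>
  define F where "F b i = (if i < 3 then e b else if i = 3 \<and> e b \<noteq> e (b + 9) then 0 else e (b + 9))" for b i :: nat
  define q where "q j = (if j = k \<or> j = M then 0 else F (j - j mod 9) (j mod 9))" for j
  have ne: "e b \<noteq> 0" for b using e[of b] by auto
  have q0: "j mod 9 = 3 \<and> e (j - j mod 9) \<noteq> e (j - j mod 9 + 9)" if "q j = 0" "j \<noteq> k" "j \<noteq> M" for j
    using that ne by (auto simp: q_def F_def split: if_splits)
  have k9: "k mod 9 = 0" "M mod 9 = 0" using k by auto
  have F: "F b i * F b (Suc i) \<ge> 0 \<and> (F b i = 0 --> F b (Suc i) \<noteq> 0)" for b i
    by (cases "i < 3"; cases "i = 2"; cases "e b = e (b + 9)") (simp_all add: F_def ne)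
  have step: "q j * q (Suc j) \<ge> 0 \<and> (q j = 0 --> q (Suc j) \<noteq> 0)" if j: "k \<le> j" "j < M" for j
  proof -
    consider "j mod 9 = 8" | "j mod 9 < 8" by linarith
    thus ?thesis
    proof cases
      case 1
      have jk: "j \<noteq> k" "j \<noteq> M" using 1 k9 by auto
      have m: "Suc j mod 9 = 0" using 1 by (simp add: mod_Suc)
      have b: "j - j mod 9 + 9 = Suc j" using 1 mod_less_eq_dividend[of j 9] by simp
      have "q j = F (j - j mod 9) 8" using jk 1 by (simp add: q_def)
      hence "q j = e (Suc j)" unfolding b[symmetric] by (simp add: F_def)
      moreover have "q (Suc j) = 0 \<or> q (Suc j) = e (Suc j)" using m by (simp add: q_def F_def)
      ultimately show ?thesis using ne by auto
    next
      case 2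
      have m: "Suc j mod 9 = Suc (j mod 9)" using 2 by (simp add: mod_Suc)
      have s: "Suc j \<noteq> k" "Suc j \<noteq> M" using m k9 by auto
      have qs: "q (Suc j) = F (j - j mod 9) (Suc (j mod 9))"
        using s by (simp only: q_def m diff_Suc_Suc if_False simp_thms)
      show ?thesis
      proof (cases "j = k")
        case True
        hence "q j = 0" "j mod 9 = 0" using k9 by (auto simp: q_def)
        thus ?thesis using qs ne by (simp add: F_def)
      next
        case False
        hence "q j = F (j - j mod 9) (j mod 9)" using j by (simp add: q_def)
        thus ?thesis unfolding qs using F by metis
      qed
    qed
  qed
  have zero3: "3 dvd j" if "k \<le> j" "j \<le> M" "q j = 0" for j
  proof (cases "j = k \<or> j = M")
    case True
    hence "9 dvd j" using k by blast
    thus ?thesis by presburger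
  next
    case False
    hence "j mod 9 = 3" using q0[OF that(3)] by blast
    thus ?thesis by presburger
  qed
  define Z where "Z = {j. k < j \<and> j < M \<and> q j = 0}"
  \<comment> \<open>A change of side at \<open>b + 3\<close> is charged to the crossing at
    \<open>b + 9\<close>, which is never the first one; hence one less than the number of
    crossings.\<close>
  have "(\<lambda>j. j + 6) ` Z \<subseteq> X - {Min X}"
  proof
    fix y assume "y \<in> (\<lambda>j. j + 6) ` Z"
    then obtain j where j: "y = j + 6" "k < j" "j < M" "q j = 0" by (auto simp: Z_def)
    define b where "b = j - j mod 9"
    have j3: "j mod 9 = 3" "e b \<noteq> e (b + 9)" using q0[OF j(4)] j by (auto simp: b_def)
    have y: "y = b + 9" using j3(1) j(1) mod_less_eq_dividend[of j 9] by (auto simp: b_def)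
    have b9: "9 dvd b" unfolding b_def by (rule dvd_minus_mod)
    have cc: "c b \<noteq> c (b + 9)" "X \<noteq> {}" using j3(2) by (auto simp: e_def split: if_splits)
    have "y \<in> X"
    proof (rule ccontr)
      assume "y \<notin> X"
      have "x \<le> b" if x: "x \<in> X" "x \<le> b + 9" for x
      proof -
        have "x \<noteq> b + 9" using x(1) \<open>y \<notin> X\<close> y by blast
        moreover have "9 dvd x" using bspec[OF X x(1)] by simp
        ultimately show ?thesis using x(2) b9 by presburger
      qed
      hence "{x \<in> X. x \<le> b + 9} = {x \<in> X. x \<le> b}" by force
      hence "c (b + 9) = c b" by (simp only: c_def)
      thus False using cc(1) by simp
    qed
    moreover have "y \<noteq> Min X"
    proof
      assume m: "y = Min X"
      hence ge: "x \<ge> b + 9" if "x \<in> X" for x using Min_le[OF finX that] y by simp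
      have "{x \<in> X. x \<le> b} = {}" using ge by force
      hence "c b = y" using m by (simp add: c_def)
      moreover have "{x \<in> X. x \<le> b + 9} = {y}" using ge \<open>y \<in> X\<close> y by force
      hence "c (b + 9) = y" by (simp add: c_def)
      ultimately show False using cc(1) by simp
    qed
    ultimately show "y \<in> X - {Min X}" by simp
  qed
  hence "card ((\<lambda>j. j + 6) ` Z) \<le> card (X - {Min X})" by (intro card_mono) (use finX in auto)
  moreover have "card ((\<lambda>j. j + 6) ` Z) = card Z" by (rule card_image) simp
  moreover have "card (X - {Min X}) \<le> card X - 1"
    using finX by (cases "X = {}") (auto simp: card_Diff_singleton)
  ultimately have "card Z \<le> card X - 1" by simp
  moreover have "q x = sg x" if "x \<in> X" for x
    using bspec[OF X that] eX[OF that] by (auto simp: q_def F_def)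
  ultimately show thesis using step zero3 unfolding Z_def by (intro that[of q]) (simp_all add: q_def)
qed

text \<open>\<open>X\<close> collects the vertices of the straight strand at crossings, and
  \<open>sg\<close> tells on which side of the remaining strand it passes there. The implication at
  the end is the gain in the contained case: all zeros of the remaining strand are then on the
  segment and thus among the at most \<open>n\<close> counted by \<open>pstate\<close>.\<close>

lemma normal_state_fan:
  assumes N: "normal_state \<gamma> u n"
  shows "\<exists>M k r a. pstate M k n r a \<and> 3 dvd M \<and> 9 \<le> M \<and> (\<forall>l\<le>M. r l = 0 --> 3 dvd l) \<and>
    kiso (\<gamma> ` {0..1}) (polygon_set M (fan_pt (fdir M) r a)) \<and> card {l. k < l \<and> l < M \<and> r l = 0} \<le> n - 1 \<and>
    ((\<forall>t\<in>{u..1}. Im (shadow \<gamma> t) = 0 --> shadow \<gamma> t \<in> shadow \<gamma> ` {0..u}) -->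
      (\<forall>l. 0 < l --> l < k --> r l = 0 --> a k < a l \<and> a l < a 0))"
proof (cases rule: normal_state_line_diagram[OF N])
  case st: (1 M k W H)
  define Q where "Q = {l. 0 < l \<and> l < k \<and> Im (W l) = 0 \<and> Re (W k) < Re (W l) \<and> Re (W l) < Re (W 0)}"
  note L = st(1) and nine = st(2,3) and H = st(4) and img = st(5) and cr = st(6) and axis = st(8) and cont = st(9)
  have Q: "card Q \<le> n" using st(7) by (simp add: Q_def)
  note D = line_diagramD[OF L]
  define X where "X = {j. k < j \<and> j < M \<and> (\<exists>i. 0 < i \<and> i < k \<and> W i = W j)}"
  define sg :: "nat => real" where "sg j = (if \<exists>i. 0 < i \<and> i < k \<and> W i = W j \<and> H i < H j then 1 else -1)" for j
  have Wlt: "Re (W k) < Re (W j)" "Re (W j) < Re (W 0)" if "k < j" "j < M" for j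
    using line_diagram_mono[OF L, of k j] line_diagram_mono[OF L, of j M] that D(3) by auto
  have "card X \<le> card Q"
  proof -
    define \<iota> where "\<iota> j = (SOME i. 0 < i \<and> i < k \<and> W i = W j)" for j
    have \<iota>: "0 < \<iota> j \<and> \<iota> j < k \<and> W (\<iota> j) = W j" if "j \<in> X" for j
      unfolding \<iota>_def by (rule someI_ex) (use that in "auto simp: X_def")
    show ?thesis
    proof (rule card_inj_on_le[of \<iota>])
      show "inj_on \<iota> X"
      proof (rule inj_onI)
        fix i j assume ij: "i \<in> X" "j \<in> X" "\<iota> i = \<iota> j"
        hence "W i = W j" using \<iota>[OF ij(1)] \<iota>[OF ij(2)] by simp
        thus "i = j" using line_diagram_mono[OF L, of i j] line_diagram_mono[OF L, of j i] ij
          by (cases i j rule: linorder_cases) (auto simp: X_def)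
      qed
      show "\<iota> ` X \<subseteq> Q"
      proof
        fix y assume "y \<in> \<iota> ` X"
        then obtain j where j: "j \<in> X" "y = \<iota> j" by blast
        have jk: "k < j" "j < M" using j by (auto simp: X_def)
        show "y \<in> Q" using \<iota>[OF j(1)] j(2) Wlt[OF jk] D(4)[of j] jk by (simp add: Q_def)
      qed
    qed (simp add: Q_def)
  qed
  hence cX: "card X \<le> n" using Q by simp
  have XM: "\<forall>x\<in>X. k < x \<and> x < M \<and> 9 dvd x" using cr by (auto simp: X_def)
  have sg: "sg x = 1 \<or> sg x = -1" for x by (simp add: sg_def)
  obtain q where q: "q k = 0" "q M = 0" "\<And>j. k \<le> j ==> j < M ==> q j * q (Suc j) \<ge> 0"
    "\<And>j. k \<le> j ==> j < M ==> q j = 0 ==> q (Suc j) \<noteq> 0" "\<And>x. x \<in> X ==> q x = sg x"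
    "\<And>j. k \<le> j ==> j \<le> M ==> q j = 0 ==> 3 dvd j" "card {j. k < j \<and> j < M \<and> q j = 0} \<le> card X - 1"
    by (rule strand_sides[where sg = sg, OF nine(2,1) D(2) XM sg]) (rule that)
  have k9: "9 \<le> k" using nine(2) D(1) by (intro dvd_imp_le)
  have M9: "9 \<le> M" "Suc k < M" using k9 nine D(2) by (auto, presburger)
  define a where "a i = Re (W i)" for i
  have "\<exists>r. fan_ok M r (\<lambda>i. Re (W i)) \<and>
    kiso (polygon_set M (\<lambda>i. (W i, H i))) (polygon_set M (fan_pt (fdir M) r (\<lambda>i. Re (W i)))) \<and>
    (\<forall>i\<le>k. \<exists>c>0. r i = c * Im (W i)) \<and> (\<forall>i. k \<le> i --> r i = q i)"
  proof (rule line_diagram_fan[where q = q, OF L _ H q(1-4)])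
    show "3 \<le> M" using M9 by simp
    fix i j assume ij: "0 < i" "i < k" "k < j" "j < M" "W i = W j"
    have "j \<in> X" using ij by (auto simp: X_def)
    hence qj: "q j = sg j" by (rule q(5))
    have un: "i' = i" if "0 < i'" "i' < k" "W i' = W j" for i'
    proof -
      have "real i' + 0 = real i + 0" by (rule D(6)) (use that ij in auto)
      thus ?thesis by simp
    qed
    show "q j > 0 \<and> H i < H j \<or> q j < 0 \<and> H j < H i"
    proof (cases "H i < H j")
      case True
      hence "sg j = 1" unfolding sg_def using ij by auto
      thus ?thesis using True qj by simp
    next
      case False
      have "\<not> (\<exists>i'. 0 < i' \<and> i' < k \<and> W i' = W j \<and> H i' < H j)" using False un by blast
      hence "sg j = -1" unfolding sg_def by (rule if_not_P)
      moreover have "H j < H i" using cr[OF ij] False by simp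
      ultimately show ?thesis using qj by simp
    qed
  qed
  then obtain r0 where r0: "fan_ok M r0 a" "kiso (polygon_set M (\<lambda>i. (W i, H i))) (polygon_set M (fan_pt (fdir M) r0 a))"
    "\<And>i. i \<le> k ==> \<exists>c>0. r0 i = c * Im (W i)" "\<And>i. k \<le> i ==> r0 i = q i" unfolding a_def by blast
  have z0: "r0 i = 0 \<longleftrightarrow> Im (W i) = 0" if "i \<le> k" for i using r0(3)[OF that] by auto
  \<comment> \<open>Where the remaining strand runs along the axis, the vertices with index not
    divisible by 9 are pushed to the positive side. By \<open>axis\<close> their neighbours are on
    the axis too, so signs stay compatible, and the zeros left over are isolated.\<close>
  define r where "r i = (if i < k \<and> \<not> 9 dvd i \<and> r0 i = 0 then 1 else r0 i)" for i
  have rS: "r i = q i" if "k \<le> i" for i using that r0(4) by (simp add: r_def)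
  have rz: "r0 i = 0" "i < k ==> 9 dvd i" if "r i = 0" for i using that by (auto simp: r_def split: if_splits)
  have P: "fan_ok M r a \<and> fiso M (fdir M) r0 a r a"
  proof (rule fan_push[OF _ r0(1)])
    show "fan_dirs M (fdir M)" by (rule fan_dirs_fdir) (use M9 in simp)
    show "r i = r0 i" if "r0 i \<noteq> 0" for i using that by (simp add: r_def)
    show "r M = - r 0" using fan_okD(2)[OF r0(1)] D(2) by (simp add: r_def)
    show "r i * r (Suc i) \<ge> 0" if i: "i < M" for i
    proof -
      consider "i < k" "\<not> 9 dvd i" "r0 i = 0" | "\<not> (i < k \<and> \<not> 9 dvd i \<and> r0 i = 0)" "Suc i < k" "\<not> 9 dvd Suc i" "r0 (Suc i) = 0"
        | "r i = r0 i" "r (Suc i) = r0 (Suc i)" unfolding r_def by presburger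
      thus ?thesis
      proof cases
        case 1
        hence "r0 (Suc i) = 0" using axis[of i] z0[of i] z0[of "Suc i"] by simp
        thus ?thesis using 1 by (simp add: r_def)
      next
        case 2
        hence "r0 i = 0" using axis[of "Suc i"] z0[of i] z0[of "Suc i"] by simp
        hence "r i = 0" using 2(1) by (simp add: r_def)
        thus ?thesis by simp
      next
        case 3
        thus ?thesis using fan_okD(4)[OF r0(1) i] by simp
      qed
    qed
  qed
  have nadj: "r (Suc l) \<noteq> 0" if l: "l < M" "r l = 0" for l
  proof (cases "l < k")
    case True
    hence "9 dvd l" using rz(2)[OF l(2)] by simp
    hence "\<not> 9 dvd Suc l" "Suc l \<noteq> k" using nine(2) by presburger+
    thus ?thesis using True by (simp add: r_def)
  next
    case False
    thus ?thesis using q(4)[of l] l rS[of l] rS[of "Suc l"] by simp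
  qed
  have ps: "pstate M k n r a"
    unfolding pstate_def
  proof (intro conjI allI impI)
    show "fan_ok M r a" using P by blast
    show "0 < k" "Suc k < M" using D(1) M9 by auto
    have "Im (W 0) = 0" using D(2,3) D(4)[of M] by simp
    thus "r 0 = 0" using z0[of 0] by (simp add: r_def)
    show "r k = 0" using rS[of k] q(1) by simp
    show "noncross k r a"
      by (rule noncross_push[OF line_diagram_noncross[OF L r0(3), folded a_def]]) (auto simp: r_def)
    show "r (Suc l) \<noteq> 0" if "l < M" "r l = 0" for l by (rule nadj[OF that])
    show "a k < a 0" using line_diagram_mono[OF L, of k M] D(2,3) by (simp add: a_def)
    show "a k < a l" "a l < a 0" if "k < l" "l < M" for l using Wlt[OF that] by (simp_all add: a_def)
    have "{l. 0 < l \<and> l < k \<and> r l = 0 \<and> a k < a l \<and> a l < a 0} \<subseteq> Q"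
    proof
      fix l assume "l \<in> {l. 0 < l \<and> l < k \<and> r l = 0 \<and> a k < a l \<and> a l < a 0}"
      thus "l \<in> Q" using rz(1)[of l] z0[of l] by (simp add: Q_def a_def)
    qed
    hence "card {l. 0 < l \<and> l < k \<and> r l = 0 \<and> a k < a l \<and> a l < a 0} \<le> card Q"
      by (rule card_mono[rotated]) (simp add: Q_def)
    thus "card {l. 0 < l \<and> l < k \<and> r l = 0 \<and> a k < a l \<and> a l < a 0} \<le> n" using Q by simp
  qed
  have three: "3 dvd l" if "l \<le> M" "r l = 0" for l
  proof (cases "l < k")
    case True
    hence "9 dvd l" using rz(2)[OF that(2)] by simp
    thus ?thesis by presburger
  qed (use q(6)[of l] rS[of l] that in simp)
  have "{l. k < l \<and> l < M \<and> r l = 0} = {l. k < l \<and> l < M \<and> q l = 0}" using rS by auto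
  hence cS: "card {l. k < l \<and> l < M \<and> r l = 0} \<le> n - 1" using q(7) cX by simp
  have iso: "kiso (\<gamma> ` {0..1}) (polygon_set M (fan_pt (fdir M) r a))"
    unfolding img by (rule kiso_trans[OF r0(2)]) (use P in "simp add: fiso_def")
  have M3: "3 dvd M" using nine(1) by presburger
  have co: "a k < a l \<and> a l < a 0"
    if "\<forall>t\<in>{u..1}. Im (shadow \<gamma> t) = 0 --> shadow \<gamma> t \<in> shadow \<gamma> ` {0..u}" "0 < l" "l < k" "r l = 0" for l
    using cont[OF that(1-3)] rz(1)[OF that(4)] z0[of l] that by (simp add: a_def)
  show ?thesis using ps M3 M9(1) three iso cS co by blast
qed


section \<open>Counting petals\<close>

lemma petal_number_le:
  assumes K: "represents \<gamma> K" and iso: "kiso (\<gamma> ` {0..1}) (\<gamma>' ` {0..1})"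
    and P: "petal_projection \<gamma>' c" and n: "card (petals \<gamma>' c) \<le> n"
  shows "petal_number K \<le> enat n"
proof -
  have "polygonal_knot \<gamma>'" using P by (simp add: petal_projection_def)
  moreover have "ambient_isotopic K (inv_stereographic ` path_image \<gamma>')"
    using ambient_isotopic_trans[OF _ iso[unfolded kiso_def]] K by (simp add: represents_def path_image_def)
  ultimately have "represents \<gamma>' K" by (simp add: represents_def)
  hence "petal_number K \<le> enat (card (petals \<gamma>' c))"
    unfolding petal_number_def using P by (intro INF_lower) auto
  thus ?thesis using n by (metis enat_ord_simps(1) order_trans)
qed

text \<open>The summand 2 accounts for the ends 0 and \<open>k\<close> of the segment.\<close>

lemma pstate_zeros:
  assumes ps: "pstate M k n r a" and R: "card {l. 0 < l \<and> l < k \<and> r' l = 0} \<le> m"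
    and S: "card {l. k < l \<and> l < M \<and> r l = 0} \<le> n - 1" and r': "\<And>l. l \<le> M ==> r' l = 0 ==> r l = 0"
  shows "card {l. l < M \<and> r' l = 0} \<le> m + (n - 1) + 2"
proof -
  let ?R = "{l. 0 < l \<and> l < k \<and> r' l = 0}" and ?S = "{l. k < l \<and> l < M \<and> r l = 0}"
  have fin: "finite ?R" "finite ?S" by simp_all
  have "{l. l < M \<and> r' l = 0} \<subseteq> {0, k} \<union> (?R \<union> ?S)"
  proof
    fix l assume "l \<in> {l. l < M \<and> r' l = 0}"
    thus "l \<in> {0, k} \<union> (?R \<union> ?S)" using r'[of l] by (cases "l < k"; cases "l = k") auto
  qed
  hence "card {l. l < M \<and> r' l = 0} \<le> card ({0, k} \<union> (?R \<union> ?S))" by (rule card_mono[rotated]) (use fin in simp)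
  also have "\<dots> \<le> card {0, k} + (card ?R + card ?S)"
    using card_Un_le[of "{0, k}" "?R \<union> ?S"] card_Un_le[of ?R ?S] by linarith
  also have "card {0, k} \<le> 2" by (simp add: card_insert_if)
  finally show ?thesis using R S by linarith
qed

theorem theorem3p6:
  fixes K :: "(space \<times> real) set" and n :: nat
  assumes "knot K"
  shows "(straight_number K = enat n \<and> n \<ge> 1 \<longrightarrow> petal_number K \<le> enat (3 * n)) \<and>
         (contained_straight_number K = enat n \<longrightarrow> petal_number K \<le> enat (2 * n + 3))"
proof (intro conjI impI)
  assume "straight_number K = enat n \<and> n \<ge> 1"
  hence n: "n \<ge> 1" and sn: "straight_number K = enat n" by auto
  obtain \<gamma> where \<gamma>: "represents \<gamma> K" "straight_diagram \<gamma> n" using INF_enat_attained[OF sn[unfolded straight_number_def]] by auto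
  obtain u where u: "straight_state \<gamma> u n" using straight_diagram_state[OF \<gamma>(2) n] by blast
  obtain \<gamma>1 where g1: "kiso (\<gamma> ` {0..1}) (\<gamma>1 ` {0..1})" "straight_state \<gamma>1 u n" "mono_piece (shadow \<gamma>1) 0 u"
    using straighten[OF u] by blast
  obtain \<gamma>2 where g2: "kiso (\<gamma>1 ` {0..1}) (\<gamma>2 ` {0..1})" "normal_state \<gamma>2 u n" using normalise[OF g1(2,3)] by blast
  obtain M k r a where F: "pstate M k n r a" "3 dvd M" "9 \<le> M" "\<forall>l\<le>M. r l = 0 --> 3 dvd l"
    "kiso (\<gamma>2 ` {0..1}) (polygon_set M (fan_pt (fdir M) r a))" "card {l. k < l \<and> l < M \<and> r l = 0} \<le> n - 1"
    using normal_state_fan[OF g2(2)] by blast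
  obtain r' a' where R: "fan_ok M r' a'" "fiso M (fdir M) r a r' a'" "\<forall>l\<le>M. r' l = 0 --> r l = 0"
    "card {l. 0 < l \<and> l < k \<and> r' l = 0} < 2 * n" using pstate_reduce[OF F(1) n] by blast
  \<comment> \<open>The three summands add up to \<open>3 * n\<close>, and the minimum of three
    petals is covered since \<open>n \<ge> 1\<close>.\<close>
  have "card {l. l < M \<and> r' l = 0} \<le> (2 * n - 1) + (n - 1) + 2"
    by (rule pstate_zeros[OF F(1) _ F(6)]) (use R in auto)
  hence z: "max 3 (card {l. l < M \<and> r' l = 0}) \<le> 3 * n" using n by simp
  have d: "3 dvd l" if "l \<le> M" "r' l = 0" for l using F(4) R(3) that by blast
  obtain \<gamma>' c where P: "petal_projection \<gamma>' c" "kiso (polygon_set M (fan_pt (fdir M) r' a')) (\<gamma>' ` {0..1})"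
    "card (petals \<gamma>' c) \<le> max 3 (card {l. l < M \<and> r' l = 0})"
    using fan_petal_projection[OF R(1) F(2,3) d] by blast
  have "kiso (\<gamma> ` {0..1}) (\<gamma>' ` {0..1})"
    using g1(1) g2(1) F(5) R(2)[unfolded fiso_def] P(2) kiso_trans by meson
  thus "petal_number K \<le> enat (3 * n)" by (rule petal_number_le[OF \<gamma>(1) _ P(1) order_trans[OF P(3) z]])
next
  assume sn: "contained_straight_number K = enat n"
  obtain \<gamma> where \<gamma>: "represents \<gamma> K" "contained_straight_diagram \<gamma> n"
    using INF_enat_attained[OF sn[unfolded contained_straight_number_def]] by auto
  obtain u where u: "straight_position \<gamma> n u" "path_image (shadow \<gamma>) \<inter> extended_straight_strand \<gamma> u = {}"
    using \<gamma>(2) unfolding contained_straight_diagram_def by blast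
  define z where "z = shadow \<gamma>"
  have st: "straight_state \<gamma> u n" by (rule straight_position_state[OF u(1)])
  have u01: "0 < u" "u < 1" and im: "Im (z u) = Im (z 0)" using u(1) unfolding straight_position_def z_def by auto
  have zne: "z u \<noteq> z 0"
  proof
    assume "z u = z 0"
    moreover have "inj_on z {0..u}" using st by (simp add: straight_state_def z_def)
    ultimately show False using u01 inj_onD[of z "{0..u}" u 0] by simp
  qed
  obtain \<gamma>2 where g2: "kiso (\<gamma> ` {0..1}) (\<gamma>2 ` {0..1})" "normal_state \<gamma>2 u n"
    "\<And>t. shadow \<gamma>2 t = (z t - z 0) / (z u - z 0)"
    using normalise[OF st contained_mono_piece[OF u(1)]] unfolding z_def by blast
  \<comment> \<open>The normalisation is real affine along the line of the straight strand, so real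
    points of the new shadow come from that line; by hypothesis they lie on the segment.\<close>
  have con: "\<forall>t\<in>{u..1}. Im (shadow \<gamma>2 t) = 0 --> shadow \<gamma>2 t \<in> shadow \<gamma>2 ` {0..u}"
  proof (intro ballI impI)
    fix t assume t: "t \<in> {u..1}" "Im (shadow \<gamma>2 t) = 0"
    have "z u - z 0 = of_real (Re (z u - z 0))" using im by (simp add: complex_eq_iff)
    hence "Im ((z t - z 0) / of_real (Re (z u - z 0))) = 0" using t(2) g2(3) by simp
    moreover have "Re (z u - z 0) \<noteq> 0" using zne im by (auto simp: complex_eq_iff)
    ultimately have "Im (z t) = Im (z 0)" by simp
    moreover have "z t \<in> path_image z" using t(1) u01 by (auto simp: path_image_def)
    ultimately have "z t \<in> z ` {0..u}" using u(2) unfolding extended_straight_strand_def z_def by blast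
    thus "shadow \<gamma>2 t \<in> shadow \<gamma>2 ` {0..u}" unfolding g2(3) by auto
  qed
  obtain M k r a where F: "pstate M k n r a" "3 dvd M" "9 \<le> M" "\<forall>l\<le>M. r l = 0 --> 3 dvd l"
    "kiso (\<gamma>2 ` {0..1}) (polygon_set M (fan_pt (fdir M) r a))" "card {l. k < l \<and> l < M \<and> r l = 0} \<le> n - 1"
    "\<forall>l. 0 < l --> l < k --> r l = 0 --> a k < a l \<and> a l < a 0"
    using normal_state_fan[OF g2(2)] con by blast
  have "{l. 0 < l \<and> l < k \<and> r l = 0} = {l. 0 < l \<and> l < k \<and> r l = 0 \<and> a k < a l \<and> a l < a 0}" using F(7) by blast
  hence "card {l. 0 < l \<and> l < k \<and> r l = 0} \<le> n" using F(1) by (simp add: pstate_def)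
  hence "card {l. l < M \<and> r l = 0} \<le> n + (n - 1) + 2" by (rule pstate_zeros[OF F(1) _ F(6)])
  \<comment> \<open>For \<open>n > 0\<close> the count is at most \<open>2 * n + 1\<close>. The
    constant 3 is due to \<open>n = 0\<close>, where the construction may produce three
    petals.\<close>
  hence z: "max 3 (card {l. l < M \<and> r l = 0}) \<le> 2 * n + 3" by simp
  have ok: "fan_ok M r a" using F(1) by (simp add: pstate_def)
  have d: "3 dvd l" if "l \<le> M" "r l = 0" for l using F(4) that by blast
  obtain \<gamma>' c where P: "petal_projection \<gamma>' c" "kiso (polygon_set M (fan_pt (fdir M) r a)) (\<gamma>' ` {0..1})"
    "card (petals \<gamma>' c) \<le> max 3 (card {l. l < M \<and> r l = 0})"
    using fan_petal_projection[OF ok F(2,3) d] by blast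
  have "kiso (\<gamma> ` {0..1}) (\<gamma>' ` {0..1})" using g2(1) F(5) P(2) kiso_trans by meson
  thus "petal_number K \<le> enat (2 * n + 3)" by (rule petal_number_le[OF \<gamma>(1) _ P(1) order_trans[OF P(3) z]])
qed

end
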